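(* Let $\Omega\subset\mathbb{R}^n$, $n\ge2$, be a bounded domain, let $p:\Omega\to(1,\infty)$ be log-Hölder continuous with $1<p_-\le p(\cdot)\le p_+<\infty$, and let $p'(x):=p(x)/(p(x)-1)$. Then $\mu_{p(\cdot)}\in\mathcal{M}_b(\Omega)$ does not charge the sets of Sobolev $p(\cdot)$-capacity zero if and only if $\mu_{p(\cdot)}\in L^1(\Omega)+W^{-1,p'(\cdot)}(\Omega)$, i.e. there exist $f\in L^1(\Omega)$ and $G\in(L^{p'(\cdot)}(\Omega))^n$ such that $\mu_{p(\cdot)}=f-\operatorname{div}G$ in the sense of distributions.
   Context: $p$ is log-Hölder continuous if there is $c>0$ with $|p(x)-p(y)|\le -c/\log(|x-y|)$ for $|x-y|<1/2$. $L^{p(\cdot)}(\Omega)$ is the variable exponent Lebesgue space of measurable $f$ with $\int_\Omega|f|^{p(x)}dx<\infty$, with Luxemburg norm; $W^{1,p(\cdot)}(\Omega)$ is the space of $f\in L^{p(\cdot)}(\Omega)$ with distributional gradient in $L^{p(\cdot)}$; $W_0^{1,p(\cdot)}(\Omega)$ is the closure of $C_0^\infty(\Omega)$ in it, and $W^{-1,p'(\cdot)}(\Omega)=(W_0^{1,p(\cdot)}(\Omega))'$. $\mathcal{M}_b(\Omega)$ is the set of (signed) Radon measures on $\Omega$ with bounded total variation. Capacity: for compact $K\subset\Omega$, $\mathrm{cap}_{p(\cdot)}(K,\Omega)=\inf\{\int_\Omega|\nabla v|^{p(x)}dx\}$ over nonnegative $v\in W^{1,p(\cdot)}(\Omega)\cap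 C_0(\Omega)$ with $v\ge1$ on $K$ ($C_0(\Omega)$: continuous functions vanishing on $\partial\Omega$); for open $A\subset\Omega$ take the supremum over compact $K\subset A$; for arbitrary $E\subset\Omega$ take the infimum over open $A$ with $E\subset A\subset\Omega$. A set $E\subset\Omega$ has Sobolev $p(\cdot)$-capacity zero if $\mathrm{cap}_{p(\cdot)}(E,\Omega)=0$. A measure $\mu$ does not charge such sets if $\mu(E)=0$ for every Borel $E\subset\Omega$ of capacity zero. $\mu=f-\operatorname{div}G$ in the sense of distributions means $\int_\Omega\phi\,d\mu=\int_\Omega f\phi\,dx+\int_\Omega G\cdot\nabla\phi\,dx$ for all $\phi\in C_0^\infty(\Omega)$. *)

theory Defs
  imports "HOL-Analysis.Analysis"
begin

section \<open>Test functions\<close>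

primrec Ck :: "nat \<Rightarrow> ('a::euclidean_space \<Rightarrow> real) \<Rightarrow> bool" where
  "Ck 0 f \<longleftrightarrow> continuous_on UNIV f"
| "Ck (Suc k) f \<longleftrightarrow> f differentiable_on UNIV \<and>
     (\<forall>b\<in>Basis. Ck k (\<lambda>x. frechet_derivative f (at x) b))"

definition grad :: "('a::euclidean_space \<Rightarrow> real) \<Rightarrow> 'a \<Rightarrow> 'a" where
  "grad f x = (\<Sum>b\<in>Basis. frechet_derivative f (at x) b *\<^sub>R b)"

text \<open>Elements of \<open>C_0^\<infinity>(\<Omega>)\<close> are represented by their extension by zero to the whole space.\<close>

definition test_functions :: "'a::euclidean_space set \<Rightarrow> ('a \<Rightarrow> real) set" where
  "test_functions \<Omega> = {\<phi>. (\<forall>k. Ck k \<phi>) \<and>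
     compact (closure {x. \<phi> x \<noteq> 0}) \<and> closure {x. \<phi> x \<noteq> 0} \<subseteq> \<Omega>}"


section \<open>Variable exponent spaces\<close>

text \<open>At \<open>x = y\<close> both sides of the inequality are 0, because \<open>ln 0 = 0\<close> and \<open>- c / 0 = 0\<close>.\<close>

definition log_Hoelder_on :: "'a::euclidean_space set \<Rightarrow> ('a \<Rightarrow> real) \<Rightarrow> bool" where
  "log_Hoelder_on \<Omega> p \<longleftrightarrow> (\<exists>c>0. \<forall>x\<in>\<Omega>. \<forall>y\<in>\<Omega>.
     dist x y < 1/2 \<longrightarrow> \<bar>p x - p y\<bar> \<le> - c / ln (dist x y))"

definition modular :: "'a::euclidean_space set \<Rightarrow> ('a \<Rightarrow> real) \<Rightarrow> ('a \<Rightarrow> real) \<Rightarrow> ennreal" where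
  "modular \<Omega> p f = (\<integral>\<^sup>+x. ennreal (\<bar>f x\<bar> powr p x) \<partial>lebesgue_on \<Omega>)"

definition Lp_var :: "'a::euclidean_space set \<Rightarrow> ('a \<Rightarrow> real) \<Rightarrow> ('a \<Rightarrow> real) set" where
  "Lp_var \<Omega> p = {f \<in> borel_measurable (lebesgue_on \<Omega>). modular \<Omega> p f < \<infinity>}"

definition luxemburg_norm :: "'a::euclidean_space set \<Rightarrow> ('a \<Rightarrow> real) \<Rightarrow> ('a \<Rightarrow> real) \<Rightarrow> real" where
  "luxemburg_norm \<Omega> p f = Inf {t. t > 0 \<and> modular \<Omega> p (\<lambda>x. f x / t) \<le> 1}"

definition Lp_var_vec :: "'a::euclidean_space set \<Rightarrow> ('a \<Rightarrow> real) \<Rightarrow> ('a \<Rightarrow> 'a) set" where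
  "Lp_var_vec \<Omega> p = {G. \<forall>b\<in>Basis. (\<lambda>x. G x \<bullet> b) \<in> Lp_var \<Omega> p}"

text \<open>The integrals below are vector valued. Local integrability makes all of them
  meaningful, and it makes \<open>g\<close> unique up to null sets.\<close>

definition has_weak_gradient ::
    "'a::euclidean_space set \<Rightarrow> ('a \<Rightarrow> real) \<Rightarrow> ('a \<Rightarrow> 'a) \<Rightarrow> bool" where
  "has_weak_gradient \<Omega> u g \<longleftrightarrow>
     (\<forall>K. compact K \<and> K \<subseteq> \<Omega> \<longrightarrow> integrable (lebesgue_on K) u \<and> integrable (lebesgue_on K) g) \<and>
     (\<forall>\<phi>\<in>test_functions \<Omega>.
        (LINT x|lebesgue_on \<Omega>. u x *\<^sub>R grad \<phi> x) = - (LINT x|lebesgue_on \<Omega>. \<phi> x *\<^sub>R g x))"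

definition weak_grad :: "'a::euclidean_space set \<Rightarrow> ('a \<Rightarrow> real) \<Rightarrow> 'a \<Rightarrow> 'a" where
  "weak_grad \<Omega> u = (SOME g. has_weak_gradient \<Omega> u g)"

text \<open>Sobolev functions are represented by functions rather than by classes modulo null sets.
  Their values outside \<open>\<Omega>\<close> play no role here.\<close>

definition W1p :: "'a::euclidean_space set \<Rightarrow> ('a \<Rightarrow> real) \<Rightarrow> ('a \<Rightarrow> real) set" where
  "W1p \<Omega> p = {u \<in> Lp_var \<Omega> p. \<exists>g. has_weak_gradient \<Omega> u g \<and> g \<in> Lp_var_vec \<Omega> p}"

definition W1p_norm :: "'a::euclidean_space set \<Rightarrow> ('a \<Rightarrow> real) \<Rightarrow> ('a \<Rightarrow> real) \<Rightarrow> real" where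
  "W1p_norm \<Omega> p u =
     luxemburg_norm \<Omega> p u + luxemburg_norm \<Omega> p (\<lambda>x. norm (weak_grad \<Omega> u x))"

definition W1p_0 :: "'a::euclidean_space set \<Rightarrow> ('a \<Rightarrow> real) \<Rightarrow> ('a \<Rightarrow> real) set" where
  "W1p_0 \<Omega> p = {u \<in> W1p \<Omega> p.
     \<forall>e>0. \<exists>\<phi>\<in>test_functions \<Omega>. W1p_norm \<Omega> p (\<lambda>x. u x - \<phi> x) < e}"

text \<open>Boundedness forces a functional to take the same value on functions that agree
  almost everywhere, so it acts on classes modulo null sets.\<close>

definition dual_W1p_0 :: "'a::euclidean_space set \<Rightarrow> ('a \<Rightarrow> real) \<Rightarrow> (('a \<Rightarrow> real) \<Rightarrow> real) set" where
  "dual_W1p_0 \<Omega> p = {T.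
     (\<forall>u\<in>W1p_0 \<Omega> p. \<forall>v\<in>W1p_0 \<Omega> p. T (\<lambda>x. u x + v x) = T u + T v) \<and>
     (\<forall>u\<in>W1p_0 \<Omega> p. \<forall>c. T (\<lambda>x. c * u x) = c * T u) \<and>
     (\<exists>C. \<forall>u\<in>W1p_0 \<Omega> p. \<bar>T u\<bar> \<le> C * W1p_norm \<Omega> p u)}"


section \<open>Sobolev capacity\<close>

definition C_0 :: "'a::euclidean_space set \<Rightarrow> ('a \<Rightarrow> real) set" where
  "C_0 \<Omega> = {v. continuous_on (closure \<Omega>) v \<and> (\<forall>x\<in>frontier \<Omega>. v x = 0)}"

definition cap_compact ::
    "'a::euclidean_space set \<Rightarrow> ('a \<Rightarrow> real) \<Rightarrow> 'a set \<Rightarrow> ennreal" where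
  "cap_compact \<Omega> p K =
     (INF v\<in>{v \<in> W1p \<Omega> p \<inter> C_0 \<Omega>. (\<forall>x\<in>\<Omega>. 0 \<le> v x) \<and> (\<forall>x\<in>K. 1 \<le> v x)}.
        modular \<Omega> p (\<lambda>x. norm (weak_grad \<Omega> v x)))"

definition cap_open ::
    "'a::euclidean_space set \<Rightarrow> ('a \<Rightarrow> real) \<Rightarrow> 'a set \<Rightarrow> ennreal" where
  "cap_open \<Omega> p A = (SUP K\<in>{K. compact K \<and> K \<subseteq> A}. cap_compact \<Omega> p K)"

definition sobolev_cap ::
    "'a::euclidean_space set \<Rightarrow> ('a \<Rightarrow> real) \<Rightarrow> 'a set \<Rightarrow> ennreal" where
  "sobolev_cap \<Omega> p E = (INF A\<in>{A. open A \<and> E \<subseteq> A \<and> A \<subseteq> \<Omega>}. cap_open \<Omega> p A)"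


section \<open>Signed measures\<close>

text \<open>A signed measure on \<open>\<Omega>\<close> is a real valued set function; only its values on
  the Borel subsets of \<open>\<Omega>\<close> are relevant.\<close>

abbreviation borel_sets :: "'a::euclidean_space set \<Rightarrow> 'a set set" where
  "borel_sets \<Omega> \<equiv> sets (restrict_space borel \<Omega>)"

definition signed_measure :: "'a::euclidean_space set \<Rightarrow> ('a set \<Rightarrow> real) \<Rightarrow> bool" where
  "signed_measure \<Omega> \<mu> \<longleftrightarrow> (\<forall>A::nat \<Rightarrow> 'a set. range A \<subseteq> borel_sets \<Omega> \<and> disjoint_family A \<longrightarrow>
     (\<lambda>i. \<mu> (A i)) sums \<mu> (\<Union>i. A i))"

definition total_variation ::
    "'a::euclidean_space set \<Rightarrow> ('a set \<Rightarrow> real) \<Rightarrow> 'a set \<Rightarrow> ennreal" where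
  "total_variation \<Omega> \<mu> E =
     (SUP P\<in>{P. finite P \<and> P \<subseteq> borel_sets \<Omega> \<and> partition_on E P}. \<Sum>A\<in>P. ennreal \<bar>\<mu> A\<bar>)"

definition bounded_radon_measures :: "'a::euclidean_space set \<Rightarrow> ('a set \<Rightarrow> real) set" where
  "bounded_radon_measures \<Omega> = {\<mu>. signed_measure \<Omega> \<mu> \<and> total_variation \<Omega> \<mu> \<Omega> < \<infinity> \<and>
     (\<forall>E\<in>borel_sets \<Omega>. total_variation \<Omega> \<mu> E =
        (SUP K\<in>{K. compact K \<and> K \<subseteq> E}. total_variation \<Omega> \<mu> K))}"

text \<open>The positive part of the Jordan decomposition; the negative part of \<open>\<mu>\<close> is the
  positive part of \<open>- \<mu>\<close>. Negative values are cut off by \<^term>\<open>ennreal\<close>, which does not change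
  the supremum since \<open>\<mu> {} = 0\<close>.\<close>

definition positive_part :: "'a::euclidean_space set \<Rightarrow> ('a set \<Rightarrow> real) \<Rightarrow> 'a measure" where
  "positive_part \<Omega> \<mu> = measure_of \<Omega> (borel_sets \<Omega>)
     (\<lambda>E. SUP A\<in>{A \<in> borel_sets \<Omega>. A \<subseteq> E}. ennreal (\<mu> A))"

definition signed_integral ::
    "'a::euclidean_space set \<Rightarrow> ('a set \<Rightarrow> real) \<Rightarrow> ('a \<Rightarrow> real) \<Rightarrow> real" where
  "signed_integral \<Omega> \<mu> \<phi> =
     (LINT x|positive_part \<Omega> \<mu>. \<phi> x) - (LINT x|positive_part \<Omega> (\<lambda>A. - \<mu> A). \<phi> x)"

definition does_not_charge_null_cap ::
    "'a::euclidean_space set \<Rightarrow> ('a \<Rightarrow> real) \<Rightarrow> ('a set \<Rightarrow> real) \<Rightarrow> bool" where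
  "does_not_charge_null_cap \<Omega> p \<mu> \<longleftrightarrow>
     (\<forall>E\<in>borel_sets \<Omega>. sobolev_cap \<Omega> p E = 0 \<longrightarrow> \<mu> E = 0)"

text \<open>Membership in \<open>L\<^sup>1(\<Omega>) + W\<^sup>-\<^sup>1\<^sup>,\<^sup>p\<^sup>'(\<Omega>)\<close>, as an identity of distributions;
  the second summand is the dual of \<open>W\<^sub>0\<^sup>1\<^sup>,\<^sup>p(\<Omega>)\<close>.\<close>

definition in_L1_plus_dual ::
    "'a::euclidean_space set \<Rightarrow> ('a \<Rightarrow> real) \<Rightarrow> ('a set \<Rightarrow> real) \<Rightarrow> bool" where
  "in_L1_plus_dual \<Omega> p \<mu> \<longleftrightarrow>
     (\<exists>f T. integrable (lebesgue_on \<Omega>) f \<and> T \<in> dual_W1p_0 \<Omega> p \<and>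
        (\<forall>\<phi>\<in>test_functions \<Omega>.
           signed_integral \<Omega> \<mu> \<phi> = (LINT x|lebesgue_on \<Omega>. f x * \<phi> x) + T \<phi>))"

definition eq_minus_div ::
    "'a::euclidean_space set \<Rightarrow> ('a set \<Rightarrow> real) \<Rightarrow> ('a \<Rightarrow> real) \<Rightarrow> ('a \<Rightarrow> 'a) \<Rightarrow> bool" where
  "eq_minus_div \<Omega> \<mu> f G \<longleftrightarrow>
     (\<forall>\<phi>\<in>test_functions \<Omega>. signed_integral \<Omega> \<mu> \<phi> =
        (LINT x|lebesgue_on \<Omega>. f x * \<phi> x) + (LINT x|lebesgue_on \<Omega>. G x \<bullet> grad \<phi> x))"

end

theory Submission
  imports Defs
begin

text \<open>Suppose that \<open>\<mu>\<close> does not charge null sets. By the Borel-Cantelli argument, test functions \<open>\<phi>\<close> with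
  \<open>\<bar>\<phi>\<bar> \<le> 1\<close> and small energy \<open>\<integral> \<bar>grad \<phi>\<bar> ^ p + \<bar>\<phi>\<bar> ^ p\<close> have small integral \<open>\<nu> \<phi>\<close> against \<open>\<mu>\<close>. Consequently, for every
  \<open>\<epsilon> > 0\<close>, the functional \<open>\<integral> \<bar>grad \<phi>\<bar> ^ p + k \<integral> \<bar>\<phi>\<bar> ^ p + \<epsilon> sup \<bar>\<phi>\<bar> - \<nu> \<phi>\<close> is bounded below on test functions. By
  uniform convexity it has a minimiser \<open>(u, V)\<close> in the completion, whose Euler-Lagrange inequality
  splits off from \<open>\<nu>\<close> a function in \<open>L\<^sup>1\<close> and the divergence of a field in \<open>L\<close> with exponent \<open>p'\<close>,
  and leaves a residual of size \<open>\<epsilon> sup \<bar>\<phi>\<bar>\<close>. The \<open>L\<^sup>1\<close> norm of the function is bounded by the size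
  of \<open>\<nu>\<close>, and for large \<open>k\<close> the field is small. Iterating on the residual with summable \<open>\<epsilon>\<close> and
  adding up gives \<open>f\<close> and \<open>G\<close>.

  Conversely, a functional in \<open>L\<^sup>1\<close> plus the dual tends to 0 along test functions that are bounded by 1
  and whose gradients tend to 0. If \<open>K\<close> is a compact set of capacity zero, log-Hoelder continuity
  makes mollification bounded for the modular, so the competitors for the capacity of \<open>K\<close> yield
  such test functions that are bounded below on \<open>K\<close>. Localising them to a set that carries the
  positive part of \<open>\<mu>\<close> shows that \<open>\<mu>\<close> vanishes on \<open>K\<close>, and inner regularity does the rest.\<close>

section \<open>Smooth functions\<close>

text \<open>The obstacle in the forward direction is that a bounded measure is controlled by the
  supremum norm and not by the energy; it is small for small energy only on the supremum unit ball.
  The penalty \<epsilon> sup |\<phi>| bridges this: for functions of large supremum either the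
  penalty or the energy absorbs the functional. By convexity minimising sequences are Cauchy, so
  neither weak compactness nor quasicontinuous representatives occur. The weight \<open>k\<close> is
  free because the bound of the L^1 part, obtained by testing with smooth signs of the minimising
  sequence, does not depend on it, whereas the field tends to 0 along a sequence of weights. So both
  series converge, although the size of a residual does not control the field split off from it. In
  the converse direction the obstacle is that competitors for the capacity are Sobolev functions
  that merely vanish on the boundary, while the identity for \<open>\<mu>\<close> is available on
  test functions only. Estimates are made on modulars; the Luxemburg norm enters by comparison with
  the modular where the dual space is concerned.\<close>

definition smooth :: "('a::euclidean_space \<Rightarrow> real) \<Rightarrow> bool" where
  "smooth f \<longleftrightarrow> (\<forall>k. Ck k f)"

lemma has_derivative_imp_frechet_derivative:
  "(f has_derivative D) (at x) \<Longrightarrow> frechet_derivative f (at x) = D"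
  by (metis frechet_derivative_at)

text \<open>\<open>Ck\<close> refers to the chosen \<open>frechet_derivative\<close>; by uniqueness
  of the derivative any explicit family \<open>D\<close> may be supplied instead.\<close>

lemma Ck_SucI:
  assumes "\<And>x. (f has_derivative D x) (at x)" "\<And>b. b \<in> Basis \<Longrightarrow> Ck k (\<lambda>x. D x b)"
  shows "Ck (Suc k) f"
proof -
  have "frechet_derivative f (at x) = D x" for x
    by (rule has_derivative_imp_frechet_derivative[OF assms(1)])
  moreover have "f differentiable_on UNIV"
    using assms(1) differentiableI by (auto simp: differentiable_on_def)
  ultimately show ?thesis
    using assms(2) by auto
qed

lemma Ck_SucE:
  assumes "Ck (Suc k) f"
  shows "(f has_derivative frechet_derivative f (at x)) (at x)"
    "b \<in> Basis \<Longrightarrow> Ck k (\<lambda>x. frechet_derivative f (at x) b)"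
  using assms by (auto simp: differentiable_on_def frechet_derivative_works[symmetric])

lemma Ck_Suc_imp_Ck: "Ck (Suc k) f \<Longrightarrow> Ck k f"
proof (induction k arbitrary: f)
  case 0
  then show ?case by (auto intro: differentiable_imp_continuous_on)
next
  case (Suc k)
  then show ?case by (metis Ck.simps(2))
qed

lemma Ck_0: "Ck k f \<Longrightarrow> continuous_on UNIV f"
  by (induction k) (auto dest: Ck_Suc_imp_Ck intro: differentiable_imp_continuous_on)

lemma Ck_const: "Ck k (\<lambda>x. c)"
proof (induction k arbitrary: c)
  case (Suc k)
  show ?case
    by (rule Ck_SucI[where D = "\<lambda>x h. 0"]) (use Suc in auto)
qed auto

lemma Ck_inner: "Ck k (\<lambda>x. x \<bullet> c)"
proof (cases k)
  case (Suc m)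
  show ?thesis unfolding Suc
    by (rule Ck_SucI[where D = "\<lambda>x h. h \<bullet> c"])
      (auto intro!: derivative_eq_intros Ck_const)
qed (auto intro!: continuous_intros)

lemma Ck_add: "Ck k f \<Longrightarrow> Ck k g \<Longrightarrow> Ck k (\<lambda>x. f x + g x)"
proof (induction k arbitrary: f g)
  case (Suc k)
  show ?case
    by (rule Ck_SucI[where D = "\<lambda>x h. frechet_derivative f (at x) h + frechet_derivative g (at x) h"])
      (intro Suc.IH Ck_SucE(2)[OF Suc.prems(1)] Ck_SucE(2)[OF Suc.prems(2)] has_derivative_add
        Ck_SucE(1)[OF Suc.prems(1)] Ck_SucE(1)[OF Suc.prems(2)])+
qed (auto intro!: continuous_intros)

lemma Ck_mult: "Ck k f \<Longrightarrow> Ck k g \<Longrightarrow> Ck k (\<lambda>x. f x * g x)"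
proof (induction k arbitrary: f g)
  case (Suc k)
  show ?case
    by (rule Ck_SucI[OF has_derivative_mult[OF Ck_SucE(1)[OF Suc.prems(1)] Ck_SucE(1)[OF Suc.prems(2)]]])
      (intro Ck_add Suc.IH Ck_SucE(2)[OF Suc.prems(1)] Ck_SucE(2)[OF Suc.prems(2)]
        Ck_Suc_imp_Ck[OF Suc.prems(1)] Ck_Suc_imp_Ck[OF Suc.prems(2)])
qed (auto intro!: continuous_intros)

text \<open>\<open>S\<close> is a function listed with all its derivatives. The induction runs over
  all \<open>i\<close> at once, since the chain rule turns \<open>S i\<close> into
  \<open>S (Suc i)\<close>; this avoids a formula for higher derivatives of a composition.\<close>

lemma Ck_compose:
  assumes "\<And>i x. (S i has_real_derivative S (Suc i) x) (at x)"
  shows "Ck k f \<Longrightarrow> Ck k (\<lambda>x. S i (f x))"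
proof (induction k arbitrary: i)
  case 0
  have "continuous_on UNIV (S i)"
    using assms by (metis DERIV_continuous_on has_field_derivative_at_within)
  then show ?case
    using 0 by (auto intro: continuous_on_compose2)
next
  case (Suc k)
  have D: "((\<lambda>x. S i (f x)) has_derivative (\<lambda>h. frechet_derivative f (at x) h * S (Suc i) (f x))) (at x)" for x
    by (rule DERIV_compose_FDERIV[OF assms Ck_SucE(1)[OF Suc.prems]])
  show ?case
    by (rule Ck_SucI[OF D]) (intro Ck_mult Suc.IH Ck_SucE(2)[OF Suc.prems] Ck_Suc_imp_Ck[OF Suc.prems])
qed

lemma Ck_affine: "Ck k f \<Longrightarrow> Ck k (\<lambda>x. f (a + c *\<^sub>R x))"
proof (induction k arbitrary: f)
  case 0
  then show ?case by (auto intro!: continuous_on_compose2[of UNIV f] continuous_intros)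
next
  case (Suc k)
  have D: "((\<lambda>x. f (a + c *\<^sub>R x)) has_derivative (\<lambda>h. c * frechet_derivative f (at (a + c *\<^sub>R x)) h)) (at x)" for x
  proof -
    have "((\<lambda>x. f (a + c *\<^sub>R x)) has_derivative (\<lambda>h. frechet_derivative f (at (a + c *\<^sub>R x)) (c *\<^sub>R h))) (at x)"
      by (rule has_derivative_compose[of "\<lambda>x. a + c *\<^sub>R x"])
        (auto intro!: derivative_eq_intros Ck_SucE(1)[OF Suc.prems])
    moreover have "frechet_derivative f (at y) (c *\<^sub>R h) = c * frechet_derivative f (at y) h" for y h
      using Ck_SucE(1)[OF Suc.prems, of y] has_derivative_linear linear_scale by fastforce
    ultimately show ?thesis by simp
  qed
  have IH: "Ck k (\<lambda>x. frechet_derivative f (at (a + c *\<^sub>R x)) b)" if "b \<in> Basis" for b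
    using Suc.IH[OF Ck_SucE(2)[OF Suc.prems that]] .
  show ?case
    by (rule Ck_SucI[OF D], rule Ck_mult, rule Ck_const, rule IH)
qed

lemma smooth_const [intro]: "smooth (\<lambda>x. c)"
  by (simp add: smooth_def Ck_const)

lemma smooth_inner [intro]: "smooth (\<lambda>x. x \<bullet> c)"
  by (simp add: smooth_def Ck_inner)

lemma smooth_add [intro]: "smooth f \<Longrightarrow> smooth g \<Longrightarrow> smooth (\<lambda>x. f x + g x)"
  by (simp add: smooth_def Ck_add)

lemma smooth_mult [intro]: "smooth f \<Longrightarrow> smooth g \<Longrightarrow> smooth (\<lambda>x. f x * g x)"
  by (simp add: smooth_def Ck_mult)

lemma smooth_diff [intro]: "smooth f \<Longrightarrow> smooth g \<Longrightarrow> smooth (\<lambda>x. f x - g x)"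
  using smooth_add[of f "\<lambda>x. (-1) * g x"] smooth_mult[OF smooth_const, of g "-1"] by simp

lemma smooth_sum [intro]: "(\<And>i. i \<in> I \<Longrightarrow> smooth (f i)) \<Longrightarrow> smooth (\<lambda>x. \<Sum>i\<in>I. f i x)"
  by (induction I rule: infinite_finite_induct) auto

lemma smooth_affine:
  assumes "smooth f"
  shows "smooth (\<lambda>x. f (a + c *\<^sub>R x))"
  unfolding smooth_def
proof
  show "Ck k (\<lambda>x. f (a + c *\<^sub>R x))" for k
    using Ck_affine[of k f a c] assms unfolding smooth_def by blast
qed

lemma smooth_compose:
  assumes "\<And>i x. (S i has_real_derivative S (Suc i) x) (at x)" "smooth f"
  shows "smooth (\<lambda>x. S i (f x))"
  unfolding smooth_def
proof
  show "Ck k (\<lambda>x. S i (f x))" for k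
    using Ck_compose[of S k f i] assms unfolding smooth_def by blast
qed

lemma smooth_continuous: "smooth f \<Longrightarrow> continuous_on A f"
  unfolding smooth_def by (meson Ck_0 continuous_on_subset subset_UNIV)

text \<open>Induction on the order, for all members of \<open>F\<close> at once. It serves
  convolutions with a fixed \<open>w\<close>, whose partial derivatives are convolutions of
  \<open>w\<close> with another smooth kernel.\<close>

lemma smooth_coinduct:
  assumes "f \<in> F"
    and "\<And>f x. f \<in> F \<Longrightarrow> f differentiable (at x)"
    and "\<And>f b. f \<in> F \<Longrightarrow> b \<in> Basis \<Longrightarrow> (\<lambda>x. frechet_derivative f (at x) b) \<in> F"
  shows "smooth f"
proof -
  have "\<forall>f\<in>F. Ck k f" for k
  proof (induction k)
    case 0
    show ?case
      using assms(2) differentiable_imp_continuous_on[where s = UNIV]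
      unfolding differentiable_on_def Ck.simps by blast
  next
    case (Suc k)
    show ?case
      using Suc assms(2,3) unfolding differentiable_on_def Ck.simps by blast
  qed
  then show ?thesis using assms(1) unfolding smooth_def by blast
qed

lemma smooth_frechet_derivative: "smooth f \<Longrightarrow> b \<in> Basis \<Longrightarrow> smooth (\<lambda>x. frechet_derivative f (at x) b)"
  unfolding smooth_def by (metis Ck.simps(2))

lemma smooth_has_derivative:
  fixes f :: "'a::euclidean_space \<Rightarrow> real"
  assumes "smooth f"
  shows "(f has_derivative (\<lambda>h. h \<bullet> grad f x)) (at x)"
proof -
  have D: "(f has_derivative frechet_derivative f (at x)) (at x)"
    by (rule Ck_SucE(1)[of 0]) (use assms in \<open>simp only: smooth_def\<close>)
  have "h \<bullet> grad f x = frechet_derivative f (at x) h" for h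
  proof -
    have "frechet_derivative f (at x) h = frechet_derivative f (at x) (\<Sum>b\<in>Basis. (h \<bullet> b) *\<^sub>R b)"
      by (simp add: euclidean_representation)
    also have "\<dots> = (\<Sum>b\<in>Basis. (h \<bullet> b) * frechet_derivative f (at x) b)"
      using has_derivative_linear[OF D] by (simp add: linear_sum linear_scale)
    finally show ?thesis
      by (simp add: grad_def inner_sum_right inner_scaleR_right mult.commute)
  qed
  then show ?thesis using D by simp
qed

lemma has_derivative_imp_grad:
  fixes f :: "'a::euclidean_space \<Rightarrow> real"
  assumes "(f has_derivative (\<lambda>h. h \<bullet> v)) (at x)"
  shows "grad f x = v"
  unfolding grad_def has_derivative_imp_frechet_derivative[OF assms]
  by (metis (no_types, lifting) euclidean_representation inner_commute sum.cong)

lemma grad_inner_Basis: "b \<in> Basis \<Longrightarrow> grad f x \<bullet> b = frechet_derivative f (at x) b"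
  by (simp add: grad_def)

lemma smooth_grad_inner: "smooth f \<Longrightarrow> b \<in> Basis \<Longrightarrow> smooth (\<lambda>x. grad f x \<bullet> b)"
  by (simp add: grad_inner_Basis smooth_frechet_derivative)

lemma smooth_grad_continuous: "smooth f \<Longrightarrow> continuous_on A (grad f)"
  by (rule continuous_on_componentwise[THEN iffD2])
    (auto intro: smooth_continuous smooth_grad_inner)

lemma grad_const [simp]: "grad (\<lambda>x. c) x = 0"
  by (rule has_derivative_imp_grad) simp

lemma grad_inner [simp]: "grad (\<lambda>x. x \<bullet> c) x = c"
  by (rule has_derivative_imp_grad) (auto intro!: derivative_eq_intros)

lemma grad_add: "smooth f \<Longrightarrow> smooth g \<Longrightarrow> grad (\<lambda>x. f x + g x) x = grad f x + grad g x"
  by (rule has_derivative_imp_grad, unfold inner_add_right)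
    (intro has_derivative_add smooth_has_derivative)

lemma grad_mult:
  assumes "smooth f" "smooth g"
  shows "grad (\<lambda>x. f x * g x) x = f x *\<^sub>R grad g x + g x *\<^sub>R grad f x"
  by (rule has_derivative_imp_grad)
    (use has_derivative_mult[OF smooth_has_derivative[OF assms(1)] smooth_has_derivative[OF assms(2)]]
      in \<open>simp add: inner_add_right mult.commute\<close>)

lemma grad_cmult: "smooth f \<Longrightarrow> grad (\<lambda>x. c * f x) x = c *\<^sub>R grad f x"
  using grad_mult[OF smooth_const, of f c] by simp

lemma grad_diff: "smooth f \<Longrightarrow> smooth g \<Longrightarrow> grad (\<lambda>x. f x - g x) x = grad f x - grad g x"
  by (rule has_derivative_imp_grad, unfold inner_diff_right)
    (intro has_derivative_diff smooth_has_derivative)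

lemma grad_sum: "(\<And>i. i \<in> I \<Longrightarrow> smooth (f i)) \<Longrightarrow>
    grad (\<lambda>x. \<Sum>i\<in>I. f i x) x = (\<Sum>i\<in>I. grad (f i) x)"
  by (rule has_derivative_imp_grad, unfold inner_sum_right)
    (intro has_derivative_sum smooth_has_derivative)

lemma grad_compose:
  assumes "(S has_real_derivative S') (at (f x))" "smooth f"
  shows "grad (\<lambda>x. S (f x)) x = S' *\<^sub>R grad f x"
  by (rule has_derivative_imp_grad)
    (use DERIV_compose_FDERIV[OF assms(1) smooth_has_derivative[OF assms(2)]] in \<open>simp add: mult.commute\<close>)

lemma grad_affine:
  assumes "smooth f"
  shows "grad (\<lambda>x. f (a + c *\<^sub>R x)) x = c *\<^sub>R grad f (a + c *\<^sub>R x)"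
proof (rule has_derivative_imp_grad)
  have "((\<lambda>x. f (a + c *\<^sub>R x)) has_derivative (\<lambda>h. (c *\<^sub>R h) \<bullet> grad f (a + c *\<^sub>R x))) (at x)"
    by (rule has_derivative_compose[of "\<lambda>x. a + c *\<^sub>R x"])
      (auto intro!: derivative_eq_intros smooth_has_derivative[OF assms])
  then show "((\<lambda>x. f (a + c *\<^sub>R x)) has_derivative (\<lambda>h. h \<bullet> (c *\<^sub>R grad f (a + c *\<^sub>R x)))) (at x)"
    by simp
qed

subsection \<open>The hyperbolic tangent and the flat function\<close>

text \<open>The derivative of tanh is a polynomial in tanh, so the induction closes. The function
  serves as a smooth truncation to (-1, 1), and with a large factor inside as a smooth sign.\<close>

lemma smooth_tanh:
  assumes "smooth f"
  shows "smooth (\<lambda>x. tanh (f x))"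
proof -
  have "Ck k f \<Longrightarrow> Ck k (\<lambda>x. tanh (f x))" for k
  proof (induction k)
    case 0
    then show ?case by (auto intro!: continuous_intros)
  next
    case (Suc k)
    have D: "((\<lambda>x. tanh (f x)) has_derivative
        (\<lambda>h. frechet_derivative f (at x) h * (1 + (-1) * (tanh (f x) * tanh (f x))))) (at x)" for x
    proof -
      have "(tanh has_real_derivative (1 + (-1) * (tanh (f x) * tanh (f x)))) (at (f x))"
        by (auto intro!: derivative_eq_intros simp: power2_eq_square)
      from DERIV_compose_FDERIV[OF this Ck_SucE(1)[OF Suc.prems]] show ?thesis .
    qed
    show ?case
      by (rule Ck_SucI[OF D])
        (intro Ck_mult Ck_add Ck_const Suc.IH Ck_SucE(2)[OF Suc.prems] Ck_Suc_imp_Ck[OF Suc.prems])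
  qed
  then show ?thesis using assms by (simp add: smooth_def)
qed

lemma grad_tanh: "smooth f \<Longrightarrow> grad (\<lambda>x. tanh (f x)) x = (1 - (tanh (f x))\<^sup>2) *\<^sub>R grad f x"
  by (rule grad_compose) (auto intro!: derivative_eq_intros)

text \<open>All derivatives of \<open>exp (- (1 / x))\<close>, extended by 0, have this form with a
  polynomial in \<open>1 / x\<close>.\<close>

definition flat_poly :: "real poly \<Rightarrow> real \<Rightarrow> real" where
  "flat_poly q x = (if x > 0 then poly q (1 / x) * exp (- (1 / x)) else 0)"

lemma poly_exp_tendsto_0: "((\<lambda>t. poly q t / exp t) \<longlongrightarrow> (0::real)) at_top"
proof -
  have "((\<lambda>t. \<Sum>i\<le>degree q. coeff q i * (t ^ i / exp t)) \<longlongrightarrow> (\<Sum>i\<le>degree q. coeff q i * 0)) at_top"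
    by (intro tendsto_intros tendsto_power_div_exp_0)
  then show ?thesis
    by (simp add: poly_altdef sum_divide_distrib)
qed

lemma flat_poly_tendsto_0: "(flat_poly q \<longlongrightarrow> 0) (at_right 0)"
proof -
  have "((\<lambda>x. poly q (inverse x) / exp (inverse x)) \<longlongrightarrow> 0) (at_right 0)"
    by (rule filterlim_compose[OF poly_exp_tendsto_0 filterlim_inverse_at_top_right])
  moreover have "\<forall>\<^sub>F x in at_right 0. poly q (inverse x) / exp (inverse x) = flat_poly q x"
    by (auto simp: eventually_at_filter flat_poly_def field_simps exp_minus)
  ultimately show ?thesis by (rule Lim_transform_eventually)
qed

text \<open>In the variable t = 1 / x the operator d/dx is - t^2 d/dt, and it turns q(t) exp (- t)
  into t^2 (q - q')(t) exp (- t); the polynomial \<open>[:0, 0, 1:]\<close> is t^2.\<close>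

lemma flat_poly_has_derivative:
  "(flat_poly q has_real_derivative flat_poly ([:0, 0, 1:] * (q - pderiv q)) x) (at x)"
proof -
  consider "x > 0" | "x < 0" | "x = 0" by linarith
  then show ?thesis
  proof cases
    case 1
    have D1: "((\<lambda>x. 1 / x) has_real_derivative - 1 / x\<^sup>2) (at x)"
      using 1 by (auto intro!: derivative_eq_intros simp: power2_eq_square)
    have D2: "((\<lambda>x. poly q (1 / x)) has_real_derivative poly (pderiv q) (1 / x) * (- 1 / x\<^sup>2)) (at x)"
      by (rule DERIV_chain2[OF poly_DERIV D1])
    have D3: "((\<lambda>x. exp (- (1 / x))) has_real_derivative exp (- (1 / x)) * - (- 1 / x\<^sup>2)) (at x)"
      by (rule DERIV_chain2[OF DERIV_exp DERIV_minus[OF D1]])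
    have "((\<lambda>x. poly q (1 / x) * exp (- (1 / x))) has_real_derivative
        flat_poly ([:0, 0, 1:] * (q - pderiv q)) x) (at x)"
      by (rule DERIV_cong[OF DERIV_mult[OF D2 D3]])
        (use 1 in \<open>simp add: flat_poly_def power2_eq_square left_diff_distrib right_diff_distrib\<close>)
    moreover have "\<forall>\<^sub>F y in nhds x. poly q (1 / y) * exp (- (1 / y)) = flat_poly q y"
      using eventually_nhds_in_open[of "{0<..}" x] 1
      by (auto simp: flat_poly_def elim: eventually_mono)
    ultimately show ?thesis
      by (rule DERIV_cong_ev[OF refl _ refl, THEN iffD1, rotated])
  next
    case 2
    have "((\<lambda>x. 0) has_real_derivative flat_poly ([:0, 0, 1:] * (q - pderiv q)) x) (at x)"
      using 2 by (simp add: flat_poly_def)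
    moreover have "\<forall>\<^sub>F y in nhds x. 0 = flat_poly q y"
      using eventually_nhds_in_open[of "{..<0}" x] 2
      by (auto simp: flat_poly_def elim!: eventually_mono)
    ultimately show ?thesis
      by (rule DERIV_cong_ev[OF refl _ refl, THEN iffD1, rotated])
  next
    case 3
    \<comment> \<open>Dividing by \<open>h\<close> multiplies the polynomial by t, so the difference
      quotient at 0 is again a \<open>flat_poly\<close> and tends to 0.\<close>
    have "((\<lambda>h. flat_poly q h / h) \<longlongrightarrow> 0) (at_right 0)"
    proof (rule Lim_transform_eventually[OF flat_poly_tendsto_0[of "[:0, 1:] * q"]])
      show "\<forall>\<^sub>F x in at_right 0. flat_poly ([:0, 1:] * q) x = flat_poly q x / x"
        by (auto simp: eventually_at_filter flat_poly_def)
    qed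
    moreover have "((\<lambda>h. flat_poly q h / h) \<longlongrightarrow> 0) (at_left 0)"
      by (rule Lim_transform_eventually[OF tendsto_const])
        (auto simp: eventually_at_filter flat_poly_def)
    ultimately have "((\<lambda>h. flat_poly q h / h) \<longlongrightarrow> 0) (at 0)"
      by (simp add: filterlim_split_at)
    then show ?thesis
      using 3 by (simp add: DERIV_def flat_poly_def)
  qed
qed

definition flat :: "real \<Rightarrow> real" where
  "flat = flat_poly 1"

lemma flat_eq: "flat x = (if x > 0 then exp (- (1 / x)) else 0)"
  by (simp add: flat_def flat_poly_def)

lemma flat_pos [simp]: "flat x > 0 \<longleftrightarrow> x > 0" and flat_nonneg [simp]: "flat x \<ge> 0"
  and flat_le_1: "flat x \<le> 1" and flat_eq_0: "flat x = 0 \<longleftrightarrow> x \<le> 0"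
  by (auto simp: flat_eq)

lemma flat_mono: "x \<le> y \<Longrightarrow> flat x \<le> flat y"
  by (auto simp: flat_eq field_simps)

lemma smooth_flat:
  assumes "smooth f"
  shows "smooth (\<lambda>x. flat (f x))"
proof -
  define S where "S i = flat_poly (((\<lambda>q. [:0, 0, 1:] * (q - pderiv q)) ^^ i) 1)" for i
  have "(S i has_real_derivative S (Suc i) x) (at x)" for i x
    unfolding S_def by (simp only: funpow.simps o_apply) (rule flat_poly_has_derivative)
  from smooth_compose[where S = S and i = 0, OF this assms] show ?thesis by (simp add: S_def flat_def)
qed

lemma flat_has_derivative:
  obtains flat' :: "real \<Rightarrow> real" and B where "\<And>x. (flat has_real_derivative flat' x) (at x)"
    "\<And>x. x \<le> 0 \<Longrightarrow> flat' x = 0" "B > 0" "\<And>x. \<bar>flat' x\<bar> \<le> B"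
proof
  let ?f = "flat_poly ([:0, 0, 1:] * (1 - pderiv 1))"
  show "(flat has_real_derivative ?f x) (at x)" for x
    unfolding flat_def by (rule flat_poly_has_derivative)
  show "x \<le> 0 \<Longrightarrow> ?f x = 0" for x by (simp add: flat_poly_def)
  show "\<bar>?f x\<bar> \<le> 2" for x
  proof (cases "x > 0")
    case True
    \<comment> \<open>The derivative is \<open>(1/x)\<^sup>2 * exp (- (1/x))\<close>; the quadratic
      Taylor bound gives the constant 2.\<close>
    have "1 + 1/x + (1/x)\<^sup>2 / 2 \<le> exp (1 / x)"
      using exp_lower_Taylor_quadratic[of "1/x"] True by simp
    then have "(1/x)\<^sup>2 \<le> 2 * exp (1 / x)" using True by (smt (verit) divide_pos_pos field_sum_of_halves)
    then show ?thesis
      using True by (simp add: flat_poly_def exp_minus field_simps power2_eq_square)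
  qed (simp add: flat_poly_def)
qed simp

section \<open>Test functions\<close>

lemma test_functionsI:
  assumes "smooth \<phi>" "compact K" "K \<subseteq> \<Omega>" "\<And>x. x \<notin> K \<Longrightarrow> \<phi> x = 0"
  shows "\<phi> \<in> test_functions \<Omega>"
proof -
  have "closure {x. \<phi> x \<noteq> 0} \<subseteq> K"
    using assms by (intro closure_minimal) (auto intro: compact_imp_closed)
  moreover from this have "compact (closure {x. \<phi> x \<noteq> 0})"
    using assms(2) by (metis closed_closure compact_Int_closed inf.absorb_iff2)
  ultimately show ?thesis
    using assms unfolding test_functions_def smooth_def by auto
qed

lemma test_functions_smooth: "\<phi> \<in> test_functions \<Omega> \<Longrightarrow> smooth \<phi>"
  by (simp add: test_functions_def smooth_def)

lemma grad_eq_0: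
  fixes \<phi> :: "'a::euclidean_space \<Rightarrow> real"
  assumes "open U" "x \<in> U" "\<And>y. y \<in> U \<Longrightarrow> \<phi> y = 0"
  shows "grad \<phi> x = 0"
proof (rule has_derivative_imp_grad)
  have "((\<lambda>y. 0) has_derivative (\<lambda>h. h \<bullet> 0)) (at x)" by simp
  then show "(\<phi> has_derivative (\<lambda>h. h \<bullet> 0)) (at x)"
    by (rule has_derivative_transform_within_open[OF _ assms(1,2)]) (simp add: assms(3))
qed

lemma test_functionsE:
  assumes "\<phi> \<in> test_functions \<Omega>"
  obtains K where "compact K" "K \<subseteq> \<Omega>" "\<And>x. x \<notin> K \<Longrightarrow> \<phi> x = 0" "\<And>x. x \<notin> K \<Longrightarrow> grad \<phi> x = 0"
proof
  let ?K = "closure {x. \<phi> x \<noteq> 0}"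
  show "compact ?K" "?K \<subseteq> \<Omega>" using assms unfolding test_functions_def by simp_all
  show z: "\<phi> x = 0" if "x \<notin> ?K" for x
    using that closure_subset[of "{x. \<phi> x \<noteq> 0}"] by auto
  show "grad \<phi> x = 0" if "x \<notin> ?K" for x
  proof (rule grad_eq_0)
    show "open (- ?K)" by (rule open_Compl[OF closed_closure])
    show "x \<in> - ?K" using that by simp
    show "\<phi> y = 0" if "y \<in> - ?K" for y using that z[of y] by simp
  qed
qed

lemma test_functions_outside:
  assumes "\<phi> \<in> test_functions \<Omega>" "x \<notin> \<Omega>"
  shows "\<phi> x = 0" "grad \<phi> x = 0"
  using test_functionsE[OF assms(1)] assms(2) by (metis subsetD)+

lemma test_functions_mono: "U \<subseteq> V \<Longrightarrow> \<phi> \<in> test_functions U \<Longrightarrow> \<phi> \<in> test_functions V"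
  by (auto simp: test_functions_def)

lemma test_functions_bounded:
  assumes "\<phi> \<in> test_functions \<Omega>"
  obtains B where "B > 0" "\<And>x. \<bar>\<phi> x\<bar> \<le> B" "\<And>x. norm (grad \<phi> x) \<le> B"
proof -
  obtain K where K: "compact K" "\<And>x. x \<notin> K \<Longrightarrow> \<phi> x = 0" "\<And>x. x \<notin> K \<Longrightarrow> grad \<phi> x = 0"
    using test_functionsE[OF assms] by metis
  note sm = test_functions_smooth[OF assms]
  obtain B1 where B1: "\<And>x. x \<in> K \<Longrightarrow> norm (\<phi> x) \<le> B1"
    using compact_imp_bounded[OF compact_continuous_image[OF smooth_continuous[OF sm] K(1)]]
    by (auto simp: bounded_iff)
  obtain B2 where B2: "\<And>x. x \<in> K \<Longrightarrow> norm (grad \<phi> x) \<le> B2"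
    using compact_imp_bounded[OF compact_continuous_image[OF smooth_grad_continuous[OF sm] K(1)]]
    by (auto simp: bounded_iff)
  show thesis
  proof (rule that[of "max 1 (max B1 B2)"])
    show "\<bar>\<phi> x\<bar> \<le> max 1 (max B1 B2)" for x
      using B1[of x] K(2)[of x] by (cases "x \<in> K") auto
    show "norm (grad \<phi> x) \<le> max 1 (max B1 B2)" for x
      using B2[of x] K(3)[of x] by (cases "x \<in> K") auto
  qed simp
qed

lemma test_functions_mult:
  assumes "\<phi> \<in> test_functions \<Omega>" "smooth f"
  shows "(\<lambda>x. f x * \<phi> x) \<in> test_functions \<Omega>"
proof -
  obtain K where K: "compact K" "K \<subseteq> \<Omega>" "\<And>x. x \<notin> K \<Longrightarrow> \<phi> x = 0"
    using test_functionsE[OF assms(1)] by metis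
  show ?thesis
    by (rule test_functionsI[OF _ K(1,2)]) (auto simp: K assms test_functions_smooth[OF assms(1)])
qed

lemma test_functions_cmult: "\<phi> \<in> test_functions \<Omega> \<Longrightarrow> (\<lambda>x. c * \<phi> x) \<in> test_functions \<Omega>"
  using test_functions_mult[of \<phi> \<Omega> "\<lambda>x. c"] by blast

lemma test_functions_add:
  assumes "\<phi> \<in> test_functions \<Omega>" "\<psi> \<in> test_functions \<Omega>"
  shows "(\<lambda>x. \<phi> x + \<psi> x) \<in> test_functions \<Omega>"
proof -
  obtain K where K: "compact K" "K \<subseteq> \<Omega>" "\<And>x. x \<notin> K \<Longrightarrow> \<phi> x = 0"
    using test_functionsE[OF assms(1)] by metis
  obtain L where L: "compact L" "L \<subseteq> \<Omega>" "\<And>x. x \<notin> L \<Longrightarrow> \<psi> x = 0"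
    using test_functionsE[OF assms(2)] by metis
  show ?thesis
    by (rule test_functionsI[OF _ compact_Un[OF K(1) L(1)]])
      (use K L in \<open>auto intro!: smooth_add test_functions_smooth[OF assms(1)] test_functions_smooth[OF assms(2)]\<close>)
qed

lemma test_functions_diff:
  "\<phi> \<in> test_functions \<Omega> \<Longrightarrow> \<psi> \<in> test_functions \<Omega> \<Longrightarrow> (\<lambda>x. \<phi> x - \<psi> x) \<in> test_functions \<Omega>"
  using test_functions_add[OF _ test_functions_cmult[of \<psi> \<Omega> "-1"]] by simp

lemma test_functions_zero: "(\<lambda>x. 0) \<in> test_functions \<Omega>"
  by (rule test_functionsI[of _ "{}"]) auto

lemma test_functions_sum:
  "(\<And>i. i \<in> I \<Longrightarrow> \<phi> i \<in> test_functions \<Omega>) \<Longrightarrow> (\<lambda>x. \<Sum>i\<in>I. \<phi> i x) \<in> test_functions \<Omega>"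
  by (induction I rule: infinite_finite_induct) (auto intro: test_functions_zero test_functions_add)

lemma test_functions_tanh:
  assumes "\<phi> \<in> test_functions \<Omega>"
  shows "(\<lambda>x. tanh (\<phi> x)) \<in> test_functions \<Omega>"
proof -
  obtain K where K: "compact K" "K \<subseteq> \<Omega>" "\<And>x. x \<notin> K \<Longrightarrow> \<phi> x = 0"
    using test_functionsE[OF assms(1)] by metis
  show ?thesis
    by (rule test_functionsI[OF _ K(1,2)]) (auto simp: K intro: smooth_tanh test_functions_smooth[OF assms(1)])
qed

lemma bump_test_function:
  assumes "r > 0" "cball a r \<subseteq> \<Omega>"
  shows "(\<lambda>x. flat (r\<^sup>2 - (norm (x - a))\<^sup>2)) \<in> test_functions \<Omega>"
proof (rule test_functionsI[of _ "cball a r"])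
  have "smooth (\<lambda>x. r\<^sup>2 - (\<Sum>b\<in>Basis. (x \<bullet> b - a \<bullet> b) * (x \<bullet> b - a \<bullet> b)))"
    by (intro smooth_diff smooth_sum smooth_mult smooth_const smooth_inner)
  also have "(\<lambda>x. r\<^sup>2 - (\<Sum>b\<in>Basis. (x \<bullet> b - a \<bullet> b) * (x \<bullet> b - a \<bullet> b))) = (\<lambda>x. r\<^sup>2 - (norm (x - a))\<^sup>2)"
    by (intro ext, simp only: power2_norm_eq_inner, subst (2) euclidean_inner) (simp add: inner_diff_left)
  finally show "smooth (\<lambda>x. flat (r\<^sup>2 - (norm (x - a))\<^sup>2))"
    by (rule smooth_flat)
  show "flat (r\<^sup>2 - (norm (x - a))\<^sup>2) = 0" if "x \<notin> cball a r" for x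
    using that assms by (auto simp: flat_eq_0 dist_norm norm_minus_commute intro!: power_mono)
qed (use assms in auto)

text \<open>By the Lindeloef property \<open>U\<close> is a countable union of balls, each carrying
  a bump that is positive exactly on it. Finite sums of bumps keep compact support, and tanh of
  \<open>m\<close> times the sum of the first \<open>m\<close> bumps tends to 1 wherever some bump
  is positive.\<close>

lemma test_functions_approx_indicator:
  fixes U :: "'a::euclidean_space set"
  assumes "open U"
  obtains \<psi> :: "nat \<Rightarrow> 'a \<Rightarrow> real" where "\<And>m. \<psi> m \<in> test_functions U"
    "\<And>m x. 0 \<le> \<psi> m x" "\<And>m x. \<psi> m x \<le> 1" "\<And>x. (\<lambda>m. \<psi> m x) \<longlonglongrightarrow> indicator U x"
proof (cases "U = {}")
  case True
  then show ?thesis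
    using that[of "\<lambda>m x. 0"] by (auto simp: test_functions_zero)
next
  case False
  have "\<exists>r>0. cball x r \<subseteq> U" if "x \<in> U" for x
    using assms that open_contains_cball by blast
  then obtain r where r: "\<And>x. x \<in> U \<Longrightarrow> r x > 0" "\<And>x. x \<in> U \<Longrightarrow> cball x (r x) \<subseteq> U"
    by metis
  obtain F where F: "F \<subseteq> (\<lambda>x. ball x (r x)) ` U" "countable F" "\<Union>F = (\<Union>x\<in>U. ball x (r x))"
    using Lindelof[of "(\<lambda>x. ball x (r x)) ` U"] by auto
  obtain C where C: "countable C" "C \<subseteq> U" "F = (\<lambda>x. ball x (r x)) ` C"
    using countable_subset_image[of F "\<lambda>x. ball x (r x)" U, THEN iffD1, OF conjI[OF F(2,1)]] by blast
  have UC: "U = (\<Union>x\<in>C. ball x (r x))"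
  proof -
    have "U = (\<Union>x\<in>U. ball x (r x))"
    proof (intro subset_antisym subsetI)
      show "x \<in> (\<Union>x\<in>U. ball x (r x))" if "x \<in> U" for x
        using that r(1)[OF that] by (intro UN_I[of x]) auto
      show "x \<in> U" if "x \<in> (\<Union>x\<in>U. ball x (r x))" for x
        using that r(2) ball_subset_cball by blast
    qed
    then show ?thesis using F(3) C(3) by simp
  qed
  then have "C \<noteq> {}" using False by auto
  define a where "a = from_nat_into C"
  have a: "range a = C"
    unfolding a_def using C(1) \<open>C \<noteq> {}\<close> by (rule range_from_nat_into[rotated])
  have aU: "a i \<in> U" for i using a C(2) by blast
  define b where "b i x = flat ((r (a i))\<^sup>2 - (norm (x - a i))\<^sup>2)" for i x
  have b_test: "b i \<in> test_functions U" for i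
    unfolding b_def by (rule bump_test_function) (use r aU in auto)
  have b_pos: "b i x > 0 \<longleftrightarrow> x \<in> ball (a i) (r (a i))" for i x
    unfolding b_def flat_pos using r(1)[OF aU, of i]
    by (auto simp: dist_norm norm_minus_commute intro: power_strict_mono power2_less_imp_less)
  define \<psi> where "\<psi> m x = tanh (real m * (\<Sum>i<m. b i x))" for m x
  show ?thesis
  proof
    show "\<psi> m \<in> test_functions U" for m
      unfolding \<psi>_def by (intro test_functions_tanh test_functions_cmult test_functions_sum b_test)
    show "0 \<le> \<psi> m x" for m x
      by (auto simp: \<psi>_def b_def intro!: mult_nonneg_nonneg sum_nonneg)
    show "\<psi> m x \<le> 1" for m x
      unfolding \<psi>_def using tanh_real_lt_1 less_imp_le by blast
    show "(\<lambda>m. \<psi> m x) \<longlonglongrightarrow> indicator U x" for x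
    proof (cases "x \<in> U")
      case True
      then obtain i where i: "b i x > 0"
        using UC a b_pos by auto
      have "filterlim (\<lambda>m. real m * b i x) at_top sequentially"
        using i by (rule filterlim_at_top_mult_tendsto_pos[OF tendsto_const _ filterlim_real_sequentially])
      then have "filterlim (\<lambda>m. real m * (\<Sum>i<m. b i x)) at_top sequentially"
      proof (rule filterlim_at_top_mono)
        show "\<forall>\<^sub>F m in sequentially. real m * b i x \<le> real m * (\<Sum>i<m. b i x)"
          using eventually_gt_at_top[of i]
        proof eventually_elim
          case (elim m)
          have "b i x \<le> (\<Sum>i<m. b i x)"
            using elim by (intro member_le_sum) (auto simp: b_def)
          then show ?case by (intro mult_left_mono) auto
        qed
      qed
      then have "(\<lambda>m. \<psi> m x) \<longlonglongrightarrow> 1"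
        unfolding \<psi>_def by (rule filterlim_compose[OF tanh_real_at_top])
      then show ?thesis using True by simp
    next
      case False
      have "b i x = 0" for i
      proof -
        have "x \<notin> ball (a i) (r (a i))" using False UC a by blast
        then have "\<not> b i x > 0" by (simp only: b_pos not_False_eq_True)
        moreover have "b i x \<ge> 0" by (simp add: b_def)
        ultimately show ?thesis by simp
      qed
      then show ?thesis using False by (simp add: \<psi>_def)
    qed
  qed
qed

subsection \<open>Integration by parts\<close>

lemma integrable_compact_support:
  fixes h :: "'a::euclidean_space \<Rightarrow> 'b::euclidean_space"
  assumes "continuous_on UNIV h" "compact K" "\<And>x. x \<notin> K \<Longrightarrow> h x = 0"
  shows "integrable lborel h"
proof -
  have "integrable lborel (\<lambda>x. indicator K x *\<^sub>R h x)"
    using assms by (intro borel_integrable_compact) (auto intro: continuous_on_subset)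
  also have "(\<lambda>x. indicator K x *\<^sub>R h x) = h"
    using assms(3) by (auto simp: indicator_def)
  finally show ?thesis .
qed

text \<open>Translation invariance and Fubini are used on the Borel measure \<open>lborel\<close>,
  while the function spaces are built on the completed measure \<open>lebesgue_on \<Omega>\<close>;
  this passes between the two.\<close>

lemma integral_lebesgue_on_eq_lborel:
  fixes h :: "'a::euclidean_space \<Rightarrow> 'b::euclidean_space"
  assumes "\<Omega> \<in> sets lebesgue" "h \<in> borel_measurable borel" "\<And>x. x \<notin> \<Omega> \<Longrightarrow> h x = 0"
  shows "(LINT x|lebesgue_on \<Omega>. h x) = (LINT x|lborel. h x)"
    and "integrable (lebesgue_on \<Omega>) h \<longleftrightarrow> integrable lborel h"
proof -
  have eq: "(\<lambda>x. indicator \<Omega> x *\<^sub>R h x) = h"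
    using assms(3) by (auto simp: indicator_def)
  have m: "h \<in> borel_measurable lborel" using assms(2) by simp
  show "(LINT x|lebesgue_on \<Omega>. h x) = (LINT x|lborel. h x)"
    using assms(1) m by (subst integral_restrict_space) (auto simp: eq integral_completion)
  show "integrable (lebesgue_on \<Omega>) h \<longleftrightarrow> integrable lborel h"
    using assms(1) m by (subst integrable_restrict_space) (auto simp: eq integrable_completion)
qed

lemma integrable_lebesgue_on_compact_support:
  fixes h :: "'a::euclidean_space \<Rightarrow> 'b::euclidean_space"
  assumes "continuous_on UNIV h" "compact K" "\<And>x. x \<notin> K \<Longrightarrow> h x = 0" "K \<subseteq> \<Omega>" "\<Omega> \<in> sets lebesgue"
  shows "integrable (lebesgue_on \<Omega>) h"
  using integrable_compact_support[OF assms(1-3)] assms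
  by (subst integral_lebesgue_on_eq_lborel) (auto simp: borel_measurable_continuous_onI)

lemma test_functions_integrable:
  assumes "\<phi> \<in> test_functions \<Omega>" "open \<Omega>"
  shows "integrable (lebesgue_on \<Omega>) \<phi>" "integrable (lebesgue_on \<Omega>) (grad \<phi>)"
proof -
  obtain K where K: "compact K" "K \<subseteq> \<Omega>" "\<And>x. x \<notin> K \<Longrightarrow> \<phi> x = 0" "\<And>x. x \<notin> K \<Longrightarrow> grad \<phi> x = 0"
    using test_functionsE[OF assms(1)] by metis
  note sm = test_functions_smooth[OF assms(1)]
  show "integrable (lebesgue_on \<Omega>) \<phi>"
    by (rule integrable_lebesgue_on_compact_support[OF smooth_continuous[OF sm] K(1,3,2)])
      (use assms in auto)
  show "integrable (lebesgue_on \<Omega>) (grad \<phi>)"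
    by (rule integrable_lebesgue_on_compact_support[OF smooth_grad_continuous[OF sm] K(1,4,2)])
      (use assms in auto)
qed

lemma lborel_integral_translate:
  fixes f :: "'a::euclidean_space \<Rightarrow> real"
  assumes "f \<in> borel_measurable borel"
  shows "(LINT x|lborel. f (c + x)) = (LINT x|lborel. f x)"
proof -
  have "(LINT x|lborel. f x) = (LINT x|distr lborel borel ((+) c). f x)"
    by (simp add: lborel_distr_plus)
  also have "\<dots> = (LINT x|lborel. f (c + x))"
    by (rule integral_distr) (use assms in auto)
  finally show ?thesis by simp
qed

text \<open>By translation invariance every difference quotient of \<phi> has integral 0, and the
  quotients tend boundedly to the directional derivative. Neither Fubini nor a one-dimensional
  fundamental theorem is involved.\<close>

lemma integral_grad_eq_0:
  assumes "\<phi> \<in> test_functions \<Omega>" "open \<Omega>"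
  shows "(LINT x|lebesgue_on \<Omega>. grad \<phi> x) = 0"
proof -
  obtain K where K: "compact K" "K \<subseteq> \<Omega>" "\<And>x. x \<notin> K \<Longrightarrow> \<phi> x = 0" "\<And>x. x \<notin> K \<Longrightarrow> grad \<phi> x = 0"
    using test_functionsE[OF assms(1)] by metis
  obtain B where B: "B > 0" "\<And>x. norm (grad \<phi> x) \<le> B"
    using test_functions_bounded[OF assms(1)] by metis
  note sm = test_functions_smooth[OF assms(1)]
  have meas [measurable]: "\<phi> \<in> borel_measurable borel" "grad \<phi> \<in> borel_measurable borel"
    using smooth_continuous[OF sm] smooth_grad_continuous[OF sm] by (auto intro: borel_measurable_continuous_onI)
  have int: "integrable lborel \<phi>"
    by (rule integrable_compact_support[OF smooth_continuous[OF sm] K(1,3)])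
  have gint: "integrable lborel (grad \<phi>)"
    by (rule integrable_compact_support[OF smooth_grad_continuous[OF sm] K(1,4)])
  have "h \<bullet> (LINT x|lborel. grad \<phi> x) = 0" for h
  proof -
    \<comment> \<open>A compact set that contains the supports of all the difference quotients,
      since the translations have length at most \<open>norm h\<close>.\<close>
    define L where "L = (\<lambda>(x, y). x + y) ` (K \<times> cball 0 (norm h))"
    have L: "compact L"
      unfolding L_def case_prod_beta by (intro compact_continuous_image compact_Times K continuous_intros) auto
    define s where "s n x = real (Suc n) * (\<phi> ((1 / real (Suc n)) *\<^sub>R h + x) - \<phi> x)" for n x
    have s0: "(LINT x|lborel. s n x) = 0" for n
    proof -
      have "integrable lborel (\<lambda>x. \<phi> ((1 / real (Suc n)) *\<^sub>R h + x))"
      proof (rule integrable_compact_support)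
        show "continuous_on UNIV (\<lambda>x. \<phi> ((1 / real (Suc n)) *\<^sub>R h + x))"
          by (intro continuous_on_compose2[OF smooth_continuous[OF sm, of UNIV]] continuous_intros) auto
        show "compact ((\<lambda>x. - ((1 / real (Suc n)) *\<^sub>R h) + x) ` K)"
          by (rule compact_translation[OF K(1)])
        show "\<phi> ((1 / real (Suc n)) *\<^sub>R h + x) = 0" if "x \<notin> (\<lambda>x. - ((1 / real (Suc n)) *\<^sub>R h) + x) ` K" for x
          by (rule K(3)) (use that in \<open>force simp: image_iff\<close>)
      qed
      then show ?thesis
        unfolding s_def using int lborel_integral_translate[OF meas(1), of "(1 / real (Suc n)) *\<^sub>R h"] by simp
    qed
    have sB: "\<bar>s n x\<bar> \<le> indicator L x * (B * norm h)" for n x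
    proof -
      have tn: "norm ((1 / real (Suc n)) *\<^sub>R h) \<le> norm h"
        by (simp add: field_simps mult_left_le_one_le)
      show ?thesis
      proof (cases "x \<in> L")
        case True
        have "norm (\<phi> ((1 / real (Suc n)) *\<^sub>R h + x) - \<phi> x) \<le> B * norm ((1 / real (Suc n)) *\<^sub>R h + x - x)"
        proof (rule differentiable_bound[of UNIV])
          show "(\<phi> has_derivative (\<lambda>h. h \<bullet> grad \<phi> x)) (at x within UNIV)" for x
            by (rule smooth_has_derivative[OF sm])
          show "onorm (\<lambda>h. h \<bullet> grad \<phi> x) \<le> B" for x
            by (rule onorm_le) (metis B(2) Cauchy_Schwarz_ineq2 mult.commute mult_right_mono norm_ge_zero order_trans real_norm_def)
        qed auto
        then have "\<bar>s n x\<bar> \<le> real (Suc n) * (B * norm ((1 / real (Suc n)) *\<^sub>R h))"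
          unfolding s_def by (simp add: abs_mult del: norm_scaleR)
        also have "\<dots> = B * norm h" by simp
        finally show ?thesis using True by simp
      next
        case False
        have "x \<notin> K" "(1 / real (Suc n)) *\<^sub>R h + x \<notin> K"
        proof -
          show "x \<notin> K" using False unfolding L_def by force
          show "(1 / real (Suc n)) *\<^sub>R h + x \<notin> K"
          proof
            assume *: "(1 / real (Suc n)) *\<^sub>R h + x \<in> K"
            have "x = (\<lambda>(x, y). x + y) ((1 / real (Suc n)) *\<^sub>R h + x, - ((1 / real (Suc n)) *\<^sub>R h))" by simp
            moreover have "((1 / real (Suc n)) *\<^sub>R h + x, - ((1 / real (Suc n)) *\<^sub>R h)) \<in> K \<times> cball 0 (norm h)"
              using * tn by simp
            ultimately show False using False unfolding L_def by blast
          qed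
        qed
        then show ?thesis using False K(3) by (simp add: s_def)
      qed
    qed
    have slim: "(\<lambda>n. s n x) \<longlonglongrightarrow> h \<bullet> grad \<phi> x" for x
    proof -
      have "((\<lambda>t. \<phi> (t *\<^sub>R h + x)) has_derivative (\<lambda>t. (t *\<^sub>R h) \<bullet> grad \<phi> x)) (at 0)"
        by (rule has_derivative_compose[of "\<lambda>t. t *\<^sub>R h + x" "\<lambda>t. t *\<^sub>R h"])
          (auto intro!: derivative_eq_intros smooth_has_derivative[OF sm])
      then have "((\<lambda>t. \<phi> (t *\<^sub>R h + x)) has_real_derivative (h \<bullet> grad \<phi> x)) (at 0)"
        unfolding has_field_derivative_def by (rule has_derivative_eq_rhs) (simp add: fun_eq_iff)
      then have D: "((\<lambda>t. (\<phi> (t *\<^sub>R h + x) - \<phi> x) / t) \<longlongrightarrow> h \<bullet> grad \<phi> x) (at 0)"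
        by (simp add: DERIV_def)
      have "filterlim (\<lambda>n. 1 / real (Suc n)) (at 0) sequentially"
        using LIMSEQ_inverse_real_of_nat
        by (auto simp: filterlim_at inverse_eq_divide)
      from filterlim_compose[OF D this] show ?thesis
        by (simp add: s_def mult.commute)
    qed
    have "(\<lambda>n. LINT x|lborel. s n x) \<longlonglongrightarrow> (LINT x|lborel. h \<bullet> grad \<phi> x)"
    proof (rule integral_dominated_convergence[where w = "\<lambda>x. indicator L x * (B * norm h)"])
      show "integrable lborel (\<lambda>x. indicator L x * (B * norm h))"
        using L by (intro integrable_mult_left integrable_real_indicator)
          (use emeasure_compact_finite[OF L] in \<open>auto simp: borel_compact\<close>)
      show "s n \<in> borel_measurable lborel" for n
        unfolding s_def by measurable
    qed (use slim sB in auto)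
    then have "(LINT x|lborel. h \<bullet> grad \<phi> x) = 0"
      using s0 by (simp add: LIMSEQ_const_iff)
    then show ?thesis using gint by simp
  qed
  then have "(LINT x|lborel. grad \<phi> x) = 0"
    using inner_eq_zero_iff by blast
  then show ?thesis
    using integral_lebesgue_on_eq_lborel(1)[of \<Omega> "grad \<phi>"] assms meas(2) test_functions_outside(2)[OF assms(1)] by auto
qed

subsection \<open>Weak gradients\<close>

definition loc_int :: "'a::euclidean_space set \<Rightarrow> ('a \<Rightarrow> 'b::euclidean_space) \<Rightarrow> bool" where
  "loc_int \<Omega> f \<longleftrightarrow> (\<forall>K. compact K \<and> K \<subseteq> \<Omega> \<longrightarrow> integrable (lebesgue_on K) f)"

lemma integrable_lebesgue_on:
  fixes f :: "'a::euclidean_space \<Rightarrow> 'b::euclidean_space"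
  assumes "S \<in> sets lebesgue"
  shows "integrable (lebesgue_on S) f \<longleftrightarrow> integrable lebesgue (\<lambda>x. indicator S x *\<^sub>R f x)"
  using assms by (simp add: integrable_restrict_space)

lemma loc_intD:
  fixes f :: "'a::euclidean_space \<Rightarrow> 'b::euclidean_space"
  assumes "loc_int \<Omega> f" "compact K" "K \<subseteq> \<Omega>"
  shows "integrable lebesgue (\<lambda>x. indicator K x *\<^sub>R f x)"
  using assms integrable_lebesgue_on[of K f]
  by (simp add: loc_int_def borel_compact lmeasurable_compact)

lemma loc_int_integrable:
  fixes f :: "'a::euclidean_space \<Rightarrow> 'b::euclidean_space"
  assumes "integrable (lebesgue_on \<Omega>) f" "\<Omega> \<in> sets lebesgue"
  shows "loc_int \<Omega> f"
  unfolding loc_int_def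
proof (intro allI impI)
  fix K assume K: "compact K \<and> K \<subseteq> \<Omega>"
  then have Km: "K \<in> sets lebesgue" by (simp add: borel_compact lmeasurable_compact)
  have "integrable lebesgue (\<lambda>x. indicator K x *\<^sub>R (indicator \<Omega> x *\<^sub>R f x))"
    by (rule integrable_mult_indicator[OF Km]) (use assms in \<open>simp add: integrable_lebesgue_on\<close>)
  also have "(\<lambda>x. indicator K x *\<^sub>R (indicator \<Omega> x *\<^sub>R f x)) = (\<lambda>x. indicator K x *\<^sub>R f x)"
  proof
    fix x show "indicator K x *\<^sub>R (indicator \<Omega> x *\<^sub>R f x) = indicator K x *\<^sub>R f x"
      using K by (cases "x \<in> K") auto
  qed
  finally show "integrable (lebesgue_on K) f"
    using Km by (simp add: integrable_restrict_space)
qed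

lemma loc_int_mult:
  fixes f :: "'a::euclidean_space \<Rightarrow> 'b::euclidean_space"
  assumes "loc_int \<Omega> f" "\<Omega> \<in> sets lebesgue" "continuous_on UNIV \<phi>" "compact K" "K \<subseteq> \<Omega>"
    "\<And>x. x \<notin> K \<Longrightarrow> \<phi> x = (0::real)"
  shows "integrable (lebesgue_on \<Omega>) (\<lambda>x. \<phi> x *\<^sub>R f x)"
proof -
  have Km: "K \<in> sets lebesgue" using assms by (simp add: borel_compact lmeasurable_compact)
  obtain B where B: "\<And>x. x \<in> K \<Longrightarrow> norm (\<phi> x) \<le> B"
    using compact_imp_bounded[OF compact_continuous_image[OF continuous_on_subset[OF assms(3)] assms(4)]]
    by (auto simp: bounded_iff)
  have i: "integrable lebesgue (\<lambda>x. indicator K x *\<^sub>R f x)"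
    by (rule loc_intD[OF assms(1,4,5)])
  have "\<phi> \<in> borel_measurable borel" using assms(3) by (rule borel_measurable_continuous_onI)
  then have [measurable]: "\<phi> \<in> borel_measurable lebesgue" by (simp add: measurable_completion)
  have "integrable lebesgue (\<lambda>x. \<phi> x *\<^sub>R (indicator K x *\<^sub>R f x))"
  proof (rule Bochner_Integration.integrable_bound)
    show "integrable lebesgue (\<lambda>x. \<bar>B\<bar> *\<^sub>R (indicator K x *\<^sub>R f x))"
      by (intro integrable_scaleR_right i)
    show "(\<lambda>x. \<phi> x *\<^sub>R (indicator K x *\<^sub>R f x)) \<in> borel_measurable lebesgue"
      using i by measurable
    show "AE x in lebesgue. norm (\<phi> x *\<^sub>R (indicator K x *\<^sub>R f x)) \<le> norm (\<bar>B\<bar> *\<^sub>R (indicator K x *\<^sub>R f x))"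
    proof (rule AE_I2)
      fix x show "norm (\<phi> x *\<^sub>R (indicator K x *\<^sub>R f x)) \<le> norm (\<bar>B\<bar> *\<^sub>R (indicator K x *\<^sub>R f x))"
        using B[of x] by (cases "x \<in> K") (auto intro!: mult_right_mono)
    qed
  qed
  also have "(\<lambda>x. \<phi> x *\<^sub>R (indicator K x *\<^sub>R f x)) = (\<lambda>x. indicator \<Omega> x *\<^sub>R (\<phi> x *\<^sub>R f x))"
  proof
    fix x show "\<phi> x *\<^sub>R (indicator K x *\<^sub>R f x) = indicator \<Omega> x *\<^sub>R (\<phi> x *\<^sub>R f x)"
      using assms(5) assms(6)[of x] by (cases "x \<in> K") auto
  qed
  finally show ?thesis using assms(2) by (simp add: integrable_restrict_space)
qed

lemma test_mult_integrable:
  fixes f :: "'a::euclidean_space \<Rightarrow> 'b::euclidean_space"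
  assumes "loc_int \<Omega> f" "open \<Omega>" "\<phi> \<in> test_functions \<Omega>"
  shows "integrable (lebesgue_on \<Omega>) (\<lambda>x. \<phi> x *\<^sub>R f x)"
proof -
  obtain K where K: "compact K" "K \<subseteq> \<Omega>" "\<And>x. x \<notin> K \<Longrightarrow> \<phi> x = 0"
    using test_functionsE[OF assms(3)] by metis
  show ?thesis
    by (rule loc_int_mult[OF assms(1) _ smooth_continuous[OF test_functions_smooth[OF assms(3)]] K])
      (use assms in auto)
qed

lemma loc_int_continuous:
  fixes f :: "'a::euclidean_space \<Rightarrow> 'b::euclidean_space"
  assumes "continuous_on UNIV f"
  shows "loc_int \<Omega> f"
  unfolding loc_int_def
proof (intro allI impI)
  fix K assume K: "compact K \<and> K \<subseteq> \<Omega>"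
  then have "integrable lborel (\<lambda>x. indicator K x *\<^sub>R f x)"
    using assms by (intro borel_integrable_compact) (auto intro: continuous_on_subset)
  then have "integrable lebesgue (\<lambda>x. indicator K x *\<^sub>R f x)"
    using borel_measurable_integrable by (subst integrable_completion) auto
  then show "integrable (lebesgue_on K) f"
    using K by (simp add: integrable_restrict_space borel_compact lmeasurable_compact)
qed

text \<open>The product \<open>u x * \<phi> x\<close> is a test function, so the integral of its
  gradient vanishes; the product rule splits it into the two sides.\<close>

lemma smooth_has_weak_gradient:
  assumes "smooth u" "open \<Omega>"
  shows "has_weak_gradient \<Omega> u (grad u)"
  unfolding has_weak_gradient_def
proof (intro conjI ballI)
  have l: "loc_int \<Omega> u" "loc_int \<Omega> (grad u)"
    by (intro loc_int_continuous smooth_continuous smooth_grad_continuous assms)+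
  then show "\<forall>K. compact K \<and> K \<subseteq> \<Omega> \<longrightarrow> integrable (lebesgue_on K) u \<and> integrable (lebesgue_on K) (grad u)"
    by (simp add: loc_int_def)
  fix \<phi> assume \<phi>: "\<phi> \<in> test_functions \<Omega>"
  obtain K where K: "compact K" "K \<subseteq> \<Omega>" "\<And>x. x \<notin> K \<Longrightarrow> grad \<phi> x = 0"
    using test_functionsE[OF \<phi>] by metis
  have "integrable (lebesgue_on \<Omega>) (\<lambda>x. u x *\<^sub>R grad \<phi> x)"
    by (rule integrable_lebesgue_on_compact_support[OF _ K(1) _ K(2)])
      (use K assms in \<open>auto intro!: continuous_intros smooth_continuous smooth_grad_continuous test_functions_smooth[OF \<phi>]\<close>)
  moreover have "integrable (lebesgue_on \<Omega>) (\<lambda>x. \<phi> x *\<^sub>R grad u x)"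
    by (rule test_mult_integrable[OF l(2) assms(2) \<phi>])
  moreover have "0 = (LINT x|lebesgue_on \<Omega>. u x *\<^sub>R grad \<phi> x + \<phi> x *\<^sub>R grad u x)"
    using integral_grad_eq_0[OF test_functions_mult[OF \<phi> assms(1)] assms(2)]
    by (simp add: grad_mult assms test_functions_smooth[OF \<phi>])
  ultimately show "(LINT x|lebesgue_on \<Omega>. u x *\<^sub>R grad \<phi> x) = - (LINT x|lebesgue_on \<Omega>. \<phi> x *\<^sub>R grad u x)"
    by (simp add: eq_neg_iff_add_eq_0)
qed

lemma integral_restrict_compact:
  fixes f :: "'a::euclidean_space \<Rightarrow> 'b::euclidean_space"
  assumes "K \<subseteq> \<Omega>" "\<Omega> \<in> sets lebesgue" "\<And>x. x \<notin> K \<Longrightarrow> \<phi> x = (0::real)"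
  shows "(LINT x|lebesgue_on \<Omega>. \<phi> x *\<^sub>R f x) = (LINT x|lebesgue. \<phi> x *\<^sub>R (indicator K x *\<^sub>R f x))"
proof -
  have "(\<lambda>x. \<phi> x *\<^sub>R (indicator K x *\<^sub>R f x)) = (\<lambda>x. indicator \<Omega> x *\<^sub>R (\<phi> x *\<^sub>R f x))"
  proof
    fix x show "\<phi> x *\<^sub>R (indicator K x *\<^sub>R f x) = indicator \<Omega> x *\<^sub>R (\<phi> x *\<^sub>R f x)"
      using assms(1) assms(3)[of x] by (cases "x \<in> K") auto
  qed
  then show ?thesis
    using assms(2) by (simp add: integral_restrict_space)
qed

text \<open>The identity passes from test functions to indicators of open sets, then to decreasing
  intersections of such, and these are the measurable sets up to null sets.\<close>

lemma fundamental_lemma: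
  fixes f :: "'a::euclidean_space \<Rightarrow> real"
  assumes "open \<Omega>" "loc_int \<Omega> f"
    and "\<And>\<phi>. \<phi> \<in> test_functions \<Omega> \<Longrightarrow> (LINT x|lebesgue_on \<Omega>. \<phi> x * f x) = 0"
  shows "AE x in lebesgue_on \<Omega>. f x = 0"
proof -
  \<comment> \<open>\<open>f\<close> is integrable only on compact sets, so the argument runs inside
    an open \<open>W\<close> with a compact superset \<open>K\<close>, on which the truncation
    \<open>F\<close> is integrable.\<close>
  have W: "AE x in lebesgue. x \<in> W \<longrightarrow> f x = 0" if W: "open W" "W \<subseteq> K" "compact K" "K \<subseteq> \<Omega>" for W K
  proof -
    define F where "F x = indicator K x *\<^sub>R f x" for x
    have Km: "K \<in> sets lebesgue" using W by (simp add: borel_compact lmeasurable_compact)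
    have F: "integrable lebesgue F"
      unfolding F_def by (rule loc_intD[OF assms(2) W(3,4)])
    have U: "(LINT x|lebesgue. indicator U x * F x) = 0" if U: "open U" "U \<subseteq> W" for U
    proof -
      obtain \<psi> :: "nat \<Rightarrow> 'a \<Rightarrow> real" where \<psi>: "\<And>m. \<psi> m \<in> test_functions U" "\<And>m x. 0 \<le> \<psi> m x"
        "\<And>m x. \<psi> m x \<le> 1" "\<And>x. (\<lambda>m. \<psi> m x) \<longlonglongrightarrow> indicator U x"
        using test_functions_approx_indicator[OF U(1)] by metis
      have "(LINT x|lebesgue. \<psi> m x * F x) = 0" for m
      proof -
        have "\<psi> m x = 0" if "x \<notin> K" for x
          using test_functions_outside(1)[OF \<psi>(1)] U W that by blast
        then have "(LINT x|lebesgue_on \<Omega>. \<psi> m x *\<^sub>R f x) = (LINT x|lebesgue. \<psi> m x *\<^sub>R F x)"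
          unfolding F_def using W assms(1) by (intro integral_restrict_compact) auto
        moreover have "\<psi> m \<in> test_functions \<Omega>"
          by (rule test_functions_mono[OF _ \<psi>(1)]) (use U W in blast)
        ultimately show ?thesis using assms(3)[of "\<psi> m"] by simp
      qed
      moreover have "(\<lambda>m. LINT x|lebesgue. \<psi> m x * F x) \<longlonglongrightarrow> (LINT x|lebesgue. indicator U x * F x)"
      proof (rule integral_dominated_convergence[where w = "\<lambda>x. norm (F x)"])
        have "\<psi> m \<in> borel_measurable lebesgue" for m
          using smooth_continuous[OF test_functions_smooth[OF \<psi>(1)]]
          by (intro measurable_completion) (auto intro: borel_measurable_continuous_onI)
        then show "(\<lambda>x. \<psi> m x * F x) \<in> borel_measurable lebesgue" for m
          using F by measurable
        have "U \<in> sets lebesgue" using U by auto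
        then show "(\<lambda>x. indicator U x * F x) \<in> borel_measurable lebesgue"
          using F by measurable
        show "AE x in lebesgue. (\<lambda>m. \<psi> m x * F x) \<longlonglongrightarrow> indicator U x * F x"
          by (intro AE_I2 tendsto_mult \<psi> tendsto_const)
        show "AE x in lebesgue. norm (\<psi> m x * F x) \<le> norm (F x)" for m
          using \<psi>(2,3) by (intro AE_I2) (simp add: abs_mult mult_left_le_one_le)
      qed (use F in auto)
      ultimately show ?thesis by (simp add: LIMSEQ_const_iff)
    qed
    have A: "(LINT x|lebesgue. indicator A x * F x) = 0" if A: "A \<in> sets lebesgue" "A \<subseteq> W" for A
    proof -
      obtain C T where C: "gdelta C" "T \<in> null_sets lebesgue" "A \<union> T = C" "disjnt A T"
        using lebesgue_set_almost_gdelta[OF A(1)] by metis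
      obtain O' where O': "C = (\<Inter>n. O' n)" "\<And>n::nat. open (O' n)"
        using C(1) by (auto simp: gdelta.simps)
      \<comment> \<open>Decreasing open subsets of \<open>W\<close> with intersection
        \<open>W \<inter> C\<close>, which differs from \<open>A\<close> by a null set.\<close>
      define V where "V n = W \<inter> (\<Inter>i\<le>n. O' i)" for n
      have V: "open (V n)" "V n \<subseteq> W" for n
        unfolding V_def using W O' by (auto intro!: open_Int open_INT)
      have lim: "(\<lambda>n. indicator (V n) x) \<longlonglongrightarrow> (indicator (W \<inter> C) x :: real)" for x
      proof -
        have "(\<lambda>n. indicator (V n) x) \<longlonglongrightarrow> (indicator (\<Inter>n. V n) x :: real)"
          by (rule LIMSEQ_indicator_decseq) (auto simp: decseq_def V_def)
        moreover have "(\<Inter>n. V n) = W \<inter> C"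
          unfolding V_def O' by auto
        ultimately show ?thesis by simp
      qed
      have "(\<lambda>n. LINT x|lebesgue. indicator (V n) x * F x) \<longlonglongrightarrow> (LINT x|lebesgue. indicator A x * F x)"
      proof (rule integral_dominated_convergence[where w = "\<lambda>x. norm (F x)"])
        have "V n \<in> sets lebesgue" for n using V by auto
        then show "(\<lambda>x. indicator (V n) x * F x) \<in> borel_measurable lebesgue" for n
          using F by measurable
        show "(\<lambda>x. indicator A x * F x) \<in> borel_measurable lebesgue"
          using A F by measurable
        have "AE x in lebesgue. x \<notin> T" using C(2) by (rule AE_not_in)
        then show "AE x in lebesgue. (\<lambda>n. indicator (V n) x * F x) \<longlonglongrightarrow> indicator A x * F x"
        proof eventually_elim
          case (elim x)
          then have "indicator A x = (indicator (W \<inter> C) x :: real)"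
            using A(2) C(3) by (auto simp: indicator_def)
          then show ?case using lim[of x] by (intro tendsto_mult) auto
        qed
      qed (use F in \<open>auto simp: indicator_def\<close>)
      then show ?thesis using U[OF V] by (simp add: LIMSEQ_const_iff)
    qed
    \<comment> \<open>With \<open>A\<close> the part of \<open>W\<close> where
      \<open>s * f x\<close> is positive, a nonnegative function has integral 0; the two signs
      together give \<open>f x = 0\<close>.\<close>
    have pos: "AE x in lebesgue. x \<in> W \<longrightarrow> s * f x \<le> 0" if "s = 1 \<or> s = -1" for s :: real
    proof -
      have Wm: "W \<in> sets lebesgue" using W by auto
      define A where "A = W \<inter> {x. s * F x > 0}"
      have "{x \<in> space lebesgue. s * F x > 0} \<in> sets lebesgue"
        using F by measurable
      then have Am: "A \<in> sets lebesgue" unfolding A_def using Wm by auto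
      have "integrable lebesgue (\<lambda>x. indicator A x *\<^sub>R F x)"
        by (rule integrable_mult_indicator[OF Am F])
      then have i: "integrable lebesgue (\<lambda>x. s * (indicator A x * F x))" by simp
      have "(LINT x|lebesgue. s * (indicator A x * F x)) = s * (LINT x|lebesgue. indicator A x * F x)"
        by (rule integral_mult_right_zero)
      then have z: "(LINT x|lebesgue. s * (indicator A x * F x)) = 0"
        using A[OF Am] by (simp add: A_def)
      have nn: "AE x in lebesgue. 0 \<le> s * (indicator A x * F x)"
        by (rule AE_I2) (simp add: A_def indicator_def)
      have "AE x in lebesgue. s * (indicator A x * F x) = 0"
        by (rule integral_nonneg_eq_0_iff_AE[OF i nn, THEN iffD1, OF z])
      then show ?thesis
      proof eventually_elim
        case (elim x)
        show ?case
        proof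
          assume x: "x \<in> W"
          then have "F x = f x" using W by (auto simp: F_def)
          then show "s * f x \<le> 0"
            using elim x by (cases "x \<in> A") (auto simp: A_def)
        qed
      qed
    qed
    show ?thesis using pos[of 1] pos[of "-1"] by auto
  qed
  \<comment> \<open>Exhaustion by compact sets: the interiors cover \<Omega>, and countably many
    null sets are collected.\<close>
  obtain C where C: "\<And>n. compact (C n)" "\<And>n. C n \<subseteq> \<Omega>" "\<And>n. C n \<subseteq> interior (C (Suc n))" "\<Union> (range C) = \<Omega>"
    using open_Union_compact_subsets[OF assms(1)] by metis
  have "AE x in lebesgue. x \<in> interior (C n) \<longrightarrow> f x = 0" for n
    by (rule W[OF open_interior interior_subset C(1,2)])
  then have "AE x in lebesgue. \<forall>n. x \<in> interior (C n) \<longrightarrow> f x = 0"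
    by (rule AE_all_countable[THEN iffD2, OF allI])
  then have "AE x in lebesgue. x \<in> \<Omega> \<longrightarrow> f x = 0"
    by eventually_elim (use C(3,4) in blast)
  then show ?thesis
    using assms(1) by (subst AE_restrict_space_iff) auto
qed

lemma fundamental_lemma_vec:
  fixes f :: "'a::euclidean_space \<Rightarrow> 'b::euclidean_space"
  assumes "open \<Omega>" "loc_int \<Omega> f"
    and "\<And>\<phi>. \<phi> \<in> test_functions \<Omega> \<Longrightarrow> (LINT x|lebesgue_on \<Omega>. \<phi> x *\<^sub>R f x) = 0"
  shows "AE x in lebesgue_on \<Omega>. f x = 0"
proof -
  have "AE x in lebesgue_on \<Omega>. f x \<bullet> b = 0" if "b \<in> Basis" for b
  proof (rule fundamental_lemma[OF assms(1)])
    show "loc_int \<Omega> (\<lambda>x. f x \<bullet> b)"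
      using assms(2) unfolding loc_int_def by auto
    show "(LINT x|lebesgue_on \<Omega>. \<phi> x * (f x \<bullet> b)) = 0" if "\<phi> \<in> test_functions \<Omega>" for \<phi>
      using assms(3)[OF that] integral_inner_left[of b "lebesgue_on \<Omega>" "\<lambda>x. \<phi> x *\<^sub>R f x"]
        test_mult_integrable[OF assms(2,1) that] by simp
  qed
  then have "AE x in lebesgue_on \<Omega>. \<forall>b\<in>Basis. f x \<bullet> b = 0"
    by (intro AE_ball_countable[THEN iffD2]) (auto simp: countable_finite)
  then show ?thesis
    by eventually_elim (auto intro: euclidean_eqI)
qed

lemma has_weak_gradient_loc_int:
  "has_weak_gradient \<Omega> u g \<Longrightarrow> loc_int \<Omega> u" "has_weak_gradient \<Omega> u g \<Longrightarrow> loc_int \<Omega> g"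
  by (auto simp: has_weak_gradient_def loc_int_def)

lemma weak_gradient_unique:
  assumes "open \<Omega>" "has_weak_gradient \<Omega> u g" "has_weak_gradient \<Omega> u h"
  shows "AE x in lebesgue_on \<Omega>. g x = h x"
proof -
  note l = has_weak_gradient_loc_int(2)[OF assms(2)] has_weak_gradient_loc_int(2)[OF assms(3)]
  have "AE x in lebesgue_on \<Omega>. g x - h x = 0"
  proof (rule fundamental_lemma_vec[OF assms(1)])
    show "loc_int \<Omega> (\<lambda>x. g x - h x)"
      using l by (auto simp: loc_int_def)
    show "(LINT x|lebesgue_on \<Omega>. \<phi> x *\<^sub>R (g x - h x)) = 0" if \<phi>: "\<phi> \<in> test_functions \<Omega>" for \<phi>
    proof -
      have "(LINT x|lebesgue_on \<Omega>. \<phi> x *\<^sub>R g x) = (LINT x|lebesgue_on \<Omega>. \<phi> x *\<^sub>R h x)"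
        using assms(2,3) \<phi> unfolding has_weak_gradient_def by (metis neg_equal_iff_equal)
      then show ?thesis
        using test_mult_integrable[OF l(1) assms(1) \<phi>] test_mult_integrable[OF l(2) assms(1) \<phi>]
        by (simp add: scaleR_diff_right)
    qed
  qed
  then show ?thesis by simp
qed

text \<open>\<open>weak_grad\<close> is a choice. By uniqueness it agrees almost everywhere with any
  weak gradient at hand, so modulars and norms may be computed with that one.\<close>

lemma weak_grad_AE:
  assumes "open \<Omega>" "has_weak_gradient \<Omega> u g"
  shows "AE x in lebesgue_on \<Omega>. weak_grad \<Omega> u x = g x"
  by (rule weak_gradient_unique[OF assms(1) _ assms(2)])
    (unfold weak_grad_def, rule someI[of "has_weak_gradient \<Omega> u", OF assms(2)])

lemma weak_grad_smooth:
  assumes "open \<Omega>" "smooth u"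
  shows "AE x in lebesgue_on \<Omega>. weak_grad \<Omega> u x = grad u x"
  by (rule weak_grad_AE[OF assms(1) smooth_has_weak_gradient[OF assms(2,1)]])

lemma has_weak_gradient_add:
  assumes "open \<Omega>" "has_weak_gradient \<Omega> u g" "has_weak_gradient \<Omega> v h"
  shows "has_weak_gradient \<Omega> (\<lambda>x. u x + v x) (\<lambda>x. g x + h x)"
  unfolding has_weak_gradient_def
proof (intro conjI ballI)
  show "\<forall>K. compact K \<and> K \<subseteq> \<Omega> \<longrightarrow> integrable (lebesgue_on K) (\<lambda>x. u x + v x) \<and>
      integrable (lebesgue_on K) (\<lambda>x. g x + h x)"
    using assms(2,3) unfolding has_weak_gradient_def by auto
  fix \<phi> assume \<phi>: "\<phi> \<in> test_functions \<Omega>"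
  obtain K where K: "compact K" "K \<subseteq> \<Omega>" "\<And>x. x \<notin> K \<Longrightarrow> grad \<phi> x = 0"
    using test_functionsE[OF \<phi>] by metis
  have i: "integrable (lebesgue_on \<Omega>) (\<lambda>x. w x *\<^sub>R grad \<phi> x)" if "loc_int \<Omega> w" for w :: "'a \<Rightarrow> real"
  proof (subst euclidean_representation[symmetric], intro Bochner_Integration.integrable_sum)
    fix b :: 'a assume b: "b \<in> Basis"
    have "integrable (lebesgue_on \<Omega>) (\<lambda>x. (grad \<phi> x \<bullet> b) *\<^sub>R w x)"
      by (rule loc_int_mult[OF that _ smooth_continuous[OF smooth_grad_inner[OF test_functions_smooth[OF \<phi>] b]] K(1,2)])
        (use K assms in auto)
    then show "integrable (lebesgue_on \<Omega>) (\<lambda>x. (w x *\<^sub>R grad \<phi> x \<bullet> b) *\<^sub>R b)"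
      by (simp add: mult.commute)
  qed
  note l = has_weak_gradient_loc_int[OF assms(2)] has_weak_gradient_loc_int[OF assms(3)]
  show "(LINT x|lebesgue_on \<Omega>. (u x + v x) *\<^sub>R grad \<phi> x) = - (LINT x|lebesgue_on \<Omega>. \<phi> x *\<^sub>R (g x + h x))"
    using assms(2,3) \<phi> i[OF l(1)] i[OF l(3)] test_mult_integrable[OF l(2) assms(1) \<phi>] test_mult_integrable[OF l(4) assms(1) \<phi>]
    unfolding has_weak_gradient_def by (simp add: scaleR_add_left scaleR_add_right)
qed

lemma has_weak_gradient_cmult:
  assumes "has_weak_gradient \<Omega> u g"
  shows "has_weak_gradient \<Omega> (\<lambda>x. c * u x) (\<lambda>x. c *\<^sub>R g x)"
proof -
  have "(LINT x|lebesgue_on \<Omega>. \<phi> x *\<^sub>R c *\<^sub>R g x) = c *\<^sub>R (LINT x|lebesgue_on \<Omega>. \<phi> x *\<^sub>R g x)" for \<phi>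
    by (simp only: scaleR_left_commute[of _ c] integral_scaleR_right)
  moreover have "(LINT x|lebesgue_on \<Omega>. (c * u x) *\<^sub>R grad \<phi> x) = c *\<^sub>R (LINT x|lebesgue_on \<Omega>. u x *\<^sub>R grad \<phi> x)" for \<phi>
    by (simp flip: scaleR_scaleR)
  ultimately show ?thesis
    using assms unfolding has_weak_gradient_def by simp
qed

section \<open>Inequalities for powers of norms\<close>

text \<open>The mean value theorem on either side of 1. By homogeneity this normalised case gives
  the tangent inequality at every positive point.\<close>

lemma bernoulli_powr_strict:
  assumes "q > 1" "t \<ge> 0" "t \<noteq> (1::real)"
  shows "1 + q * (t - 1) < t powr q"
proof -
  have D: "((\<lambda>t. t powr q) has_real_derivative q * x powr (q - 1)) (at x)" if "x > 0" for x
    using that by (auto intro!: derivative_eq_intros)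
  consider "t = 0" | "0 < t" "t < 1" | "t > 1" using assms by linarith
  then show ?thesis
  proof cases
    case 1
    then show ?thesis using assms by simp
  next
    case 2
    obtain z where z: "t < z" "z < 1" "1 powr q - t powr q = (1 - t) * (q * z powr (q - 1))"
      using MVT2[of t 1 "\<lambda>t. t powr q" "\<lambda>x. q * x powr (q - 1)"] D 2 by auto
    have "z powr (q - 1) < 1 powr (q - 1)"
      using z 2 assms by (intro powr_less_mono2) auto
    then have "(1 - t) * (q * z powr (q - 1)) < (1 - t) * (q * 1)"
      using 2 assms by (intro mult_strict_left_mono) auto
    then show ?thesis using z(3) by (simp add: algebra_simps)
  next
    case 3
    obtain z where z: "1 < z" "z < t" "t powr q - 1 powr q = (t - 1) * (q * z powr (q - 1))"
      using MVT2[of 1 t "\<lambda>t. t powr q" "\<lambda>x. q * x powr (q - 1)"] D 3 by auto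
    have "1 powr (q - 1) < z powr (q - 1)"
      using z assms by (intro powr_less_mono2) auto
    then have "(t - 1) * (q * 1) < (t - 1) * (q * z powr (q - 1))"
      using 3 assms by (intro mult_strict_left_mono) auto
    then show ?thesis using z(3) by (simp add: algebra_simps)
  qed
qed

lemma powr_tangent_strict:
  assumes "q > 1" "t \<ge> 0" "s > 0" "t \<noteq> (s::real)"
  shows "s powr q + q * s powr (q - 1) * (t - s) < t powr q"
proof -
  have "1 + q * (t / s - 1) < (t / s) powr q"
    by (rule bernoulli_powr_strict) (use assms in auto)
  then have "s powr q * (1 + q * (t / s - 1)) < s powr q * ((t / s) powr q)"
    using assms by (intro mult_strict_left_mono) auto
  also have "s powr q * ((t / s) powr q) = t powr q"
    using assms by (simp add: powr_divide)
  also have "s powr q * (1 + q * (t / s - 1)) = s powr q + q * s powr (q - 1) * (t - s)"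
  proof -
    have "s powr q = s powr (q - 1) * s"
      using assms by (simp add: powr_mult_base mult.commute)
    then have "s powr q * (q * (t / s - 1)) = q * s powr (q - 1) * (s * (t / s - 1))"
      by (simp only: ac_simps)
    also have "s * (t / s - 1) = t - s" using assms by (simp add: right_diff_distrib)
    finally show ?thesis by (simp add: distrib_left)
  qed
  finally show ?thesis .
qed

lemma powr_tangent:
  assumes "q > 1" "t \<ge> 0" "s \<ge> (0::real)"
  shows "s powr q + q * s powr (q - 1) * (t - s) \<le> t powr q"
  using powr_tangent_strict[of q t s] assms by (cases "s = 0"; cases "t = s") auto

text \<open>Add the two strict tangent inequalities at the midpoint; their linear terms
  \<open>X\<close> and \<open>- X\<close> cancel.\<close>

lemma powr_midpoint_strict:
  assumes "q > 1" "a \<ge> 0" "b \<ge> 0" "a \<noteq> (b::real)"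
  shows "((a + b) / 2) powr q < (a powr q + b powr q) / 2"
proof -
  let ?m = "(a + b) / 2"
  have m: "?m > 0" "a \<noteq> ?m" "b \<noteq> ?m" using assms by (auto simp: field_simps)
  define X where "X = q * ?m powr (q - 1) * (b - ?m)"
  have "q * ?m powr (q - 1) * (a - ?m) = - X"
    unfolding X_def by (simp only: mult_minus_right[symmetric]) (simp add: field_simps)
  then have "?m powr q + - X < a powr q"
    using powr_tangent_strict[OF assms(1,2) m(1,2)] by simp
  moreover have "?m powr q + X < b powr q"
    unfolding X_def by (rule powr_tangent_strict[OF assms(1,3) m(1,3)])
  moreover have "P < (A + B) / 2" if "P + - X < A" "P + X < B" for P A B :: real
    using add_strict_mono[OF that] by simp
  ultimately show ?thesis by blast
qed

lemma powr_midpoint: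
  assumes "q > 1" "a \<ge> 0" "b \<ge> (0::real)"
  shows "((a + b) / 2) powr q \<le> (a powr q + b powr q) / 2"
  using powr_midpoint_strict[OF assms] by (cases "a = b") auto

lemma powr_add_le:
  assumes "q > 1" "a \<ge> 0" "b \<ge> (0::real)"
  shows "(a + b) powr q \<le> 2 powr q * (a powr q + b powr q)"
proof -
  have "(a + b) powr q = 2 powr q * ((a + b) / 2) powr q"
    using assms by (simp add: powr_divide)
  also have "\<dots> \<le> 2 powr q * ((a powr q + b powr q) / 2)"
    using powr_midpoint[OF assms] by (intro mult_left_mono) auto
  also have "\<dots> \<le> 2 powr q * (a powr q + b powr q)"
    by (intro mult_left_mono) auto
  finally show ?thesis .
qed

text \<open>Jensen's inequality for weights of total mass at most 1: the missing mass may be thought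
  of as sitting at 0, where the power vanishes. The proof averages the tangent inequality at the
  mean \<open>m\<close>; the missing mass is absorbed by \<open>q > 1\<close>.\<close>

lemma powr_convex_sum:
  fixes w a :: "'i \<Rightarrow> real"
  assumes "q > 1" "finite I" "\<And>i. i \<in> I \<Longrightarrow> w i \<ge> 0" "\<And>i. i \<in> I \<Longrightarrow> a i \<ge> 0" "sum w I \<le> 1"
  shows "(\<Sum>i\<in>I. w i * a i) powr q \<le> (\<Sum>i\<in>I. w i * a i powr q)"
proof -
  define m where "m = (\<Sum>i\<in>I. w i * a i)"
  have m: "m \<ge> 0" unfolding m_def using assms by (intro sum_nonneg) auto
  have "m powr q = sum w I * m powr q + (1 - sum w I) * m powr q"
    by (simp add: algebra_simps)
  also have "\<dots> \<le> sum w I * m powr q + q * m powr (q - 1) * (m - sum w I * m)"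
  proof -
    have "(1 - sum w I) * m powr q \<le> q * ((1 - sum w I) * m powr q)"
      using assms by (intro mult_le_cancel_right1[THEN iffD2] order_refl) (auto simp: mult_le_cancel_right1 not_less)
    also have "\<dots> = q * m powr (q - 1) * (m - sum w I * m)"
    proof (cases "m = 0")
      case False
      then have "m powr q = m powr (q - 1) * m" using m by (simp add: powr_mult_base mult.commute)
      then show ?thesis by (simp add: algebra_simps)
    qed simp
    finally show ?thesis by simp
  qed
  also have "\<dots> = (\<Sum>i\<in>I. w i * (m powr q + q * m powr (q - 1) * (a i - m)))"
  proof -
    have "(\<Sum>i\<in>I. w i * (A + c * (a i - r))) = sum w I * A + c * ((\<Sum>i\<in>I. w i * a i) - sum w I * r)" for A c r
      by (simp add: sum.distrib sum_subtractf sum_distrib_left sum_distrib_right algebra_simps)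
    then show ?thesis by (simp only: m_def[symmetric])
  qed
  also have "\<dots> \<le> (\<Sum>i\<in>I. w i * a i powr q)"
    using assms m by (intro sum_mono mult_left_mono powr_tangent) auto
  finally show ?thesis by (simp add: m_def)
qed

text \<open>\<open>Agrad q\<close> is the gradient of \<open>norm a powr q\<close>; the exponent \<open>q - 2\<close> may be negative,
  but the product vanishes at the origin.\<close>

definition Agrad :: "real \<Rightarrow> 'b::euclidean_space \<Rightarrow> 'b" where
  "Agrad q a = (q * norm a powr (q - 2)) *\<^sub>R a"

lemma norm_Agrad: "q > 1 \<Longrightarrow> norm (Agrad q a) = q * norm a powr (q - 1)"
  by (cases "a = 0") (auto simp: Agrad_def abs_mult powr_mult_base mult.commute mult.left_commute)

lemma Agrad_inner_self: "q > 1 \<Longrightarrow> Agrad q a \<bullet> a = q * norm a powr q"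
proof (cases "a = 0")
  case False
  have "norm a powr (q - 2) * (norm a)\<^sup>2 = norm a powr q"
    using False by (simp add: powr_add[symmetric] flip: powr_numeral)
  then show ?thesis by (simp add: Agrad_def power2_norm_eq_inner)
qed (simp add: Agrad_def)

text \<open>Cauchy-Schwarz bounds \<open>Agrad q a \<bullet> b\<close> by the product of the norms,
  with equality for \<open>b = a\<close>; this reduces convexity to the tangent inequality for the
  real power.\<close>

lemma Agrad_tangent:
  assumes "q > 1"
  shows "norm a powr q + Agrad q a \<bullet> (b - a) \<le> norm b powr q"
proof -
  have "Agrad q a \<bullet> b \<le> q * norm a powr (q - 1) * norm b"
    using norm_cauchy_schwarz[of "Agrad q a" b] norm_Agrad[OF assms, of a] by simp
  moreover have "norm a powr q = norm a powr (q - 1) * norm a"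
    by (cases "a = 0") (auto simp: powr_mult_base mult.commute)
  then have "Agrad q a \<bullet> a = q * norm a powr (q - 1) * norm a"
    using Agrad_inner_self[OF assms, of a] by simp
  ultimately have "Agrad q a \<bullet> (b - a) \<le> q * norm a powr (q - 1) * (norm b - norm a)"
    by (simp add: inner_diff_right right_diff_distrib)
  then show ?thesis
    using powr_tangent[of q "norm b" "norm a"] assms by simp
qed

text \<open>Away from 0 the formula is continuous. At 0 the factor
  \<open>norm a powr (q - 2)\<close> may be unbounded, but the norm of the product is
  \<open>q * norm a powr (q - 1)\<close> and tends to 0.\<close>

lemma tendsto_Agrad:
  assumes "q > 1" "(f \<longlongrightarrow> a) F"
  shows "((\<lambda>x. Agrad q (f x)) \<longlongrightarrow> Agrad q a) F"
proof (cases "a = 0")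
  case True
  have "((\<lambda>x. norm (f x)) \<longlongrightarrow> 0) F"
    using tendsto_norm[OF assms(2)] True by simp
  then have "((\<lambda>x. q * norm (f x) powr (q - 1)) \<longlongrightarrow> q * 0 powr (q - 1)) F"
    using assms by (intro tendsto_intros tendsto_powr') auto
  then have "((\<lambda>x. norm (Agrad q (f x))) \<longlongrightarrow> 0) F"
    using assms by (simp add: norm_Agrad)
  then have "((\<lambda>x. Agrad q (f x)) \<longlongrightarrow> 0) F" by (rule tendsto_norm_zero_cancel)
  then show ?thesis using True by (simp add: Agrad_def)
next
  case False
  then show ?thesis unfolding Agrad_def
    using assms by (intro tendsto_intros) auto
qed

subsection \<open>Uniform convexity\<close>

text \<open>The gap in midpoint convexity of the q-th power of the norm. It takes the place of a
  modulus of convexity and can be integrated with \<open>q\<close> varying from point to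
  point.\<close>

definition defect :: "real \<Rightarrow> 'b::euclidean_space \<Rightarrow> 'b \<Rightarrow> real" where
  "defect q a b = (norm a powr q + norm b powr q) / 2 - norm ((1/2) *\<^sub>R (a + b)) powr q"

lemma norm_midpoint_le: "norm ((1/2) *\<^sub>R (a + b)) \<le> (norm a + norm b) / 2"
  using norm_triangle_ineq[of a b] by simp

lemma defect_nonneg: "q > 1 \<Longrightarrow> 0 \<le> defect q a b"
  using powr_midpoint[of q "norm a" "norm b"] powr_mono2[OF _ _ norm_midpoint_le, of q a b]
  by (simp add: defect_def)

text \<open>If the norms differ, strict convexity of the real power decides; if they agree, strict
  convexity of the Euclidean norm.\<close>

lemma defect_pos:
  assumes "q > 1" "a \<noteq> b"
  shows "0 < defect q a b"
proof (cases "norm a = norm b")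
  case False
  then show ?thesis
    using powr_midpoint_strict[of q "norm a" "norm b"] powr_mono2[OF _ _ norm_midpoint_le, of q a b] assms
    by (simp add: defect_def)
next
  case True
  have "norm (a + b) \<noteq> norm a + norm b"
  proof
    assume "norm (a + b) = norm a + norm b"
    then have "norm a *\<^sub>R b = norm b *\<^sub>R a" by (simp add: norm_triangle_eq)
    then show False using True assms(2) by (cases "norm a = 0") auto
  qed
  then have "norm ((1/2) *\<^sub>R (a + b)) < norm a"
    using norm_triangle_ineq[of a b] True by simp
  then have "norm ((1/2) *\<^sub>R (a + b)) powr q < norm a powr q"
    using assms by (intro powr_less_mono2) auto
  then show ?thesis using True by (simp add: defect_def)
qed

lemma norm_scaleR_powr: "s \<ge> 0 \<Longrightarrow> norm (s *\<^sub>R a) powr q = s powr q * norm a powr q"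
  by (simp add: powr_mult)

lemma defect_scale:
  assumes "s \<ge> 0"
  shows "defect q (s *\<^sub>R a) (s *\<^sub>R b) = s powr q * defect q a b"
proof -
  have "(1/2) *\<^sub>R (s *\<^sub>R a + s *\<^sub>R b) = s *\<^sub>R ((1/2) *\<^sub>R (a + b))"
    by (simp add: algebra_simps)
  then show ?thesis
    unfolding defect_def using assms by (simp only: norm_scaleR_powr) (simp add: algebra_simps)
qed

text \<open>By homogeneity it suffices to treat \<open>max (norm a) (norm b) = 1\<close>, a compact set on which the
  defect is bounded below where \<open>a\<close> and \<open>b\<close> are apart.\<close>

lemma uniform_convexity:
  assumes "1 < pm" "\<epsilon> > 0"
  obtains C where "C > 0"
    "\<And>q (a::'b::euclidean_space) b. pm \<le> q \<Longrightarrow> q \<le> pp \<Longrightarrow>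
      norm (a - b) powr q \<le> \<epsilon> * (norm a powr q + norm b powr q) + C * defect q a b"
proof -
  \<comment> \<open>The exponent is a coordinate of the compact set, which makes \<open>C\<close>
    uniform over \<open>q\<close> between \<open>pm\<close> and \<open>pp\<close>.\<close>
  define S :: "(real \<times> 'b \<times> 'b) set" where
    "S = {pm..pp} \<times> {z \<in> cball 0 1 \<times> cball 0 1. max (norm (fst z)) (norm (snd z)) = 1}"
  define f :: "real \<times> 'b \<times> 'b \<Rightarrow> real" where "f = (\<lambda>(q, a, b). norm (a - b) powr q)"
  define d :: "real \<times> 'b \<times> 'b \<Rightarrow> real" where "d = (\<lambda>(q, a, b). defect q a b)"
  have "closed ({z \<in> cball 0 1 \<times> cball 0 1. max (norm (fst z)) (norm (snd z)) = 1} :: ('b \<times> 'b) set)"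
    by (rule continuous_closed_preimage_constant) (auto intro!: continuous_intros closed_Times)
  then have "compact ({z \<in> cball 0 1 \<times> cball 0 1. max (norm (fst z)) (norm (snd z)) = 1} :: ('b \<times> 'b) set)"
    by (subst compact_eq_bounded_closed)
      (auto intro!: bounded_subset[OF bounded_Times[OF bounded_cball[of 0 1] bounded_cball[of 0 1]]])
  then have S: "compact S"
    unfolding S_def by (intro compact_Times) auto
  have cf: "continuous_on S f"
    unfolding f_def case_prod_beta by (intro continuous_on_powr' continuous_intros) (use assms in \<open>auto simp: S_def\<close>)
  have cd: "continuous_on S d"
    unfolding d_def defect_def case_prod_beta
    by (intro continuous_on_diff continuous_on_divide continuous_on_add continuous_on_powr' continuous_intros)
      (use assms in \<open>auto simp: S_def\<close>)
  \<comment> \<open>Off \<open>T\<close> the term with \<epsilon> already suffices, because one of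
    the two norms is 1; on \<open>T\<close> the points are apart and the defect is positive.\<close>
  define T where "T = {z \<in> S. f z \<ge> \<epsilon>}"
  have T: "compact T"
  proof -
    have "closedin (top_of_set S) (S \<inter> f -` {\<epsilon>..})"
      by (rule continuous_closedin_preimage[OF cf]) auto
    moreover have "T = S \<inter> f -` {\<epsilon>..}" by (auto simp: T_def)
    ultimately show ?thesis using S closedin_compact by metis
  qed
  have dpos: "d z > 0" if "z \<in> T" for z
  proof -
    obtain q a b where z: "z = (q, a, b)" by (cases z)
    have "q > 1" "a \<noteq> b" using that assms by (auto simp: T_def S_def f_def z)
    then show ?thesis by (simp add: z d_def defect_pos)
  qed
  obtain \<delta> where \<delta>: "\<delta> > 0" "\<And>z. z \<in> T \<Longrightarrow> d z \<ge> \<delta>"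
  proof (cases "T = {}")
    case True
    then show ?thesis using that[of 1] by auto
  next
    case False
    have "continuous_on T d" using cd by (rule continuous_on_subset) (auto simp: T_def)
    from continuous_attains_inf[OF T False this] dpos that show ?thesis by metis
  qed
  \<comment> \<open>\<open>2 powr pp\<close> bounds \<open>norm (a - b) powr q\<close> for vectors
    of norm at most 1, and \<delta> is a positive lower bound of the defect on
    \<open>T\<close>.\<close>
  define C where "C = 2 powr pp / \<delta>"
  have C: "C > 0" using \<delta> by (simp add: C_def)
  show thesis
  proof (rule that[OF C])
    fix q and a b :: 'b assume q: "pm \<le> q" "q \<le> pp"
    then have q1: "q > 1" using assms by simp
    show "norm (a - b) powr q \<le> \<epsilon> * (norm a powr q + norm b powr q) + C * defect q a b"
    proof (cases "a = 0 \<and> b = 0")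
      case False
      define s where "s = max (norm a) (norm b)"
      have s: "s > 0" using False by (auto simp: s_def max_def)
      define a' b' where "a' = (1/s) *\<^sub>R a" and "b' = (1/s) *\<^sub>R b"
      have ab: "a = s *\<^sub>R a'" "b = s *\<^sub>R b'" using s by (auto simp: a'_def b'_def)
      have le: "norm a' \<le> 1" "norm b' \<le> 1" and eq: "norm a' = 1 \<or> norm b' = 1"
        using s by (auto simp: a'_def b'_def s_def max_def)
      then have inS: "(q, a', b') \<in> S"
        using q by (auto simp: S_def max_def)
      have "norm (a' - b') powr q \<le> \<epsilon> * (norm a' powr q + norm b' powr q) + C * defect q a' b'"
      proof (cases "(q, a', b') \<in> T")
        case True
        have "norm (a' - b') \<le> 2" using le norm_triangle_ineq4[of a' b'] by linarith
        then have "norm (a' - b') powr q \<le> 2 powr q"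
          using q1 by (intro powr_mono2) auto
        also have "\<dots> \<le> 2 powr pp" using q by (intro powr_mono) auto
        also have "\<dots> = C * \<delta>" using \<delta> by (simp add: C_def)
        also have "\<dots> \<le> C * defect q a' b'"
          using \<delta>(2)[OF True] C by (intro mult_left_mono) (auto simp: d_def)
        finally show ?thesis using assms(2) by (simp add: add_increasing)
      next
        case F: False
        then have "norm (a' - b') powr q \<le> \<epsilon> * 1"
          using inS by (auto simp: T_def f_def)
        also have "\<dots> \<le> \<epsilon> * (norm a' powr q + norm b' powr q)"
          using assms(2) eq by (intro mult_left_mono) auto
        finally show ?thesis using C defect_nonneg[OF q1, of a' b'] by (simp add: add_increasing2)
      qed
      then have "s powr q * norm (a' - b') powr q \<le>
          s powr q * (\<epsilon> * (norm a' powr q + norm b' powr q) + C * defect q a' b')"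
        by (intro mult_left_mono) auto
      moreover have "a - b = s *\<^sub>R (a' - b')" by (simp add: ab algebra_simps)
      ultimately show ?thesis
        using s by (simp only: ab defect_scale norm_scaleR_powr less_imp_le flip: scaleR_diff_right)
          (simp add: algebra_simps)
    qed (simp add: defect_def)
  qed
qed

section \<open>Variable exponent Lebesgue spaces\<close>

text \<open>Stated for a general exponent and finite measure, so that the dual exponent is a second
  instance and the lemmas apply to both spaces.\<close>

locale var_exp =
  fixes M :: "'a measure" and p :: "'a \<Rightarrow> real" and pm pp :: real
  assumes p_meas [measurable]: "p \<in> borel_measurable M"
    and finite_M: "finite_measure M"
    and pm_gt_1: "1 < pm" and pm_le_pp: "pm \<le> pp"
    and p_bounds: "\<And>x. x \<in> space M \<Longrightarrow> pm \<le> p x \<and> p x \<le> pp"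
begin

definition Lp :: "('a \<Rightarrow> 'b::euclidean_space) \<Rightarrow> bool" where
  "Lp V \<longleftrightarrow> V \<in> borel_measurable M \<and> integrable M (\<lambda>x. norm (V x) powr p x)"

text \<open>The integral is 0 by convention for functions that are not integrable, so the value is
  meaningful only together with \<open>Lp\<close>.\<close>

definition rho :: "('a \<Rightarrow> 'b::euclidean_space) \<Rightarrow> real" where
  "rho V = (LINT x|M. norm (V x) powr p x)"

lemma p_gt_1: "x \<in> space M \<Longrightarrow> 1 < p x"
  using p_bounds[of x] pm_gt_1 by simp

lemma Lp_measurable [measurable_dest]: "Lp V \<Longrightarrow> V \<in> borel_measurable M"
  by (simp add: Lp_def)

lemma rho_nonneg: "0 \<le> rho V"
  by (simp add: rho_def)

lemma rho_norm: "rho (\<lambda>x. norm (V x)) = rho V"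
  by (simp add: rho_def)

lemma Lp_norm: "Lp V \<Longrightarrow> Lp (\<lambda>x. norm (V x))"
  by (auto simp: Lp_def)

lemma Lp_bound:
  fixes V :: "'a \<Rightarrow> 'b::euclidean_space" and H :: "'a \<Rightarrow> 'c::euclidean_space"
  assumes "Lp H" "V \<in> borel_measurable M" "AE x in M. norm (V x) \<le> norm (H x)"
  shows "Lp V" "rho V \<le> rho H"
proof -
  have [measurable]: "V \<in> borel_measurable M" by fact
  have le: "AE x in M. norm (V x) powr p x \<le> norm (H x) powr p x"
    using assms(3) AE_space
  proof eventually_elim
    case (elim x)
    then show ?case using p_gt_1[of x] by (auto intro!: powr_mono2)
  qed
  show "Lp V"
    unfolding Lp_def
  proof
    show "integrable M (\<lambda>x. norm (V x) powr p x)"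
      by (rule Bochner_Integration.integrable_bound[of M "\<lambda>x. norm (H x) powr p x"])
        (use assms(1) le in \<open>auto simp: Lp_def\<close>)
  qed fact
  then show "rho V \<le> rho H"
    unfolding rho_def using assms(1) le by (intro integral_mono_AE) (auto simp: Lp_def)
qed

lemma Lp_iff_nn:
  "Lp V \<longleftrightarrow> V \<in> borel_measurable M \<and> (\<integral>\<^sup>+x. ennreal (norm (V x) powr p x) \<partial>M) < \<infinity>"
  by (auto simp: Lp_def integrable_iff_bounded)

lemma nn_integral_eq_rho: "Lp V \<Longrightarrow> (\<integral>\<^sup>+x. ennreal (norm (V x) powr p x) \<partial>M) = ennreal (rho V)"
  unfolding rho_def by (subst nn_integral_eq_integral) (auto simp: Lp_def)

lemma Lp_add:
  assumes "Lp V" "Lp W"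
  shows "Lp (\<lambda>x. V x + W x)" "rho (\<lambda>x. V x + W x) \<le> 2 powr pp * (rho V + rho W)"
proof -
  have [measurable]: "V \<in> borel_measurable M" "W \<in> borel_measurable M"
    using assms by (auto simp: Lp_def)
  have le: "norm (V x + W x) powr p x \<le> 2 powr pp * (norm (V x) powr p x + norm (W x) powr p x)"
    if x: "x \<in> space M" for x
  proof -
    have "norm (V x + W x) powr p x \<le> (norm (V x) + norm (W x)) powr p x"
      using p_gt_1[OF x] by (intro powr_mono2 norm_triangle_ineq) auto
    also have "\<dots> \<le> 2 powr p x * (norm (V x) powr p x + norm (W x) powr p x)"
      using p_gt_1[OF x] by (intro powr_add_le) auto
    also have "\<dots> \<le> 2 powr pp * (norm (V x) powr p x + norm (W x) powr p x)"
      using p_bounds[OF x] by (intro mult_right_mono powr_mono) auto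
    finally show ?thesis .
  qed
  have int: "integrable M (\<lambda>x. 2 powr pp * (norm (V x) powr p x + norm (W x) powr p x))"
    using assms by (auto simp: Lp_def)
  show L: "Lp (\<lambda>x. V x + W x)"
    unfolding Lp_def
  proof
    show "integrable M (\<lambda>x. norm (V x + W x) powr p x)"
      by (rule Bochner_Integration.integrable_bound[OF int]) (auto intro!: AE_I2 le simp: abs_mult)
  qed measurable
  have "rho (\<lambda>x. V x + W x) \<le> (LINT x|M. 2 powr pp * (norm (V x) powr p x + norm (W x) powr p x))"
    unfolding rho_def using L int le by (intro integral_mono) (auto simp: Lp_def)
  also have "\<dots> = 2 powr pp * (rho V + rho W)"
    unfolding rho_def using assms by (simp add: Lp_def)
  finally show "rho (\<lambda>x. V x + W x) \<le> 2 powr pp * (rho V + rho W)" .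
qed

lemma Lp_scaleR:
  assumes "Lp V"
  shows "Lp (\<lambda>x. c *\<^sub>R V x)"
proof -
  have [measurable]: "V \<in> borel_measurable M" using assms by (auto simp: Lp_def)
  have "integrable M (\<lambda>x. norm (c *\<^sub>R V x) powr p x)"
  proof (rule Bochner_Integration.integrable_bound)
    show "integrable M (\<lambda>x. (1 + \<bar>c\<bar>) powr pp * norm (V x) powr p x)"
      using assms by (auto simp: Lp_def)
    show "AE x in M. norm (norm (c *\<^sub>R V x) powr p x) \<le> norm ((1 + \<bar>c\<bar>) powr pp * norm (V x) powr p x)"
    proof (rule AE_I2)
      fix x assume x: "x \<in> space M"
      have "\<bar>c\<bar> powr p x \<le> (1 + \<bar>c\<bar>) powr p x" using p_gt_1[OF x] by (intro powr_mono2) auto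
      also have "\<dots> \<le> (1 + \<bar>c\<bar>) powr pp" using p_bounds[OF x] by (intro powr_mono) auto
      finally show "norm (norm (c *\<^sub>R V x) powr p x) \<le> norm ((1 + \<bar>c\<bar>) powr pp * norm (V x) powr p x)"
        by (simp add: powr_mult mult_right_mono)
    qed
  qed measurable
  then show ?thesis by (simp add: Lp_def)
qed

lemma Lp_cmult: "Lp f \<Longrightarrow> Lp (\<lambda>x. c * f x)" for f :: "'a \<Rightarrow> real"
  using Lp_scaleR[of f c] by simp

lemma Lp_diff: "Lp V \<Longrightarrow> Lp W \<Longrightarrow> Lp (\<lambda>x. V x - W x)"
  using Lp_add(1)[of V "\<lambda>x. (-1) *\<^sub>R W x"] Lp_scaleR[of W "-1"] by simp

text \<open>The modular is not homogeneous. A scalar comes out with an exponent between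
  \<open>pm\<close> and \<open>pp\<close>, and which of the two gives the upper bound depends on
  whether the scalar exceeds 1.\<close>

lemma rho_scaleR:
  assumes "Lp V" "c \<ge> 0"
  shows "c \<le> 1 \<Longrightarrow> rho (\<lambda>x. c *\<^sub>R V x) \<le> c powr pm * rho V"
    and "1 \<le> c \<Longrightarrow> rho (\<lambda>x. c *\<^sub>R V x) \<le> c powr pp * rho V"
    and "1 \<le> c \<Longrightarrow> c powr pm * rho V \<le> rho (\<lambda>x. c *\<^sub>R V x)"
proof -
  have i: "integrable M (\<lambda>x. norm (c *\<^sub>R V x) powr p x)" using Lp_scaleR[OF assms(1)] by (simp add: Lp_def)
  have i': "integrable M (\<lambda>x. norm (V x) powr p x)" using assms(1) by (simp add: Lp_def)
  have eq: "norm (c *\<^sub>R V x) powr p x = c powr p x * norm (V x) powr p x" for x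
    using assms(2) by (simp add: powr_mult)
  show "rho (\<lambda>x. c *\<^sub>R V x) \<le> c powr pm * rho V" if "c \<le> 1"
  proof -
    have "rho (\<lambda>x. c *\<^sub>R V x) \<le> (LINT x|M. c powr pm * norm (V x) powr p x)"
      unfolding rho_def
    proof (rule integral_mono[OF i integrable_mult_right[OF i']])
      fix x assume "x \<in> space M"
      then have "c powr p x \<le> c powr pm" using p_bounds[of x] that assms(2) by (intro powr_mono') auto
      then show "norm (c *\<^sub>R V x) powr p x \<le> c powr pm * norm (V x) powr p x"
        unfolding eq by (intro mult_right_mono) auto
    qed
    then show ?thesis by (simp add: rho_def)
  qed
  show "rho (\<lambda>x. c *\<^sub>R V x) \<le> c powr pp * rho V" if "1 \<le> c"
  proof -
    have "rho (\<lambda>x. c *\<^sub>R V x) \<le> (LINT x|M. c powr pp * norm (V x) powr p x)"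
      unfolding rho_def
    proof (rule integral_mono[OF i integrable_mult_right[OF i']])
      fix x assume "x \<in> space M"
      then have "c powr p x \<le> c powr pp" using p_bounds[of x] that by (intro powr_mono) auto
      then show "norm (c *\<^sub>R V x) powr p x \<le> c powr pp * norm (V x) powr p x"
        unfolding eq by (intro mult_right_mono) auto
    qed
    then show ?thesis by (simp add: rho_def)
  qed
  show "c powr pm * rho V \<le> rho (\<lambda>x. c *\<^sub>R V x)" if "1 \<le> c"
  proof -
    have "(LINT x|M. c powr pm * norm (V x) powr p x) \<le> rho (\<lambda>x. c *\<^sub>R V x)"
      unfolding rho_def
    proof (rule integral_mono[OF integrable_mult_right[OF i'] i])
      fix x assume "x \<in> space M"
      then have "c powr pm \<le> c powr p x" using p_bounds[of x] that by (intro powr_mono) auto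
      then show "c powr pm * norm (V x) powr p x \<le> norm (c *\<^sub>R V x) powr p x"
        unfolding eq by (intro mult_right_mono) auto
    qed
    then show ?thesis by (simp add: rho_def)
  qed
qed

lemma le_1_add_powr: "x \<in> space M \<Longrightarrow> t \<ge> 0 \<Longrightarrow> t \<le> 1 + t powr p x"
  using powr_mono[of 1 "p x" t] p_gt_1[of x] by (cases "t \<le> 1") (auto intro: add_increasing2)

lemma Lp_integrable:
  assumes "Lp V" shows "integrable M V"
proof (rule Bochner_Integration.integrable_bound)
  interpret finite_measure M by (rule finite_M)
  show "integrable M (\<lambda>x. 1 + norm (V x) powr p x)"
    using assms by (auto simp: Lp_def)
  show "AE x in M. norm (V x) \<le> norm (1 + norm (V x) powr p x)"
    by (intro AE_I2) (use le_1_add_powr in auto)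
qed (use assms in \<open>simp add: Lp_def\<close>)

lemma Lp_bounded:
  fixes V :: "'a \<Rightarrow> 'b::euclidean_space"
  assumes "V \<in> borel_measurable M" "AE x in M. norm (V x) \<le> B"
  shows "Lp V"
proof (rule Lp_bound(1)[OF _ assms(1)])
  interpret finite_measure M by (rule finite_M)
  have "integrable M (\<lambda>x. norm (\<bar>B\<bar>) powr p x)"
  proof (rule integrable_const_bound)
    show "AE x in M. norm (norm (\<bar>B\<bar>) powr p x) \<le> (1 + \<bar>B\<bar>) powr pp"
    proof (rule AE_I2)
      fix x assume x: "x \<in> space M"
      have "\<bar>B\<bar> powr p x \<le> (1 + \<bar>B\<bar>) powr p x" using p_gt_1[OF x] by (intro powr_mono2) auto
      also have "\<dots> \<le> (1 + \<bar>B\<bar>) powr pp" using p_bounds[OF x] by (intro powr_mono) auto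
      finally show "norm (norm (\<bar>B\<bar>) powr p x) \<le> (1 + \<bar>B\<bar>) powr pp" by simp
    qed
  qed measurable
  then show "Lp (\<lambda>x. \<bar>B\<bar>)" by (simp add: Lp_def)
  show "AE x in M. norm (V x) \<le> norm \<bar>B\<bar>" using assms(2) by eventually_elim auto
qed

lemma rho_dominated:
  fixes V :: "nat \<Rightarrow> 'a \<Rightarrow> 'b::euclidean_space" and H :: "'a \<Rightarrow> real"
  assumes "\<And>n. V n \<in> borel_measurable M" "W \<in> borel_measurable M" "Lp H"
    "AE x in M. (\<lambda>n. V n x) \<longlonglongrightarrow> W x" "\<And>n. AE x in M. norm (V n x) \<le> H x"
  shows "(\<lambda>n. rho (V n)) \<longlonglongrightarrow> rho W"
  unfolding rho_def
proof (rule integral_dominated_convergence[where w = "\<lambda>x. norm (H x) powr p x"])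
  have [measurable]: "V n \<in> borel_measurable M" "W \<in> borel_measurable M" for n using assms by auto
  show "(\<lambda>x. norm (W x) powr p x) \<in> borel_measurable M"
    and "(\<lambda>x. norm (V n x) powr p x) \<in> borel_measurable M" for n by measurable
  show "integrable M (\<lambda>x. norm (H x) powr p x)" using assms by (simp add: Lp_def)
  show "AE x in M. (\<lambda>n. norm (V n x) powr p x) \<longlonglongrightarrow> norm (W x) powr p x"
    using assms(4) AE_space
    by eventually_elim (use p_gt_1 in \<open>force intro!: tendsto_powr' tendsto_intros\<close>)
  show "AE x in M. norm (norm (V n x) powr p x) \<le> norm (H x) powr p x" for n
    using assms(5)[of n] AE_space
  proof eventually_elim
    case (elim x)
    then show ?case using p_gt_1[of x] by (auto intro!: powr_mono2)
  qed
qed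

subsection \<open>Completeness\<close>

text \<open>Writing the sum as a combination of the functions \<open>2 ^ Suc k * f k x\<close> with
  weights \<open>(1/2) ^ Suc k\<close> and using convexity pointwise bounds its modular by 1. This
  replaces Minkowski's inequality.\<close>

lemma Lp_summable:
  fixes f :: "nat \<Rightarrow> 'a \<Rightarrow> real"
  assumes "\<And>k. f k \<in> borel_measurable M" "\<And>k x. x \<in> space M \<Longrightarrow> f k x \<ge> 0"
    and le: "\<And>k. (\<integral>\<^sup>+x. ennreal ((2 ^ Suc k * f k x) powr p x) \<partial>M) \<le> 1"
  shows "AE x in M. summable (\<lambda>k. f k x)" "Lp (\<lambda>x. \<Sum>k. f k x)"
proof -
  have [measurable]: "f k \<in> borel_measurable M" for k by fact
  define Q where "Q x = (\<Sum>k. ennreal ((1/2) ^ Suc k * (2 ^ Suc k * f k x) powr p x))" for x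
  have Qm: "Q \<in> borel_measurable M" unfolding Q_def by measurable
  have "(\<integral>\<^sup>+x. Q x \<partial>M) = (\<Sum>k. \<integral>\<^sup>+x. ennreal ((1/2) ^ Suc k * (2 ^ Suc k * f k x) powr p x) \<partial>M)"
    unfolding Q_def by (rule nn_integral_suminf) measurable
  also have "\<dots> = (\<Sum>k. ennreal ((1/2) ^ Suc k) * (\<integral>\<^sup>+x. ennreal ((2 ^ Suc k * f k x) powr p x) \<partial>M))"
    by (intro suminf_cong) (simp add: ennreal_mult nn_integral_cmult del: power_Suc)
  also have "\<dots> \<le> (\<Sum>k. ennreal ((1/2) ^ Suc k) * 1)"
    by (intro suminf_le mult_left_mono le) auto
  also have "\<dots> = ennreal 1"
    unfolding mult_1_right by (rule suminf_ennreal_eq[OF _ power_half_series]) simp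
  finally have Q1: "(\<integral>\<^sup>+x. Q x \<partial>M) \<le> 1" by simp
  then have "AE x in M. Q x \<noteq> \<infinity>"
    using Qm neq_top_trans[OF ennreal_one_neq_top Q1] by (intro nn_integral_PInf_AE) auto
  then have *: "AE x in M. summable (\<lambda>k. f k x) \<and> ennreal ((\<Sum>k. f k x) powr p x) \<le> Q x"
    using AE_space
  proof eventually_elim
    case (elim x)
    then have p1: "1 < p x" and f0: "\<And>k. 0 \<le> f k x" using p_gt_1 assms(2) by auto
    define R where "R = enn2real (Q x)"
    have R: "Q x = ennreal R" using elim by (simp add: R_def less_top)
    have R0: "R \<ge> 0" by (simp add: R_def)
    have b: "(\<Sum>k<n. f k x) powr p x \<le> R" for n
    proof -
      have "(\<Sum>k<n. f k x) = (\<Sum>k<n. (1/2) ^ Suc k * (2 ^ Suc k * f k x))"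
        by (intro sum.cong refl) (simp add: power_divide)
      also have "\<dots> powr p x \<le> (\<Sum>k<n. (1/2) ^ Suc k * (2 ^ Suc k * f k x) powr p x)"
      proof (rule powr_convex_sum[OF p1])
        show "(\<Sum>k<n. (1/2::real) ^ Suc k) \<le> 1"
          using sum_le_suminf[OF sums_summable[OF power_half_series], of "{..<n}"] sums_unique[OF power_half_series]
          by (auto simp del: power_Suc)
      qed (use f0 in auto)
      finally have "ennreal ((\<Sum>k<n. f k x) powr p x) \<le> ennreal (\<Sum>k<n. (1/2) ^ Suc k * (2 ^ Suc k * f k x) powr p x)"
        by (rule ennreal_leI)
      also have "\<dots> = (\<Sum>k<n. ennreal ((1/2) ^ Suc k * (2 ^ Suc k * f k x) powr p x))"
        by (subst sum_ennreal) auto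
      also have "\<dots> \<le> Q x"
        unfolding Q_def by (rule sum_le_suminf) auto
      finally show ?thesis using R R0 by simp
    qed
    \<comment> \<open>Bounded powers bound the partial sums themselves, since \<open>p x\<close>
      exceeds 1.\<close>
    have b': "(\<Sum>k<n. f k x) \<le> 1 + R" for n
    proof -
      have "(\<Sum>k<n. f k x) \<le> 1 + (\<Sum>k<n. f k x) powr p x"
        by (rule le_1_add_powr[OF elim(2)]) (intro sum_nonneg f0)
      then show ?thesis using b[of n] by linarith
    qed
    have s: "summable (\<lambda>k. f k x)"
      by (rule summableI_nonneg_bounded[OF f0 b'])
    have "(\<lambda>n. (\<Sum>k<n. f k x) powr p x) \<longlonglongrightarrow> (\<Sum>k. f k x) powr p x"
      using s f0 p1 by (intro tendsto_powr' summable_LIMSEQ tendsto_const) (auto intro!: always_eventually sum_nonneg)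
    then have "(\<Sum>k. f k x) powr p x \<le> R"
      by (rule LIMSEQ_le_const2) (use b in auto)
    then show ?case using s R R0 by simp
  qed
  show "AE x in M. summable (\<lambda>k. f k x)" using * by eventually_elim auto
  show "Lp (\<lambda>x. \<Sum>k. f k x)"
    unfolding Lp_iff_nn
  proof
    have "(\<integral>\<^sup>+x. ennreal (norm (\<Sum>k. f k x) powr p x) \<partial>M) \<le> (\<integral>\<^sup>+x. Q x \<partial>M)"
      using * AE_space by (intro nn_integral_mono_AE, eventually_elim) (use assms(2) in \<open>auto simp: suminf_nonneg abs_of_nonneg\<close>)
    also have "\<dots> < \<infinity>" using Q1 by (auto simp: order_le_less_trans)
    finally show "(\<integral>\<^sup>+x. ennreal (norm (\<Sum>k. f k x) powr p x) \<partial>M) < \<infinity>" .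
  qed measurable
qed

text \<open>The Riesz-Fischer construction. Besides the limit it provides the majorant
  \<open>H\<close>, which dominates the minimising sequences in the later limits.\<close>

lemma Lp_Cauchy_subseq:
  fixes V :: "nat \<Rightarrow> 'a \<Rightarrow> 'b::euclidean_space"
  assumes "\<And>n. Lp (V n)"
    and cauchy: "\<And>\<epsilon>. \<epsilon> > 0 \<Longrightarrow> \<exists>N. \<forall>m\<ge>N. \<forall>n\<ge>N. rho (\<lambda>x. V m x - V n x) \<le> \<epsilon>"
  obtains r W and H :: "'a \<Rightarrow> real" where "strict_mono (r :: nat \<Rightarrow> nat)" "Lp W" "Lp H"
    "AE x in M. (\<lambda>k. V (r k) x) \<longlonglongrightarrow> W x" "\<And>k. AE x in M. norm (V (r k) x) \<le> H x"
proof -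
  have [measurable]: "V n \<in> borel_measurable M" for n using assms(1) by (simp add: Lp_def)
  \<comment> \<open>Chosen so that the k-th difference, multiplied by \<open>2 ^ Suc k\<close>, has
    modular at most 1, as \<open>Lp_summable\<close> requires.\<close>
  define e where "e k = 1 / (2 ^ Suc k) powr pp" for k :: nat
  have "\<exists>N. \<forall>m\<ge>N. \<forall>n\<ge>N. rho (\<lambda>x. V m x - V n x) \<le> e k" for k
    by (rule cauchy) (simp add: e_def)
  then have "\<forall>k. \<exists>N. \<forall>m\<ge>N. \<forall>n\<ge>N. rho (\<lambda>x. V m x - V n x) \<le> e k" by blast
  from choice[OF this] obtain N where N: "\<And>k m n. m \<ge> N k \<Longrightarrow> n \<ge> N k \<Longrightarrow> rho (\<lambda>x. V m x - V n x) \<le> e k"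
    by blast
  define r where "r = rec_nat (N 0) (\<lambda>k m. max (Suc m) (N (Suc k)))"
  have r0: "r 0 = N 0" and rS: "r (Suc k) = max (Suc (r k)) (N (Suc k))" for k
    by (simp_all add: r_def)
  have r: "strict_mono r" by (rule strict_monoI_Suc) (simp add: rS)
  have rN: "r k \<ge> N k" for k by (cases k) (auto simp: r0 rS)
  define d where "d k x = norm (V (r (Suc k)) x - V (r k) x)" for k x
  have dm: "d k \<in> borel_measurable M" for k unfolding d_def by measurable
  have "(\<integral>\<^sup>+x. ennreal ((2 ^ Suc k * d k x) powr p x) \<partial>M) \<le> 1" for k
  proof -
    let ?D = "\<lambda>x. V (r (Suc k)) x - V (r k) x"
    have L: "Lp ?D" by (intro Lp_diff assms(1))
    have c: "(2::real) ^ Suc k \<ge> 1" by (rule one_le_power) simp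
    have "(\<integral>\<^sup>+x. ennreal ((2 ^ Suc k * d k x) powr p x) \<partial>M) = (\<integral>\<^sup>+x. ennreal (norm ((2 ^ Suc k) *\<^sub>R ?D x) powr p x) \<partial>M)"
      by (simp add: d_def)
    also have "\<dots> = ennreal (rho (\<lambda>x. (2 ^ Suc k) *\<^sub>R ?D x))"
      by (rule nn_integral_eq_rho[OF Lp_scaleR[OF L]])
    also have "\<dots> \<le> ennreal ((2 ^ Suc k) powr pp * rho ?D)"
      using rho_scaleR(2)[OF L _ c] c by (intro ennreal_leI) auto
    also have "\<dots> \<le> ennreal ((2 ^ Suc k) powr pp * e k)"
      using N[of k "r (Suc k)" "r k"] rN[of k] strict_mono_less[OF r, of k "Suc k"]
      by (intro ennreal_leI mult_left_mono) auto
    also have "\<dots> = 1" by (simp add: e_def)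
    finally show ?thesis .
  qed
  note S = Lp_summable[of d, OF dm _ this]
  have Sd: "AE x in M. summable (\<lambda>k. d k x)" and LH: "Lp (\<lambda>x. \<Sum>k. d k x)"
    using S by (auto simp: d_def)
  define H where "H x = norm (V (r 0) x) + (\<Sum>k. d k x)" for x
  have H: "Lp H" unfolding H_def by (intro Lp_add Lp_norm assms LH)
  define W where "W x = lim (\<lambda>k. V (r k) x)" for x
  have Wm [measurable]: "W \<in> borel_measurable M" unfolding W_def by measurable
  have A: "AE x in M. (\<lambda>k. V (r k) x) \<longlonglongrightarrow> W x \<and> (\<forall>k. norm (V (r k) x) \<le> H x)"
    using Sd
  proof eventually_elim
    case (elim x)
    have tel: "V (r k) x = V (r 0) x + (\<Sum>j<k. V (r (Suc j)) x - V (r j) x)" for k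
      by (induction k) auto
    have "summable (\<lambda>j. V (r (Suc j)) x - V (r j) x)"
      by (rule summable_norm_cancel) (use elim in \<open>simp add: d_def\<close>)
    then have "(\<lambda>k. V (r 0) x + (\<Sum>j<k. V (r (Suc j)) x - V (r j) x)) \<longlonglongrightarrow> V (r 0) x + (\<Sum>j. V (r (Suc j)) x - V (r j) x)"
      by (intro tendsto_intros summable_LIMSEQ)
    then have "convergent (\<lambda>k. V (r k) x)"
      unfolding tel[symmetric] convergent_def by blast
    then have "(\<lambda>k. V (r k) x) \<longlonglongrightarrow> W x"
      by (simp add: W_def convergent_LIMSEQ_iff)
    moreover have "norm (V (r k) x) \<le> H x" for k
    proof -
      have "norm (V (r k) x) \<le> norm (V (r 0) x) + (\<Sum>j<k. d j x)"
        unfolding d_def by (subst tel) (intro norm_triangle_le add_left_mono norm_sum)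
      also have "(\<Sum>j<k. d j x) \<le> (\<Sum>j. d j x)"
        using elim by (intro sum_le_suminf) (auto simp: d_def)
      finally show ?thesis by (simp add: H_def)
    qed
    ultimately show ?case by blast
  qed
  show thesis
  proof (rule that[OF r _ H])
    show "Lp W"
    proof (rule Lp_bound(1)[OF H Wm])
      show "AE x in M. norm (W x) \<le> norm (H x)"
        using A
      proof eventually_elim
        case (elim x)
        then have "(\<lambda>k. norm (V (r k) x)) \<longlonglongrightarrow> norm (W x)" by (intro tendsto_norm) auto
        then have "norm (W x) \<le> H x"
          by (rule LIMSEQ_le_const2) (use elim in auto)
        then show ?case by simp
      qed
    qed
    show "AE x in M. (\<lambda>k. V (r k) x) \<longlonglongrightarrow> W x" using A by eventually_elim auto
    show "AE x in M. norm (V (r k) x) \<le> H x" for k using A by eventually_elim auto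
  qed
qed

subsection \<open>The dual exponent\<close>

definition dual_p :: "'a \<Rightarrow> real" where
  "dual_p x = p x / (p x - 1)"

definition Lq :: "('a \<Rightarrow> 'b::euclidean_space) \<Rightarrow> bool" where
  "Lq F \<longleftrightarrow> F \<in> borel_measurable M \<and> integrable M (\<lambda>x. norm (F x) powr dual_p x)"

definition rhoq :: "('a \<Rightarrow> 'b::euclidean_space) \<Rightarrow> real" where
  "rhoq F = (LINT x|M. norm (F x) powr dual_p x)"

text \<open>The dual exponent decreases as \<open>p\<close> increases, so its upper bound comes from
  the lower bound \<open>pm\<close>.\<close>

definition qp :: real where "qp = pm / (pm - 1)"

lemma pp_gt_1: "1 < pp" using pm_gt_1 pm_le_pp by simp

lemma var_exp_dual: "var_exp M dual_p (pp / (pp - 1)) qp"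
proof (intro var_exp.intro)
  show "dual_p \<in> borel_measurable M" unfolding dual_p_def by measurable
  show "finite_measure M" by (rule finite_M)
  show "1 < pp / (pp - 1)" "pp / (pp - 1) \<le> qp"
    using pm_gt_1 pm_le_pp pp_gt_1 by (auto simp: qp_def field_simps)
  show "pp / (pp - 1) \<le> dual_p x \<and> dual_p x \<le> qp" if "x \<in> space M" for x
    using p_bounds[OF that] pm_gt_1 pp_gt_1 by (auto simp: dual_p_def qp_def field_simps)
qed

lemma Lq_eq: "Lq = var_exp.Lp M dual_p" and rhoq_eq: "rhoq = var_exp.rho M dual_p"
  by (auto simp: fun_eq_iff Lq_def rhoq_def var_exp.Lp_def[OF var_exp_dual] var_exp.rho_def[OF var_exp_dual])

lemma dual_p_bounds: "x \<in> space M \<Longrightarrow> 1 < dual_p x \<and> dual_p x \<le> qp"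
  using var_exp.p_bounds[OF var_exp_dual, of x] var_exp.pm_gt_1[OF var_exp_dual] by auto

lemma Lq_measurable [measurable_dest]: "Lq F \<Longrightarrow> F \<in> borel_measurable M"
  by (simp add: Lq_def)

lemma rhoq_nonneg: "0 \<le> rhoq F" by (simp add: rhoq_def)

lemma young:
  assumes "x \<in> space M" "a \<ge> 0" "b \<ge> 0"
  shows "a * b \<le> a powr dual_p x + b powr p x"
proof -
  have p: "1 < p x" and q: "1 < dual_p x" using p_gt_1 dual_p_bounds assms by auto
  have "a * b \<le> a powr dual_p x / dual_p x + b powr p x / p x"
    by (rule Youngs_inequality) (use p q assms in \<open>auto simp: dual_p_def field_simps\<close>)
  also have "\<dots> \<le> a powr dual_p x + b powr p x"
    using p q by (intro add_mono) (auto simp: divide_le_eq mult_le_cancel_left1)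
  finally show ?thesis .
qed

lemma young_integrable:
  fixes F :: "'a \<Rightarrow> 'b::euclidean_space" and H :: "'a \<Rightarrow> 'c::euclidean_space"
  assumes "Lq F" "Lp H"
  shows "integrable M (\<lambda>x. norm (F x) * norm (H x))"
    "(LINT x|M. norm (F x) * norm (H x)) \<le> rhoq F + rho H"
proof -
  have [measurable]: "F \<in> borel_measurable M" "H \<in> borel_measurable M" using assms by (auto simp: Lp_def Lq_def)
  have i: "integrable M (\<lambda>x. norm (F x) powr dual_p x)" "integrable M (\<lambda>x. norm (H x) powr p x)"
    using assms by (auto simp: Lp_def Lq_def)
  show *: "integrable M (\<lambda>x. norm (F x) * norm (H x))"
  proof (rule Bochner_Integration.integrable_bound[OF Bochner_Integration.integrable_add[OF i]])
    show "AE x in M. norm (norm (F x) * norm (H x)) \<le> norm (norm (F x) powr dual_p x + norm (H x) powr p x)"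
      by (rule AE_I2) (use young in auto)
  qed measurable
  have "(LINT x|M. norm (F x) * norm (H x)) \<le> (LINT x|M. norm (F x) powr dual_p x + norm (H x) powr p x)"
    by (rule integral_mono[OF * Bochner_Integration.integrable_add[OF i]]) (use young in auto)
  then show "(LINT x|M. norm (F x) * norm (H x)) \<le> rhoq F + rho H"
    using i by (simp add: rho_def rhoq_def)
qed

lemma inner_integrable:
  fixes F H :: "'a \<Rightarrow> 'b::euclidean_space"
  assumes "Lq F" "Lp H"
  shows "integrable M (\<lambda>x. F x \<bullet> H x)"
    "\<bar>LINT x|M. F x \<bullet> H x\<bar> \<le> (LINT x|M. norm (F x) * norm (H x))"
proof -
  have [measurable]: "F \<in> borel_measurable M" "H \<in> borel_measurable M" using assms by (auto simp: Lp_def Lq_def)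
  show *: "integrable M (\<lambda>x. F x \<bullet> H x)"
    by (rule Bochner_Integration.integrable_bound[OF young_integrable(1)[OF assms]])
      (auto simp: Cauchy_Schwarz_ineq2)
  have "\<bar>LINT x|M. F x \<bullet> H x\<bar> \<le> (LINT x|M. \<bar>F x \<bullet> H x\<bar>)"
    by (rule integral_abs_bound)
  also have "\<dots> \<le> (LINT x|M. norm (F x) * norm (H x))"
    using * young_integrable(1)[OF assms] by (intro integral_mono) (auto simp: Cauchy_Schwarz_ineq2)
  finally show "\<bar>LINT x|M. F x \<bullet> H x\<bar> \<le> (LINT x|M. norm (F x) * norm (H x))" .
qed

text \<open>Young's inequality for \<open>\<theta> *\<^sub>R F x\<close> and
  \<open>(1/\<theta>) *\<^sub>R H x\<close>: the first term is small by the choice of \<theta>, and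
  then the second because the modular of \<open>H\<close> is small. This expresses continuity of the
  pairing without norms.\<close>

lemma Lq_small:
  fixes F :: "'a \<Rightarrow> 'b::euclidean_space"
  assumes "Lq F" "\<epsilon> > 0"
  obtains \<eta> where "\<eta> > 0"
    "\<And>H :: 'a \<Rightarrow> 'c::euclidean_space. Lp H \<Longrightarrow> rho H \<le> \<eta> \<Longrightarrow> (LINT x|M. norm (F x) * norm (H x)) \<le> \<epsilon>"
proof -
  define \<theta> where "\<theta> = min 1 (\<epsilon> / (2 * (rhoq F + 1)))"
  have r0: "rhoq F \<ge> 0" by (rule rhoq_nonneg)
  have \<theta>: "0 < \<theta>" "\<theta> \<le> 1" using assms r0 by (auto simp: \<theta>_def)
  have "\<theta> * rhoq F \<le> \<epsilon> / (2 * (rhoq F + 1)) * (rhoq F + 1)"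
    unfolding \<theta>_def using r0 assms by (intro mult_mono) auto
  also have "\<dots> = \<epsilon> / 2" using r0 by (simp add: field_simps add_nonneg_eq_0_iff)
  finally have th: "\<theta> * rhoq F \<le> \<epsilon> / 2" .
  define \<eta> where "\<eta> = \<epsilon> / 2 * \<theta> powr pp"
  interpret d: var_exp M dual_p "pp / (pp - 1)" qp by (rule var_exp_dual)
  show thesis
  proof
    show "\<eta> > 0" using assms \<theta> by (simp add: \<eta>_def)
    fix H :: "'a \<Rightarrow> 'c" assume H: "Lp H" "rho H \<le> \<eta>"
    have F: "d.Lp F" using assms by (simp add: Lq_eq)
    have "(LINT x|M. norm (F x) * norm (H x)) = (LINT x|M. norm (\<theta> *\<^sub>R F x) * norm ((1/\<theta>) *\<^sub>R H x))"
      using \<theta> by simp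
    also have "\<dots> \<le> rhoq (\<lambda>x. \<theta> *\<^sub>R F x) + rho (\<lambda>x. (1/\<theta>) *\<^sub>R H x)"
      using d.Lp_scaleR[OF F] Lp_scaleR[OF H(1)] by (intro young_integrable) (simp_all only: Lq_eq)
    also have "\<dots> \<le> \<theta> * rhoq F + (1/\<theta>) powr pp * rho H"
    proof (rule add_mono)
      have "rhoq (\<lambda>x. \<theta> *\<^sub>R F x) \<le> \<theta> powr (pp / (pp - 1)) * rhoq F"
        unfolding rhoq_eq using \<theta> by (intro d.rho_scaleR(1)[OF F]) auto
      also have "\<theta> powr (pp / (pp - 1)) \<le> \<theta> powr 1"
        using \<theta> d.pm_gt_1 by (intro powr_mono') auto
      finally show "rhoq (\<lambda>x. \<theta> *\<^sub>R F x) \<le> \<theta> * rhoq F"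
        using \<theta> r0 by (simp add: mult_right_mono)
      show "rho (\<lambda>x. (1/\<theta>) *\<^sub>R H x) \<le> (1/\<theta>) powr pp * rho H"
        using \<theta> by (intro rho_scaleR(2)[OF H(1)]) auto
    qed
    also have "(1/\<theta>) powr pp * rho H \<le> (1/\<theta>) powr pp * \<eta>"
      using H by (intro mult_left_mono) auto
    also have "\<dots> = \<epsilon> / 2" using \<theta> by (simp add: \<eta>_def powr_divide)
    finally show "(LINT x|M. norm (F x) * norm (H x)) \<le> \<epsilon>" using th by simp
  qed
qed

text \<open>Because \<open>(p x - 1) * dual_p x = p x\<close>, the dual power of
  \<open>norm (Agrad (p x) (V x))\<close> is a bounded multiple of
  \<open>norm (V x) powr p x\<close>.\<close>

lemma Agrad_Lq:
  assumes "Lp V"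
  shows "Lq (\<lambda>x. Agrad (p x) (V x))" "rhoq (\<lambda>x. Agrad (p x) (V x)) \<le> pp powr qp * rho V"
proof -
  have [measurable]: "V \<in> borel_measurable M" using assms by (auto simp: Lp_def)
  have le: "norm (Agrad (p x) (V x)) powr dual_p x \<le> pp powr qp * norm (V x) powr p x" if x: "x \<in> space M" for x
  proof -
    note b = p_gt_1[OF x] p_bounds[OF x] dual_p_bounds[OF x]
    have "(p x - 1) * dual_p x = p x" using b by (simp add: dual_p_def)
    then have "norm (Agrad (p x) (V x)) powr dual_p x = p x powr dual_p x * norm (V x) powr p x"
      using b by (simp add: norm_Agrad powr_mult powr_powr)
    also have "p x powr dual_p x \<le> pp powr dual_p x" using b by (intro powr_mono2) auto
    also have "pp powr dual_p x \<le> pp powr qp" using b pp_gt_1 by (intro powr_mono) auto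
    finally show ?thesis by (simp add: mult_right_mono)
  qed
  have m [measurable]: "(\<lambda>x. Agrad (p x) (V x)) \<in> borel_measurable M"
    unfolding Agrad_def by measurable
  have dm [measurable]: "dual_p \<in> borel_measurable M" unfolding dual_p_def by measurable
  have i: "integrable M (\<lambda>x. pp powr qp * norm (V x) powr p x)" using assms by (simp add: Lp_def)
  have i2: "integrable M (\<lambda>x. norm (Agrad (p x) (V x)) powr dual_p x)"
    by (rule Bochner_Integration.integrable_bound[OF i]) (auto intro!: AE_I2 simp: abs_mult le)
  then show "Lq (\<lambda>x. Agrad (p x) (V x))" by (simp add: Lq_def)
  have "rhoq (\<lambda>x. Agrad (p x) (V x)) \<le> (LINT x|M. pp powr qp * norm (V x) powr p x)"
    unfolding rhoq_def by (rule integral_mono[OF i2 i le])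
  then show "rhoq (\<lambda>x. Agrad (p x) (V x)) \<le> pp powr qp * rho V" by (simp add: rho_def)
qed

lemma Agrad_tangent_integral:
  assumes "Lp V" "Lp W"
  shows "rho W + (LINT x|M. Agrad (p x) (W x) \<bullet> (V x - W x)) \<le> rho V"
proof -
  have i: "integrable M (\<lambda>x. Agrad (p x) (W x) \<bullet> (V x - W x))"
    by (intro inner_integrable Agrad_Lq Lp_diff assms)
  have "rho W + (LINT x|M. Agrad (p x) (W x) \<bullet> (V x - W x)) =
      (LINT x|M. norm (W x) powr p x + Agrad (p x) (W x) \<bullet> (V x - W x))"
    unfolding rho_def using i assms by (simp add: Lp_def)
  also have "\<dots> \<le> (LINT x|M. norm (V x) powr p x)"
    using i assms by (intro integral_mono) (auto simp: Lp_def intro!: Agrad_tangent p_gt_1)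
  finally show ?thesis by (simp add: rho_def)
qed

text \<open>With one majorant \<open>Z\<close> for both sequences the integrand is at most
  \<open>pp * norm (Z x) powr p x\<close>, the powers \<open>p x - 1\<close> and 1 adding
  up.\<close>

lemma Agrad_dominated:
  fixes V G :: "nat \<Rightarrow> 'a \<Rightarrow> 'b::euclidean_space" and Z :: "'a \<Rightarrow> real"
  assumes "\<And>n. V n \<in> borel_measurable M" "W \<in> borel_measurable M"
    "\<And>n. G n \<in> borel_measurable M" "F \<in> borel_measurable M" "Lp Z"
    "AE x in M. (\<lambda>n. V n x) \<longlonglongrightarrow> W x" "AE x in M. (\<lambda>n. G n x) \<longlonglongrightarrow> F x"
    "\<And>n. AE x in M. norm (V n x) \<le> Z x" "\<And>n. AE x in M. norm (G n x) \<le> Z x"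
  shows "(\<lambda>n. LINT x|M. Agrad (p x) (V n x) \<bullet> G n x) \<longlonglongrightarrow> (LINT x|M. Agrad (p x) (W x) \<bullet> F x)"
proof (rule integral_dominated_convergence[where w = "\<lambda>x. pp * norm (Z x) powr p x"])
  have [measurable]: "V n \<in> borel_measurable M" "W \<in> borel_measurable M"
    "G n \<in> borel_measurable M" "F \<in> borel_measurable M" for n using assms by auto
  show "(\<lambda>x. Agrad (p x) (W x) \<bullet> F x) \<in> borel_measurable M"
    "(\<lambda>x. Agrad (p x) (V n x) \<bullet> G n x) \<in> borel_measurable M" for n
    unfolding Agrad_def by measurable
  show "integrable M (\<lambda>x. pp * norm (Z x) powr p x)" using assms by (simp add: Lp_def)
  show "AE x in M. (\<lambda>n. Agrad (p x) (V n x) \<bullet> G n x) \<longlonglongrightarrow> Agrad (p x) (W x) \<bullet> F x"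
    using assms(6,7) AE_space
    by eventually_elim (intro tendsto_inner tendsto_Agrad p_gt_1)
  show "AE x in M. norm (Agrad (p x) (V n x) \<bullet> G n x) \<le> pp * norm (Z x) powr p x" for n
    using assms(8,9)[of n] AE_space
  proof eventually_elim
    case (elim x)
    note b = p_bounds[OF elim(3)] p_gt_1[OF elim(3)]
    have Z: "Z x \<ge> 0" using elim(1) norm_ge_zero order_trans by blast
    have "norm (Agrad (p x) (V n x) \<bullet> G n x) \<le> norm (Agrad (p x) (V n x)) * norm (G n x)"
      by (simp add: Cauchy_Schwarz_ineq2)
    also have "\<dots> = p x * norm (V n x) powr (p x - 1) * norm (G n x)"
      using b by (simp add: norm_Agrad)
    also have "\<dots> \<le> pp * Z x powr (p x - 1) * Z x"
      using b elim Z by (intro mult_mono powr_mono2) auto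
    also have "\<dots> = pp * Z x powr p x"
      using Z by (cases "Z x = 0") (auto simp: powr_mult_base mult.commute)
    finally show ?case using Z by simp
  qed
qed

lemma rho_defect_eq:
  assumes "Lp V" "Lp W"
  shows "integrable M (\<lambda>x. defect (p x) (V x) (W x))"
    "(LINT x|M. defect (p x) (V x) (W x)) = (rho V + rho W) / 2 - rho (\<lambda>x. (1/2) *\<^sub>R (V x + W x))"
proof -
  have i: "integrable M (\<lambda>x. norm (V x) powr p x)" "integrable M (\<lambda>x. norm (W x) powr p x)"
    "integrable M (\<lambda>x. norm ((1/2) *\<^sub>R (V x + W x)) powr p x)"
    using assms Lp_scaleR[OF Lp_add(1)[OF assms], of "1/2"] by (auto simp: Lp_def)
  show "integrable M (\<lambda>x. defect (p x) (V x) (W x))"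
    unfolding defect_def by (intro Bochner_Integration.integrable_diff integrable_divide Bochner_Integration.integrable_add i)
  show "(LINT x|M. defect (p x) (V x) (W x)) = (rho V + rho W) / 2 - rho (\<lambda>x. (1/2) *\<^sub>R (V x + W x))"
    unfolding defect_def rho_def
    by (subst Bochner_Integration.integral_diff)
      (simp_all only: Bochner_Integration.integral_add[OF i(1,2)] integral_divide_zero i integrable_divide
        Bochner_Integration.integrable_add)
qed

lemma rho_midpoint:
  assumes "Lp V" "Lp W"
  shows "rho (\<lambda>x. (1/2) *\<^sub>R (V x + W x)) \<le> (rho V + rho W) / 2"
proof -
  have "0 \<le> (LINT x|M. defect (p x) (V x) (W x))"
    by (rule integral_nonneg_AE) (auto intro!: AE_I2 defect_nonneg p_gt_1)
  then show ?thesis by (simp add: rho_defect_eq(2)[OF assms])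
qed

text \<open>The pointwise inequality can be integrated because its constant does not depend on the
  exponent.\<close>

lemma rho_uniform_convexity:
  assumes "\<epsilon> > 0"
  obtains C where "C > 0"
    "\<And>V W :: 'a \<Rightarrow> 'b::euclidean_space. Lp V \<Longrightarrow> Lp W \<Longrightarrow>
      rho (\<lambda>x. V x - W x) \<le> \<epsilon> * (rho V + rho W) + C * ((rho V + rho W) / 2 - rho (\<lambda>x. (1/2) *\<^sub>R (V x + W x)))"
proof -
  obtain C where C: "C > 0"
    "\<And>q (a::'b) b. pm \<le> q \<Longrightarrow> q \<le> pp \<Longrightarrow>
      norm (a - b) powr q \<le> \<epsilon> * (norm a powr q + norm b powr q) + C * defect q a b"
    using uniform_convexity[OF pm_gt_1 assms, where pp = pp] by metis
  show thesis
  proof (rule that[OF C(1)])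
    fix V W :: "'a \<Rightarrow> 'b" assume VW: "Lp V" "Lp W"
    note i = Lp_diff[OF VW, unfolded Lp_def, THEN conjunct2] rho_defect_eq(1)[OF VW]
      VW[unfolded Lp_def, THEN conjunct2]
    have "rho (\<lambda>x. V x - W x) \<le>
        (LINT x|M. \<epsilon> * (norm (V x) powr p x + norm (W x) powr p x) + C * defect (p x) (V x) (W x))"
      unfolding rho_def
      by (rule integral_mono) (use i p_bounds C(2) in \<open>auto intro!: Bochner_Integration.integrable_add integrable_mult_right\<close>)
    also have "\<dots> = \<epsilon> * (rho V + rho W) + C * (LINT x|M. defect (p x) (V x) (W x))"
      unfolding rho_def using i by simp
    finally show "rho (\<lambda>x. V x - W x) \<le> \<epsilon> * (rho V + rho W) + C * ((rho V + rho W) / 2 - rho (\<lambda>x. (1/2) *\<^sub>R (V x + W x)))"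
      by (simp only: rho_defect_eq(2)[OF VW])
  qed
qed

end

section \<open>Functionals on test functions\<close>

definition supn :: "('a \<Rightarrow> real) \<Rightarrow> real" where
  "supn \<phi> = (SUP x. \<bar>\<phi> x\<bar>)"

lemma supn_le: "(\<And>x. \<bar>\<phi> x\<bar> \<le> B) \<Longrightarrow> supn \<phi> \<le> B"
  unfolding supn_def by (rule cSUP_least) auto

locale sobolev = var_exp "lebesgue_on \<Omega>" p pm pp
  for \<Omega> :: "'a::euclidean_space set" and p :: "'a \<Rightarrow> real" and pm pp :: real +
  assumes open_domain: "open \<Omega>" and bounded_domain: "bounded \<Omega>"
begin

abbreviation "X \<equiv> test_functions \<Omega>"

lemma X_bounded: "\<phi> \<in> X \<Longrightarrow> bdd_above (range (\<lambda>x. \<bar>\<phi> x\<bar>))"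
  using test_functions_bounded[of \<phi> \<Omega>] by (metis bdd_aboveI2)

lemma supn_ge: "\<phi> \<in> X \<Longrightarrow> \<bar>\<phi> x\<bar> \<le> supn \<phi>"
  unfolding supn_def by (rule cSUP_upper[OF UNIV_I X_bounded])

lemma supn_nonneg: "\<phi> \<in> X \<Longrightarrow> 0 \<le> supn \<phi>"
  using supn_ge[of \<phi> undefined] abs_ge_zero order_trans by blast

lemma supn_add: "\<phi> \<in> X \<Longrightarrow> \<psi> \<in> X \<Longrightarrow> supn (\<lambda>x. \<phi> x + \<psi> x) \<le> supn \<phi> + supn \<psi>"
  by (rule supn_le) (meson abs_triangle_ineq add_mono order_trans supn_ge)

lemma supn_cmult_le: "\<phi> \<in> X \<Longrightarrow> supn (\<lambda>x. c * \<phi> x) \<le> \<bar>c\<bar> * supn \<phi>"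
  by (rule supn_le) (simp add: abs_mult mult_left_mono supn_ge)

lemma X_smooth: "\<phi> \<in> X \<Longrightarrow> smooth \<phi>"
  by (rule test_functions_smooth)

lemma X_Lp: "\<phi> \<in> X \<Longrightarrow> Lp \<phi>"
  and X_Lp_grad: "\<phi> \<in> X \<Longrightarrow> Lp (grad \<phi>)"
proof -
  assume \<phi>: "\<phi> \<in> X"
  obtain B where B: "\<And>x. \<bar>\<phi> x\<bar> \<le> B" "\<And>x. norm (grad \<phi> x) \<le> B"
    using test_functions_bounded[OF \<phi>] by metis
  show "Lp \<phi>" "Lp (grad \<phi>)"
    using test_functions_integrable[OF \<phi> open_domain] B by (auto intro!: Lp_bounded[of _ B])
qed

lemma X_measurable: "\<phi> \<in> X \<Longrightarrow> \<phi> \<in> borel_measurable (lebesgue_on \<Omega>)"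
  "\<phi> \<in> X \<Longrightarrow> grad \<phi> \<in> borel_measurable (lebesgue_on \<Omega>)"
  using X_Lp X_Lp_grad Lp_measurable by blast+

section \<open>Midpoint convexity of the energy, and sequences whose gaps tend to 0\<close>

definition mid :: "('a \<Rightarrow> real) \<Rightarrow> ('a \<Rightarrow> real) \<Rightarrow> 'a \<Rightarrow> real" where
  "mid \<phi> \<psi> x = (1/2) * (\<phi> x + \<psi> x)"

lemma mid_X: "\<phi> \<in> X \<Longrightarrow> \<psi> \<in> X \<Longrightarrow> mid \<phi> \<psi> \<in> X"
  using test_functions_cmult[OF test_functions_add, of \<phi> \<Omega> \<psi> "1/2"] by (simp add: mid_def[abs_def])

lemma grad_mid: "\<phi> \<in> X \<Longrightarrow> \<psi> \<in> X \<Longrightarrow> grad (mid \<phi> \<psi>) x = (1/2) *\<^sub>R (grad \<phi> x + grad \<psi> x)"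
  using grad_cmult[OF smooth_add, OF X_smooth X_smooth, of \<phi> \<psi> "1/2" x]
  by (simp add: mid_def[abs_def] grad_add X_smooth)

definition energy :: "real \<Rightarrow> ('a \<Rightarrow> real) \<Rightarrow> real" where
  "energy k \<phi> = rho (grad \<phi>) + k * rho \<phi>"

lemma energy_nonneg: "k \<ge> 0 \<Longrightarrow> 0 \<le> energy k \<phi>"
  by (simp add: energy_def rho_nonneg)

lemma energy_mono: "k \<le> l \<Longrightarrow> energy k \<phi> \<le> energy l \<phi>"
  by (simp add: energy_def rho_nonneg mult_right_mono)

definition gap :: "real \<Rightarrow> ('a \<Rightarrow> real) \<Rightarrow> ('a \<Rightarrow> real) \<Rightarrow> real" where
  "gap k \<phi> \<psi> = (energy k \<phi> + energy k \<psi>) / 2 - energy k (mid \<phi> \<psi>)"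

text \<open>The gradient part and the function part are nonnegative separately. Hence the gap
  increases with \<open>k\<close>, and the convexity inequalities of both parts can be
  added.\<close>

lemma gap_parts:
  assumes "\<phi> \<in> X" "\<psi> \<in> X"
  shows "gap k \<phi> \<psi> = ((rho (grad \<phi>) + rho (grad \<psi>)) / 2 - rho (\<lambda>x. (1/2) *\<^sub>R (grad \<phi> x + grad \<psi> x)))
      + k * ((rho \<phi> + rho \<psi>) / 2 - rho (\<lambda>x. (1/2) *\<^sub>R (\<phi> x + \<psi> x)))"
    "0 \<le> (rho (grad \<phi>) + rho (grad \<psi>)) / 2 - rho (\<lambda>x. (1/2) *\<^sub>R (grad \<phi> x + grad \<psi> x))"
    "0 \<le> (rho \<phi> + rho \<psi>) / 2 - rho (\<lambda>x. (1/2) *\<^sub>R (\<phi> x + \<psi> x))"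
proof -
  have "grad (mid \<phi> \<psi>) = (\<lambda>x. (1/2) *\<^sub>R (grad \<phi> x + grad \<psi> x))" "mid \<phi> \<psi> = (\<lambda>x. (1/2) *\<^sub>R (\<phi> x + \<psi> x))"
    using grad_mid[OF assms] by (auto simp: mid_def)
  then show "gap k \<phi> \<psi> = ((rho (grad \<phi>) + rho (grad \<psi>)) / 2 - rho (\<lambda>x. (1/2) *\<^sub>R (grad \<phi> x + grad \<psi> x)))
      + k * ((rho \<phi> + rho \<psi>) / 2 - rho (\<lambda>x. (1/2) *\<^sub>R (\<phi> x + \<psi> x)))"
    by (simp only: gap_def energy_def) (simp add: field_simps)
  show "0 \<le> (rho (grad \<phi>) + rho (grad \<psi>)) / 2 - rho (\<lambda>x. (1/2) *\<^sub>R (grad \<phi> x + grad \<psi> x))"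
    using rho_midpoint[OF X_Lp_grad[OF assms(1)] X_Lp_grad[OF assms(2)]] by linarith
  show "0 \<le> (rho \<phi> + rho \<psi>) / 2 - rho (\<lambda>x. (1/2) *\<^sub>R (\<phi> x + \<psi> x))"
    using rho_midpoint[OF X_Lp[OF assms(1)] X_Lp[OF assms(2)]] by linarith
qed

lemma gap_mono:
  assumes "\<phi> \<in> X" "\<psi> \<in> X" "k \<le> l"
  shows "gap k \<phi> \<psi> \<le> gap l \<phi> \<psi>"
  using gap_parts(3)[OF assms(1,2)] assms(3)
  unfolding gap_parts(1)[OF assms(1,2)] by (intro add_left_mono mult_right_mono)

lemma energy_uniform_convexity:
  assumes "\<epsilon> > 0"
  obtains C where "C > 0"
    "\<And>\<phi> \<psi>. \<phi> \<in> X \<Longrightarrow> \<psi> \<in> X \<Longrightarrow>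
      energy 1 (\<lambda>x. \<phi> x - \<psi> x) \<le> \<epsilon> * (energy 1 \<phi> + energy 1 \<psi>) + C * gap 1 \<phi> \<psi>"
proof -
  obtain C1 where C1: "C1 > 0" "\<And>V W :: 'a \<Rightarrow> 'a. Lp V \<Longrightarrow> Lp W \<Longrightarrow>
      rho (\<lambda>x. V x - W x) \<le> \<epsilon> * (rho V + rho W) + C1 * ((rho V + rho W) / 2 - rho (\<lambda>x. (1/2) *\<^sub>R (V x + W x)))"
    by (rule rho_uniform_convexity[OF assms]) (rule that)
  obtain C2 where C2: "C2 > 0" "\<And>V W :: 'a \<Rightarrow> real. Lp V \<Longrightarrow> Lp W \<Longrightarrow>
      rho (\<lambda>x. V x - W x) \<le> \<epsilon> * (rho V + rho W) + C2 * ((rho V + rho W) / 2 - rho (\<lambda>x. (1/2) *\<^sub>R (V x + W x)))"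
    by (rule rho_uniform_convexity[OF assms]) (rule that)
  show thesis
  proof (rule that[of "C1 + C2"])
    fix \<phi> \<psi> assume X: "\<phi> \<in> X" "\<psi> \<in> X"
    define D1 where "D1 = (rho (grad \<phi>) + rho (grad \<psi>)) / 2 - rho (\<lambda>x. (1/2) *\<^sub>R (grad \<phi> x + grad \<psi> x))"
    define D2 where "D2 = (rho \<phi> + rho \<psi>) / 2 - rho (\<lambda>x. (1/2) *\<^sub>R (\<phi> x + \<psi> x))"
    have D: "D1 \<ge> 0" "D2 \<ge> 0" "gap 1 \<phi> \<psi> = D1 + D2"
      using gap_parts(1)[OF X, of 1] gap_parts(2,3)[OF X] by (auto simp: D1_def D2_def)
    have g: "grad (\<lambda>x. \<phi> x - \<psi> x) = (\<lambda>x. grad \<phi> x - grad \<psi> x)"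
      by (intro ext grad_diff X_smooth X)
    have "energy 1 (\<lambda>x. \<phi> x - \<psi> x) \<le> (\<epsilon> * (rho (grad \<phi>) + rho (grad \<psi>)) + C1 * D1) + (\<epsilon> * (rho \<phi> + rho \<psi>) + C2 * D2)"
      using C1(2)[OF X_Lp_grad[OF X(1)] X_Lp_grad[OF X(2)]] C2(2)[OF X_Lp[OF X(1)] X_Lp[OF X(2)]]
      by (simp add: energy_def g D1_def D2_def)
    also have "\<dots> \<le> (\<epsilon> * (rho (grad \<phi>) + rho (grad \<psi>)) + (C1 + C2) * D1) + (\<epsilon> * (rho \<phi> + rho \<psi>) + (C1 + C2) * D2)"
      using D C1(1) C2(1) by (intro add_mono mult_right_mono) (auto simp: rho_nonneg)
    also have "\<dots> = \<epsilon> * (energy 1 \<phi> + energy 1 \<psi>) + (C1 + C2) * gap 1 \<phi> \<psi>"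
      by (simp add: D(3) energy_def algebra_simps)
    finally show "energy 1 (\<lambda>x. \<phi> x - \<psi> x) \<le> \<epsilon> * (energy 1 \<phi> + energy 1 \<psi>) + (C1 + C2) * gap 1 \<phi> \<psi>" .
  qed (use C1 C2 in auto)
qed

text \<open>The pair of \<phi> and its gradient is treated as one map into the product space, so
  that one subsequence and one majorant serve both.\<close>

lemma energy_Cauchy_subseq:
  assumes X: "\<And>n. \<phi> n \<in> X" and R: "\<And>n. energy 1 (\<phi> n) \<le> R"
    and gap: "\<And>\<delta>. \<delta> > 0 \<Longrightarrow> \<exists>N. \<forall>m\<ge>N. \<forall>n\<ge>N. gap 1 (\<phi> m) (\<phi> n) \<le> \<delta>"
  obtains r u V and H :: "'a \<Rightarrow> real" where "strict_mono (r :: nat \<Rightarrow> nat)" "Lp u" "Lp V" "Lp H"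
    "AE x in lebesgue_on \<Omega>. (\<lambda>k. \<phi> (r k) x) \<longlonglongrightarrow> u x"
    "AE x in lebesgue_on \<Omega>. (\<lambda>k. grad (\<phi> (r k)) x) \<longlonglongrightarrow> V x"
    "\<And>k. AE x in lebesgue_on \<Omega>. norm (\<phi> (r k) x) \<le> H x"
    "\<And>k. AE x in lebesgue_on \<Omega>. norm (grad (\<phi> (r k)) x) \<le> H x"
proof -
  have R0: "R \<ge> 0" using R[of 0] energy_nonneg[of 1 "\<phi> 0"] by simp
  define U where "U n x = (\<phi> n x, grad (\<phi> n) x)" for n x
  have Lpair: "Lp (\<lambda>x. (f x, F x))" and rpair: "rho (\<lambda>x. (f x, F x)) \<le> 2 powr pp * (rho f + rho F)"
    if "Lp f" "Lp F" for f :: "'a \<Rightarrow> real" and F :: "'a \<Rightarrow> 'a"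
  proof -
    have m [measurable]: "f \<in> borel_measurable (lebesgue_on \<Omega>)" "F \<in> borel_measurable (lebesgue_on \<Omega>)"
      using that Lp_measurable by blast+
    have L: "Lp (\<lambda>x. norm (f x) + norm (F x))" by (intro Lp_add Lp_norm that)
    have le: "AE x in lebesgue_on \<Omega>. norm (f x, F x) \<le> norm (norm (f x) + norm (F x))"
      by (rule AE_I2) (simp add: norm_Pair sqrt_add_le_add_sqrt[THEN order_trans])
    show "Lp (\<lambda>x. (f x, F x))" by (rule Lp_bound(1)[OF L _ le]) measurable
    have "rho (\<lambda>x. (f x, F x)) \<le> rho (\<lambda>x. norm (f x) + norm (F x))" by (rule Lp_bound(2)[OF L _ le]) measurable
    also have "\<dots> \<le> 2 powr pp * (rho (\<lambda>x. norm (f x)) + rho (\<lambda>x. norm (F x)))" by (intro Lp_add Lp_norm that)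
    finally show "rho (\<lambda>x. (f x, F x)) \<le> 2 powr pp * (rho f + rho F)" by (simp only: rho_norm)
  qed
  have LU: "Lp (U n)" for n
    unfolding U_def by (intro Lpair X_Lp X_Lp_grad X)
  have cau: "\<exists>N. \<forall>m\<ge>N. \<forall>n\<ge>N. rho (\<lambda>x. U m x - U n x) \<le> \<epsilon>" if "\<epsilon> > 0" for \<epsilon>
  proof -
    define e where "e = \<epsilon> / 2 powr pp"
    have e: "e > 0" using that by (simp add: e_def)
    \<comment> \<open>Since the energies are at most \<open>R\<close>, this makes the first term of
      uniform convexity at most \<open>e / 2\<close>; the factor \<open>2 powr pp\<close> in
      \<open>e\<close> accounts for passing to pairs.\<close>
    define e' where "e' = e / (4 * (R + 1))"
    have e': "e' > 0" using e R0 by (simp add: e'_def)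
    obtain C where C: "C > 0" "\<And>\<phi> \<psi>. \<phi> \<in> X \<Longrightarrow> \<psi> \<in> X \<Longrightarrow>
      energy 1 (\<lambda>x. \<phi> x - \<psi> x) \<le> e' * (energy 1 \<phi> + energy 1 \<psi>) + C * gap 1 \<phi> \<psi>"
      using energy_uniform_convexity[OF e'] by metis
    obtain N where N: "\<And>m n. m \<ge> N \<Longrightarrow> n \<ge> N \<Longrightarrow> gap 1 (\<phi> m) (\<phi> n) \<le> e / (2 * C)"
      using gap[of "e / (2 * C)"] e C(1) by auto
    have "rho (\<lambda>x. U m x - U n x) \<le> \<epsilon>" if "m \<ge> N" "n \<ge> N" for m n
    proof -
      let ?d = "\<lambda>x. \<phi> m x - \<phi> n x"
      have dX: "?d \<in> X" by (intro test_functions_diff X)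
      have "rho (\<lambda>x. U m x - U n x) = rho (\<lambda>x. (?d x, grad ?d x))"
        unfolding U_def by (simp add: grad_diff X_smooth X)
      also have "\<dots> \<le> 2 powr pp * energy 1 ?d"
        using rpair[OF X_Lp[OF dX] X_Lp_grad[OF dX]] by (simp add: energy_def add.commute)
      also have "energy 1 ?d \<le> e' * (energy 1 (\<phi> m) + energy 1 (\<phi> n)) + C * gap 1 (\<phi> m) (\<phi> n)"
        by (rule C(2)[OF X X])
      also have "\<dots> \<le> e' * (R + R) + C * (e / (2 * C))"
        using e' C(1) by (intro add_mono mult_left_mono R N that) auto
      also have "\<dots> \<le> e / 2 + e / 2"
      proof (rule add_mono)
        have "e' * (R + R) \<le> e' * (2 * (R + 1))" using e' by (intro mult_left_mono) auto
        also have "\<dots> = e / 2" unfolding e'_def using R0 by (simp add: field_simps)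
        finally show "e' * (R + R) \<le> e / 2" .
      qed (use C(1) in simp)
      finally show ?thesis by (simp add: e_def field_simps)
    qed
    then show ?thesis by blast
  qed
  obtain r W and H :: "'a \<Rightarrow> real" where r: "strict_mono (r :: nat \<Rightarrow> nat)" "Lp W" "Lp H"
    "AE x in lebesgue_on \<Omega>. (\<lambda>k. U (r k) x) \<longlonglongrightarrow> W x" "\<And>k. AE x in lebesgue_on \<Omega>. norm (U (r k) x) \<le> H x"
    by (rule Lp_Cauchy_subseq[of U, OF LU]) (erule cau, rule that)
  have Wm [measurable]: "W \<in> borel_measurable (lebesgue_on \<Omega>)" using r(2) Lp_measurable by blast
  show thesis
  proof (rule that[of r "\<lambda>x. fst (W x)" "\<lambda>x. snd (W x)" H])
    have fm: "(\<lambda>x. fst (W x)) \<in> borel_measurable (lebesgue_on \<Omega>)" "(\<lambda>x. snd (W x)) \<in> borel_measurable (lebesgue_on \<Omega>)"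
      by (rule borel_measurable_continuous_on[OF _ Wm], intro continuous_intros)+
    have n: "norm (fst z) \<le> norm z" "norm (snd z) \<le> norm z" for z :: "real \<times> 'a"
      by (metis norm_fst_le norm_snd_le prod.collapse)+
    show "Lp (\<lambda>x. fst (W x))" "Lp (\<lambda>x. snd (W x))"
      by (rule Lp_bound(1)[OF r(2)], rule fm, rule AE_I2, rule n)+
    show "AE x in lebesgue_on \<Omega>. (\<lambda>k. \<phi> (r k) x) \<longlonglongrightarrow> fst (W x)"
      using r(4) by eventually_elim (auto dest: tendsto_fst simp: U_def)
    show "AE x in lebesgue_on \<Omega>. (\<lambda>k. grad (\<phi> (r k)) x) \<longlonglongrightarrow> snd (W x)"
      using r(4) by eventually_elim (auto dest: tendsto_snd simp: U_def)
    show "AE x in lebesgue_on \<Omega>. norm (\<phi> (r k) x) \<le> H x" for k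
      using r(5)[of k] by eventually_elim (metis U_def fst_conv norm_fst_le order_trans)
    show "AE x in lebesgue_on \<Omega>. norm (grad (\<phi> (r k)) x) \<le> H x" for k
      using r(5)[of k] by eventually_elim (metis U_def snd_conv norm_snd_le order_trans)
  qed (use r in auto)
qed

section \<open>Linear functionals that are continuous in energy, and their coercivity\<close>

definition linear_on_X :: "(('a \<Rightarrow> real) \<Rightarrow> real) \<Rightarrow> bool" where
  "linear_on_X \<nu> \<longleftrightarrow> (\<forall>\<phi>\<in>X. \<forall>\<psi>\<in>X. \<nu> (\<lambda>x. \<phi> x + \<psi> x) = \<nu> \<phi> + \<nu> \<psi>) \<and> (\<forall>\<phi>\<in>X. \<forall>c. \<nu> (\<lambda>x. c * \<phi> x) = c * \<nu> \<phi>)"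

text \<open>The last condition says that on the unit ball of the supremum norm the functional is continuous
  at 0 with respect to the Sobolev modular. For measures it encodes that sets of capacity zero are
  not charged.\<close>

definition energy_cont :: "real \<Rightarrow> (('a \<Rightarrow> real) \<Rightarrow> real) \<Rightarrow> bool" where
  "energy_cont A \<nu> \<longleftrightarrow> linear_on_X \<nu> \<and> (\<forall>\<phi>\<in>X. \<bar>\<nu> \<phi>\<bar> \<le> A * supn \<phi>) \<and>
    (\<forall>\<epsilon>>0. \<exists>\<eta>>0. \<forall>\<phi>\<in>X. supn \<phi> \<le> 1 \<longrightarrow> energy 1 \<phi> \<le> \<eta> \<longrightarrow> \<bar>\<nu> \<phi>\<bar> \<le> \<epsilon>)"

lemma linear_on_X_cmult: "linear_on_X \<nu> \<Longrightarrow> \<phi> \<in> X \<Longrightarrow> \<nu> (\<lambda>x. c * \<phi> x) = c * \<nu> \<phi>"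
  and linear_on_X_add: "linear_on_X \<nu> \<Longrightarrow> \<phi> \<in> X \<Longrightarrow> \<psi> \<in> X \<Longrightarrow> \<nu> (\<lambda>x. \<phi> x + \<psi> x) = \<nu> \<phi> + \<nu> \<psi>"
  by (auto simp: linear_on_X_def)

lemma grad_cmult_fun: "\<phi> \<in> X \<Longrightarrow> grad (\<lambda>x. c * \<phi> x) = (\<lambda>x. c *\<^sub>R grad \<phi> x)"
  by (intro ext grad_cmult X_smooth)

lemma energy_scale_ge:
  assumes "\<phi> \<in> X" "c \<ge> 1" "k \<ge> 0"
  shows "c powr pm * energy k \<phi> \<le> energy k (\<lambda>x. c * \<phi> x)"
proof -
  have "c powr pm * rho (grad \<phi>) \<le> rho (grad (\<lambda>x. c * \<phi> x))"
    using rho_scaleR(3)[OF X_Lp_grad[OF assms(1)], of c] assms by (simp add: grad_cmult_fun)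
  moreover have "c powr pm * rho \<phi> \<le> rho (\<lambda>x. c * \<phi> x)"
    using rho_scaleR(3)[OF X_Lp[OF assms(1)], of c] assms by simp
  then have "k * (c powr pm * rho \<phi>) \<le> k * rho (\<lambda>x. c * \<phi> x)"
    using assms by (intro mult_left_mono)
  ultimately show ?thesis by (simp add: energy_def algebra_simps)
qed

text \<open>For \<open>s \<le> 1\<close>, where \<open>s\<close> is the supremum of \<phi>, the
  constant suffices. Otherwise \<phi> is scaled to supremum at most 1. If the scaled energy is at
  most \<eta>, the term with \<epsilon> suffices; if not, the energy of \<phi> is at least
  \<open>s powr pm * \<eta>\<close>, which outgrows \<open>A * s\<close> because
  \<open>pm > 1\<close>.\<close>

lemma coercive:
  assumes "energy_cont A \<nu>" "A \<ge> 0" "\<epsilon> > 0"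
  obtains B where "B \<ge> 0" "\<And>\<phi>. \<phi> \<in> X \<Longrightarrow> \<nu> \<phi> \<le> B + (1/2) * energy 1 \<phi> + (\<epsilon>/2) * supn \<phi>"
proof -
  have lin: "linear_on_X \<nu>" and bd: "\<And>\<phi>. \<phi> \<in> X \<Longrightarrow> \<bar>\<nu> \<phi>\<bar> \<le> A * supn \<phi>"
    using assms(1) by (auto simp: energy_cont_def)
  have "\<epsilon> / 2 > 0" using assms by simp
  then obtain \<eta> where \<eta>: "\<eta> > 0" "\<And>\<phi>. \<phi> \<in> X \<Longrightarrow> supn \<phi> \<le> 1 \<Longrightarrow> energy 1 \<phi> \<le> \<eta> \<Longrightarrow> \<bar>\<nu> \<phi>\<bar> \<le> \<epsilon> / 2"
    using assms(1) unfolding energy_cont_def by meson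
  \<comment> \<open>Beyond this supremum \<open>A * s\<close> is at most half of
    \<open>s powr pm * \<eta>\<close>.\<close>
  define s0 where "s0 = (2 * A / \<eta>) powr (1 / (pm - 1))"
  have s0: "s0 \<ge> 0" by (simp add: s0_def)
  show thesis
  proof (rule that[of "A + A * s0"])
    show "A + A * s0 \<ge> 0" using assms s0 by auto
    fix \<phi> assume \<phi>: "\<phi> \<in> X"
    define s where "s = supn \<phi>"
    have s: "s \<ge> 0" using supn_nonneg[OF \<phi>] by (simp add: s_def)
    have e0: "energy 1 \<phi> \<ge> 0" by (rule energy_nonneg) simp
    have le: "\<nu> \<phi> \<le> A * s" using bd[OF \<phi>] by (simp add: s_def)
    show "\<nu> \<phi> \<le> (A + A * s0) + (1/2) * energy 1 \<phi> + (\<epsilon>/2) * supn \<phi>"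
    proof (cases "s \<le> 1")
      case True
      then have "A * s \<le> A * 1" using assms by (intro mult_left_mono)
      moreover have "(\<epsilon>/2) * supn \<phi> \<ge> 0" using s assms by (simp add: s_def)
      moreover have "A * s0 \<ge> 0" using assms s0 by simp
      ultimately show ?thesis using le e0 by simp
    next
      case False
      define \<phi>' where "\<phi>' x = (1/s) * \<phi> x" for x
      have \<phi>': "\<phi>' \<in> X" unfolding \<phi>'_def by (intro test_functions_cmult \<phi>)
      have eq: "\<phi> = (\<lambda>x. s * \<phi>' x)" using False by (auto simp: \<phi>'_def)
      have sup: "supn \<phi>' \<le> 1"
        using supn_cmult_le[OF \<phi>, of "1/s"] False by (simp add: \<phi>'_def[abs_def] s_def)
      have nn: "A + A * s0 \<ge> 0" "(\<epsilon>/2) * s \<ge> 0" using assms s0 s by auto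
      show ?thesis
      proof (cases "energy 1 \<phi>' \<le> \<eta>")
        case True
        have "\<nu> \<phi> = s * \<nu> \<phi>'" by (subst eq) (rule linear_on_X_cmult[OF lin \<phi>'])
        also have "\<dots> \<le> s * (\<epsilon> / 2)" using \<eta>(2)[OF \<phi>' sup True] s by (intro mult_left_mono) auto
        finally show ?thesis using nn e0 by (simp add: s_def mult.commute)
      next
        case E: False
        have "s powr pm * \<eta> \<le> s powr pm * energy 1 \<phi>'" using E by (intro mult_left_mono) auto
        also have "\<dots> \<le> energy 1 \<phi>"
          using energy_scale_ge[OF \<phi>', of s 1] False by (simp flip: eq)
        finally have en: "s powr pm * \<eta> \<le> energy 1 \<phi>" .
        have "A * s \<le> A * s0 + (1/2) * (s powr pm * \<eta>)"
        proof (cases "s \<le> s0")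
          case True
          then have "A * s \<le> A * s0" using assms by (intro mult_left_mono)
          then show ?thesis using \<eta>(1) by (simp add: add_increasing2)
        next
          case G: False
          have "2 * A / \<eta> = s0 powr (pm - 1)"
            using pm_gt_1 assms \<eta>(1) by (simp add: s0_def powr_powr)
          also have "\<dots> \<le> s powr (pm - 1)" using G s0 pm_gt_1 by (intro powr_mono2) auto
          finally have "2 * A \<le> s powr (pm - 1) * \<eta>" using \<eta>(1) by (simp add: divide_le_eq)
          then have "2 * A * s \<le> s powr (pm - 1) * \<eta> * s" using s by (intro mult_right_mono)
          also have "\<dots> = s powr pm * \<eta>" using False by (simp add: powr_mult_base mult.commute mult.left_commute)
          finally show ?thesis using assms s0 by (simp add: add_increasing)
        qed
        then show ?thesis using le en nn assms by (simp add: s_def)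
      qed
    qed
  qed
qed

section \<open>The penalised minimisation problem\<close>

definition J :: "real \<Rightarrow> real \<Rightarrow> (('a \<Rightarrow> real) \<Rightarrow> real) \<Rightarrow> ('a \<Rightarrow> real) \<Rightarrow> real" where
  "J k \<epsilon> \<nu> \<phi> = energy k \<phi> + \<epsilon> * supn \<phi> - \<nu> \<phi>"

lemma J_mid:
  assumes "linear_on_X \<nu>" "\<epsilon> \<ge> 0" "\<phi> \<in> X" "\<psi> \<in> X"
  shows "J k \<epsilon> \<nu> (mid \<phi> \<psi>) \<le> (J k \<epsilon> \<nu> \<phi> + J k \<epsilon> \<nu> \<psi>) / 2 - gap k \<phi> \<psi>"
proof -
  have a: "(\<lambda>x. \<phi> x + \<psi> x) \<in> X" by (intro test_functions_add assms)
  have "\<nu> (mid \<phi> \<psi>) = (1/2) * (\<nu> \<phi> + \<nu> \<psi>)"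
    unfolding mid_def[abs_def] by (simp only: linear_on_X_cmult[OF assms(1) a] linear_on_X_add[OF assms(1,3,4)])
  moreover have "supn (mid \<phi> \<psi>) \<le> (1/2) * (supn \<phi> + supn \<psi>)"
    unfolding mid_def[abs_def] using supn_cmult_le[OF a, of "1/2"] supn_add[OF assms(3,4)] by simp
  then have "\<epsilon> * supn (mid \<phi> \<psi>) \<le> \<epsilon> * ((1/2) * (supn \<phi> + supn \<psi>))"
    using assms(2) by (intro mult_left_mono)
  ultimately show ?thesis
    by (simp add: J_def gap_def field_simps)
qed

text \<open>The term \<open>(k - 1) * rho \<phi>\<close> is kept because it forces the modular of
  near-minimisers to 0 when \<open>k\<close> grows.\<close>

lemma J_ge:
  assumes "\<And>\<phi>. \<phi> \<in> X \<Longrightarrow> \<nu> \<phi> \<le> B + (1/2) * energy 1 \<phi> + (\<epsilon>/2) * supn \<phi>" "k \<ge> 1" "\<epsilon> \<ge> 0" "\<phi> \<in> X"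
  shows "(1/2) * energy 1 \<phi> + (\<epsilon>/2) * supn \<phi> - B + (k - 1) * rho \<phi> \<le> J k \<epsilon> \<nu> \<phi>"
proof -
  have "energy k \<phi> = energy 1 \<phi> + (k - 1) * rho \<phi>"
    by (simp add: energy_def algebra_simps)
  then show ?thesis using assms(1)[OF assms(4)] by (simp add: J_def)
qed

text \<open>The minimiser \<open>(u, V)\<close> lives in the completion of the test functions, so the minimising sequence
  belongs to the conclusion. The term \<open>\<epsilon> * supn\<close> of \<open>J\<close> is not differentiable; its one-sided
  increments give the residual in the Euler-Lagrange inequality.\<close>

lemma minimiser_exists:
  assumes energy_cont: "energy_cont A \<nu>" and A: "A \<ge> 0" and \<epsilon>: "\<epsilon> > 0" and k: "k \<ge> 1"
  obtains \<phi> :: "nat \<Rightarrow> 'a \<Rightarrow> real" and u :: "'a \<Rightarrow> real" and V :: "'a \<Rightarrow> 'a" where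
    "\<And>n. \<phi> n \<in> X" "\<And>n. J k \<epsilon> \<nu> (\<phi> n) \<le> (INF \<phi>\<in>X. J k \<epsilon> \<nu> \<phi>) + 1 / real (Suc n)"
    "Lp u" "Lp V" "(\<lambda>n. rho (grad (\<phi> n))) \<longlonglongrightarrow> rho V"
    "\<And>\<psi>. \<psi> \<in> X \<Longrightarrow> \<bar>\<nu> \<psi> - k * (LINT x|lebesgue_on \<Omega>. Agrad (p x) (u x) * \<psi> x)
        - (LINT x|lebesgue_on \<Omega>. Agrad (p x) (V x) \<bullet> grad \<psi> x)\<bar> \<le> \<epsilon> * supn \<psi>"
    "k * (LINT x|lebesgue_on \<Omega>. \<bar>Agrad (p x) (u x)\<bar>) \<le> A + \<epsilon>"
proof -
  let ?M = "lebesgue_on \<Omega>" and ?J = "J k \<epsilon> \<nu>"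
  have lin: "linear_on_X \<nu>" using energy_cont by (simp add: energy_cont_def)
  obtain B where B: "B \<ge> 0" "\<And>\<phi>. \<phi> \<in> X \<Longrightarrow> \<nu> \<phi> \<le> B + (1/2) * energy 1 \<phi> + (\<epsilon>/2) * supn \<phi>"
    using coercive[OF energy_cont A \<epsilon>] by metis
  have e0: "energy 1 \<phi> \<ge> 0" for \<phi> by (rule energy_nonneg) simp
  have lower: "(1/2) * energy 1 \<phi> - B \<le> ?J \<phi>" if "\<phi> \<in> X" for \<phi>
  proof -
    have "(\<epsilon>/2) * supn \<phi> \<ge> 0" using \<epsilon> supn_nonneg[OF that] by simp
    moreover have "(k - 1) * rho \<phi> \<ge> 0" using k rho_nonneg[of \<phi>] by simp
    ultimately show ?thesis using J_ge[of \<nu> B \<epsilon> k \<phi>, OF B(2) k _ that] \<epsilon> by simp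
  qed
  define m where "m = (INF \<phi>\<in>X. ?J \<phi>)"
  have Xne: "X \<noteq> {}" using test_functions_zero by blast
  have bdd: "bdd_below (?J ` X)"
  proof (rule bdd_belowI2)
    show "- B \<le> ?J \<phi>" if "\<phi> \<in> X" for \<phi>
      using lower[OF that] e0[of \<phi>] by linarith
  qed
  have m_le: "m \<le> ?J \<phi>" if "\<phi> \<in> X" for \<phi>
    unfolding m_def by (rule cINF_lower[OF bdd that])
  have "\<exists>\<phi>\<in>X. ?J \<phi> < m + 1 / real (Suc n)" for n
    using cINF_less_iff[OF Xne bdd, of "m + 1 / real (Suc n)"] by (simp add: m_def)
  then have "\<exists>\<phi>. \<phi> \<in> X \<and> ?J \<phi> < m + 1 / real (Suc n)" for n by blast
  then obtain \<phi>0 where \<phi>0: "\<And>n. \<phi>0 n \<in> X" "\<And>n. ?J (\<phi>0 n) < m + 1 / real (Suc n)" by metis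
  have R: "energy 1 (\<phi>0 n) \<le> 2 * (m + 1 + B)" for n
  proof -
    have "1 / real (Suc n) \<le> 1" by simp
    moreover have "e \<le> 2 * (m + 1 + B)" if "d \<le> 1" "(1/2) * e - B \<le> j" "j < m + d" for d e j :: real
      using that by argo
    ultimately show ?thesis using lower[OF \<phi>0(1)[of n]] \<phi>0(2)[of n] by blast
  qed
  \<comment> \<open>The value at the midpoint of two near-minimisers is not below the infimum, so
    their gap is at most the error of the two values.\<close>
  have gp: "\<exists>N. \<forall>i\<ge>N. \<forall>j\<ge>N. gap 1 (\<phi>0 i) (\<phi>0 j) \<le> \<delta>" if \<delta>: "\<delta> > 0" for \<delta>
  proof -
    obtain N where N: "1 / real (Suc N) < \<delta>" using nat_approx_posE[OF \<delta>] by metis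
    have "gap 1 (\<phi>0 i) (\<phi>0 j) \<le> \<delta>" if "i \<ge> N" "j \<ge> N" for i j
    proof -
      have "1 / real (Suc i) \<le> 1 / real (Suc N)" "1 / real (Suc j) \<le> 1 / real (Suc N)"
        using that by (simp_all add: frac_le)
      moreover have "m \<le> ?J (mid (\<phi>0 i) (\<phi>0 j))" by (intro m_le mid_X \<phi>0)
      moreover have "?J (mid (\<phi>0 i) (\<phi>0 j)) \<le> (?J (\<phi>0 i) + ?J (\<phi>0 j)) / 2 - gap k (\<phi>0 i) (\<phi>0 j)"
        using \<epsilon> by (intro J_mid lin \<phi>0) auto
      moreover have "gap 1 (\<phi>0 i) (\<phi>0 j) \<le> gap k (\<phi>0 i) (\<phi>0 j)" by (rule gap_mono[OF \<phi>0(1) \<phi>0(1) k])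
      moreover have "g \<le> \<delta>" if "d1 \<le> d" "d2 \<le> d" "m \<le> j" "j \<le> (j1 + j2) / 2 - g'" "g \<le> g'"
        "j1 < m + d1" "j2 < m + d2" "d < \<delta>" for d d1 d2 j j1 j2 g g' :: real
        using that by (simp add: field_simps)
      ultimately show ?thesis using \<phi>0(2)[of i] \<phi>0(2)[of j] N by blast
    qed
    then show ?thesis by blast
  qed
  obtain r u V and H :: "'a \<Rightarrow> real" where r: "strict_mono (r :: nat \<Rightarrow> nat)" "Lp u" "Lp V" "Lp H"
    "AE x in ?M. (\<lambda>k. \<phi>0 (r k) x) \<longlonglongrightarrow> u x"
    "AE x in ?M. (\<lambda>k. grad (\<phi>0 (r k)) x) \<longlonglongrightarrow> V x"
    "\<And>k. AE x in ?M. norm (\<phi>0 (r k) x) \<le> H x"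
    "\<And>k. AE x in ?M. norm (grad (\<phi>0 (r k)) x) \<le> H x"
    by (rule energy_Cauchy_subseq[of \<phi>0, OF \<phi>0(1) R]) (erule gp, rule that)
  define \<phi> where "\<phi> n = \<phi>0 (r n)" for n
  have \<phi>X: "\<phi> n \<in> X" for n by (simp add: \<phi>_def \<phi>0)
  \<comment> \<open>\<open>r n\<close> is at least \<open>n\<close>, so the subsequence keeps the
    error \<open>1 / real (Suc n)\<close>.\<close>
  have \<phi>J: "?J (\<phi> n) \<le> m + 1 / real (Suc n)" for n
  proof -
    have "1 / real (Suc (r n)) \<le> 1 / real (Suc n)"
      using seq_suble[OF r(1), of n] by (simp add: frac_le)
    then show ?thesis using \<phi>0(2)[of "r n"] by (simp add: \<phi>_def)
  qed
  note lim = r(5,6)[folded \<phi>_def] and dom = r(7,8)[folded \<phi>_def]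
  have um [measurable]: "u \<in> borel_measurable ?M" "V \<in> borel_measurable ?M" "H \<in> borel_measurable ?M"
    using r(2,3,4) Lp_measurable by blast+
  have pm [measurable]: "\<phi> n \<in> borel_measurable ?M" "grad (\<phi> n) \<in> borel_measurable ?M" for n
    using X_measurable[OF \<phi>X] by auto
  have EL1: "\<nu> \<psi> - k * (LINT x|?M. Agrad (p x) (u x) * \<psi> x)
        - (LINT x|?M. Agrad (p x) (V x) \<bullet> grad \<psi> x) \<le> \<epsilon> * supn \<psi>" if \<psi>: "\<psi> \<in> X" for \<psi>
  proof -
    \<comment> \<open>The increment is the square root of the error: divided by \<open>t n\<close>,
      the error \<open>1 / real (Suc n)\<close> becomes \<open>t n\<close>, which still tends to
      0.\<close>
    define t where "t n = sqrt (1 / real (Suc n))" for n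
    have t: "t n > 0" "t n \<le> 1" "t n * t n = 1 / real (Suc n)" for n
      by (auto simp: t_def)
    have tlim: "t \<longlonglongrightarrow> 0"
      using tendsto_real_sqrt[OF LIMSEQ_inverse_real_of_nat] by (simp add: t_def[abs_def] inverse_eq_divide)
    define I1 where "I1 n = (LINT x|?M. Agrad (p x) (\<phi> n x + t n * \<psi> x) * \<psi> x)" for n
    define I2 where "I2 n = (LINT x|?M. Agrad (p x) (grad (\<phi> n) x + t n *\<^sub>R grad \<psi> x) \<bullet> grad \<psi> x)" for n
    have m\<psi> [measurable]: "\<psi> \<in> borel_measurable ?M" "grad \<psi> \<in> borel_measurable ?M"
      using X_measurable[OF \<psi>] by auto
    have key: "\<nu> \<psi> \<le> t n + I2 n + k * I1 n + \<epsilon> * supn \<psi>" for n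
    proof -
      let ?w = "\<lambda>x. \<phi> n x + t n * \<psi> x"
      have t\<psi>: "(\<lambda>x. t n * \<psi> x) \<in> X" by (intro test_functions_cmult \<psi>)
      have w: "?w \<in> X" by (intro test_functions_add \<phi>X t\<psi>)
      have gw: "grad ?w = (\<lambda>x. grad (\<phi> n) x + t n *\<^sub>R grad \<psi> x)"
        using grad_add[OF X_smooth[OF \<phi>X[of n]] X_smooth[OF t\<psi>]] by (auto simp: grad_cmult_fun \<psi>)
      \<comment> \<open>The tangent is taken at the perturbed point \<open>?w\<close>, not at
        \<open>\<phi> n\<close>; this bounds the increment of the modular from above.\<close>
      have *: "rho ?w + (LINT x|?M. Agrad (p x) (?w x) \<bullet> (\<phi> n x - ?w x)) \<le> rho (\<phi> n)"
        by (intro Agrad_tangent_integral X_Lp \<phi>X w)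
      have r1: "rho ?w \<le> rho (\<phi> n) + t n * I1 n"
      proof -
        have "(LINT x|?M. Agrad (p x) (?w x) \<bullet> (\<phi> n x - ?w x)) = (LINT x|?M. (- t n) * (Agrad (p x) (?w x) * \<psi> x))"
          by (intro Bochner_Integration.integral_cong refl) simp
        also have "\<dots> = - t n * I1 n" unfolding I1_def by (rule integral_mult_right_zero)
        finally have eq: "(LINT x|?M. Agrad (p x) (?w x) \<bullet> (\<phi> n x - ?w x)) = - t n * I1 n" .
        show ?thesis using *[unfolded eq] by simp
      qed
      have "rho (grad ?w) + (LINT x|?M. Agrad (p x) (grad ?w x) \<bullet> (grad (\<phi> n) x - grad ?w x)) \<le> rho (grad (\<phi> n))"
        by (intro Agrad_tangent_integral X_Lp_grad \<phi>X w)
      then have r2: "rho (grad ?w) \<le> rho (grad (\<phi> n)) + t n * I2 n"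
        by (simp add: I2_def gw)
      have "supn ?w \<le> supn (\<phi> n) + t n * supn \<psi>"
        using supn_add[OF \<phi>X t\<psi>, of n] supn_cmult_le[OF \<psi>, of "t n"] t(1)[of n] by simp
      then have sw: "\<epsilon> * supn ?w \<le> \<epsilon> * supn (\<phi> n) + t n * (\<epsilon> * supn \<psi>)"
        using mult_left_mono[of _ _ \<epsilon>] \<epsilon> by (fastforce simp: algebra_simps)
      have "\<nu> ?w = \<nu> (\<phi> n) + t n * \<nu> \<psi>"
        by (simp only: linear_on_X_add[OF lin \<phi>X t\<psi>] linear_on_X_cmult[OF lin \<psi>])
      then have "?J ?w \<le> ?J (\<phi> n) + t n * (I2 n + k * I1 n + \<epsilon> * supn \<psi> - \<nu> \<psi>)"
        using r2 sw mult_left_mono[OF r1, of k] k by (simp add: J_def energy_def algebra_simps)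
      then have "0 \<le> t n * t n + t n * (I2 n + k * I1 n + \<epsilon> * supn \<psi> - \<nu> \<psi>)"
        using m_le[OF w] \<phi>J[of n] t(3)[of n] by linarith
      then have "0 \<le> t n * (t n + (I2 n + k * I1 n + \<epsilon> * supn \<psi> - \<nu> \<psi>))"
        by (simp add: distrib_left)
      then show ?thesis using t(1)[of n] by (simp add: zero_le_mult_iff)
    qed
    have Z1: "Lp (\<lambda>x. H x + norm (\<psi> x))" "Lp (\<lambda>x. H x + norm (grad \<psi> x))"
      by (intro Lp_add Lp_norm r X_Lp X_Lp_grad \<psi>)+
    have nb: "norm (a + t n *\<^sub>R b) \<le> h + norm b" if "norm a \<le> h" for a b :: 'a and h n
    proof -
      have "norm (t n *\<^sub>R b) \<le> norm b" using t(1,2)[of n] by (simp add: mult_left_le_one_le)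
      then show ?thesis using that norm_triangle_ineq[of a "t n *\<^sub>R b"] by linarith
    qed
    have nb': "\<bar>a + t n * b\<bar> \<le> h + \<bar>b\<bar>" if "\<bar>a\<bar> \<le> h" for a b h :: real and n
    proof -
      have "\<bar>t n * b\<bar> \<le> \<bar>b\<bar>" using t(1,2)[of n] by (simp add: abs_mult mult_left_le_one_le)
      then show ?thesis using that by linarith
    qed
    have "(\<lambda>n. LINT x|?M. Agrad (p x) (\<phi> n x + t n * \<psi> x) \<bullet> \<psi> x) \<longlonglongrightarrow> (LINT x|?M. Agrad (p x) (u x) \<bullet> \<psi> x)"
    proof (rule Agrad_dominated[OF _ _ _ _ Z1(1)])
      show "AE x in ?M. (\<lambda>n. \<phi> n x + t n * \<psi> x) \<longlonglongrightarrow> u x"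
        using lim(1)
      proof eventually_elim
        case (elim x)
        have "(\<lambda>n. \<phi> n x + t n * \<psi> x) \<longlonglongrightarrow> u x + 0 * \<psi> x"
          by (intro tendsto_add elim tendsto_mult tlim tendsto_const)
        then show ?case by simp
      qed
      show "AE x in ?M. norm (\<phi> n x + t n * \<psi> x) \<le> H x + norm (\<psi> x)" for n
        using dom(1)[of n] by eventually_elim (simp add: nb')
      show "AE x in ?M. norm (\<psi> x) \<le> H x + norm (\<psi> x)" for n :: nat
        using dom(1)[of n] by eventually_elim (auto intro: order_trans[OF abs_ge_zero])
    qed (auto intro!: AE_I2)
    then have L1: "I1 \<longlonglongrightarrow> (LINT x|?M. Agrad (p x) (u x) * \<psi> x)" by (simp add: I1_def[abs_def])
    have L2: "I2 \<longlonglongrightarrow> (LINT x|?M. Agrad (p x) (V x) \<bullet> grad \<psi> x)"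
      unfolding I2_def[abs_def]
    proof (rule Agrad_dominated[OF _ _ _ _ Z1(2)])
      show "AE x in ?M. (\<lambda>n. grad (\<phi> n) x + t n *\<^sub>R grad \<psi> x) \<longlonglongrightarrow> V x"
        using lim(2)
      proof eventually_elim
        case (elim x)
        have "(\<lambda>n. grad (\<phi> n) x + t n *\<^sub>R grad \<psi> x) \<longlonglongrightarrow> V x + 0 *\<^sub>R grad \<psi> x"
          by (intro tendsto_add elim tendsto_scaleR tlim tendsto_const)
        then show ?case by simp
      qed
      show "AE x in ?M. norm (grad (\<phi> n) x + t n *\<^sub>R grad \<psi> x) \<le> H x + norm (grad \<psi> x)" for n
        using dom(2)[of n] by eventually_elim (rule nb)
      show "AE x in ?M. norm (grad \<psi> x) \<le> H x + norm (grad \<psi> x)" for n :: nat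
        using dom(2)[of n] by eventually_elim (auto intro: order_trans[OF norm_ge_zero])
    qed (auto intro!: AE_I2)
    have "(\<lambda>n. t n + I2 n + k * I1 n + \<epsilon> * supn \<psi>) \<longlonglongrightarrow>
        0 + (LINT x|?M. Agrad (p x) (V x) \<bullet> grad \<psi> x) + k * (LINT x|?M. Agrad (p x) (u x) * \<psi> x) + \<epsilon> * supn \<psi>"
      by (intro tendsto_intros tlim L1 L2)
    then have "\<nu> \<psi> \<le> 0 + (LINT x|?M. Agrad (p x) (V x) \<bullet> grad \<psi> x) + k * (LINT x|?M. Agrad (p x) (u x) * \<psi> x) + \<epsilon> * supn \<psi>"
      by (rule LIMSEQ_le_const) (use key in auto)
    then show ?thesis by simp
  qed
  \<comment> \<open>The opposite inequality is the first one for the negative of \<psi>.\<close>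
  have EL2: "- (\<epsilon> * supn \<psi>) \<le> \<nu> \<psi> - k * (LINT x|?M. Agrad (p x) (u x) * \<psi> x)
        - (LINT x|?M. Agrad (p x) (V x) \<bullet> grad \<psi> x)" if \<psi>: "\<psi> \<in> X" for \<psi>
  proof -
    have n: "(\<lambda>x. (-1) * \<psi> x) \<in> X" by (intro test_functions_cmult \<psi>)
    have s: "\<epsilon> * supn (\<lambda>x. (-1) * \<psi> x) \<le> \<epsilon> * supn \<psi>"
      using supn_cmult_le[OF \<psi>, of "-1"] \<epsilon> by (intro mult_left_mono) auto
    have g: "grad (\<lambda>x. (-1) * \<psi> x) = (\<lambda>x. - grad \<psi> x)"
      using grad_cmult_fun[OF \<psi>, of "-1"] by simp
    have "\<nu> (\<lambda>x. (-1) * \<psi> x) = - \<nu> \<psi>"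
      using linear_on_X_cmult[OF lin \<psi>, of "-1"] by simp
    then show ?thesis using EL1[OF n] s unfolding g by simp
  qed
  have L1: "k * (LINT x|?M. \<bar>Agrad (p x) (u x)\<bar>) \<le> A + \<epsilon>"
  proof -
    have *: "k * (LINT x|?M. Agrad (p x) (u x) * tanh (real N * u x)) \<le> A + \<epsilon>" for N :: nat
    proof -
      define \<psi> where "\<psi> n x = tanh (real N * \<phi> n x)" for n x
      have \<psi>: "\<psi> n \<in> X" for n
        unfolding \<psi>_def by (intro test_functions_tanh test_functions_cmult \<phi>X)
      have sup: "supn (\<psi> n) \<le> 1" for n
        by (rule supn_le) (simp add: \<psi>_def abs_le_iff less_imp_le tanh_real_lt_1 tanh_real_gt_neg1 minus_le_iff)
      have g: "grad (\<psi> n) x = (1 - (tanh (real N * \<phi> n x))\<^sup>2) *\<^sub>R real N *\<^sub>R grad (\<phi> n) x" for n x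
        unfolding \<psi>_def using X_smooth[OF test_functions_cmult[OF \<phi>X[of n]], of "real N"]
        by (simp add: grad_tanh grad_cmult X_smooth[OF \<phi>X])
      have tb: "\<bar>tanh z\<bar> \<le> 1" for z :: real
        by (simp add: abs_le_iff less_imp_le tanh_real_lt_1 tanh_real_gt_neg1 minus_le_iff)
      have t2: "0 \<le> 1 - (tanh z)\<^sup>2" "1 - (tanh z)\<^sup>2 \<le> 1" for z :: real
        using tb[of z] by (auto simp: abs_square_le_1)
      have b: "k * (LINT x|?M. Agrad (p x) (u x) * \<psi> n x) + (LINT x|?M. Agrad (p x) (V x) \<bullet> grad (\<psi> n) x) \<le> A + \<epsilon>" for n
      proof -
        have "\<nu> (\<psi> n) \<le> A * supn (\<psi> n)" using energy_cont \<psi>[of n] by (auto simp: energy_cont_def abs_le_iff)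
        also have "\<dots> \<le> A * 1" using A sup by (intro mult_left_mono)
        finally have 1: "\<nu> (\<psi> n) \<le> A" by simp
        have "\<epsilon> * supn (\<psi> n) \<le> \<epsilon> * 1" using \<epsilon> sup by (intro mult_left_mono) auto
        then show ?thesis using EL2[OF \<psi>[of n]] 1 by simp
      qed
      have Z: "Lp (\<lambda>x. (1 + real N) * norm (H x) + norm (V x) + norm (u x) + 1)"
        by (intro Lp_add Lp_norm Lp_cmult r Lp_bounded[of _ 1]) auto
      have mt [measurable]: "(\<lambda>x. tanh (f x)) \<in> borel_measurable ?M" if "f \<in> borel_measurable ?M" for f :: "'a \<Rightarrow> real"
        by (rule borel_measurable_continuous_on[OF _ that]) (auto intro!: continuous_intros)
      have m1 [measurable]: "\<psi> n \<in> borel_measurable ?M" "grad (\<psi> n) \<in> borel_measurable ?M" for n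
        using X_measurable[OF \<psi>] by auto
      have "(\<lambda>n. LINT x|?M. Agrad (p x) (u x) \<bullet> \<psi> n x) \<longlonglongrightarrow> (LINT x|?M. Agrad (p x) (u x) \<bullet> tanh (real N * u x))"
      proof (rule Agrad_dominated[OF _ _ _ _ Z])
        show "AE x in ?M. (\<lambda>n. \<psi> n x) \<longlonglongrightarrow> tanh (real N * u x)"
          using lim(1) unfolding \<psi>_def by eventually_elim (intro tendsto_intros, auto)
        show "AE x in ?M. norm (u x) \<le> (1 + real N) * norm (H x) + norm (V x) + norm (u x) + 1" for n :: nat
          by (rule AE_I2) (simp add: add_nonneg_nonneg)
        show "AE x in ?M. norm (\<psi> n x) \<le> (1 + real N) * norm (H x) + norm (V x) + norm (u x) + 1" for n
          by (rule AE_I2) (simp add: \<psi>_def add_increasing tb)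
      qed auto
      then have l1: "(\<lambda>n. LINT x|?M. Agrad (p x) (u x) * \<psi> n x) \<longlonglongrightarrow> (LINT x|?M. Agrad (p x) (u x) * tanh (real N * u x))"
        by simp
      let ?F = "\<lambda>x. (1 - (tanh (real N * u x))\<^sup>2) *\<^sub>R real N *\<^sub>R V x"
      have l2: "(\<lambda>n. LINT x|?M. Agrad (p x) (V x) \<bullet> grad (\<psi> n) x) \<longlonglongrightarrow> (LINT x|?M. Agrad (p x) (V x) \<bullet> ?F x)"
      proof (rule Agrad_dominated[OF _ _ _ _ Z])
        show "AE x in ?M. (\<lambda>n. grad (\<psi> n) x) \<longlonglongrightarrow> ?F x"
          using lim unfolding g by eventually_elim (intro tendsto_intros, auto)
        show "AE x in ?M. norm (V x) \<le> (1 + real N) * norm (H x) + norm (V x) + norm (u x) + 1" for n :: nat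
          by (rule AE_I2) (simp add: add_nonneg_nonneg)
        show "AE x in ?M. norm (grad (\<psi> n) x) \<le> (1 + real N) * norm (H x) + norm (V x) + norm (u x) + 1" for n
          using dom(2)[of n]
        proof eventually_elim
          case (elim x)
          have "norm (grad (\<psi> n) x) \<le> 1 * (real N * norm (grad (\<phi> n) x))"
            unfolding g norm_scaleR using t2[of "real N * \<phi> n x"] by (intro mult_mono) auto
          also have "\<dots> \<le> (1 + real N) * norm (H x)"
            using elim by (simp only: mult_1) (intro mult_mono, auto)
          finally show ?case by (smt (verit) norm_ge_zero)
        qed
      qed measurable
      have "0 \<le> (LINT x|?M. Agrad (p x) (V x) \<bullet> ?F x)"
      proof (rule integral_nonneg_AE, rule AE_I2)
        fix x assume "x \<in> space ?M"
        then have "1 < p x" by (rule p_gt_1)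
        then have "Agrad (p x) (V x) \<bullet> V x \<ge> 0" by (simp add: Agrad_inner_self)
        then show "0 \<le> Agrad (p x) (V x) \<bullet> ?F x" using t2(1)[of "real N * u x"] by simp
      qed
      moreover have "k * (LINT x|?M. Agrad (p x) (u x) * tanh (real N * u x)) + (LINT x|?M. Agrad (p x) (V x) \<bullet> ?F x) \<le> A + \<epsilon>"
        by (rule LIMSEQ_le_const2[OF tendsto_add[OF tendsto_mult[OF tendsto_const l1] l2]]) (use b in auto)
      ultimately show ?thesis by linarith
    qed
    have iA: "integrable ?M (\<lambda>x. \<bar>Agrad (p x) (u x)\<bar>)"
    proof -
      have "Lq (\<lambda>x. Agrad (p x) (u x))" by (rule Agrad_Lq[OF r(2)])
      then have "integrable ?M (\<lambda>x. Agrad (p x) (u x))"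
        unfolding Lq_eq by (rule var_exp.Lp_integrable[OF var_exp_dual])
      then show ?thesis by (rule integrable_abs)
    qed
    \<comment> \<open>Now \<open>N\<close> tends to infinity, and tanh becomes the sign of
      \<open>u x\<close>, which is also the sign of \<open>Agrad (p x) (u x)\<close>.\<close>
    have "(\<lambda>N. LINT x|?M. Agrad (p x) (u x) * tanh (real N * u x)) \<longlonglongrightarrow> (LINT x|?M. \<bar>Agrad (p x) (u x)\<bar>)"
    proof (rule integral_dominated_convergence[OF _ _ iA])
      have mt [measurable]: "(\<lambda>x. tanh (f x)) \<in> borel_measurable ?M" if "f \<in> borel_measurable ?M" for f :: "'a \<Rightarrow> real"
        by (rule borel_measurable_continuous_on[OF _ that]) (auto intro!: continuous_intros)
      show "(\<lambda>x. Agrad (p x) (u x) * tanh (real N * u x)) \<in> borel_measurable ?M"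
        "(\<lambda>x. \<bar>Agrad (p x) (u x)\<bar>) \<in> borel_measurable ?M" for N :: nat
        unfolding Agrad_def by measurable
      show "AE x in ?M. norm (Agrad (p x) (u x) * tanh (real N * u x)) \<le> \<bar>Agrad (p x) (u x)\<bar>" for N :: nat
        by (rule AE_I2) (simp add: abs_mult mult_right_le_one_le abs_le_iff less_imp_le tanh_real_lt_1 tanh_real_gt_neg1 minus_le_iff)
      show "AE x in ?M. (\<lambda>N. Agrad (p x) (u x) * tanh (real N * u x)) \<longlonglongrightarrow> \<bar>Agrad (p x) (u x)\<bar>"
      proof (rule AE_I2)
        fix x assume "x \<in> space ?M"
        then have p1: "1 < p x" by (rule p_gt_1)
        consider "u x = 0" | "u x > 0" | "u x < 0" by linarith
        then show "(\<lambda>N. Agrad (p x) (u x) * tanh (real N * u x)) \<longlonglongrightarrow> \<bar>Agrad (p x) (u x)\<bar>"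
        proof cases
          case 2
          have "filterlim (\<lambda>N. real N * u x) at_top sequentially"
            by (rule filterlim_at_top_mult_tendsto_pos[OF tendsto_const 2 filterlim_real_sequentially])
          then have "(\<lambda>N. tanh (real N * u x)) \<longlonglongrightarrow> 1"
            by (rule filterlim_compose[OF tanh_real_at_top])
          then have "(\<lambda>N. Agrad (p x) (u x) * tanh (real N * u x)) \<longlonglongrightarrow> Agrad (p x) (u x) * 1"
            by (intro tendsto_mult tendsto_const)
          then show ?thesis using 2 p1 by (simp add: Agrad_def abs_mult)
        next
          case 3
          then have "0 < - u x" by simp
          then have "filterlim (\<lambda>N. real N * - u x) at_top sequentially"
            by (rule filterlim_at_top_mult_tendsto_pos[OF tendsto_const _ filterlim_real_sequentially])
          then have "(\<lambda>N. tanh (real N * - u x)) \<longlonglongrightarrow> 1"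
            by (rule filterlim_compose[OF tanh_real_at_top])
          then have "(\<lambda>N. (- Agrad (p x) (u x)) * tanh (real N * - u x)) \<longlonglongrightarrow> (- Agrad (p x) (u x)) * 1"
            by (intro tendsto_mult tendsto_const)
          then show ?thesis using 3 p1 by (simp add: Agrad_def abs_mult)
        qed (simp add: Agrad_def)
      qed
    qed
    then have "(\<lambda>N. k * (LINT x|?M. Agrad (p x) (u x) * tanh (real N * u x))) \<longlonglongrightarrow> k * (LINT x|?M. \<bar>Agrad (p x) (u x)\<bar>)"
      by (intro tendsto_mult tendsto_const)
    then show ?thesis
      by (rule LIMSEQ_le_const2) (use * in auto)
  qed
  show thesis
  proof (rule that[of \<phi> u V])
    show "?J (\<phi> n) \<le> (INF \<phi>\<in>X. ?J \<phi>) + 1 / real (Suc n)" for n using \<phi>J by (simp add: m_def)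
    show "(\<lambda>n. rho (grad (\<phi> n))) \<longlonglongrightarrow> rho V"
      by (rule rho_dominated[OF pm(2) um(2) r(4) lim(2) dom(2)])
    show "\<bar>\<nu> \<psi> - k * (LINT x|?M. Agrad (p x) (u x) * \<psi> x)
        - (LINT x|?M. Agrad (p x) (V x) \<bullet> grad \<psi> x)\<bar> \<le> \<epsilon> * supn \<psi>" if "\<psi> \<in> X" for \<psi>
      using EL1[OF that] EL2[OF that] by (simp add: abs_le_iff)
  qed (use \<phi>X r L1 in auto)
qed

section \<open>Vanishing of the gradients for growing weight\<close>

lemma X_by_parts:
  assumes "\<phi> \<in> X" "\<xi> \<in> X"
  shows "(LINT x|lebesgue_on \<Omega>. \<phi> x *\<^sub>R grad \<xi> x) = - (LINT x|lebesgue_on \<Omega>. \<xi> x *\<^sub>R grad \<phi> x)"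
  using smooth_has_weak_gradient[OF X_smooth[OF assms(1)] open_domain] assms(2)
  by (simp add: has_weak_gradient_def)

lemma gap_commute: "gap k \<phi> \<psi> = gap k \<psi> \<phi>"
proof -
  have "mid \<phi> \<psi> = mid \<psi> \<phi>" by (auto simp: mid_def)
  then show ?thesis by (simp add: gap_def add.commute)
qed

lemma rho_eq_0:
  assumes "Lp V"
  shows "rho V = 0 \<longleftrightarrow> (AE x in lebesgue_on \<Omega>. V x = 0)"
proof -
  have "rho V = 0 \<longleftrightarrow> (AE x in lebesgue_on \<Omega>. norm (V x) powr p x = 0)"
    unfolding rho_def using assms by (intro integral_nonneg_eq_0_iff_AE) (auto simp: Lp_def)
  then show ?thesis by simp
qed

text \<open>Near-minimisers of \<open>J k \<epsilon> \<nu>\<close> for growing \<open>k\<close> tend to 0 in the Lebesgue modular while their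
  gradients form a Cauchy sequence; hence the gradients tend to 0 as well.\<close>

lemma grad_small:
  assumes energy_cont: "energy_cont A \<nu>" and A: "A \<ge> 0" and \<epsilon>: "\<epsilon> > 0" and \<psi>X: "\<And>j. \<psi> j \<in> X"
    and near: "\<And>j. J (real (Suc j)) \<epsilon> \<nu> (\<psi> j) \<le> (INF \<phi>\<in>X. J (real (Suc j)) \<epsilon> \<nu> \<phi>) + 1 / real (Suc j)"
  obtains r where "strict_mono (r :: nat \<Rightarrow> nat)" "(\<lambda>i. rho (grad (\<psi> (r i)))) \<longlonglongrightarrow> 0"
proof -
  let ?M = "lebesgue_on \<Omega>"
  have lin: "linear_on_X \<nu>" using energy_cont by (simp add: energy_cont_def)
  obtain B where B: "B \<ge> 0" "\<And>\<phi>. \<phi> \<in> X \<Longrightarrow> \<nu> \<phi> \<le> B + (1/2) * energy 1 \<phi> + (\<epsilon>/2) * supn \<phi>"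
    using coercive[OF energy_cont A \<epsilon>] by metis
  have e0: "energy 1 \<phi> \<ge> 0" for \<phi> by (rule energy_nonneg) simp
  define J' where "J' j = J (real (Suc j)) \<epsilon> \<nu>" for j
  have lower: "(1/2) * energy 1 \<phi> - B + real j * rho \<phi> \<le> J' j \<phi>" if "\<phi> \<in> X" for \<phi> j
  proof -
    have "(\<epsilon>/2) * supn \<phi> \<ge> 0" using \<epsilon> supn_nonneg[OF that] by simp
    then show ?thesis using J_ge[of \<nu> B \<epsilon> "real (Suc j)" \<phi>, OF B(2) _ _ that] \<epsilon> by (simp add: J'_def)
  qed
  define m where "m j = (INF \<phi>\<in>X. J' j \<phi>)" for j
  have bdd: "bdd_below (J' j ` X)" for j
  proof (rule bdd_belowI2)
    fix \<phi> assume "\<phi> \<in> X"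
    then have "(1/2) * energy 1 \<phi> - B + real j * rho \<phi> \<le> J' j \<phi>" by (rule lower)
    moreover have "real j * rho \<phi> \<ge> 0" by (simp add: rho_nonneg)
    moreover have "- B \<le> j" if "(1/2) * e - B + t \<le> j" "t \<ge> 0" "e \<ge> 0" for e t j :: real
      using that by argo
    ultimately show "- B \<le> J' j \<phi>" using e0[of \<phi>] by blast
  qed
  have m_le: "m j \<le> J' j \<phi>" if "\<phi> \<in> X" for j \<phi>
    unfolding m_def by (rule cINF_lower[OF bdd that])
  \<comment> \<open>The zero function has value 0, so the infima, which increase with the weight,
    stay bounded and converge.\<close>
  have m0: "m j \<le> 0" for j
  proof -
    have "\<nu> (\<lambda>x. 0 * (\<lambda>x. 0) x) = 0 * \<nu> (\<lambda>x. 0)"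
      by (rule linear_on_X_cmult[OF lin test_functions_zero])
    then have "J' j (\<lambda>x. 0) = 0"
      by (simp add: J'_def J_def energy_def rho_def supn_def)
    then show ?thesis using m_le[OF test_functions_zero, of j] by simp
  qed
  have J_mono: "J' i \<phi> \<le> J' j \<phi>" if "i \<le> j" for i j \<phi>
    using energy_mono[of "real (Suc i)" "real (Suc j)" \<phi>] that by (simp add: J'_def J_def)
  have near': "J' j (\<psi> j) \<le> m j + 1 / real (Suc j)" for j
    using near[of j] by (simp add: J'_def m_def)
  have m_mono: "m i \<le> m j" if "i \<le> j" for i j
    unfolding m_def[of j]
  proof (rule cINF_greatest)
    show "X \<noteq> {}" using test_functions_zero by blast
    show "m i \<le> J' j \<phi>" if "\<phi> \<in> X" for \<phi>
      using m_le[OF that, of i] J_mono[OF \<open>i \<le> j\<close>, of \<phi>] by simp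
  qed
  have J1: "J' j (\<psi> j) \<le> 1" for j
  proof -
    have "1 / real (Suc j) \<le> 1" by simp
    then have "m j + 1 / real (Suc j) \<le> 0 + 1" using m0[of j] by (intro add_mono)
    then show ?thesis using near'[of j] by simp
  qed
  have R: "energy 1 (\<psi> j) \<le> 2 * (1 + B)" for j
  proof -
    have "real j * rho (\<psi> j) \<ge> 0" by (simp add: rho_nonneg)
    moreover have "e \<le> 2 * (1 + B)" if "(1/2) * e - B + t \<le> J1" "J1 \<le> 1" "t \<ge> 0" for e t J1 :: real
      using that by argo
    ultimately show ?thesis using lower[OF \<psi>X[of j], of j] J1[of j] by blast
  qed
  have rj: "real j * rho (\<psi> j) \<le> 1 + B" for j
    using lower[OF \<psi>X[of j], of j] J1[of j] e0[of "\<psi> j"] by simp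
  obtain L where L: "m \<longlonglongrightarrow> L"
    by (rule incseq_convergent[of m 0]) (use m_mono m0 in \<open>auto simp: incseq_def\<close>)
  \<comment> \<open>Both functions are compared in the functional of the smaller index
    \<open>i\<close>, where \<open>\<psi> j\<close> is still a near-minimiser up to the additional
    error \<open>m j - m i\<close>.\<close>
  have gp': "gap 1 (\<psi> i) (\<psi> j) \<le> (m j - m i) / 2 + 1 / real (Suc i)" if "i \<le> j" for i j
  proof -
    have 1: "m i \<le> J' i (mid (\<psi> i) (\<psi> j))" by (intro m_le mid_X \<psi>X)
    have 2: "J' i (mid (\<psi> i) (\<psi> j)) \<le> (J' i (\<psi> i) + J' i (\<psi> j)) / 2 - gap (real (Suc i)) (\<psi> i) (\<psi> j)"
      unfolding J'_def using \<epsilon> by (intro J_mid lin \<psi>X) auto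
    have 3: "gap 1 (\<psi> i) (\<psi> j) \<le> gap (real (Suc i)) (\<psi> i) (\<psi> j)" by (intro gap_mono \<psi>X) simp
    have 4: "J' i (\<psi> j) \<le> m j + 1 / real (Suc j)" using J_mono[OF that] near' order_trans by blast
    have 5: "1 / real (Suc j) \<le> 1 / real (Suc i)" using that by (simp add: frac_le)
    have "g \<le> (mj - mi) / 2 + d" if "mi \<le> a" "a \<le> (b + c) / 2 - g'" "g \<le> g'" "b \<le> mi + d" "c \<le> mj + d'" "d' \<le> d"
      for mi mj a b c d d' g g' :: real
      using that by argo
    from this[OF 1 2 3 near' 4 5] show ?thesis .
  qed
  have gp: "\<exists>N. \<forall>i\<ge>N. \<forall>j\<ge>N. gap 1 (\<psi> i) (\<psi> j) \<le> \<delta>" if \<delta>: "\<delta> > 0" for \<delta>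
  proof -
    have "\<delta> / 2 > 0" using \<delta> by simp
    obtain N1 where N1: "\<And>i j. i \<ge> N1 \<Longrightarrow> j \<ge> N1 \<Longrightarrow> norm (m i - m j) < \<delta>"
      using LIMSEQ_imp_Cauchy[OF L] \<delta> unfolding Cauchy_iff by blast
    obtain N2 where N2: "1 / real (Suc N2) < \<delta> / 2" using nat_approx_posE[OF \<open>\<delta> / 2 > 0\<close>] by metis
    have *: "gap 1 (\<psi> i) (\<psi> j) \<le> \<delta>" if "i \<ge> max N1 N2" "i \<le> j" for i j
    proof -
      have 1: "m j - m i \<le> \<delta>" using N1[of j i] that by auto
      have 2: "1 / real (Suc i) \<le> \<delta> / 2" using that N2 frac_le[of 1 1 "real (Suc N2)" "real (Suc i)"] by simp
      have "g \<le> \<delta>" if "g \<le> a / 2 + b" "a \<le> \<delta>" "b \<le> \<delta> / 2" for a b g :: real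
        using that by argo
      from this[OF gp'[OF that(2)] 1 2] show ?thesis .
    qed
    show ?thesis
    proof (intro exI allI impI)
      fix i j assume "max N1 N2 \<le> i" "max N1 N2 \<le> j"
      then show "gap 1 (\<psi> i) (\<psi> j) \<le> \<delta>"
        using *[of i j] *[of j i] gap_commute[of 1 "\<psi> i" "\<psi> j"] by (cases "i \<le> j") auto
    qed
  qed
  obtain r u V and H :: "'a \<Rightarrow> real" where r: "strict_mono (r :: nat \<Rightarrow> nat)" "Lp u" "Lp V" "Lp H"
    "AE x in ?M. (\<lambda>k. \<psi> (r k) x) \<longlonglongrightarrow> u x"
    "AE x in ?M. (\<lambda>k. grad (\<psi> (r k)) x) \<longlonglongrightarrow> V x"
    "\<And>k. AE x in ?M. norm (\<psi> (r k) x) \<le> H x"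
    "\<And>k. AE x in ?M. norm (grad (\<psi> (r k)) x) \<le> H x"
    by (rule energy_Cauchy_subseq[of \<psi>, OF \<psi>X R]) (erule gp, rule that)
  have um [measurable]: "u \<in> borel_measurable ?M" "V \<in> borel_measurable ?M" "H \<in> borel_measurable ?M"
    using r(2,3,4) Lp_measurable by blast+
  have \<psi>m [measurable]: "\<psi> n \<in> borel_measurable ?M" "grad (\<psi> n) \<in> borel_measurable ?M" for n
    using X_measurable[OF \<psi>X] by auto
  have iH: "integrable ?M H" by (rule Lp_integrable[OF r(4)])
  have "(\<lambda>i. rho (\<psi> (r i))) \<longlonglongrightarrow> rho u"
    by (rule rho_dominated[OF \<psi>m(1) um(1) r(4,5,7)])
  moreover have "(\<lambda>i. rho (\<psi> (r i))) \<longlonglongrightarrow> 0"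
  proof -
    have "(\<lambda>j. rho (\<psi> j)) \<longlonglongrightarrow> 0"
    proof (rule tendsto_sandwich[OF _ _ tendsto_const])
      show "\<forall>\<^sub>F j in sequentially. 0 \<le> rho (\<psi> j)" by (simp add: rho_nonneg)
      show "\<forall>\<^sub>F j in sequentially. rho (\<psi> j) \<le> (1 + B) / real j"
        using eventually_gt_at_top[of 0]
      proof eventually_elim
        case (elim j)
        then show ?case using rj[of j] by (simp add: pos_le_divide_eq mult.commute)
      qed
      show "(\<lambda>j. (1 + B) / real j) \<longlonglongrightarrow> 0" by (rule lim_const_over_n)
    qed
    from LIMSEQ_subseq_LIMSEQ[OF this r(1)] show ?thesis by (simp add: o_def)
  qed
  ultimately have "rho u = 0" by (rule LIMSEQ_unique)
  then have u0: "AE x in ?M. u x = 0" using rho_eq_0[OF r(2)] by simp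
  \<comment> \<open>\<open>V\<close> is the weak gradient of the limit \<open>u\<close>, which is 0
    almost everywhere: pass to the limit on both sides of the integration by parts.\<close>
  have "AE x in ?M. V x = 0"
  proof (rule fundamental_lemma_vec[OF open_domain])
    show "loc_int \<Omega> V"
      using Lp_integrable[OF r(3)] open_domain by (intro loc_int_integrable) auto
    fix \<xi> assume \<xi>: "\<xi> \<in> X"
    obtain C where C: "C > 0" "\<And>x. \<bar>\<xi> x\<bar> \<le> C" "\<And>x. norm (grad \<xi> x) \<le> C"
      using test_functions_bounded[OF \<xi>] by metis
    have [measurable]: "\<xi> \<in> borel_measurable ?M" "grad \<xi> \<in> borel_measurable ?M"
      using X_measurable[OF \<xi>] by auto
    have 1: "(\<lambda>i. LINT x|?M. \<xi> x *\<^sub>R grad (\<psi> (r i)) x) \<longlonglongrightarrow> (LINT x|?M. \<xi> x *\<^sub>R V x)"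
    proof (rule integral_dominated_convergence[where w = "\<lambda>x. C * H x"])
      show "AE x in ?M. (\<lambda>i. \<xi> x *\<^sub>R grad (\<psi> (r i)) x) \<longlonglongrightarrow> \<xi> x *\<^sub>R V x"
        using r(6) by eventually_elim (intro tendsto_intros)
      show "AE x in ?M. norm (\<xi> x *\<^sub>R grad (\<psi> (r i)) x) \<le> C * H x" for i
        using r(8)[of i] by eventually_elim (use C in \<open>auto intro!: mult_mono\<close>)
    qed (use iH in auto)
    have 2: "(\<lambda>i. LINT x|?M. \<psi> (r i) x *\<^sub>R grad \<xi> x) \<longlonglongrightarrow> (LINT x|?M. 0)"
    proof (rule integral_dominated_convergence[where w = "\<lambda>x. C * H x"])
      show "AE x in ?M. (\<lambda>i. \<psi> (r i) x *\<^sub>R grad \<xi> x) \<longlonglongrightarrow> 0"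
        using r(5) u0
      proof eventually_elim
        case (elim x)
        have "(\<lambda>i. \<psi> (r i) x *\<^sub>R grad \<xi> x) \<longlonglongrightarrow> u x *\<^sub>R grad \<xi> x"
          by (intro tendsto_intros elim)
        then show ?case using elim(2) by simp
      qed
      show "AE x in ?M. norm (\<psi> (r i) x *\<^sub>R grad \<xi> x) \<le> C * H x" for i
        using r(7)[of i] by eventually_elim (use C in \<open>auto intro!: mult_mono simp: mult.commute[of C]\<close>)
    qed (use iH in auto)
    have "(\<lambda>i. LINT x|?M. \<xi> x *\<^sub>R grad (\<psi> (r i)) x) \<longlonglongrightarrow> - 0"
      using tendsto_minus[OF 2] by (simp add: X_by_parts[OF \<psi>X \<xi>])
    with 1 show "(LINT x|?M. \<xi> x *\<^sub>R V x) = 0"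
      using LIMSEQ_unique by fastforce
  qed
  then have "rho V = 0" using rho_eq_0[OF r(3)] by simp
  moreover have "(\<lambda>i. rho (grad (\<psi> (r i)))) \<longlonglongrightarrow> rho V"
    by (rule rho_dominated[OF \<psi>m(2) um(2) r(4,6,8)])
  ultimately show thesis using that[OF r(1)] by simp
qed

section \<open>Iteration on the residual\<close>

definition residual :: "(('a \<Rightarrow> real) \<Rightarrow> real) \<Rightarrow> ('a \<Rightarrow> real) \<Rightarrow> ('a \<Rightarrow> 'a) \<Rightarrow> ('a \<Rightarrow> real) \<Rightarrow> real" where
  "residual \<nu> g G \<psi> = \<nu> \<psi> - (LINT x|lebesgue_on \<Omega>. g x * \<psi> x) - (LINT x|lebesgue_on \<Omega>. G x \<bullet> grad \<psi> x)"

lemma Lq_mult_integrable: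
  assumes "Lq g" "\<phi> \<in> X"
  shows "integrable (lebesgue_on \<Omega>) (\<lambda>x. g x * \<phi> x)"
  using inner_integrable(1)[OF assms(1) X_Lp[OF assms(2)]] by simp

text \<open>The iteration can be continued only if the residual is again continuous in energy. For
  this the integral of \<open>g x * \<psi> x\<close> has to be small with the energy, so
  \<open>g\<close> is taken in the dual space \<open>Lq\<close> and not only in L^1.\<close>

lemma residual_energy_cont:
  assumes "energy_cont A \<nu>" "Lq g" "Lq G" "\<And>\<psi>. \<psi> \<in> X \<Longrightarrow> \<bar>residual \<nu> g G \<psi>\<bar> \<le> \<epsilon> * supn \<psi>"
  shows "energy_cont \<epsilon> (residual \<nu> g G)"
  unfolding energy_cont_def
proof (intro conjI allI impI ballI)
  have lin: "linear_on_X \<nu>" using assms(1) by (simp add: energy_cont_def)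
  note i1 = Lq_mult_integrable[OF assms(2)] and i2 = inner_integrable(1)[OF assms(3) X_Lp_grad]
  show "linear_on_X (residual \<nu> g G)"
    unfolding linear_on_X_def
  proof (intro conjI ballI allI)
    fix \<phi> \<psi> assume *: "\<phi> \<in> X" "\<psi> \<in> X"
    show "residual \<nu> g G (\<lambda>x. \<phi> x + \<psi> x) = residual \<nu> g G \<phi> + residual \<nu> g G \<psi>"
      using i1[OF *(1)] i1[OF *(2)] i2[OF *(1)] i2[OF *(2)]
      by (simp add: residual_def linear_on_X_add[OF lin *] grad_add X_smooth * inner_add_right distrib_left)
  next
    fix \<phi> c assume *: "\<phi> \<in> X"
    have "(LINT x|lebesgue_on \<Omega>. g x * (c * \<phi> x)) = c * (LINT x|lebesgue_on \<Omega>. g x * \<phi> x)"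
      by (simp add: mult.left_commute)
    then show "residual \<nu> g G (\<lambda>x. c * \<phi> x) = c * residual \<nu> g G \<phi>"
      by (simp add: residual_def linear_on_X_cmult[OF lin *] grad_cmult X_smooth * right_diff_distrib)
  qed
  show "\<bar>residual \<nu> g G \<phi>\<bar> \<le> \<epsilon> * supn \<phi>" if "\<phi> \<in> X" for \<phi> by (rule assms(4)[OF that])
  fix e :: real assume e: "e > 0"
  then have e3: "e / 3 > 0" by simp
  obtain \<eta>1 where 1: "\<eta>1 > 0" "\<And>\<phi>. \<phi> \<in> X \<Longrightarrow> supn \<phi> \<le> 1 \<Longrightarrow> energy 1 \<phi> \<le> \<eta>1 \<Longrightarrow> \<bar>\<nu> \<phi>\<bar> \<le> e / 3"
    using assms(1) e3 unfolding energy_cont_def by meson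
  obtain \<eta>2 where 2: "\<eta>2 > 0" "\<And>H :: 'a \<Rightarrow> real. Lp H \<Longrightarrow> rho H \<le> \<eta>2 \<Longrightarrow>
      (LINT x|lebesgue_on \<Omega>. norm (g x) * norm (H x)) \<le> e / 3"
    by (rule Lq_small[OF assms(2) e3]) (rule that)
  obtain \<eta>3 where 3: "\<eta>3 > 0" "\<And>H :: 'a \<Rightarrow> 'a. Lp H \<Longrightarrow> rho H \<le> \<eta>3 \<Longrightarrow>
      (LINT x|lebesgue_on \<Omega>. norm (G x) * norm (H x)) \<le> e / 3"
    by (rule Lq_small[OF assms(3) e3]) (rule that)
  show "\<exists>\<eta>>0. \<forall>\<phi>\<in>X. supn \<phi> \<le> 1 \<longrightarrow> energy 1 \<phi> \<le> \<eta> \<longrightarrow> \<bar>residual \<nu> g G \<phi>\<bar> \<le> e"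
  proof (intro exI[of _ "min \<eta>1 (min \<eta>2 \<eta>3)"] conjI ballI impI)
    fix \<phi> assume \<phi>: "\<phi> \<in> X" and s: "supn \<phi> \<le> 1" and en: "energy 1 \<phi> \<le> min \<eta>1 (min \<eta>2 \<eta>3)"
    have r: "rho \<phi> \<le> \<eta>2" "rho (grad \<phi>) \<le> \<eta>3"
      using en rho_nonneg[of \<phi>] rho_nonneg[of "grad \<phi>"] by (auto simp: energy_def)
    have "\<bar>\<nu> \<phi>\<bar> \<le> e / 3" using 1(2)[OF \<phi> s] en by simp
    moreover have "\<bar>LINT x|lebesgue_on \<Omega>. g x * \<phi> x\<bar> \<le> e / 3"
      using inner_integrable(2)[OF assms(2) X_Lp[OF \<phi>]] 2(2)[OF X_Lp[OF \<phi>] r(1)] by simp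
    moreover have "\<bar>LINT x|lebesgue_on \<Omega>. G x \<bullet> grad \<phi> x\<bar> \<le> e / 3"
      using inner_integrable(2)[OF assms(3) X_Lp_grad[OF \<phi>]] 3(2)[OF X_Lp_grad[OF \<phi>] r(2)] by simp
    moreover have "\<bar>a - b - c\<bar> \<le> e" if "\<bar>a\<bar> \<le> e / 3" "\<bar>b\<bar> \<le> e / 3" "\<bar>c\<bar> \<le> e / 3" for a b c :: real
      using that unfolding abs_le_iff by argo
    ultimately show "\<bar>residual \<nu> g G \<phi>\<bar> \<le> e"
      unfolding residual_def by blast
  qed (use 1 2 3 in auto)
qed

text \<open>The bound \<open>A + \<epsilon>\<close> holds for every weight, while the dual modular
  of the field is at most \<open>pp powr qp * rho V\<close> and tends to 0 along a sequence of
  weights; one large weight serves both.\<close>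

lemma decomposition_step:
  assumes energy_cont: "energy_cont A \<nu>" and A: "A \<ge> 0" and \<epsilon>: "\<epsilon> > 0" and \<delta>: "\<delta> > 0"
  obtains g G where "integrable (lebesgue_on \<Omega>) g" "(LINT x|lebesgue_on \<Omega>. \<bar>g x\<bar>) \<le> A + \<epsilon>"
    "Lq g" "Lq G" "rhoq G \<le> \<delta>" "energy_cont \<epsilon> (residual \<nu> g G)"
proof -
  let ?M = "lebesgue_on \<Omega>"
  define good where "good j \<phi> u V \<longleftrightarrow> (\<forall>n. \<phi> n \<in> X) \<and>
      (\<forall>n. J (real (Suc j)) \<epsilon> \<nu> (\<phi> n) \<le> (INF \<phi>\<in>X. J (real (Suc j)) \<epsilon> \<nu> \<phi>) + 1 / real (Suc n)) \<and>
      Lp u \<and> Lp V \<and> (\<lambda>n. rho (grad (\<phi> n))) \<longlonglongrightarrow> rho V \<and>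
      (\<forall>\<psi>\<in>X. \<bar>\<nu> \<psi> - real (Suc j) * (LINT x|?M. Agrad (p x) (u x) * \<psi> x)
        - (LINT x|?M. Agrad (p x) (V x) \<bullet> grad \<psi> x)\<bar> \<le> \<epsilon> * supn \<psi>) \<and>
      real (Suc j) * (LINT x|?M. \<bar>Agrad (p x) (u x)\<bar>) \<le> A + \<epsilon>"
    for j and \<phi> :: "nat \<Rightarrow> 'a \<Rightarrow> real" and u :: "'a \<Rightarrow> real" and V :: "'a \<Rightarrow> 'a"
  have "\<exists>\<phi> u V. good j \<phi> u V" for j
  proof (rule minimiser_exists[OF energy_cont A \<epsilon>, of "real (Suc j)"])
    fix \<phi> :: "nat \<Rightarrow> 'a \<Rightarrow> real" and u :: "'a \<Rightarrow> real" and V :: "'a \<Rightarrow> 'a"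
    assume *: "\<And>n. \<phi> n \<in> X" "\<And>n. J (real (Suc j)) \<epsilon> \<nu> (\<phi> n) \<le> (INF \<phi>\<in>X. J (real (Suc j)) \<epsilon> \<nu> \<phi>) + 1 / real (Suc n)"
      "Lp u" "Lp V" "(\<lambda>n. rho (grad (\<phi> n))) \<longlonglongrightarrow> rho V"
      "\<And>\<psi>. \<psi> \<in> X \<Longrightarrow> \<bar>\<nu> \<psi> - real (Suc j) * (LINT x|?M. Agrad (p x) (u x) * \<psi> x)
        - (LINT x|?M. Agrad (p x) (V x) \<bullet> grad \<psi> x)\<bar> \<le> \<epsilon> * supn \<psi>"
      "real (Suc j) * (LINT x|?M. \<bar>Agrad (p x) (u x)\<bar>) \<le> A + \<epsilon>"
    have "good j \<phi> u V" unfolding good_def using * by blast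
    then show ?thesis by blast
  qed simp
  then have "\<forall>j. \<exists>z. good j (fst z) (fst (snd z)) (snd (snd z))" by (metis fst_conv snd_conv)
  from choice[OF this] obtain z where z: "\<And>j. good j (fst (z j)) (fst (snd (z j))) (snd (snd (z j)))" by blast
  define \<phi> u V where "\<phi> j = fst (z j)" and "u j = fst (snd (z j))" and "V j = snd (snd (z j))" for j
  have gd: "good j (\<phi> j) (u j) (V j)" for j using z by (simp add: \<phi>_def u_def V_def)
  \<comment> \<open>For each weight a member of its own minimising sequence is selected whose
    gradient modular is close to that of the minimiser; \<open>n \<ge> j\<close> makes the errors
    tend to 0 along the resulting diagonal sequence.\<close>
  have "\<exists>n\<ge>j. rho (V j) \<le> rho (grad (\<phi> j n)) + 1 / real (Suc j)" for j
  proof -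
    have "(\<lambda>n. rho (grad (\<phi> j n))) \<longlonglongrightarrow> rho (V j)" using gd by (simp add: good_def)
    then have "\<forall>\<^sub>F n in sequentially. dist (rho (grad (\<phi> j n))) (rho (V j)) < 1 / real (Suc j)"
      by (rule tendstoD) simp
    then have "\<forall>\<^sub>F n in sequentially. n \<ge> j \<and> dist (rho (grad (\<phi> j n))) (rho (V j)) < 1 / real (Suc j)"
      using eventually_ge_at_top by (simp add: eventually_conj)
    then obtain n where "n \<ge> j" "dist (rho (grad (\<phi> j n))) (rho (V j)) < 1 / real (Suc j)"
      using eventually_happens'[OF sequentially_bot] by blast
    then show ?thesis by (intro exI[of _ n]) (auto simp: dist_real_def abs_less_iff)
  qed
  then obtain n where n: "\<And>j. n j \<ge> j" "\<And>j. rho (V j) \<le> rho (grad (\<phi> j (n j))) + 1 / real (Suc j)" by metis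
  define \<psi> where "\<psi> j = \<phi> j (n j)" for j
  have \<psi>X: "\<psi> j \<in> X" for j using gd[of j] by (auto simp: \<psi>_def good_def)
  have near: "J (real (Suc j)) \<epsilon> \<nu> (\<psi> j) \<le> (INF \<phi>\<in>X. J (real (Suc j)) \<epsilon> \<nu> \<phi>) + 1 / real (Suc j)" for j
  proof -
    have "1 / real (Suc (n j)) \<le> 1 / real (Suc j)" using n(1)[of j] by (simp add: frac_le)
    moreover have "J (real (Suc j)) \<epsilon> \<nu> (\<psi> j) \<le> (INF \<phi>\<in>X. J (real (Suc j)) \<epsilon> \<nu> \<phi>) + 1 / real (Suc (n j))"
      using gd[of j] by (auto simp: \<psi>_def good_def)
    ultimately show ?thesis by (meson add_left_mono order_trans)
  qed
  obtain r where r: "strict_mono (r :: nat \<Rightarrow> nat)" "(\<lambda>i. rho (grad (\<psi> (r i)))) \<longlonglongrightarrow> 0"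
    by (rule grad_small[where \<psi> = \<psi>, OF energy_cont A \<epsilon> \<psi>X near]) (rule that)
  have "(\<lambda>j. 1 / real (Suc j)) \<longlonglongrightarrow> 0"
    using LIMSEQ_inverse_real_of_nat by (simp add: inverse_eq_divide)
  from LIMSEQ_subseq_LIMSEQ[OF this r(1)]
  have "(\<lambda>i. pp powr qp * (rho (grad (\<psi> (r i))) + 1 / real (Suc (r i)))) \<longlonglongrightarrow> pp powr qp * (0 + 0)"
    by (intro tendsto_mult tendsto_add tendsto_const r) (simp add: o_def)
  then have "\<forall>\<^sub>F i in sequentially. pp powr qp * (rho (grad (\<psi> (r i))) + 1 / real (Suc (r i))) < \<delta>"
    by (rule order_tendstoD) (use \<delta> in simp)
  then obtain i where i: "pp powr qp * (rho (grad (\<psi> (r i))) + 1 / real (Suc (r i))) < \<delta>"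
    using eventually_happens'[OF sequentially_bot] by blast
  define j where "j = r i"
  define g where "g x = real (Suc j) * Agrad (p x) (u j x)" for x
  define G where "G x = Agrad (p x) (V j x)" for x
  have Lu: "Lp (u j)" "Lp (V j)" using gd[of j] by (auto simp: good_def)
  have Lg: "Lq g"
  proof -
    have "Lq (\<lambda>x. Agrad (p x) (u j x))" by (rule Agrad_Lq[OF Lu(1)])
    then show ?thesis unfolding Lq_eq g_def by (rule var_exp.Lp_cmult[OF var_exp_dual])
  qed
  have LG: "Lq G" unfolding G_def by (rule Agrad_Lq[OF Lu(2)])
  show thesis
  proof (rule that[of g G])
    show "integrable ?M g" using Lg unfolding Lq_eq by (rule var_exp.Lp_integrable[OF var_exp_dual])
    have "(LINT x|?M. \<bar>g x\<bar>) = real (Suc j) * (LINT x|?M. \<bar>Agrad (p x) (u j x)\<bar>)"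
      unfolding g_def abs_mult by simp
    then show "(LINT x|?M. \<bar>g x\<bar>) \<le> A + \<epsilon>" using gd[of j] by (auto simp: good_def)
    have "rhoq G \<le> pp powr qp * rho (V j)" unfolding G_def by (rule Agrad_Lq[OF Lu(2)])
    also have "\<dots> \<le> pp powr qp * (rho (grad (\<psi> j)) + 1 / real (Suc j))"
      using n(2)[of j] by (intro mult_left_mono) (auto simp: \<psi>_def)
    also have "\<dots> \<le> \<delta>" using i by (simp add: j_def)
    finally show "rhoq G \<le> \<delta>" .
    show "energy_cont \<epsilon> (residual \<nu> g G)"
    proof (rule residual_energy_cont[OF energy_cont Lg LG])
      fix \<psi> assume "\<psi> \<in> X"
      moreover have "(LINT x|?M. g x * \<psi> x) = real (Suc j) * (LINT x|?M. Agrad (p x) (u j x) * \<psi> x)"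
        unfolding g_def mult.assoc by simp
      ultimately show "\<bar>residual \<nu> g G \<psi>\<bar> \<le> \<epsilon> * supn \<psi>"
        using gd[of j] by (simp add: good_def residual_def G_def)
    qed
  qed (use Lg LG in auto)
qed

lemma L1_summable:
  fixes g :: "nat \<Rightarrow> 'a \<Rightarrow> real"
  assumes i: "\<And>j. integrable (lebesgue_on \<Omega>) (g j)" and s: "summable (\<lambda>j. LINT x|lebesgue_on \<Omega>. \<bar>g j x\<bar>)"
  shows "AE x in lebesgue_on \<Omega>. summable (\<lambda>j. \<bar>g j x\<bar>)"
proof -
  let ?M = "lebesgue_on \<Omega>"
  have [measurable]: "g j \<in> borel_measurable ?M" for j using i by auto
  have "(\<integral>\<^sup>+x. (\<Sum>j. ennreal \<bar>g j x\<bar>) \<partial>?M) = (\<Sum>j. \<integral>\<^sup>+x. ennreal \<bar>g j x\<bar> \<partial>?M)"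
    by (rule nn_integral_suminf) measurable
  also have "\<dots> = (\<Sum>j. ennreal (LINT x|?M. \<bar>g j x\<bar>))"
    using i by (intro suminf_cong nn_integral_eq_integral) auto
  also have "\<dots> = ennreal (\<Sum>j. LINT x|?M. \<bar>g j x\<bar>)"
    by (rule suminf_ennreal2[OF _ s]) simp
  finally have "(\<integral>\<^sup>+x. (\<Sum>j. ennreal \<bar>g j x\<bar>) \<partial>?M) \<noteq> \<infinity>" by simp
  then have "AE x in ?M. (\<Sum>j. ennreal \<bar>g j x\<bar>) \<noteq> \<infinity>"
    by (intro nn_integral_PInf_AE) auto
  then show ?thesis
    by eventually_elim (auto intro: summable_suminf_not_top)
qed

theorem decomposition:
  assumes energy_cont: "energy_cont A \<nu>" and A: "A \<ge> 0"
  obtains f G where "integrable (lebesgue_on \<Omega>) f" "Lq G"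
    "\<And>\<psi>. \<psi> \<in> X \<Longrightarrow> \<nu> \<psi> = (LINT x|lebesgue_on \<Omega>. f x * \<psi> x) + (LINT x|lebesgue_on \<Omega>. G x \<bullet> grad \<psi> x)"
proof -
  let ?M = "lebesgue_on \<Omega>"
  define \<epsilon> where "\<epsilon> j = (1/2::real) ^ Suc j" for j
  \<comment> \<open>\<open>a j\<close> bounds the j-th functional against the supremum:
    \<open>A\<close> for \<nu> itself, afterwards the \<epsilon> of the preceding step.\<close>
  define a where "a j = (case j of 0 \<Rightarrow> A | Suc i \<Rightarrow> \<epsilon> i)" for j
  \<comment> \<open>Chosen so that \<open>2 ^ Suc j\<close> times the j-th field has dual modular at
    most 1, the condition for summing the fields.\<close>
  define d where "d j = 1 / ((2::real) ^ Suc j) powr qp" for j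
  have pos: "\<epsilon> j > 0" "d j > 0" "a j \<ge> 0" for j using A by (auto simp: \<epsilon>_def d_def a_def split: nat.split)
  define Q where "Q j \<mu> \<mu>' g G \<longleftrightarrow> integrable ?M g \<and> (LINT x|?M. \<bar>g x\<bar>) \<le> a j + \<epsilon> j \<and>
      Lq G \<and> rhoq G \<le> d j \<and> Lq g \<and> \<mu>' = residual \<mu> g G"
    for j :: nat and \<mu> \<mu>' :: "('a \<Rightarrow> real) \<Rightarrow> real" and g :: "'a \<Rightarrow> real" and G :: "'a \<Rightarrow> 'a"
  \<comment> \<open>Dependent choice; the clause for \<open>j = 0\<close> makes the sequence start
    at \<nu>.\<close>
  have "\<exists>\<mu>. \<forall>j. (energy_cont (a j) (\<mu> j) \<and> (j = 0 \<longrightarrow> \<mu> j = \<nu>)) \<and> (\<exists>g G. Q j (\<mu> j) (\<mu> (Suc j)) g G)"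
  proof (rule dependent_nat_choice)
    show "\<exists>\<mu>. energy_cont (a 0) \<mu> \<and> (0 = 0 \<longrightarrow> \<mu> = \<nu>)" using energy_cont by (auto simp: a_def)
    fix \<mu> j assume "energy_cont (a j) \<mu> \<and> (j = 0 \<longrightarrow> \<mu> = \<nu>)"
    then have "energy_cont (a j) \<mu>" by simp
    then show "\<exists>\<mu>'. (energy_cont (a (Suc j)) \<mu>' \<and> (Suc j = 0 \<longrightarrow> \<mu>' = \<nu>)) \<and> (\<exists>g G. Q j \<mu> \<mu>' g G)"
    proof (rule decomposition_step[OF _ pos(3) pos(1)[of j] pos(2)[of j]])
      fix g G assume "integrable ?M g" "(LINT x|?M. \<bar>g x\<bar>) \<le> a j + \<epsilon> j"
        "Lq g" "Lq G" "rhoq G \<le> d j" "energy_cont (\<epsilon> j) (residual \<mu> g G)"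
      then show ?thesis by (intro exI[of _ "residual \<mu> g G"]) (auto simp: Q_def a_def)
    qed
  qed
  then obtain \<mu> where \<mu>: "\<And>j. energy_cont (a j) (\<mu> j)" "\<mu> 0 = \<nu>" "\<forall>j. \<exists>g G. Q j (\<mu> j) (\<mu> (Suc j)) g G" by blast
  from \<mu>(3) obtain g G where Q: "\<And>j. Q j (\<mu> j) (\<mu> (Suc j)) (g j) (G j)" by metis
  have gi: "integrable ?M (g j)" and gb: "(LINT x|?M. \<bar>g j x\<bar>) \<le> a j + \<epsilon> j" and LG: "Lq (G j)" and Lg: "Lq (g j)"
    and rG: "rhoq (G j) \<le> d j" and res: "\<mu> (Suc j) = residual (\<mu> j) (g j) (G j)" for j
    using Q[of j] by (auto simp: Q_def)
  have [measurable]: "g j \<in> borel_measurable ?M" "G j \<in> borel_measurable ?M" for j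
    using gi LG Lq_measurable by auto
  have s\<epsilon>: "summable \<epsilon>" unfolding \<epsilon>_def[abs_def] using power_half_series sums_summable by blast
  have sa: "summable a"
    using summable_Suc_iff[of a] s\<epsilon> by (simp add: a_def[abs_def])
  have gs: "summable (\<lambda>j. LINT x|?M. \<bar>g j x\<bar>)"
    by (rule summable_comparison_test'[OF summable_add[OF sa s\<epsilon>], of 0]) (use gb in simp)
  have gAE: "AE x in ?M. summable (\<lambda>j. \<bar>g j x\<bar>)" by (rule L1_summable[OF gi gs])
  define f where "f x = (\<Sum>j. g j x)" for x
  have fi: "integrable ?M f"
    unfolding f_def using gi gAE gs by (intro integrable_suminf) auto
  interpret D: var_exp ?M dual_p "pp / (pp - 1)" qp by (rule var_exp_dual)
  have "(\<integral>\<^sup>+x. ennreal ((2 ^ Suc j * norm (G j x)) powr dual_p x) \<partial>?M) \<le> 1" for j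
  proof -
    have L: "D.Lp (G j)" using LG by (simp add: Lq_eq)
    have c: "(2::real) ^ Suc j \<ge> 1" by (rule one_le_power) simp
    have "(\<integral>\<^sup>+x. ennreal ((2 ^ Suc j * norm (G j x)) powr dual_p x) \<partial>?M) = (\<integral>\<^sup>+x. ennreal (norm ((2 ^ Suc j) *\<^sub>R G j x) powr dual_p x) \<partial>?M)"
      by simp
    also have "\<dots> = ennreal (D.rho (\<lambda>x. (2 ^ Suc j) *\<^sub>R G j x))"
      by (rule D.nn_integral_eq_rho[OF D.Lp_scaleR[OF L]])
    also have "\<dots> \<le> ennreal ((2 ^ Suc j) powr qp * D.rho (G j))"
      using D.rho_scaleR(2)[OF L _ c] c by (intro ennreal_leI) auto
    also have "\<dots> \<le> ennreal ((2 ^ Suc j) powr qp * d j)"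
      using rG[of j] unfolding rhoq_eq by (intro ennreal_leI mult_left_mono) auto
    also have "\<dots> = 1" by (simp add: d_def)
    finally show ?thesis .
  qed
  note S = D.Lp_summable[of "\<lambda>j x. norm (G j x)", OF _ _ this]
  have GAE: "AE x in ?M. summable (\<lambda>j. norm (G j x))" and LS: "Lq (\<lambda>x. \<Sum>j. norm (G j x))"
    using S by (auto simp: Lq_eq)
  define S where "S x = (\<Sum>j. norm (G j x))" for x
  define F where "F x = (\<Sum>j. G j x)" for x
  have Fm: "F \<in> borel_measurable ?M" unfolding F_def by measurable
  have LF: "Lq F"
    unfolding Lq_eq
  proof (rule D.Lp_bound(1)[OF LS[folded S_def, unfolded Lq_eq] Fm])
    show "AE x in ?M. norm (F x) \<le> norm (S x)"
      using GAE by eventually_elim (auto simp: F_def S_def intro!: summable_norm order_trans[OF _ abs_ge_self])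
  qed
  have iS: "integrable ?M S"
    using LS unfolding Lq_eq S_def by (rule D.Lp_integrable)
  show thesis
  proof (rule that[OF fi LF])
    fix \<psi> assume \<psi>: "\<psi> \<in> X"
    obtain C where C: "C > 0" "\<And>x. \<bar>\<psi> x\<bar> \<le> C" "\<And>x. norm (grad \<psi> x) \<le> C"
      using test_functions_bounded[OF \<psi>] by metis
    have [measurable]: "\<psi> \<in> borel_measurable ?M" "grad \<psi> \<in> borel_measurable ?M"
      using X_measurable[OF \<psi>] by auto
    have gi': "integrable ?M (\<lambda>x. g j x * \<psi> x)" for j by (rule Lq_mult_integrable[OF Lg \<psi>])
    have Gi': "integrable ?M (\<lambda>x. G j x \<bullet> grad \<psi> x)" for j by (rule inner_integrable(1)[OF LG X_Lp_grad[OF \<psi>]])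
    have s1: "(\<lambda>j. LINT x|?M. g j x * \<psi> x) sums (LINT x|?M. (\<Sum>j. g j x * \<psi> x))"
    proof (rule sums_integral[OF gi'])
      show "AE x in ?M. summable (\<lambda>j. norm (g j x * \<psi> x))"
        using gAE by eventually_elim (auto simp: abs_mult intro: summable_mult2)
      show "summable (\<lambda>j. LINT x|?M. norm (g j x * \<psi> x))"
      proof (rule summable_comparison_test'[OF summable_mult[OF gs, of C], of 0])
        fix j
        have "(LINT x|?M. norm (g j x * \<psi> x)) \<le> (LINT x|?M. C * \<bar>g j x\<bar>)"
        proof (rule integral_mono)
          show "integrable ?M (\<lambda>x. norm (g j x * \<psi> x))" by (rule integrable_norm[OF gi'])
          show "integrable ?M (\<lambda>x. C * \<bar>g j x\<bar>)" using gi by auto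
          show "norm (g j x * \<psi> x) \<le> C * \<bar>g j x\<bar>" for x
            using C(2) by (simp add: abs_mult mult.commute[of C] mult_left_mono)
        qed
        then show "norm (LINT x|?M. norm (g j x * \<psi> x)) \<le> C * (LINT x|?M. \<bar>g j x\<bar>)" by simp
      qed
    qed
    have e1: "(LINT x|?M. (\<Sum>j. g j x * \<psi> x)) = (LINT x|?M. f x * \<psi> x)"
    proof (rule integral_cong_AE)
      show "AE x in ?M. (\<Sum>j. g j x * \<psi> x) = f x * \<psi> x"
        using gAE
      proof eventually_elim
        case (elim x)
        then have "summable (\<lambda>j. g j x)" by (rule summable_rabs_cancel)
        then show ?case unfolding f_def by (rule suminf_mult2[symmetric])
      qed
    qed (use fi in measurable)
    have s2: "(\<lambda>j. LINT x|?M. G j x \<bullet> grad \<psi> x) sums (LINT x|?M. (\<Sum>j. G j x \<bullet> grad \<psi> x))"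
    proof (rule sums_integral[OF Gi'])
      have le: "norm (G j x \<bullet> grad \<psi> x) \<le> C * norm (G j x)" for j x
      proof -
        have "norm (G j x \<bullet> grad \<psi> x) \<le> norm (G j x) * norm (grad \<psi> x)" by (simp add: Cauchy_Schwarz_ineq2)
        also have "\<dots> \<le> norm (G j x) * C" using C by (intro mult_left_mono) auto
        finally show ?thesis by (simp add: mult.commute)
      qed
      show "AE x in ?M. summable (\<lambda>j. norm (G j x \<bullet> grad \<psi> x))"
        using GAE
      proof eventually_elim
        case (elim x)
        show ?case by (rule summable_comparison_test'[OF summable_mult[OF elim, of C], of 0]) (use le in auto)
      qed
      \<comment> \<open>No bound on the single integrals is summed here; the partial sums are
        controlled by the integrable majorant \<open>S\<close>, the sum of the pointwise
        norms.\<close>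
      show "summable (\<lambda>j. LINT x|?M. norm (G j x \<bullet> grad \<psi> x))"
      proof (rule summableI_nonneg_bounded)
        show "0 \<le> (LINT x|?M. norm (G j x \<bullet> grad \<psi> x))" for j by simp
        fix n
        have "(\<Sum>j<n. LINT x|?M. norm (G j x \<bullet> grad \<psi> x)) = (LINT x|?M. (\<Sum>j<n. norm (G j x \<bullet> grad \<psi> x)))"
          by (rule Bochner_Integration.integral_sum[symmetric]) (use Gi' in auto)
        also have "\<dots> \<le> (LINT x|?M. C * S x)"
        proof (rule integral_mono_AE)
          show "integrable ?M (\<lambda>x. \<Sum>j<n. norm (G j x \<bullet> grad \<psi> x))" using Gi' by auto
          show "AE x in ?M. (\<Sum>j<n. norm (G j x \<bullet> grad \<psi> x)) \<le> C * S x"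
            using GAE
          proof eventually_elim
            case (elim x)
            have "(\<Sum>j<n. norm (G j x \<bullet> grad \<psi> x)) \<le> C * (\<Sum>j<n. norm (G j x))"
              unfolding sum_distrib_left by (intro sum_mono le)
            also have "\<dots> \<le> C * S x"
              unfolding S_def using C elim by (intro mult_left_mono sum_le_suminf) auto
            finally show ?case .
          qed
        qed (use iS in auto)
        finally show "(\<Sum>j<n. LINT x|?M. norm (G j x \<bullet> grad \<psi> x)) \<le> (LINT x|?M. C * S x)" .
      qed
    qed
    have e2: "(LINT x|?M. (\<Sum>j. G j x \<bullet> grad \<psi> x)) = (LINT x|?M. F x \<bullet> grad \<psi> x)"
    proof (rule integral_cong_AE)
      show "AE x in ?M. (\<Sum>j. G j x \<bullet> grad \<psi> x) = F x \<bullet> grad \<psi> x"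
        using GAE
      proof eventually_elim
        case (elim x)
        then have "summable (\<lambda>j. G j x)" by (rule summable_norm_cancel)
        then show ?case unfolding F_def
          by (rule bounded_linear.suminf[OF bounded_linear_inner_left, symmetric])
      qed
    qed (use Fm in measurable)
    have tel: "\<nu> \<psi> = (\<Sum>j<n. (LINT x|?M. g j x * \<psi> x) + (LINT x|?M. G j x \<bullet> grad \<psi> x)) + \<mu> n \<psi>" for n
    proof (induction n)
      case (Suc n)
      then show ?case by (simp add: res residual_def)
    qed (simp add: \<mu>(2))
    have "(\<lambda>n. \<mu> n \<psi>) \<longlonglongrightarrow> 0"
    proof (rule Lim_null_comparison)
      show "\<forall>\<^sub>F n in sequentially. norm (\<mu> n \<psi>) \<le> a n * supn \<psi>"
        using \<mu>(1) \<psi> by (auto simp: energy_cont_def)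
      show "(\<lambda>n. a n * supn \<psi>) \<longlonglongrightarrow> 0"
        using tendsto_mult[OF summable_LIMSEQ_zero[OF sa] tendsto_const, of "supn \<psi>"] by simp
    qed
    then have "(\<lambda>n. \<nu> \<psi> - (\<Sum>j<n. (LINT x|?M. g j x * \<psi> x) + (LINT x|?M. G j x \<bullet> grad \<psi> x))) \<longlonglongrightarrow> 0"
    proof (rule Lim_transform_eventually)
      show "\<forall>\<^sub>F n in sequentially. \<mu> n \<psi> =
          \<nu> \<psi> - (\<Sum>j<n. (LINT x|?M. g j x * \<psi> x) + (LINT x|?M. G j x \<bullet> grad \<psi> x))"
      proof (rule always_eventually, rule allI)
        fix n
        have "m = z - s" if "z = s + m" for m s z :: real using that by simp
        from this[OF tel[of n]]
        show "\<mu> n \<psi> = \<nu> \<psi> - (\<Sum>j<n. (LINT x|?M. g j x * \<psi> x) + (LINT x|?M. G j x \<bullet> grad \<psi> x))" .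
      qed
    qed
    then have "(\<lambda>n. \<nu> \<psi> - (\<nu> \<psi> - (\<Sum>j<n. (LINT x|?M. g j x * \<psi> x) + (LINT x|?M. G j x \<bullet> grad \<psi> x)))) \<longlonglongrightarrow> \<nu> \<psi> - 0"
      by (intro tendsto_diff tendsto_const)
    then have "(\<lambda>j. (LINT x|?M. g j x * \<psi> x) + (LINT x|?M. G j x \<bullet> grad \<psi> x)) sums \<nu> \<psi>"
      by (simp add: sums_def)
    then show "\<nu> \<psi> = (LINT x|?M. f x * \<psi> x) + (LINT x|?M. F x \<bullet> grad \<psi> x)"
      using sums_unique2[OF _ sums_add[OF s1 s2]] e1 e2 by simp
  qed
qed

end

section \<open>Mollification\<close>

text \<open>\<open>C\<close> is meant to be the same for all radii; the bound
  \<open>C / \<delta> ^ DIM('a)\<close> feeds the estimate with frozen exponent. Evenness gives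
  \<open>\<rho> (x - y)\<close> total mass 1 also in the variable \<open>y\<close>.\<close>

definition mollifier :: "real \<Rightarrow> real \<Rightarrow> ('a::euclidean_space \<Rightarrow> real) \<Rightarrow> bool" where
  "mollifier C \<delta> \<rho> \<longleftrightarrow> smooth \<rho> \<and> (\<forall>z. 0 \<le> \<rho> z) \<and> (\<forall>z. norm z \<ge> \<delta> \<longrightarrow> \<rho> z = 0) \<and>
      (\<forall>z. \<rho> (- z) = \<rho> z) \<and> (\<forall>z. \<rho> z \<le> C / \<delta> ^ DIM('a)) \<and> (LINT z|lborel. \<rho> z) = 1"

lemma mollifier_exists:
  obtains C :: real where "C > 0"
    "\<And>\<delta>::real. \<delta> > 0 \<Longrightarrow> \<exists>\<rho> :: 'a::euclidean_space \<Rightarrow> real. mollifier C \<delta> \<rho>"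
proof -
  \<comment> \<open>On the ball of radius \<open>\<delta> / 2\<close> the unnormalised kernel is at
    least \<open>flat (3/4)\<close>, since 1 - 1/4 = 3/4; its integral is then at least
    \<open>u * (\<delta> / 2) ^ DIM('a)\<close>.\<close>
  define u where "u = flat (3/4) * unit_ball_vol (real DIM('a))"
  have u: "u > 0" by (simp add: u_def)
  show thesis
  proof (rule that[of "2 ^ DIM('a) / u"])
    show "2 ^ DIM('a) / u > 0" using u by simp
    fix \<delta> :: real assume \<delta>: "\<delta> > 0"
    define k where "k z = flat (1 - (norm ((1/\<delta>) *\<^sub>R z))\<^sup>2)" for z :: 'a
    have "smooth (\<lambda>z::'a. flat (1\<^sup>2 - (norm (z - 0))\<^sup>2))"
      by (rule test_functions_smooth[OF bump_test_function[of 1 0 UNIV]]) auto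
    then have "smooth (\<lambda>z::'a. flat (1 - (norm z)\<^sup>2))" by simp
    from smooth_affine[OF this, of 0 "1/\<delta>"] have sm: "smooth k"
      by (simp add: k_def[abs_def])
    have k0: "k z \<ge> 0" "k z \<le> 1" for z by (simp_all add: k_def flat_le_1)
    have kz: "k z = 0" if "norm z \<ge> \<delta>" for z
    proof -
      have "norm ((1/\<delta>) *\<^sub>R z) \<ge> 1" using that \<delta> by simp
      then have "1 \<le> (norm ((1/\<delta>) *\<^sub>R z))\<^sup>2" by (simp only: one_le_power)
      then show ?thesis by (simp only: k_def flat_eq_0)
    qed
    have kint: "integrable lborel k"
    proof (rule integrable_compact_support[OF smooth_continuous[OF sm]])
      show "compact (cball (0::'a) \<delta>)" by simp
      show "k z = 0" if "z \<notin> cball 0 \<delta>" for z using that by (intro kz) simp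
    qed
    define I where "I = (LINT z|lborel. k z)"
    have "u * (\<delta> / 2) ^ DIM('a) = flat (3/4) * measure lborel (ball (0::'a) (\<delta>/2))"
      using \<delta> by (simp add: u_def content_ball)
    also have "\<dots> = (LINT z|lborel. flat (3/4) * indicator (ball (0::'a) (\<delta>/2)) z)"
      by simp
    also have "\<dots> \<le> I"
      unfolding I_def
    proof (rule integral_mono[OF _ kint])
      show "integrable lborel (\<lambda>z. flat (3/4) * indicator (ball (0::'a) (\<delta>/2)) z)"
        by (intro integrable_mult_right integrable_real_indicator)
          (use emeasure_lborel_ball_finite[of "0::'a" "\<delta>/2"] in auto)
      show "flat (3/4) * indicator (ball 0 (\<delta>/2)) z \<le> k z" for z
      proof (cases "z \<in> ball 0 (\<delta>/2)")
        case True
        then have "norm ((1/\<delta>) *\<^sub>R z) \<le> 1/2" using \<delta> by (simp add: field_simps)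
        then have "(norm ((1/\<delta>) *\<^sub>R z))\<^sup>2 \<le> (1/2)\<^sup>2" by (intro power_mono) auto
        then have "flat (3/4) \<le> k z" unfolding k_def by (intro flat_mono) (simp add: power2_eq_square)
        then show ?thesis using True by simp
      qed (use k0 in auto)
    qed
    finally have I: "u * (\<delta> / 2) ^ DIM('a) \<le> I" .
    have Ipos: "I > 0" using u \<delta> by (intro less_le_trans[OF _ I]) simp
    show "\<exists>\<rho> :: 'a \<Rightarrow> real. mollifier (2 ^ DIM('a) / u) \<delta> \<rho>"
      unfolding mollifier_def
    proof (intro exI[of _ "\<lambda>z. (1 / I) * k z"] conjI allI impI)
      show "smooth (\<lambda>z. (1 / I) * k z)" by (intro smooth_mult smooth_const sm)
      show "0 \<le> (1 / I) * k z" for z using Ipos k0 by simp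
      show "(1 / I) * k z = 0" if "norm z \<ge> \<delta>" for z using kz[OF that] by simp
      show "(1 / I) * k (- z) = (1 / I) * k z" for z by (simp add: k_def)
      show "(1 / I) * k z \<le> 2 ^ DIM('a) / u / \<delta> ^ DIM('a)" for z
      proof -
        have "(1 / I) * k z \<le> 1 / I * 1" using Ipos k0 by (intro mult_left_mono) auto
        also have "\<dots> \<le> 1 / (u * (\<delta> / 2) ^ DIM('a))"
          using I u \<delta> by (simp add: frac_le)
        also have "\<dots> = 2 ^ DIM('a) / u / \<delta> ^ DIM('a)" by (simp add: power_divide)
        finally show ?thesis .
      qed
      show "(LINT z|lborel. (1 / I) * k z) = 1" using Ipos by (simp add: I_def)
    qed
  qed
qed

lemma continuous_compact_cbox:
  fixes K :: "'a::euclidean_space set"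
  assumes "compact K"
  obtains c where "K \<subseteq> cbox (- c) c"
  using bounded_subset_cbox_symmetric[OF compact_imp_bounded[OF assms]] by metis

text \<open>Differentiation under the integral sign, carried out for the gauge integral over a box
  that contains the support of \<open>w\<close>; the fact \<open>L\<close> translates between the
  two integrals.\<close>

lemma convolution_has_derivative:
  fixes w \<rho> :: "'a::euclidean_space \<Rightarrow> real"
  assumes w: "continuous_on UNIV w" "compact K" "\<And>x. x \<notin> K \<Longrightarrow> w x = 0" and \<rho>: "smooth \<rho>"
  shows "((\<lambda>x. LINT y|lborel. w y * \<rho> (x - y)) has_derivative
    (\<lambda>h. LINT y|lborel. w y * (h \<bullet> grad \<rho> (x - y)))) (at x)"
proof -
  obtain c where c: "K \<subseteq> cbox (- c) c" using continuous_compact_cbox[OF w(2)] by metis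
  have cb: "cbox (- c) c \<in> sets lebesgue" by simp
  have L: "(LINT y|lborel. w y * f y) = integral (cbox (- c) c) (\<lambda>y. w y * f y)" if "continuous_on UNIV f" for f
  proof -
    have cont: "continuous_on UNIV (\<lambda>y. w y * f y)" by (intro continuous_intros w that)
    have z: "w y * f y = 0" if "y \<notin> cbox (- c) c" for y using w(3)[of y] c that by auto
    have m: "(\<lambda>y. w y * f y) \<in> borel_measurable borel" by (rule borel_measurable_continuous_onI[OF cont])
    have i: "integrable (lebesgue_on (cbox (- c) c)) (\<lambda>y. w y * f y)"
      by (rule integrable_lebesgue_on_compact_support[OF cont w(2) _ c cb]) (simp add: w(3))
    show ?thesis
      using integral_lebesgue_on_eq_lborel(1)[OF cb m z] lebesgue_integral_eq_integral[OF i cb] by simp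
  qed
  have c\<rho>: "continuous_on UNIV (\<lambda>y. \<rho> (x - y))" for x
    by (intro continuous_on_compose2[OF smooth_continuous[OF \<rho>, of UNIV]] continuous_intros) auto
  have cg: "continuous_on A (\<lambda>z. grad \<rho> (f z))" if "continuous_on A f" for A and f :: "'b::topological_space \<Rightarrow> 'a"
    by (rule continuous_on_compose2[OF smooth_grad_continuous[OF \<rho>, of UNIV] that]) auto
  let ?fx = "\<lambda>x y. w y *\<^sub>R blinfun_inner_left (grad \<rho> (x - y))"
  have "((\<lambda>x. integral (cbox (- c) c) (\<lambda>y. w y * \<rho> (x - y))) has_derivative
      integral (cbox (- c) c) (?fx x)) (at x within UNIV)"
  proof (rule leibniz_rule)
    fix x t
    have "((\<lambda>x. \<rho> (x - t)) has_derivative (\<lambda>h. h \<bullet> grad \<rho> (x - t))) (at x)"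
      by (rule has_derivative_compose[OF _ smooth_has_derivative[OF \<rho>], of "\<lambda>x. x - t" "\<lambda>h. h"])
        (auto intro!: derivative_eq_intros)
    then have "((\<lambda>x. w t * \<rho> (x - t)) has_derivative (\<lambda>h. w t * (h \<bullet> grad \<rho> (x - t)))) (at x)"
      by (rule has_derivative_mult_right)
    then show "((\<lambda>x. w t * \<rho> (x - t)) has_derivative blinfun_apply (?fx x t)) (at x within UNIV)"
      by (simp add: scaleR_blinfun.rep_eq)
    show "(\<lambda>y. w y * \<rho> (x - y)) integrable_on cbox (- c) c"
      by (rule integrable_continuous)
        (rule continuous_on_subset[OF continuous_on_mult[OF w(1) c\<rho>]], simp)
  next
    show "continuous_on (UNIV \<times> cbox (- c) c) (\<lambda>(x, t). ?fx x t)"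
      unfolding case_prod_beta
      by (intro continuous_on_scaleR bounded_linear.continuous_on[OF bounded_linear_blinfun_inner_left] cg
          continuous_on_compose2[OF w(1)] continuous_intros) auto
  qed auto
  moreover have "blinfun_apply (integral (cbox (- c) c) (?fx x)) h = (LINT y|lborel. w y * (h \<bullet> grad \<rho> (x - y)))" for h
  proof -
    have "?fx x integrable_on cbox (- c) c"
      by (rule integrable_continuous)
        (intro continuous_on_scaleR bounded_linear.continuous_on[OF bounded_linear_blinfun_inner_left] cg
          continuous_on_subset[OF w(1)] continuous_intros, auto)
    then have "blinfun_apply (integral (cbox (- c) c) (?fx x)) h = integral (cbox (- c) c) (\<lambda>y. w y * (h \<bullet> grad \<rho> (x - y)))"
      by (subst blinfun_apply_integral) (auto simp: scaleR_blinfun.rep_eq)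
    also have "\<dots> = (LINT y|lborel. w y * (h \<bullet> grad \<rho> (x - y)))"
      by (rule L[symmetric]) (intro continuous_on_inner continuous_on_const cg continuous_intros)
    finally show ?thesis .
  qed
  then have "blinfun_apply (integral (cbox (- c) c) (?fx x)) = (\<lambda>h. LINT y|lborel. w y * (h \<bullet> grad \<rho> (x - y)))" by blast
  ultimately show ?thesis
    by (simp add: L[OF c\<rho>])
qed

lemma convolution_smooth:
  fixes w \<rho> :: "'a::euclidean_space \<Rightarrow> real"
  assumes w: "continuous_on UNIV w" "compact K" "\<And>x. x \<notin> K \<Longrightarrow> w x = 0" and \<rho>: "smooth \<rho>"
  shows "smooth (\<lambda>x. LINT y|lborel. w y * \<rho> (x - y))"
proof (rule smooth_coinduct)
  let ?F = "{f. \<exists>\<rho>. smooth \<rho> \<and> f = (\<lambda>x. LINT y|lborel. w y * \<rho> (x - y))}"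
  show "(\<lambda>x. LINT y|lborel. w y * \<rho> (x - y)) \<in> ?F" using \<rho> by blast
  fix f assume "f \<in> ?F"
  then obtain \<rho>' where \<rho>': "smooth \<rho>'" "f = (\<lambda>x. LINT y|lborel. w y * \<rho>' (x - y))" by blast
  note D = convolution_has_derivative[OF w \<rho>'(1), folded \<rho>'(2)]
  show "f differentiable at x" for x using D by (rule differentiableI)
  fix b :: 'a assume b: "b \<in> Basis"
  have "(\<lambda>x. frechet_derivative f (at x) b) = (\<lambda>x. LINT y|lborel. w y * (grad \<rho>' (x - y) \<bullet> b))"
    by (simp add: has_derivative_imp_frechet_derivative[OF D] inner_commute)
  then show "(\<lambda>x. frechet_derivative f (at x) b) \<in> ?F"
    using smooth_grad_inner[OF \<rho>'(1) b] by blast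
qed

context sobolev
begin

text \<open>If the ball around \<open>x\<close> lies in \<Omega>, the reflected kernel
  \<open>\<lambda>y. \<rho> (x - y)\<close> is a test function, so the definition of the weak
  gradient moves the derivative to \<open>v\<close>; the sign from the reflection cancels the one
  from the definition.\<close>

lemma grad_convolution:
  fixes v \<rho> :: "'a \<Rightarrow> real"
  assumes g: "has_weak_gradient \<Omega> v g"
    and w: "continuous_on UNIV (\<lambda>x. if x \<in> \<Omega> then v x else 0)"
    and \<rho>: "smooth \<rho>" "\<And>z. norm z \<ge> \<delta> \<Longrightarrow> \<rho> z = 0" and x: "cball x \<delta> \<subseteq> \<Omega>"
  shows "grad (\<lambda>x. LINT y|lborel. (if y \<in> \<Omega> then v y else 0) * \<rho> (x - y)) x =
    (LINT y|lebesgue_on \<Omega>. \<rho> (x - y) *\<^sub>R g y)"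
proof -
  let ?w = "\<lambda>x. if x \<in> \<Omega> then v x else 0"
  have cl: "compact (closure \<Omega>)" using bounded_domain by (simp add: compact_closure)
  have w0: "?w y = 0" if "y \<notin> closure \<Omega>" for y using that closure_subset by auto
  define \<psi> where "\<psi> y = \<rho> (x - y)" for y
  have \<psi>eq: "\<psi> = (\<lambda>y. \<rho> (x + (-1) *\<^sub>R y))" by (simp add: \<psi>_def fun_eq_iff)
  have sm: "smooth \<psi>" unfolding \<psi>eq by (rule smooth_affine[OF \<rho>(1)])
  have g\<psi>: "grad \<psi> y = - grad \<rho> (x - y)" for y
    unfolding \<psi>eq using grad_affine[OF \<rho>(1), of x "-1" y] by simp
  have \<psi>: "\<psi> \<in> X"
  proof (rule test_functionsI[OF sm _ x])
    show "\<psi> y = 0" if "y \<notin> cball x \<delta>" for y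
      using that unfolding \<psi>_def by (intro \<rho>(2)) (simp add: dist_norm)
  qed simp
  have wg: "(LINT y|lebesgue_on \<Omega>. v y *\<^sub>R grad \<psi> y) = - (LINT y|lebesgue_on \<Omega>. \<psi> y *\<^sub>R g y)"
    using g \<psi> unfolding has_weak_gradient_def by blast
  have cg: "continuous_on UNIV (\<lambda>y. grad \<rho> (x - y))"
    by (intro continuous_on_compose2[OF smooth_grad_continuous[OF \<rho>(1), of UNIV]] continuous_intros) auto
  have cont: "continuous_on UNIV (\<lambda>y. ?w y *\<^sub>R grad \<rho> (x - y))"
    by (intro continuous_on_scaleR w cg)
  have z: "?w y *\<^sub>R grad \<rho> (x - y) = 0" if "y \<notin> \<Omega>" for y using that by simp
  have int: "integrable lborel (\<lambda>y. ?w y *\<^sub>R grad \<rho> (x - y))"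
    by (rule integrable_compact_support[OF cont cl]) (use w0 in simp)
  have m: "(\<lambda>y. ?w y *\<^sub>R grad \<rho> (x - y)) \<in> borel_measurable borel"
    by (rule borel_measurable_continuous_onI[OF cont])
  have "(LINT y|lborel. ?w y *\<^sub>R grad \<rho> (x - y)) = (LINT y|lebesgue_on \<Omega>. ?w y *\<^sub>R grad \<rho> (x - y))"
    by (rule integral_lebesgue_on_eq_lborel(1)[OF _ m z, symmetric]) (use open_domain in auto)
  also have "\<dots> = (LINT y|lebesgue_on \<Omega>. - (v y *\<^sub>R grad \<psi> y))"
    by (intro Bochner_Integration.integral_cong refl) (simp add: g\<psi>)
  also have "\<dots> = (LINT y|lebesgue_on \<Omega>. \<psi> y *\<^sub>R g y)"
    unfolding integral_minus wg by simp
  finally have eq: "(LINT y|lborel. ?w y *\<^sub>R grad \<rho> (x - y)) = (LINT y|lebesgue_on \<Omega>. \<rho> (x - y) *\<^sub>R g y)"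
    by (simp add: \<psi>_def)
  show ?thesis
  proof (rule has_derivative_imp_grad)
    have "(\<lambda>h. LINT y|lborel. ?w y * (h \<bullet> grad \<rho> (x - y))) = (\<lambda>h. h \<bullet> (LINT y|lborel. ?w y *\<^sub>R grad \<rho> (x - y)))"
    proof
      fix h
      show "(LINT y|lborel. ?w y * (h \<bullet> grad \<rho> (x - y))) = h \<bullet> (LINT y|lborel. ?w y *\<^sub>R grad \<rho> (x - y))"
        by (subst integral_inner_right[symmetric]) (use int in auto)
    qed
    note e = this
    have "((\<lambda>x. LINT y|lborel. ?w y * \<rho> (x - y)) has_derivative
        (\<lambda>h. LINT y|lborel. ?w y * (h \<bullet> grad \<rho> (x - y)))) (at x)"
      by (rule convolution_has_derivative[OF w cl w0 \<rho>(1)])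
    then show "((\<lambda>x. LINT y|lborel. ?w y * \<rho> (x - y)) has_derivative (\<lambda>h. h \<bullet> (LINT y|lebesgue_on \<Omega>. \<rho> (x - y) *\<^sub>R g y))) (at x)"
      unfolding e eq .
  qed
qed

text \<open>The exponent may be frozen at its minimum \<open>q\<close> over the ball, up to a constant: by log-Hoelder
  continuity \<open>(\<delta> ^ (-n)) ^ (p x - q)\<close> stays bounded.\<close>

lemma mollify_pointwise:
  assumes lH: "log_Hoelder_on \<Omega> p" and C: "C > 0"
  shows "\<exists>D>0. \<forall>\<delta> \<rho> h x. 0 < \<delta> \<longrightarrow> \<delta> \<le> 1/4 \<longrightarrow> mollifier C \<delta> \<rho> \<longrightarrow> Lp h \<longrightarrow> (\<forall>y. 0 \<le> h y) \<longrightarrow>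
      rho h \<le> 1 \<longrightarrow> cball x \<delta> \<subseteq> \<Omega> \<longrightarrow>
      (LINT y|lebesgue_on \<Omega>. \<rho> (x - y) * h y) powr p x \<le>
        D * (1 + (LINT y|lebesgue_on \<Omega>. \<rho> (x - y) * h y powr p y))"
proof -
  let ?M = "lebesgue_on \<Omega>"
  obtain c where c: "c > 0" "\<And>x y. x \<in> \<Omega> \<Longrightarrow> y \<in> \<Omega> \<Longrightarrow> dist x y < 1/2 \<Longrightarrow> \<bar>p x - p y\<bar> \<le> - c / ln (dist x y)"
    using lH unfolding log_Hoelder_on_def by blast
  \<comment> \<open>\<open>I\<close> below is at most \<open>(1 + C) / \<delta> ^ DIM('a)\<close>
    and is raised to a power at most \<kappa>; then \<open>\<kappa> \<le> c\<close> and
    \<open>\<kappa> * ln \<delta> = - c\<close> give the two factors.\<close>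
  define D where "D = (1 + C) powr c * exp (real DIM('a) * c)"
  show ?thesis
  proof (intro exI[of _ D] conjI allI impI)
    show "D > 0" using C by (simp add: D_def)
    fix \<delta> and \<rho> h :: "'a \<Rightarrow> real" and x
    assume \<delta>: "0 < \<delta>" "\<delta> \<le> 1/4" and \<rho>: "mollifier C \<delta> \<rho>" and h: "Lp h" "\<forall>y. 0 \<le> h y" "rho h \<le> 1"
      and x: "cball x \<delta> \<subseteq> \<Omega>"
    have sm: "smooth \<rho>" and \<rho>0: "\<And>z. 0 \<le> \<rho> z" and \<rho>z: "\<And>z. norm z \<ge> \<delta> \<Longrightarrow> \<rho> z = 0"
      and even: "\<And>z. \<rho> (- z) = \<rho> z" and \<rho>C: "\<And>z. \<rho> z \<le> C / \<delta> ^ DIM('a)" and \<rho>1: "(LINT z|lborel. \<rho> z) = 1"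
      using \<rho> by (simp_all add: mollifier_def)
    have x\<Omega>: "x \<in> \<Omega>" using x \<delta> by auto
    define \<kappa> where "\<kappa> = - c / ln \<delta>"
    \<comment> \<open>A radius of at most 1/4 lies below \<open>exp (-1)\<close>, whence
      \<open>\<kappa> \<le> c\<close>.\<close>
    have ln4: "ln \<delta> \<le> -1"
    proof -
      have "ln \<delta> \<le> ln (exp (-1))"
      proof (subst ln_le_cancel_iff)
        have "exp (1::real) \<le> 3" by (rule exp_le)
        then have "1 / 3 \<le> exp (-1::real)" by (simp add: exp_minus field_simps)
        then show "\<delta> \<le> exp (-1)" using \<delta> by simp
      qed (use \<delta> in auto)
      then show ?thesis by simp
    qed
    have \<kappa>: "0 < \<kappa>" "\<kappa> \<le> c" "\<kappa> * ln \<delta> = - c"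
    proof -
      have neg: "ln \<delta> < 0" using ln4 by simp
      show "0 < \<kappa>" unfolding \<kappa>_def using c(1) neg by (intro divide_neg_neg) auto
      show "\<kappa> * ln \<delta> = - c" using neg by (simp add: \<kappa>_def)
      have "c * 1 \<le> c * (- ln \<delta>)" using ln4 c(1) by (intro mult_left_mono) auto
      then show "\<kappa> \<le> c" unfolding \<kappa>_def using neg by (subst neg_divide_le_eq) auto
    qed
    have near: "p x - \<kappa> \<le> p y" if "y \<in> cball x \<delta>" for y
    proof (cases "x = y")
      case False
      have d: "0 < dist x y" "dist x y \<le> \<delta>" using that False by auto
      then have "ln (dist x y) \<le> ln \<delta>" using \<delta> by (simp add: ln_le_cancel_iff)
      then have "- c / ln (dist x y) \<le> \<kappa>"
        unfolding \<kappa>_def using ln4 c(1) by (simp add: divide_simps)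
      then show ?thesis using c(2)[OF x\<Omega>, of y] x that d \<delta> by auto
    qed (use \<kappa> in auto)
    \<comment> \<open>The maximum with \<open>pm\<close> keeps \<open>q\<close> above 1, as the
      tangent inequality demands.\<close>
    define q where "q = max pm (p x - \<kappa>)"
    have px: "pm \<le> p x" using p_bounds x\<Omega> by auto
    have q: "1 < q" "q \<le> p x" "p x - q \<le> \<kappa>" using pm_gt_1 px \<kappa> by (auto simp: q_def)
    have pq: "q \<le> p y" if "y \<in> cball x \<delta>" for y
      using near[OF that] p_bounds[of y] x that by (auto simp: q_def)
    define r where "r y = \<rho> (x - y)" for y
    have r0: "r y \<ge> 0" for y by (simp add: r_def \<rho>0)
    have rz: "r y = 0" if "y \<notin> cball x \<delta>" for y
      using that unfolding r_def by (intro \<rho>z) (simp add: dist_norm)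
    have rC: "r y \<le> C / \<delta> ^ DIM('a)" for y by (simp add: r_def \<rho>C)
    have req: "r = (\<lambda>y. \<rho> (x + (-1) *\<^sub>R y))" by (simp add: r_def fun_eq_iff)
    have rX: "r \<in> X"
    proof (rule test_functionsI[OF _ _ x rz])
      show "smooth r" unfolding req by (rule smooth_affine[OF sm])
    qed simp
    note ri = test_functions_integrable(1)[OF rX open_domain]
    have r1: "(LINT y|?M. r y) = 1"
    proof -
      have "(LINT y|?M. r y) = (LINT y|lborel. r y)"
      proof (rule integral_lebesgue_on_eq_lborel(1))
        show "\<Omega> \<in> sets lebesgue" using open_domain by auto
        show "r \<in> borel_measurable borel" by (rule borel_measurable_continuous_onI[OF smooth_continuous[OF X_smooth[OF rX]]])
        show "r y = 0" if "y \<notin> \<Omega>" for y using x that by (intro rz) blast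
      qed
      also have "\<dots> = (LINT y|lborel. \<rho> (- x + y))"
        unfolding r_def by (subst even[symmetric]) simp
      also have "\<dots> = 1"
        using lborel_integral_translate[of \<rho> "- x"] borel_measurable_continuous_onI[OF smooth_continuous[OF sm]] \<rho>1 by simp
      finally show ?thesis .
    qed
    have hm [measurable]: "h \<in> borel_measurable ?M" using h(1) Lp_measurable by blast
    have rm [measurable]: "r \<in> borel_measurable ?M" using X_measurable[OF rX] by simp
    have h_i: "integrable ?M (\<lambda>y. h y powr p y)" using h(1,2) by (simp add: Lp_def)
    have B: "0 \<le> C / \<delta> ^ DIM('a)" using C \<delta> by simp
    have bnd: "integrable ?M (\<lambda>y. r y * f y)" if "f \<in> borel_measurable ?M" "\<And>y. y \<in> cball x \<delta> \<Longrightarrow> \<bar>f y\<bar> \<le> 1 + h y powr p y" for f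
    proof (rule Bochner_Integration.integrable_bound)
      show "integrable ?M (\<lambda>y. C / \<delta> ^ DIM('a) * (h y powr p y) + r y)" using h_i ri by auto
      show "AE y in ?M. norm (r y * f y) \<le> norm (C / \<delta> ^ DIM('a) * (h y powr p y) + r y)"
      proof (rule AE_I2)
        fix y
        have "\<bar>r y * f y\<bar> \<le> C / \<delta> ^ DIM('a) * (h y powr p y) + r y"
        proof (cases "y \<in> cball x \<delta>")
          case True
          have "\<bar>r y * f y\<bar> \<le> r y * (1 + h y powr p y)"
            using r0[of y] that(2)[OF True] by (simp add: abs_mult mult_left_mono)
          also have "\<dots> = r y + r y * (h y powr p y)" by (simp add: algebra_simps)
          also have "r y * (h y powr p y) \<le> C / \<delta> ^ DIM('a) * (h y powr p y)" by (intro mult_right_mono rC) simp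
          finally show ?thesis by simp
        next
          case False
          then show ?thesis using rz[OF False] mult_nonneg_nonneg[OF B, of "h y powr p y"] by simp
        qed
        then show "norm (r y * f y) \<le> norm (C / \<delta> ^ DIM('a) * (h y powr p y) + r y)" by simp
      qed
    qed (use that(1) in measurable)
    have le1: "h y \<le> 1 + h y powr p y" if "y \<in> cball x \<delta>" for y
      using that x h(2) by (intro le_1_add_powr) auto
    have le2: "h y powr q \<le> 1 + h y powr p y" if "y \<in> cball x \<delta>" for y
    proof (cases "h y \<le> 1")
      case True
      then have "h y powr q \<le> 1 powr q" using q h(2) by (intro powr_mono2) auto
      then show ?thesis by (simp add: add_increasing2)
    next
      case False
      then have "h y powr q \<le> h y powr p y" using pq[OF that] by (intro powr_mono) auto
      then show ?thesis by simp
    qed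
    have i1: "integrable ?M (\<lambda>y. r y * h y)" using le1 h(2) by (intro bnd) auto
    have i2: "integrable ?M (\<lambda>y. r y * h y powr q)" using le2 by (intro bnd) auto
    have i3: "integrable ?M (\<lambda>y. r y * h y powr p y)" by (intro bnd) auto
    have i4: "integrable ?M (\<lambda>y. r y * (1 + h y powr p y))" by (intro bnd) auto
    define a where "a = (LINT y|?M. r y * h y)"
    \<comment> \<open>The added 1 covers the points where \<open>h y < 1\<close>, at which lowering
      the exponent enlarges the power.\<close>
    define I where "I = 1 + (LINT y|?M. r y * h y powr p y)"
    have a0: "a \<ge> 0" unfolding a_def using r0 h(2) by (intro Bochner_Integration.integral_nonneg) auto
    have Ieq: "I = (LINT y|?M. r y * (1 + h y powr p y))"
      unfolding I_def using ri i3 r1 by (simp add: distrib_left)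
    have I1: "I \<ge> 1" unfolding I_def using r0 by (simp add: Bochner_Integration.integral_nonneg)
    have cmp: "(LINT y|?M. r y * f y) \<le> I" if "integrable ?M (\<lambda>y. r y * f y)" "\<And>y. y \<in> cball x \<delta> \<Longrightarrow> f y \<le> 1 + h y powr p y" for f
      unfolding Ieq
    proof (rule integral_mono[OF that(1) i4])
      show "r y * f y \<le> r y * (1 + h y powr p y)" for y
        using that(2)[of y] r0[of y] rz[of y] by (cases "y \<in> cball x \<delta>") (auto intro: mult_left_mono)
    qed
    have aI: "a \<le> I" unfolding a_def by (rule cmp[OF i1 le1])
    \<comment> \<open>Jensen's inequality for the probability density \<open>r\<close>, in the form
      of the tangent at the mean \<open>a\<close>.\<close>
    have "a powr q \<le> (LINT y|?M. r y * h y powr q)"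
    proof -
      have "a powr q = (LINT y|?M. (a powr q - q * a powr (q - 1) * a) * r y + (q * a powr (q - 1)) * (r y * h y))"
        using ri i1 r1 by (simp add: a_def[symmetric])
      also have "\<dots> \<le> (LINT y|?M. r y * h y powr q)"
      proof (rule integral_mono[OF _ i2])
        show "integrable ?M (\<lambda>y. (a powr q - q * a powr (q - 1) * a) * r y + (q * a powr (q - 1)) * (r y * h y))"
          by (intro Bochner_Integration.integrable_add integrable_mult_right ri i1)
        fix y
        have "r y * (a powr q + q * a powr (q - 1) * (h y - a)) \<le> r y * h y powr q"
          using q r0 h(2) a0 by (intro mult_left_mono powr_tangent) auto
        then show "(a powr q - q * a powr (q - 1) * a) * r y + (q * a powr (q - 1)) * (r y * h y) \<le> r y * h y powr q"
          by (simp add: algebra_simps)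
      qed
      finally show ?thesis .
    qed
    also have "\<dots> \<le> I" by (rule cmp[OF i2 le2])
    finally have aq: "a powr q \<le> I" .
    have "(LINT y|?M. r y * h y powr p y) \<le> (LINT y|?M. C / \<delta> ^ DIM('a) * h y powr p y)"
      by (rule integral_mono[OF i3 integrable_mult_right[OF h_i]]) (intro mult_right_mono rC, simp)
    also have "\<dots> = C / \<delta> ^ DIM('a) * rho h" using h(2) by (simp add: rho_def)
    also have "\<dots> \<le> C / \<delta> ^ DIM('a) * 1" by (rule mult_left_mono[OF h(3) B])
    finally have "I \<le> 1 + C / \<delta> ^ DIM('a)" by (simp add: I_def)
    also have "\<dots> \<le> (1 + C) / \<delta> ^ DIM('a)"
      using \<delta> C power_le_one[of \<delta> "DIM('a)"] by (simp add: field_simps)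
    finally have Ib: "I \<le> (1 + C) / \<delta> ^ DIM('a)" .
    have "I powr (p x - q) \<le> I powr \<kappa>" using I1 q by (intro powr_mono) auto
    also have "\<dots> \<le> ((1 + C) / \<delta> ^ DIM('a)) powr \<kappa>" using Ib I1 \<kappa> by (intro powr_mono2) auto
    also have "\<dots> = (1 + C) powr \<kappa> / (\<delta> ^ DIM('a)) powr \<kappa>" using C \<delta> by (simp add: powr_divide)
    also have "(\<delta> ^ DIM('a)) powr \<kappa> = exp (- (real DIM('a) * c))"
    proof -
      have "(\<delta> ^ DIM('a)) powr \<kappa> = exp (\<kappa> * (real DIM('a) * ln \<delta>))" using \<delta> by (simp add: powr_def ln_realpow)
      also have "\<kappa> * (real DIM('a) * ln \<delta>) = real DIM('a) * (\<kappa> * ln \<delta>)" by simp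
      finally show ?thesis by (simp add: \<kappa>(3))
    qed
    also have "(1 + C) powr \<kappa> / exp (- (real DIM('a) * c)) = (1 + C) powr \<kappa> * exp (real DIM('a) * c)"
      by (simp add: exp_minus field_simps)
    also have "\<dots> \<le> D" unfolding D_def using C \<kappa> by (intro mult_right_mono powr_mono) auto
    finally have ID: "I powr (p x - q) \<le> D" .
    \<comment> \<open>The power is split into the exponent \<open>q\<close>, which gives
      \<open>I\<close>, and the exponent \<open>p x - q\<close>, which is absorbed by
      \<open>D\<close>.\<close>
    have "a powr p x \<le> D * I"
    proof (cases "a = 0")
      case True
      then show ?thesis using I1 C by (simp add: D_def)
    next
      case False
      have "a powr p x = a powr q * a powr (p x - q)" by (simp flip: powr_add)
      also have "\<dots> \<le> I * I powr (p x - q)" using aq aI a0 q by (intro mult_mono powr_mono2) auto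
      also have "\<dots> \<le> I * D" using I1 by (intro mult_left_mono ID) auto
      finally show ?thesis by (simp add: mult.commute)
    qed
    then show "(LINT y|?M. \<rho> (x - y) * h y) powr p x \<le> D * (1 + (LINT y|?M. \<rho> (x - y) * h y powr p y))"
      by (simp add: a_def I_def r_def)
  qed
qed

lemma nn_integral_lebesgue_on_le: "(\<integral>\<^sup>+x. F x \<partial>lebesgue_on \<Omega>) \<le> (\<integral>\<^sup>+x. F x \<partial>lborel)"
proof -
  have "(\<integral>\<^sup>+x. F x \<partial>lebesgue_on \<Omega>) = (\<integral>\<^sup>+x. F x * indicator \<Omega> x \<partial>lebesgue)"
    using open_domain by (intro nn_integral_restrict_space) auto
  also have "\<dots> \<le> (\<integral>\<^sup>+x. F x \<partial>lebesgue)"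
    by (intro nn_integral_mono) (auto simp: indicator_def)
  finally show ?thesis by (simp add: nn_integral_completion)
qed

text \<open>Integrating the pointwise bound over \<open>x\<close>, Fubini leaves the modular of
  \<open>h\<close>. The factor \<open>c\<close> stays under the integral, so that it can be used
  without measurability of the integrand in \<open>x\<close>; the indicator confines the estimate to
  points whose ball lies in \<Omega>.\<close>

lemma mollify_modular:
  assumes lH: "log_Hoelder_on \<Omega> p" and C: "C > 0"
  shows "\<exists>E>0. \<forall>c \<delta> \<rho> h. 0 < c \<longrightarrow> 0 < \<delta> \<longrightarrow> \<delta> \<le> 1/4 \<longrightarrow> mollifier C \<delta> \<rho> \<longrightarrow> Lp h \<longrightarrow> (\<forall>y. 0 \<le> h y) \<longrightarrow> rho h \<le> 1 \<longrightarrow>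
      (\<integral>\<^sup>+x. ennreal c * (indicator {x. cball x \<delta> \<subseteq> \<Omega>} x * ennreal ((LINT y|lebesgue_on \<Omega>. \<rho> (x - y) * h y) powr p x)) \<partial>lebesgue_on \<Omega>)
        \<le> ennreal (c * E)"
proof -
  let ?M = "lebesgue_on \<Omega>"
  obtain D where D: "D > 0" "\<forall>\<delta> \<rho> h x. 0 < \<delta> \<longrightarrow> \<delta> \<le> 1/4 \<longrightarrow> mollifier C \<delta> \<rho> \<longrightarrow> Lp h \<longrightarrow> (\<forall>y. 0 \<le> h y) \<longrightarrow>
      rho h \<le> 1 \<longrightarrow> cball x \<delta> \<subseteq> \<Omega> \<longrightarrow>
      (LINT y|?M. \<rho> (x - y) * h y) powr p x \<le> D * (1 + (LINT y|?M. \<rho> (x - y) * h y powr p y))"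
    using mollify_pointwise[OF lH C] by blast
  interpret finite_measure ?M by (rule finite_M)
  show ?thesis
  proof (intro exI[of _ "D * (measure ?M \<Omega> + 1)"] conjI allI impI)
    show "D * (measure ?M \<Omega> + 1) > 0" using D(1) by (simp add: add_nonneg_pos)
    fix c \<delta> :: real and \<rho> h :: "'a \<Rightarrow> real"
    assume c: "0 < c" and \<delta>: "0 < \<delta>" "\<delta> \<le> 1/4" and \<rho>: "mollifier C \<delta> \<rho>" and h: "Lp h" "\<forall>y. 0 \<le> h y" "rho h \<le> 1"
    have sm: "smooth \<rho>" and \<rho>0: "\<And>z. 0 \<le> \<rho> z" and \<rho>z: "\<And>z. norm z \<ge> \<delta> \<Longrightarrow> \<rho> z = 0"
      and \<rho>C: "\<And>z. \<rho> z \<le> C / \<delta> ^ DIM('a)" and \<rho>1: "(LINT z|lborel. \<rho> z) = 1"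
      using \<rho> by (simp_all add: mollifier_def)
    have [measurable]: "\<rho> \<in> borel_measurable borel" by (rule borel_measurable_continuous_onI[OF smooth_continuous[OF sm]])
    have hm [measurable]: "h \<in> borel_measurable ?M" using h(1) Lp_measurable by blast
    have h_i: "integrable ?M (\<lambda>y. h y powr p y)" using h(1,2) by (simp add: Lp_def)
    then have "integrable lebesgue (\<lambda>y. indicator \<Omega> y *\<^sub>R (h y powr p y))"
      using open_domain by (simp add: integrable_lebesgue_on)
    then have "(\<lambda>y. indicator \<Omega> y *\<^sub>R (h y powr p y)) \<in> borel_measurable lebesgue" by simp
    from completion_ex_borel_measurable_real[OF this]
    \<comment> \<open>A Borel representative of the power of \<open>h\<close>, to be made
      nonnegative, because Fubini is applied on \<open>lborel\<close>.\<close>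
    obtain k0 where k0: "k0 \<in> borel_measurable lborel" "AE y in lborel. indicator \<Omega> y *\<^sub>R (h y powr p y) = k0 y" by blast
    define k where "k y = max 0 (k0 y)" for y
    have km [measurable]: "k \<in> borel_measurable borel" unfolding k_def using k0(1) by simp
    have kAE: "AE y in lborel. indicator \<Omega> y * (h y powr p y) = k y"
      using k0(2)
    proof eventually_elim
      case (elim y)
      have "0 \<le> k0 y" unfolding elim[symmetric] by simp
      then show ?case using elim by (simp add: k_def max_def)
    qed
    have kint: "(\<integral>\<^sup>+y. ennreal (f y) * ennreal (k y) \<partial>lborel) = (\<integral>\<^sup>+y. ennreal (f y * (h y powr p y)) \<partial>?M)"
      if "\<And>y. f y \<ge> 0" for f :: "'a \<Rightarrow> real"
    proof -
      have "(\<integral>\<^sup>+y. ennreal (f y) * ennreal (k y) \<partial>lborel) = (\<integral>\<^sup>+y. ennreal (f y * (h y powr p y)) * indicator \<Omega> y \<partial>lborel)"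
      proof (rule nn_integral_cong_AE)
        show "AE y in lborel. ennreal (f y) * ennreal (k y) = ennreal (f y * (h y powr p y)) * indicator \<Omega> y"
          using kAE
        proof eventually_elim
          case (elim y)
          have "k y \<ge> 0" by (simp add: k_def)
          then show ?case using elim that[of y] by (cases "y \<in> \<Omega>") (auto simp: ennreal_mult[symmetric])
        qed
      qed
      also have "\<dots> = (\<integral>\<^sup>+y. ennreal (f y * (h y powr p y)) * indicator \<Omega> y \<partial>lebesgue)"
        by (simp add: nn_integral_completion)
      also have "\<dots> = (\<integral>\<^sup>+y. ennreal (f y * (h y powr p y)) \<partial>?M)"
        using open_domain by (intro nn_integral_restrict_space[symmetric]) auto
      finally show ?thesis .
    qed
    define F where "F x = (\<integral>\<^sup>+y. ennreal (\<rho> (x - y)) * ennreal (k y) \<partial>lborel)" for x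
    have Fm: "F \<in> borel_measurable lborel"
      unfolding F_def by (rule lborel.borel_measurable_nn_integral) simp
    have FmM: "F \<in> borel_measurable ?M"
      by (rule measurable_restrict_space1[OF measurable_completion[OF Fm]])
    have Feq: "ennreal (LINT y|?M. \<rho> (x - y) * h y powr p y) = F x" for x
    proof -
      have rm: "(\<lambda>y. \<rho> (x - y)) \<in> borel_measurable ?M"
        by (rule measurable_restrict_space1[OF measurable_completion]) simp
      have "integrable ?M (\<lambda>y. \<rho> (x - y) * h y powr p y)"
      proof (rule Bochner_Integration.integrable_bound)
        show "integrable ?M (\<lambda>y. C / \<delta> ^ DIM('a) * h y powr p y)" using h_i by (rule integrable_mult_right)
        show "(\<lambda>y. \<rho> (x - y) * h y powr p y) \<in> borel_measurable ?M" using rm by measurable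
        show "AE y in ?M. norm (\<rho> (x - y) * h y powr p y) \<le> norm (C / \<delta> ^ DIM('a) * h y powr p y)"
        proof (rule AE_I2)
          fix y
          have "\<bar>\<rho> (x - y) * h y powr p y\<bar> = \<rho> (x - y) * h y powr p y" using \<rho>0 by simp
          also have "\<dots> \<le> C / \<delta> ^ DIM('a) * h y powr p y" by (intro mult_right_mono \<rho>C) simp
          also have "\<dots> \<le> \<bar>C / \<delta> ^ DIM('a) * h y powr p y\<bar>" by (rule abs_ge_self)
          finally show "norm (\<rho> (x - y) * h y powr p y) \<le> norm (C / \<delta> ^ DIM('a) * h y powr p y)"
            by (simp only: real_norm_def)
        qed
      qed
      then show ?thesis
        unfolding F_def using \<rho>0 by (subst kint) (auto intro!: nn_integral_eq_integral[symmetric] AE_I2)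
    qed
    have Fint: "(\<integral>\<^sup>+x. F x \<partial>lborel) \<le> 1"
    proof -
      have "(\<integral>\<^sup>+x. F x \<partial>lborel) = (\<integral>\<^sup>+y. \<integral>\<^sup>+x. ennreal (\<rho> (x - y)) * ennreal (k y) \<partial>lborel \<partial>lborel)"
        unfolding F_def by (rule lborel_pair.Fubini'[symmetric]) simp
      also have "\<dots> = (\<integral>\<^sup>+y. ennreal 1 * ennreal (k y) \<partial>lborel)"
      proof (rule nn_integral_cong)
        fix y
        have i: "integrable lborel (\<lambda>x. \<rho> (x - y))"
        proof (rule integrable_compact_support)
          show "continuous_on UNIV (\<lambda>x. \<rho> (x - y))"
            by (intro continuous_on_compose2[OF smooth_continuous[OF sm, of UNIV]] continuous_intros) auto
          show "compact (cball y \<delta>)" by simp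
          show "\<rho> (x - y) = 0" if "x \<notin> cball y \<delta>" for x
            using that by (intro \<rho>z) (simp add: dist_norm norm_minus_commute)
        qed
        have "(LINT x|lborel. \<rho> (x - y)) = 1"
          using lborel_integral_translate[of \<rho> "- y"] \<rho>1 by simp
        then have "(\<integral>\<^sup>+x. ennreal (\<rho> (x - y)) \<partial>lborel) = ennreal 1"
          using i \<rho>0 by (subst nn_integral_eq_integral) auto
        then show "(\<integral>\<^sup>+x. ennreal (\<rho> (x - y)) * ennreal (k y) \<partial>lborel) = ennreal 1 * ennreal (k y)"
          by (simp add: nn_integral_multc)
      qed
      also have "\<dots> = (\<integral>\<^sup>+y. ennreal (1 * (h y powr p y)) \<partial>?M)" by (rule kint) simp
      also have "\<dots> = ennreal (rho h)" using nn_integral_eq_rho[OF h(1)] h(2) by simp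
      also have "\<dots> \<le> 1" using h(3) by simp
      finally show ?thesis .
    qed
    have "(\<integral>\<^sup>+x. ennreal c * (indicator {x. cball x \<delta> \<subseteq> \<Omega>} x * ennreal ((LINT y|?M. \<rho> (x - y) * h y) powr p x)) \<partial>?M)
        \<le> (\<integral>\<^sup>+x. ennreal (c * D) * (1 + F x) \<partial>?M)"
    proof (rule nn_integral_mono)
      fix x
      show "ennreal c * (indicator {x. cball x \<delta> \<subseteq> \<Omega>} x * ennreal ((LINT y|?M. \<rho> (x - y) * h y) powr p x)) \<le> ennreal (c * D) * (1 + F x)"
      proof (cases "cball x \<delta> \<subseteq> \<Omega>")
        case True
        let ?L = "LINT y|?M. \<rho> (x - y) * h y powr p y"
        have L0: "?L \<ge> 0" using \<rho>0 by (intro Bochner_Integration.integral_nonneg) auto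
        have "(LINT y|?M. \<rho> (x - y) * h y) powr p x \<le> D * (1 + ?L)"
          using D(2) \<delta> \<rho> h True by blast
        then have "c * (LINT y|?M. \<rho> (x - y) * h y) powr p x \<le> c * (D * (1 + ?L))"
          using c by (intro mult_left_mono) auto
        then have "ennreal (c * (LINT y|?M. \<rho> (x - y) * h y) powr p x) \<le> ennreal (c * D * (1 + ?L))"
          by (intro ennreal_leI) (simp add: mult.assoc)
        also have "\<dots> = ennreal (c * D) * (1 + F x)"
          using c D(1) L0 by (simp add: ennreal_mult Feq[symmetric])
        finally show ?thesis using True c by (simp add: ennreal_mult)
      qed simp
    qed
    also have "\<dots> = ennreal (c * D) * (emeasure ?M \<Omega> + (\<integral>\<^sup>+x. F x \<partial>?M))"
      using FmM by (simp add: nn_integral_cmult nn_integral_add)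
    also have "\<dots> \<le> ennreal (c * D) * (emeasure ?M \<Omega> + 1)"
      using nn_integral_lebesgue_on_le[of F] Fint by (intro mult_left_mono add_left_mono) auto
    also have "emeasure ?M \<Omega> + 1 = ennreal (measure ?M \<Omega> + 1)"
      by (simp add: emeasure_eq_measure)
    also have "ennreal (c * D) * \<dots> = ennreal (c * (D * (measure ?M \<Omega> + 1)))"
      using c D(1) by (subst ennreal_mult[symmetric]) (auto simp: mult.assoc simp del: ennreal_plus)
    finally show "(\<integral>\<^sup>+x. ennreal c * (indicator {x. cball x \<delta> \<subseteq> \<Omega>} x * ennreal ((LINT y|?M. \<rho> (x - y) * h y) powr p x)) \<partial>?M)
        \<le> ennreal (c * (D * (measure ?M \<Omega> + 1)))" .
  qed
qed

section \<open>Test functions for compact sets of capacity zero\<close>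

lemma modular_eq_nn: "modular \<Omega> p (\<lambda>x. norm (V x)) = (\<integral>\<^sup>+x. ennreal (norm (V x) powr p x) \<partial>lebesgue_on \<Omega>)"
  by (simp add: modular_def)

lemma Lp_var_vec_measurable: "g \<in> Lp_var_vec \<Omega> p \<Longrightarrow> g \<in> borel_measurable (lebesgue_on \<Omega>)"
  unfolding Lp_var_vec_def Lp_var_def
  by (subst borel_measurable_euclidean_space) auto

text \<open>In the definition of the capacity of a compact null set one may use test functions, at the price
  of a smaller positive lower bound on \<open>K\<close>. The cut-off \<open>flat (t - 1/2)\<close> makes the mollified
  competitor vanish near the boundary.\<close>

lemma capacity_zero_test_function:
  assumes lH: "log_Hoelder_on \<Omega> p" and cap: "cap_compact \<Omega> p K = 0" and K: "K \<subseteq> \<Omega>" and \<eta>: "\<eta> > 0"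
  obtains \<phi> where "\<phi> \<in> X" "\<And>x. 0 \<le> \<phi> x" "\<And>x. \<phi> x \<le> 1" "\<And>x. x \<in> K \<Longrightarrow> flat (1/4) \<le> \<phi> x" "rho (grad \<phi>) \<le> \<eta>"
proof -
  let ?M = "lebesgue_on \<Omega>"
  obtain C where C: "C > 0" "\<And>\<delta>::real. \<delta> > 0 \<Longrightarrow> \<exists>\<rho> :: 'a \<Rightarrow> real. mollifier C \<delta> \<rho>"
    using mollifier_exists by blast
  obtain E where E: "E > 0" "\<forall>c \<delta> \<rho> h. 0 < c \<longrightarrow> 0 < \<delta> \<longrightarrow> \<delta> \<le> 1/4 \<longrightarrow> mollifier C \<delta> \<rho> \<longrightarrow> Lp h \<longrightarrow> (\<forall>y. 0 \<le> h y) \<longrightarrow> rho h \<le> 1 \<longrightarrow>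
      (\<integral>\<^sup>+x. ennreal c * (indicator {x. cball x \<delta> \<subseteq> \<Omega>} x * ennreal ((LINT y|lebesgue_on \<Omega>. \<rho> (x - y) * h y) powr p x)) \<partial>lebesgue_on \<Omega>)
        \<le> ennreal (c * E)"
    using mollify_modular[OF lH C(1)] by blast
  obtain flat' B where fl: "\<And>x. (flat has_real_derivative flat' x) (at x)"
    "\<And>x. x \<le> 0 \<Longrightarrow> flat' x = 0" "B > 0" "\<And>x. \<bar>flat' x\<bar> \<le> B"
    by (rule flat_has_derivative) (rule that)
  \<comment> \<open>The gradient of the competitor will have size \<open>t\<close>, the cut-off
    contributes \<open>B\<close> and mollification \<open>E\<close>. So
    \<open>B * t * E \<le> \<eta>\<close> is the target, and \<open>B * t \<le> 1\<close> lets its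
    exponent \<open>p x\<close> be lowered to 1.\<close>
  define t where "t = min 1 (min 1 (\<eta> / E) / B)"
  have t: "0 < t" "t \<le> 1" using \<eta> E fl by (auto simp: t_def)
  have "B * t \<le> B * (min 1 (\<eta> / E) / B)" unfolding t_def using fl by (intro mult_left_mono) auto
  then have "B * t \<le> min 1 (\<eta> / E)" using fl by simp
  then have Bt: "B * t \<le> 1" "B * t * E \<le> \<eta>" "0 < B * t" using E fl t by (auto simp: pos_le_divide_eq)
  have "(INF v\<in>{v \<in> W1p \<Omega> p \<inter> C_0 \<Omega>. (\<forall>x\<in>\<Omega>. 0 \<le> v x) \<and> (\<forall>x\<in>K. 1 \<le> v x)}.
        modular \<Omega> p (\<lambda>x. norm (weak_grad \<Omega> v x))) < ennreal (t powr pp)"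
    using cap t unfolding cap_compact_def by simp
  then obtain v where v: "v \<in> W1p \<Omega> p" "v \<in> C_0 \<Omega>" "\<And>x. x \<in> \<Omega> \<Longrightarrow> 0 \<le> v x" "\<And>x. x \<in> K \<Longrightarrow> 1 \<le> v x"
    and vm: "modular \<Omega> p (\<lambda>x. norm (weak_grad \<Omega> v x)) < ennreal (t powr pp)"
    unfolding INF_less_iff by blast
  obtain g where g: "has_weak_gradient \<Omega> v g" "g \<in> Lp_var_vec \<Omega> p"
    using v(1) unfolding W1p_def by blast
  have gm [measurable]: "g \<in> borel_measurable ?M" by (rule Lp_var_vec_measurable[OF g(2)])
  have "(\<integral>\<^sup>+x. ennreal (norm (g x) powr p x) \<partial>?M) = modular \<Omega> p (\<lambda>x. norm (weak_grad \<Omega> v x))"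
    unfolding modular_eq_nn using weak_grad_AE[OF open_domain g(1)]
    by (intro nn_integral_cong_AE) (auto elim: eventually_mono)
  then have gn: "(\<integral>\<^sup>+x. ennreal (norm (g x) powr p x) \<partial>?M) < ennreal (t powr pp)" using vm by simp
  then have Lg: "Lp g" unfolding Lp_iff_nn using gm by (auto intro: less_trans)
  have rg: "rho g \<le> t powr pp" using gn unfolding nn_integral_eq_rho[OF Lg] by (simp add: ennreal_less_iff rho_nonneg)
  \<comment> \<open>Normalised to modular at most 1, the form in which the mollification estimate
    applies.\<close>
  define h where "h y = (1/t) * norm (g y)" for y
  have Lh: "Lp h" unfolding h_def by (intro Lp_cmult Lp_norm Lg)
  have h0: "0 \<le> h y" for y using t by (simp add: h_def)
  have rh: "rho h \<le> 1"
  proof -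
    have "rho h = rho (\<lambda>y. (1/t) *\<^sub>R norm (g y))" by (simp add: h_def[abs_def])
    also have "\<dots> \<le> (1/t) powr pp * rho (\<lambda>y. norm (g y))" using t by (intro rho_scaleR(2) Lp_norm Lg) auto
    also have "\<dots> \<le> (1/t) powr pp * t powr pp" using rg by (intro mult_left_mono) (auto simp: rho_norm)
    also have "\<dots> = 1" using t by (simp add: powr_divide)
    finally show ?thesis .
  qed
  \<comment> \<open>The extension by 0 is continuous because the competitor vanishes on the
    frontier.\<close>
  define w where "w x = (if x \<in> \<Omega> then v x else 0)" for x
  have wc: "continuous_on UNIV w"
  proof -
    have "continuous_on (closure \<Omega> \<union> - \<Omega>) (\<lambda>x. if x \<in> \<Omega> then v x else 0)"
    proof (rule continuous_on_cases)
      show "continuous_on (closure \<Omega>) v" using v(2) by (simp add: C_0_def)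
      show "\<forall>x. x \<in> closure \<Omega> \<and> \<not> x \<in> \<Omega> \<or> x \<in> - \<Omega> \<and> x \<in> \<Omega> \<longrightarrow> v x = 0"
        using v(2) open_domain by (auto simp: C_0_def frontier_def interior_open)
    qed (use open_domain in auto)
    moreover have "closure \<Omega> \<union> - \<Omega> = UNIV" using closure_subset[of \<Omega>] by auto
    ultimately show ?thesis by (simp add: w_def[abs_def])
  qed
  have cl: "compact (closure \<Omega>)" using bounded_domain by (simp add: compact_closure)
  have w0: "w y = 0" if "y \<notin> closure \<Omega>" for y using that closure_subset by (auto simp: w_def)
  obtain R where R: "\<And>x. x \<in> \<Omega> \<Longrightarrow> norm x \<le> R" using bounded_domain by (auto simp: bounded_iff)
  have "uniformly_continuous_on (cball 0 (R + 1)) w"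
    by (rule compact_uniformly_continuous[OF continuous_on_subset[OF wc]]) auto
  then obtain d0 where d0: "d0 > 0"
    "\<And>x y. x \<in> cball 0 (R + 1) \<Longrightarrow> y \<in> cball 0 (R + 1) \<Longrightarrow> dist y x < d0 \<Longrightarrow> dist (w y) (w x) < 1/4"
    unfolding uniformly_continuous_on_def by (metis zero_less_divide_1_iff zero_less_numeral)
  \<comment> \<open>At this scale \<open>w\<close> oscillates by less than 1/4, so its mollification
    stays within 1/4 of it and is at least 3/4 on \<open>K\<close>; the other bound 1/4 is the range
    of the mollification estimate.\<close>
  define \<delta> where "\<delta> = min (1/4) (d0 / 2)"
  have \<delta>: "0 < \<delta>" "\<delta> \<le> 1/4" "\<delta> < d0" using d0 by (auto simp: \<delta>_def)
  have osc: "\<bar>w y - w x\<bar> < 1/4" if "dist x y \<le> \<delta>" for x y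
  proof (cases "x \<in> \<Omega> \<or> y \<in> \<Omega>")
    case True
    have "norm x \<le> R + 1" "norm y \<le> R + 1"
      using True R[of x] R[of y] that \<delta> norm_triangle_ineq2[of x y] norm_triangle_ineq2[of y x]
      by (auto simp: dist_norm norm_minus_commute)
    then show ?thesis using d0(2)[of x y] that \<delta> by (simp add: dist_commute[of x y] dist_real_def)
  qed (simp add: w_def)
  obtain \<rho> :: "'a \<Rightarrow> real" where mol: "mollifier C \<delta> \<rho>" using C(2)[OF \<delta>(1)] by blast
  then have \<rho>: "smooth \<rho>" "\<And>z. 0 \<le> \<rho> z" "\<And>z. norm z \<ge> \<delta> \<Longrightarrow> \<rho> z = 0"
      "\<And>z. \<rho> (- z) = \<rho> z" "\<And>z. \<rho> z \<le> C / \<delta> ^ DIM('a)" "(LINT z|lborel. \<rho> z) = 1"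
    by (simp_all add: mollifier_def)
  define cv where "cv x = (LINT y|lborel. w y * \<rho> (x - y))" for x
  have cvs: "smooth cv" unfolding cv_def by (rule convolution_smooth[OF wc cl w0 \<rho>(1)])
  have close: "\<bar>cv x - w x\<bar> \<le> 1/4" for x
  proof -
    have rc: "continuous_on UNIV (\<lambda>y. \<rho> (x - y))"
      by (intro continuous_on_compose2[OF smooth_continuous[OF \<rho>(1), of UNIV]] continuous_intros) auto
    have rz: "\<rho> (x - y) = 0" if "y \<notin> cball x \<delta>" for y
      using that by (intro \<rho>(3)) (simp add: dist_norm)
    have i1: "integrable lborel (\<lambda>y. \<rho> (x - y))" by (rule integrable_compact_support[OF rc compact_cball rz])
    have i2: "integrable lborel (\<lambda>y. w y * \<rho> (x - y))"
      by (rule integrable_compact_support[OF continuous_on_mult[OF wc rc] compact_cball[of x \<delta>]]) (simp add: rz)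
    have r1: "(LINT y|lborel. \<rho> (x - y)) = 1"
    proof -
      have "(LINT y|lborel. \<rho> (x - y)) = (LINT y|lborel. \<rho> (- x + y))"
        by (subst \<rho>(4)[symmetric]) simp
      also have "\<dots> = 1"
        using lborel_integral_translate[of \<rho> "- x"] borel_measurable_continuous_onI[OF smooth_continuous[OF \<rho>(1)]] \<rho>(6) by simp
      finally show ?thesis .
    qed
    have "cv x - w x = (LINT y|lborel. w y * \<rho> (x - y) - w x * \<rho> (x - y))"
      using i1 i2 r1 by (simp add: cv_def)
    also have "\<bar>\<dots>\<bar> \<le> (LINT y|lborel. \<bar>w y * \<rho> (x - y) - w x * \<rho> (x - y)\<bar>)" by (rule integral_abs_bound)
    also have "\<dots> \<le> (LINT y|lborel. (1/4) * \<rho> (x - y))"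
    proof (rule integral_mono)
      show "integrable lborel (\<lambda>y. \<bar>w y * \<rho> (x - y) - w x * \<rho> (x - y)\<bar>)" using i1 i2 by auto
      show "integrable lborel (\<lambda>y. (1/4) * \<rho> (x - y))" using i1 by auto
      show "\<bar>w y * \<rho> (x - y) - w x * \<rho> (x - y)\<bar> \<le> (1/4) * \<rho> (x - y)" for y
      proof (cases "y \<in> cball x \<delta>")
        case True
        then have "\<bar>w y - w x\<bar> \<le> 1/4" using osc[of x y] by simp
        then have "\<bar>w y - w x\<bar> * \<rho> (x - y) \<le> (1/4) * \<rho> (x - y)" by (intro mult_right_mono \<rho>(2))
        then show ?thesis using \<rho>(2)[of "x - y"] by (simp add: abs_mult flip: left_diff_distrib)
      qed (simp add: rz)
    qed
    also have "\<dots> = 1/4" using r1 by simp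
    finally show ?thesis .
  qed
  \<comment> \<open>Where the mollification is at least 1/2, \<open>w\<close> is at least 1/4 at
    \<open>x\<close>, hence positive on the whole ball, while \<open>w\<close> vanishes off
    \<Omega>.\<close>
  have inner: "cball x \<delta> \<subseteq> \<Omega>" if "1/2 \<le> cv x" for x
  proof
    fix y assume y: "y \<in> cball x \<delta>"
    show "y \<in> \<Omega>"
    proof (rule ccontr)
      assume "y \<notin> \<Omega>"
      then have "w y = 0" by (simp add: w_def)
      then show False using osc[of x y] y close[of x] that by (simp add: abs_le_iff abs_less_iff)
    qed
  qed
  define \<phi> where "\<phi> x = flat (cv x - 1/2)" for x
  have sm: "smooth (\<lambda>x. cv x - 1/2)" by (intro smooth_diff cvs smooth_const)
  have g\<phi>: "grad \<phi> x = flat' (cv x - 1/2) *\<^sub>R grad cv x" for x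
    unfolding \<phi>_def using grad_compose[of flat _ "\<lambda>x. cv x - 1/2", OF fl(1) sm] grad_diff[OF cvs smooth_const, of "1/2" x] by simp
  have gcv: "norm (grad cv x) \<le> t * (LINT y|?M. \<rho> (x - y) * h y)" if x: "cball x \<delta> \<subseteq> \<Omega>" for x
  proof -
    have "grad cv x = (LINT y|?M. \<rho> (x - y) *\<^sub>R g y)"
      using grad_convolution[OF g(1) wc[unfolded w_def[abs_def]] \<rho>(1,3) x] unfolding cv_def w_def by simp
    then have "norm (grad cv x) \<le> (LINT y|?M. norm (\<rho> (x - y) *\<^sub>R g y))" by (simp only: integral_norm_bound)
    also have "\<dots> = (LINT y|?M. t * (\<rho> (x - y) * h y))"
      using t \<rho>(2) by (intro Bochner_Integration.integral_cong refl) (simp add: h_def)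
    finally show ?thesis by simp
  qed
  show thesis
  proof (rule that[of \<phi>])
    show X: "\<phi> \<in> X"
    proof (rule test_functionsI)
      show "smooth \<phi>" unfolding \<phi>_def by (rule smooth_flat[OF sm])
      let ?S = "{x. 1/2 \<le> cv x}"
      show S: "?S \<subseteq> \<Omega>"
      proof
        fix x assume "x \<in> ?S"
        then have "cball x \<delta> \<subseteq> \<Omega>" using inner by simp
        then show "x \<in> \<Omega>" using \<delta> by (meson centre_in_cball less_imp_le subsetD)
      qed
      have "closed ?S" by (rule closed_Collect_le) (auto intro!: smooth_continuous cvs)
      then show "compact ?S" using S bounded_subset[OF bounded_domain] by (simp add: compact_eq_bounded_closed)
      show "\<phi> x = 0" if "x \<notin> ?S" for x using that by (simp add: \<phi>_def flat_eq_0)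
    qed
    show "0 \<le> \<phi> x" "\<phi> x \<le> 1" for x by (simp_all add: \<phi>_def flat_le_1)
    show "flat (1/4) \<le> \<phi> x" if "x \<in> K" for x
    proof -
      have "1 \<le> w x" using v(4)[OF that] K that by (auto simp: w_def)
      then have "1/4 \<le> cv x - 1/2" using close[of x] unfolding abs_le_iff by argo
      then show ?thesis unfolding \<phi>_def by (rule flat_mono)
    qed
    have "ennreal (rho (grad \<phi>)) = (\<integral>\<^sup>+x. ennreal (norm (grad \<phi> x) powr p x) \<partial>?M)"
      by (rule nn_integral_eq_rho[OF X_Lp_grad[OF X], symmetric])
    also have "\<dots> \<le> (\<integral>\<^sup>+x. ennreal (B * t) * (indicator {x. cball x \<delta> \<subseteq> \<Omega>} x * ennreal ((LINT y|?M. \<rho> (x - y) * h y) powr p x)) \<partial>?M)"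
    proof (rule nn_integral_mono)
      fix x assume "x \<in> space ?M"
      then have px: "1 < p x" by (rule p_gt_1)
      let ?a = "LINT y|?M. \<rho> (x - y) * h y"
      show "ennreal (norm (grad \<phi> x) powr p x) \<le> ennreal (B * t) * (indicator {x. cball x \<delta> \<subseteq> \<Omega>} x * ennreal (?a powr p x))"
      proof (cases "cv x \<le> 1/2")
        case True
        then show ?thesis using px by (simp add: g\<phi> fl(2))
      next
        case False
        then have x: "cball x \<delta> \<subseteq> \<Omega>" using inner by simp
        have a0: "?a \<ge> 0" using \<rho>(2) h0 by (intro Bochner_Integration.integral_nonneg) auto
        have "norm (grad \<phi> x) \<le> B * (t * ?a)"
          unfolding g\<phi> norm_scaleR using fl gcv[OF x] by (intro mult_mono) (auto intro: less_imp_le)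
        then have "norm (grad \<phi> x) powr p x \<le> (B * t * ?a) powr p x"
          using px by (intro powr_mono2) (auto simp: mult.assoc)
        also have "\<dots> = (B * t) powr p x * ?a powr p x" using Bt(3) a0 by (simp add: powr_mult)
        also have "\<dots> \<le> (B * t) powr 1 * ?a powr p x"
          using Bt px by (intro mult_right_mono powr_mono') auto
        finally have "norm (grad \<phi> x) powr p x \<le> B * t * ?a powr p x" using Bt(3) by simp
        then have "ennreal (norm (grad \<phi> x) powr p x) \<le> ennreal (B * t) * ennreal (?a powr p x)"
          using Bt(3) by (simp add: ennreal_leI ennreal_mult[symmetric])
        then show ?thesis using x by simp
      qed
    qed
    also have "\<dots> \<le> ennreal (B * t * E)"
      using E(2) Bt(3) \<delta>(1,2) mol Lh h0 rh by blast
    finally have "rho (grad \<phi>) \<le> B * t * E" using Bt E by (simp add: rho_nonneg)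
    then show "rho (grad \<phi>) \<le> \<eta>" using Bt(2) by simp
  qed
qed

end

section \<open>Signed measures\<close>

locale signed_on =
  fixes \<Omega> :: "'a::euclidean_space set" and \<mu> :: "'a set \<Rightarrow> real"
  assumes open_space: "open \<Omega>" and signed: "signed_measure \<Omega> \<mu>" and tv: "total_variation \<Omega> \<mu> \<Omega> < \<infinity>"
begin

lemma borel_sets_iff: "A \<in> borel_sets \<Omega> \<longleftrightarrow> A \<subseteq> \<Omega> \<and> A \<in> sets borel"
  using open_space by (subst sets_restrict_space_iff) auto

lemma borel_sets_sigma: "sigma_algebra \<Omega> (borel_sets \<Omega>)"
  using sets.sigma_algebra_axioms[of "restrict_space borel \<Omega>"] by (simp add: space_restrict_space)

lemma sums: "range A \<subseteq> borel_sets \<Omega> \<Longrightarrow> disjoint_family A \<Longrightarrow> (\<lambda>i. \<mu> (A i)) sums \<mu> (\<Union>i. A i)"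
  using signed unfolding signed_measure_def by blast

text \<open>The constant sequence of empty sets is disjoint, and a constant series converges only if
  its terms are 0.\<close>

lemma empty [simp]: "\<mu> {} = 0"
proof -
  have "(\<lambda>i::nat. \<mu> {}) sums \<mu> (\<Union>i::nat. {})"
    by (rule sums) (auto simp: disjoint_family_on_def)
  then have "summable (\<lambda>i::nat. \<mu> {})" by (rule sums_summable)
  then show ?thesis by (simp add: summable_const_iff)
qed

lemma Un_disjoint:
  assumes "A \<in> borel_sets \<Omega>" "B \<in> borel_sets \<Omega>" "A \<inter> B = {}"
  shows "\<mu> (A \<union> B) = \<mu> A + \<mu> B"
proof -
  let ?F = "binaryset A B"
  have "(\<lambda>i. \<mu> (?F i)) sums \<mu> (\<Union>i. ?F i)"
  proof (rule sums)
    show "range ?F \<subseteq> borel_sets \<Omega>" using assms by (auto simp: range_binaryset_eq)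
    show "disjoint_family ?F" using assms(3) by (auto simp: disjoint_family_on_def binaryset_def)
  qed
  moreover have "(\<lambda>i. \<mu> (?F i)) sums (\<mu> A + \<mu> B)"
    using binaryset_sums[of \<mu> A B] by simp
  ultimately show ?thesis
    unfolding UN_binaryset_eq by (rule sums_unique2)
qed

lemma Diff_subset: "A \<in> borel_sets \<Omega> \<Longrightarrow> E \<in> borel_sets \<Omega> \<Longrightarrow> A \<subseteq> E \<Longrightarrow> \<mu> (E - A) = \<mu> E - \<mu> A"
  using Un_disjoint[of A "E - A"] by (simp add: Un_absorb1 sets.Diff)

lemma bounded_by_tv:
  assumes "A \<in> borel_sets \<Omega>"
  shows "ennreal \<bar>\<mu> A\<bar> \<le> total_variation \<Omega> \<mu> \<Omega>"
proof (cases "A = {}")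
  case False
  \<comment> \<open>A partition has no empty member, so the complement is removed when it is
    empty.\<close>
  let ?P = "{A, \<Omega> - A} - {{}}"
  have \<Omega>: "\<Omega> \<in> borel_sets \<Omega>" using open_space by (simp add: borel_sets_iff)
  have "?P \<subseteq> borel_sets \<Omega>" using assms \<Omega> by auto
  moreover have "partition_on \<Omega> ?P"
    using assms by (auto simp: partition_on_def disjoint_def borel_sets_iff)
  ultimately have P: "?P \<in> {P. finite P \<and> P \<subseteq> borel_sets \<Omega> \<and> partition_on \<Omega> P}" by simp
  have "ennreal \<bar>\<mu> A\<bar> \<le> (\<Sum>A\<in>?P. ennreal \<bar>\<mu> A\<bar>)"
    using False by (intro member_le_sum) auto
  also have "\<dots> \<le> total_variation \<Omega> \<mu> \<Omega>"
    unfolding total_variation_def by (rule SUP_upper[OF P])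
  finally show ?thesis .
qed simp

section \<open>The positive variation as a measure\<close>

definition pos_var :: "'a set \<Rightarrow> ennreal" where
  "pos_var E = (SUP A\<in>{A \<in> borel_sets \<Omega>. A \<subseteq> E}. ennreal (\<mu> A))"

lemma pos_var_upper: "A \<in> borel_sets \<Omega> \<Longrightarrow> A \<subseteq> E \<Longrightarrow> ennreal (\<mu> A) \<le> pos_var E"
  unfolding pos_var_def by (rule SUP_upper) simp

lemma pos_var_mono: "E \<subseteq> F \<Longrightarrow> pos_var E \<le> pos_var F"
  unfolding pos_var_def by (intro SUP_subset_mono) auto

lemma pos_var_le_tv: "pos_var E \<le> total_variation \<Omega> \<mu> \<Omega>"
  unfolding pos_var_def
proof (rule SUP_least)
  fix A assume "A \<in> {A \<in> borel_sets \<Omega>. A \<subseteq> E}"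
  then have "ennreal \<bar>\<mu> A\<bar> \<le> total_variation \<Omega> \<mu> \<Omega>" by (intro bounded_by_tv) simp
  moreover have "ennreal (\<mu> A) \<le> ennreal \<bar>\<mu> A\<bar>" by (intro ennreal_leI) simp
  ultimately show "ennreal (\<mu> A) \<le> total_variation \<Omega> \<mu> \<Omega>" by (rule order_trans[rotated])
qed

text \<open>Unions of competitors compete for the union. When one of the two values is negative it
  is cut off at 0, and the other set competes alone.\<close>

lemma pos_var_superadditive:
  assumes "E \<inter> F = {}"
  shows "pos_var E + pos_var F \<le> pos_var (E \<union> F)"
proof -
  have *: "ennreal (\<mu> A) + ennreal (\<mu> B) \<le> pos_var (E \<union> F)"
    if A: "A \<in> borel_sets \<Omega>" "A \<subseteq> E" and B: "B \<in> borel_sets \<Omega>" "B \<subseteq> F" for A B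
  proof -
    consider "\<mu> A \<ge> 0 \<and> \<mu> B \<ge> 0" | "\<mu> A \<le> 0" | "\<mu> B \<le> 0" by linarith
    then show ?thesis
    proof cases
      case 1
      then have "ennreal (\<mu> A) + ennreal (\<mu> B) = ennreal (\<mu> (A \<union> B))"
        using A B assms by (subst Un_disjoint) auto
      also have "\<dots> \<le> pos_var (E \<union> F)" using A B by (intro pos_var_upper) auto
      finally show ?thesis .
    next
      case 2
      then show ?thesis using B by (auto simp: ennreal_neg intro!: pos_var_upper)
    next
      case 3
      then show ?thesis using A by (auto simp: ennreal_neg intro!: pos_var_upper)
    qed
  qed
  have ne: "{A \<in> borel_sets \<Omega>. A \<subseteq> G} \<noteq> {}" for G by auto
  have "pos_var E + ennreal (\<mu> B) \<le> pos_var (E \<union> F)" if B: "B \<in> borel_sets \<Omega>" "B \<subseteq> F" for B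
    unfolding pos_var_def[of E] ennreal_SUP_add_left[OF ne, symmetric]
    by (rule SUP_least) (use * B in auto)
  then show ?thesis
    unfolding pos_var_def[of F] ennreal_SUP_add_right[OF ne] by (intro SUP_least) auto
qed

lemma ennreal_add_le: "ennreal (a + b) \<le> ennreal a + ennreal b"
proof -
  have "ennreal (a + b) \<le> ennreal (max 0 a + max 0 b)" by (intro ennreal_leI) simp
  also have "\<dots> = ennreal (max 0 a) + ennreal (max 0 b)" by (rule ennreal_plus) auto
  also have "\<dots> = ennreal a + ennreal b" by (simp add: max_def ennreal_neg)
  finally show ?thesis .
qed

lemma ennreal_sum_le: "ennreal (\<Sum>i<n. f i) \<le> (\<Sum>i<n. ennreal (f i))" for n :: nat
proof (induction n)
  case (Suc n)
  then show ?case using ennreal_add_le[of "\<Sum>i<n. f i" "f n"] by (simp add: add_right_mono order_trans)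
qed simp

text \<open>One inequality is superadditivity along finite unions; for the other a competitor is cut
  into its pieces in the sets \<open>F i\<close>, each a competitor there.\<close>

lemma pos_var_countably_additive: "countably_additive (borel_sets \<Omega>) pos_var"
  unfolding countably_additive_def
proof (intro allI impI antisym)
  fix F :: "nat \<Rightarrow> 'a set"
  assume F: "range F \<subseteq> borel_sets \<Omega>" "disjoint_family F" "(\<Union>i. F i) \<in> borel_sets \<Omega>"
  show "(\<Sum>i. pos_var (F i)) \<le> pos_var (\<Union>i. F i)"
  proof (rule suminf_le_const)
    show "(\<Sum>i<n. pos_var (F i)) \<le> pos_var (\<Union>i. F i)" for n
    proof -
      have "(\<Sum>i<n. pos_var (F i)) \<le> pos_var (\<Union>i<n. F i)"
      proof (induction n)
        case (Suc n)
        have dis: "(\<Union>i<n. F i) \<inter> F n = {}"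
        proof -
          have "F i \<inter> F n = {}" if "i < n" for i
            by (rule disjoint_family_onD[OF F(2)]) (use that in auto)
          then show ?thesis by blast
        qed
        have "(\<Sum>i<Suc n. pos_var (F i)) \<le> pos_var (\<Union>i<n. F i) + pos_var (F n)"
          using Suc by (simp add: add_right_mono)
        also have "\<dots> \<le> pos_var ((\<Union>i<n. F i) \<union> F n)" by (rule pos_var_superadditive[OF dis])
        also have "(\<Union>i<n. F i) \<union> F n = (\<Union>i<Suc n. F i)" by (auto simp: less_Suc_eq)
        finally show ?case .
      qed simp
      also have "\<dots> \<le> pos_var (\<Union>i. F i)" by (rule pos_var_mono) auto
      finally show ?thesis .
    qed
  qed auto
  show "pos_var (\<Union>i. F i) \<le> (\<Sum>i. pos_var (F i))"
    unfolding pos_var_def[of "\<Union>i. F i"]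
  proof (rule SUP_least)
    fix A assume A: "A \<in> {A \<in> borel_sets \<Omega>. A \<subseteq> (\<Union>i. F i)}"
    have AF: "A \<inter> F i \<in> borel_sets \<Omega>" for i using A F(1) by (intro sets.Int) auto
    have "(\<lambda>i. \<mu> (A \<inter> F i)) sums \<mu> (\<Union>i. A \<inter> F i)"
      by (rule sums) (use AF F(2) in \<open>auto simp: disjoint_family_on_def\<close>)
    also have "(\<Union>i. A \<inter> F i) = A" using A by auto
    finally have lim: "(\<lambda>n. ennreal (\<Sum>i<n. \<mu> (A \<inter> F i))) \<longlonglongrightarrow> ennreal (\<mu> A)"
      unfolding sums_def by (rule tendsto_ennrealI)
    have "ennreal (\<Sum>i<n. \<mu> (A \<inter> F i)) \<le> (\<Sum>i. pos_var (F i))" for n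
    proof -
      have "ennreal (\<Sum>i<n. \<mu> (A \<inter> F i)) \<le> (\<Sum>i<n. ennreal (\<mu> (A \<inter> F i)))" by (rule ennreal_sum_le)
      also have "\<dots> \<le> (\<Sum>i<n. pos_var (F i))" by (intro sum_mono pos_var_upper AF) auto
      also have "\<dots> \<le> (\<Sum>i. pos_var (F i))" by (rule sum_le_suminf) auto
      finally show ?thesis .
    qed
    then show "ennreal (\<mu> A) \<le> (\<Sum>i. pos_var (F i))" by (intro LIMSEQ_le_const2[OF lim]) blast
  qed
qed

definition P :: "'a measure" where "P = positive_part \<Omega> \<mu>"

lemma P_eq: "P = measure_of \<Omega> (borel_sets \<Omega>) pos_var"
  unfolding P_def positive_part_def pos_var_def ..

lemma sets_P [measurable_cong]: "sets P = borel_sets \<Omega>"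
  unfolding P_eq using borel_sets_sigma
  by (subst sets_measure_of) (auto simp: borel_sets_iff sigma_algebra.sigma_sets_eq)

lemma space_P: "space P = \<Omega>"
  unfolding P_eq by (rule space_measure_of) (auto simp: borel_sets_iff)

lemma emeasure_P: "E \<in> borel_sets \<Omega> \<Longrightarrow> emeasure P E = pos_var E"
proof (rule emeasure_measure_of[OF P_eq])
  show "positive (sets P) pos_var"
    unfolding positive_def pos_var_def by (auto intro!: antisym SUP_least)
  show "countably_additive (sets P) pos_var" unfolding sets_P by (rule pos_var_countably_additive)
qed (auto simp: borel_sets_iff sets_P)

lemma finite_P: "finite_measure P"
proof
  have "emeasure P (space P) \<le> total_variation \<Omega> \<mu> \<Omega>"
    unfolding space_P using open_space by (subst emeasure_P) (auto simp: borel_sets_iff pos_var_le_tv)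
  then show "emeasure P (space P) \<noteq> \<infinity>" using tv by (auto simp: top_unique)
qed

lemma measure_P_upper:
  assumes "A \<in> borel_sets \<Omega>" "E \<in> borel_sets \<Omega>" "A \<subseteq> E"
  shows "\<mu> A \<le> measure P E"
proof -
  have "ennreal (\<mu> A) \<le> ennreal (measure P E)"
    using pos_var_upper[OF assms(1,3)] emeasure_P[OF assms(2)] finite_measure.emeasure_eq_measure[OF finite_P] by simp
  then show ?thesis by (simp add: ennreal_le_iff)
qed

lemma measure_P_least:
  assumes "E \<in> borel_sets \<Omega>" "\<And>A. A \<in> borel_sets \<Omega> \<Longrightarrow> A \<subseteq> E \<Longrightarrow> \<mu> A \<le> c"
  shows "measure P E \<le> c"
proof -
  have c: "c \<ge> 0" using assms(2)[of "{}"] by simp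
  have "emeasure P E \<le> ennreal c"
    unfolding emeasure_P[OF assms(1)] pos_var_def by (intro SUP_least ennreal_leI) (use assms(2) in auto)
  then show ?thesis using c by (simp add: finite_measure.emeasure_eq_measure[OF finite_P])
qed

end

section \<open>The Jordan decomposition\<close>

lemma signed_on_uminus:
  assumes "signed_on \<Omega> \<mu>"
  shows "signed_on \<Omega> (\<lambda>A. - \<mu> A)"
proof
  interpret signed_on \<Omega> \<mu> by fact
  show "open \<Omega>" by (rule open_space)
  show "signed_measure \<Omega> (\<lambda>A. - \<mu> A)"
    unfolding signed_measure_def using sums by (auto intro: sums_minus)
  show "total_variation \<Omega> (\<lambda>A. - \<mu> A) \<Omega> < \<infinity>"
    using tv by (simp add: total_variation_def)
qed

text \<open>For \<open>A \<subseteq> E\<close> the value \<open>\<mu> A\<close> is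
  \<open>\<mu> E - \<mu> (E - A)\<close>, and \<open>E - A\<close> competes for the negative part.
  Exchanging \<open>\<mu>\<close> with its negative gives the other half of the
  decomposition.\<close>

lemma jordan_le:
  assumes "signed_on \<Omega> \<mu>" "E \<in> borel_sets \<Omega>"
  shows "measure (positive_part \<Omega> \<mu>) E \<le> measure (positive_part \<Omega> (\<lambda>A. - \<mu> A)) E + \<mu> E"
proof -
  interpret p: signed_on \<Omega> \<mu> by fact
  interpret n: signed_on \<Omega> "\<lambda>A. - \<mu> A" by (rule signed_on_uminus[OF assms(1)])
  have "measure p.P E \<le> measure n.P E + \<mu> E"
  proof (rule p.measure_P_least[OF assms(2)])
    fix A assume A: "A \<in> borel_sets \<Omega>" "A \<subseteq> E"
    have "- \<mu> (E - A) \<le> measure n.P E"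
      using A assms(2) by (intro n.measure_P_upper) auto
    then show "\<mu> A \<le> measure n.P E + \<mu> E"
      using p.Diff_subset[OF A(1) assms(2) A(2)] by simp
  qed
  then show ?thesis by (simp add: p.P_def n.P_def)
qed

lemma jordan:
  assumes "signed_on \<Omega> \<mu>" "E \<in> borel_sets \<Omega>"
  shows "\<mu> E = measure (positive_part \<Omega> \<mu>) E - measure (positive_part \<Omega> (\<lambda>A. - \<mu> A)) E"
  using jordan_le[OF assms] jordan_le[OF signed_on_uminus[OF assms(1)] assms(2)] by simp

lemma signed_integral_uminus: "signed_integral \<Omega> (\<lambda>A. - \<mu> A) \<phi> = - signed_integral \<Omega> \<mu> \<phi>"
  by (simp add: signed_integral_def)

subsection \<open>Regularity\<close>

locale finite_on =
  fixes \<Omega> :: "'a::euclidean_space set" and Q :: "'a measure"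
  assumes open_space: "open \<Omega>" and sets_Q: "sets Q = borel_sets \<Omega>" and finite_Q: "finite_measure Q"
begin

lemma sets_iff: "A \<in> sets Q \<longleftrightarrow> A \<subseteq> \<Omega> \<and> A \<in> sets borel"
  unfolding sets_Q using open_space by (subst sets_restrict_space_iff) auto

lemma space_Q: "space Q = \<Omega>"
  using sets_eq_imp_space_eq[OF sets_Q] by (simp add: space_restrict_space)

text \<open>The push-forward to the whole space, where the regularity theorems for finite Borel
  measures apply; \<open>Q\<close> itself lives on \<Omega>.\<close>

definition Q' :: "'a measure" where "Q' = distr Q borel (\<lambda>x. x)"

lemma id_measurable: "(\<lambda>x. x) \<in> Q \<rightarrow>\<^sub>M borel"
  unfolding measurable_cong_sets[OF sets_Q refl] by (rule measurable_restrict_space1) simp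

lemma emeasure_Q': "A \<in> sets borel \<Longrightarrow> emeasure Q' A = emeasure Q (A \<inter> \<Omega>)"
  unfolding Q'_def by (subst emeasure_distr[OF id_measurable]) (auto simp: space_Q)

lemma Q'_regular: "sets Q' = sets borel" "emeasure Q' (space Q') \<noteq> \<infinity>"
proof -
  show "sets Q' = sets borel" by (simp add: Q'_def)
  have "space Q' = UNIV" by (simp add: Q'_def)
  then show "emeasure Q' (space Q') \<noteq> \<infinity>"
    using finite_measure.emeasure_finite[OF finite_Q] by (simp add: emeasure_Q')
qed

lemma inner_compact:
  assumes "A \<in> sets Q" "\<epsilon> > 0"
  obtains K where "compact K" "K \<subseteq> A" "K \<in> sets Q" "measure Q A \<le> measure Q K + \<epsilon>"
proof -
  have A: "A \<subseteq> \<Omega>" "A \<in> sets borel" using assms(1) by (auto simp: sets_iff)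
  have em: "emeasure Q B = ennreal (measure Q B)" for B by (rule finite_measure.emeasure_eq_measure[OF finite_Q])
  show thesis
  \<comment> \<open>In the first case the empty set serves. In the second
    \<open>measure Q A - \<epsilon>\<close> is positive, so that nothing is cut off in
    \<open>ennreal\<close>.\<close>
  proof (cases "measure Q A \<le> \<epsilon>")
    case True
    then show ?thesis using that[of "{}"] by (simp add: sets_iff)
  next
    case False
    have "ennreal (measure Q A - \<epsilon>) < emeasure Q A"
      unfolding em using False assms(2) by (simp add: ennreal_less_iff)
    also have "\<dots> = emeasure Q' A" using A by (simp add: emeasure_Q' Int_absorb2)
    also have "\<dots> = (SUP K\<in>{K. K \<subseteq> A \<and> compact K}. emeasure Q' K)"
      by (rule inner_regular[OF Q'_regular A(2)])
    finally obtain K where K: "K \<subseteq> A" "compact K" "ennreal (measure Q A - \<epsilon>) < emeasure Q' K"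
      unfolding less_SUP_iff by blast
    have Ks: "K \<in> sets borel" using K(2) by (rule borel_compact)
    have KO: "K \<inter> \<Omega> = K" using K(1) A(1) by auto
    have "ennreal (measure Q A - \<epsilon>) < ennreal (measure Q K)"
      using K(3) emeasure_Q'[OF Ks] by (simp add: KO em)
    then have "measure Q A \<le> measure Q K + \<epsilon>" using False by (simp add: ennreal_less_iff)
    then show ?thesis using that[OF K(2,1)] Ks KO by (auto simp: sets_iff)
  qed
qed

lemma outer_open:
  assumes "compact K" "K \<subseteq> \<Omega>" "\<epsilon> > 0"
  obtains U where "open U" "K \<subseteq> U" "U \<subseteq> \<Omega>" "measure Q U \<le> measure Q K + \<epsilon>"
proof -
  have Ks: "K \<in> sets borel" using assms(1) by (rule borel_compact)
  have em: "emeasure Q B = ennreal (measure Q B)" for B by (rule finite_measure.emeasure_eq_measure[OF finite_Q])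
  have KO: "K \<inter> \<Omega> = K" using assms by auto
  have "(INF U\<in>{U. K \<subseteq> U \<and> open U}. emeasure Q' U) = emeasure Q' K"
    by (rule outer_regular[OF Q'_regular Ks, symmetric])
  also have "\<dots> = ennreal (measure Q K)" using emeasure_Q'[OF Ks] by (simp add: KO em)
  also have "\<dots> < ennreal (measure Q K + \<epsilon>)" using assms(3) by (simp add: ennreal_less_iff)
  finally obtain U where U: "K \<subseteq> U" "open U" "emeasure Q' U < ennreal (measure Q K + \<epsilon>)"
    unfolding INF_less_iff by blast
  have "emeasure Q' U = ennreal (measure Q (U \<inter> \<Omega>))" using U(2) by (simp add: emeasure_Q' em)
  then have "measure Q (U \<inter> \<Omega>) \<le> measure Q K + \<epsilon>" using U(3) by (simp add: ennreal_less_iff)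
  then show ?thesis using that[of "U \<inter> \<Omega>"] U assms open_space by auto
qed

lemma integrable_bounded_continuous:
  assumes "continuous_on \<Omega> f" "\<And>x. x \<in> \<Omega> \<Longrightarrow> \<bar>f x\<bar> \<le> (B::real)"
  shows "integrable Q f"
proof (rule finite_measure.integrable_const_bound[OF finite_Q])
  show "AE x in Q. norm (f x) \<le> B" by (rule AE_I2) (use assms(2) space_Q in auto)
  show "f \<in> borel_measurable Q"
    unfolding measurable_cong_sets[OF sets_Q refl] using assms(1) by (rule borel_measurable_continuous_on_restrict)
qed

end

context var_exp
begin

lemma Lp_zero: "Lp (\<lambda>x. 0)"
  by (simp add: Lp_def)

lemma Lp_sum: "finite I \<Longrightarrow> (\<And>i. i \<in> I \<Longrightarrow> Lp (V i)) \<Longrightarrow> Lp (\<lambda>x. \<Sum>i\<in>I. V i x)"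
  by (induction I rule: finite_induct) (auto intro: Lp_zero Lp_add(1))

lemma Lp_components:
  fixes G :: "'a \<Rightarrow> 'b::euclidean_space"
  shows "Lp G \<longleftrightarrow> (\<forall>b\<in>Basis. Lp (\<lambda>x. G x \<bullet> b))"
proof
  assume L: "Lp G"
  then have [measurable]: "G \<in> borel_measurable M" by (rule Lp_measurable)
  show "\<forall>b\<in>Basis. Lp (\<lambda>x. G x \<bullet> b)"
    by (auto intro!: Lp_bound(1)[OF L] AE_I2 Basis_le_norm)
next
  assume "\<forall>b\<in>Basis. Lp (\<lambda>x. G x \<bullet> b)"
  then have c: "Lp (\<lambda>x. G x \<bullet> b)" if "b \<in> Basis" for b using that by blast
  have "Lp (\<lambda>x. (G x \<bullet> b) *\<^sub>R b)" if "b \<in> Basis" for b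
  proof (rule Lp_bound(1)[OF c[OF that]])
    have [measurable]: "(\<lambda>x. G x \<bullet> b) \<in> borel_measurable M" by (rule Lp_measurable[OF c[OF that]])
    show "(\<lambda>x. (G x \<bullet> b) *\<^sub>R b) \<in> borel_measurable M" by measurable
  qed (use that in auto)
  then have "Lp (\<lambda>x. \<Sum>b\<in>Basis. (G x \<bullet> b) *\<^sub>R b)" by (intro Lp_sum) auto
  then show "Lp G" by (simp add: euclidean_representation)
qed

end

lemma Lp_var_cong:
  assumes "\<And>x. x \<in> \<Omega> \<Longrightarrow> r x = s x"
  shows "Lp_var \<Omega> r = Lp_var \<Omega> s"
proof -
  have "modular \<Omega> r f = modular \<Omega> s f" for f
    unfolding modular_def by (rule nn_integral_cong) (simp add: assms)
  then show ?thesis by (simp add: Lp_var_def)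
qed

context sobolev
begin

lemma Lp_var_iff: "f \<in> Lp_var \<Omega> p \<longleftrightarrow> Lp f"
  by (simp add: Lp_var_def modular_def Lp_iff_nn)

lemma Lp_var_vec_iff: "g \<in> Lp_var_vec \<Omega> p \<longleftrightarrow> Lp g"
  unfolding Lp_var_vec_def using Lp_components[of g] by (simp add: Lp_var_iff)

lemma Lp_var_vec_dual_iff:
  assumes "\<And>x. x \<in> \<Omega> \<Longrightarrow> p' x = p x / (p x - 1)"
  shows "G \<in> Lp_var_vec \<Omega> p' \<longleftrightarrow> Lq G"
proof -
  interpret D: var_exp "lebesgue_on \<Omega>" dual_p "pp / (pp - 1)" qp by (rule var_exp_dual)
  have "Lp_var \<Omega> p' = Lp_var \<Omega> dual_p" by (rule Lp_var_cong) (simp add: assms dual_p_def)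
  then have "f \<in> Lp_var \<Omega> p' \<longleftrightarrow> D.Lp f" for f by (simp add: Lp_var_def modular_def D.Lp_iff_nn)
  then show ?thesis by (simp add: Lp_var_vec_def Lq_eq D.Lp_components[of G])
qed

subsection \<open>Luxemburg norms\<close>

lemma modular_eq_rho: "Lp f \<Longrightarrow> modular \<Omega> p f = ennreal (rho f)"
  using nn_integral_eq_rho[of f] by (simp add: modular_def)

lemma luxemburg_set:
  assumes "Lp f"
  shows "\<exists>t>0. modular \<Omega> p (\<lambda>x. f x / t) \<le> 1"
proof -
  \<comment> \<open>For \<open>t \<ge> 1\<close> the modular of \<open>f x / t\<close> is at most
    \<open>rho f / t\<close>, because \<open>pm\<close> exceeds 1.\<close>
  define t where "t = max 1 (rho f)"
  have t: "t \<ge> 1" "rho f \<le> t" by (auto simp: t_def)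
  have L: "Lp (\<lambda>x. (1/t) *\<^sub>R f x)" by (rule Lp_scaleR[OF assms])
  have "rho (\<lambda>x. (1/t) *\<^sub>R f x) \<le> (1/t) powr pm * rho f"
    using t by (intro rho_scaleR(1)[OF assms]) auto
  also have "\<dots> \<le> (1/t) powr 1 * t"
    using t pm_gt_1 rho_nonneg by (intro mult_mono powr_mono') auto
  also have "\<dots> = 1" using t by simp
  finally have "modular \<Omega> p (\<lambda>x. (1/t) *\<^sub>R f x) \<le> 1" unfolding modular_eq_rho[OF L] by simp
  then show ?thesis using t by (intro exI[of _ t]) simp
qed

lemma luxemburg_nonneg: "Lp f \<Longrightarrow> 0 \<le> luxemburg_norm \<Omega> p f"
  unfolding luxemburg_norm_def using luxemburg_set[of f] by (intro cInf_greatest) auto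

text \<open>The direction in which norm and modular are compared: a small modular forces a small
  norm. The exponent is \<open>pp\<close> because the scalar \<open>1 / t\<close> is at least
  1.\<close>

lemma luxemburg_le:
  assumes "Lp f" "0 < t" "t \<le> 1" "rho f \<le> t powr pp"
  shows "luxemburg_norm \<Omega> p f \<le> t"
proof -
  have L: "Lp (\<lambda>x. (1/t) *\<^sub>R f x)" by (rule Lp_scaleR[OF assms(1)])
  have "rho (\<lambda>x. (1/t) *\<^sub>R f x) \<le> (1/t) powr pp * rho f"
    using assms by (intro rho_scaleR(2)[OF assms(1)]) auto
  also have "\<dots> \<le> (1/t) powr pp * t powr pp" using assms by (intro mult_left_mono) auto
  also have "\<dots> = 1" using assms by (simp add: powr_divide)
  finally have "modular \<Omega> p (\<lambda>x. (1/t) *\<^sub>R f x) \<le> 1" unfolding modular_eq_rho[OF L] by simp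
  then have "modular \<Omega> p (\<lambda>x. f x / t) \<le> 1" by (simp add: field_simps)
  then show ?thesis
    unfolding luxemburg_norm_def using assms(2) by (intro cInf_lower bdd_belowI[of _ 0]) auto
qed

lemma luxemburg_weak_grad:
  assumes "has_weak_gradient \<Omega> u g"
  shows "luxemburg_norm \<Omega> p (\<lambda>x. norm (weak_grad \<Omega> u x)) = luxemburg_norm \<Omega> p (\<lambda>x. norm (g x))"
proof -
  have "modular \<Omega> p (\<lambda>x. norm (weak_grad \<Omega> u x) / t) = modular \<Omega> p (\<lambda>x. norm (g x) / t)" for t
    unfolding modular_def using weak_grad_AE[OF open_domain assms]
    by (intro nn_integral_cong_AE) (auto elim: eventually_mono)
  then show ?thesis by (simp add: luxemburg_norm_def)
qed

lemma W1p_norm_eq: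
  assumes "has_weak_gradient \<Omega> u g"
  shows "W1p_norm \<Omega> p u = luxemburg_norm \<Omega> p u + luxemburg_norm \<Omega> p (\<lambda>x. norm (g x))"
  by (simp add: W1p_norm_def luxemburg_weak_grad[OF assms])

lemma X_W1p_norm: "\<phi> \<in> X \<Longrightarrow> W1p_norm \<Omega> p \<phi> = luxemburg_norm \<Omega> p \<phi> + luxemburg_norm \<Omega> p (\<lambda>x. norm (grad \<phi> x))"
  by (intro W1p_norm_eq smooth_has_weak_gradient X_smooth open_domain)

lemma X_W1p: "\<phi> \<in> X \<Longrightarrow> \<phi> \<in> W1p \<Omega> p"
  using smooth_has_weak_gradient[OF X_smooth open_domain, of \<phi>] X_Lp X_Lp_grad
  by (auto simp: W1p_def Lp_var_iff Lp_var_vec_iff)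

lemma X_W1p_norm_le:
  assumes "\<phi> \<in> X" "0 < t" "t \<le> 1" "rho \<phi> \<le> t powr pp" "rho (grad \<phi>) \<le> t powr pp"
  shows "W1p_norm \<Omega> p \<phi> \<le> 2 * t"
  unfolding X_W1p_norm[OF assms(1)]
  using luxemburg_le[OF X_Lp[OF assms(1)] assms(2-4)]
    luxemburg_le[OF Lp_norm[OF X_Lp_grad[OF assms(1)]] assms(2,3)] assms(5) by (simp add: rho_norm)

lemma X_W1p_0: "\<phi> \<in> X \<Longrightarrow> \<phi> \<in> W1p_0 \<Omega> p"
  unfolding W1p_0_def
proof (intro CollectI conjI allI impI)
  assume \<phi>: "\<phi> \<in> X"
  show "\<phi> \<in> W1p \<Omega> p" by (rule X_W1p[OF \<phi>])
  fix e :: real assume e: "e > 0"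
  have "W1p_norm \<Omega> p (\<lambda>x. 0) \<le> 2 * min 1 (e / 4)"
    by (rule X_W1p_norm_le[OF test_functions_zero]) (use e in \<open>auto simp: rho_def\<close>)
  then have "W1p_norm \<Omega> p (\<lambda>x. \<phi> x - \<phi> x) < e" using e by (auto simp: min_def split: if_splits)
  then show "\<exists>\<psi>\<in>X. W1p_norm \<Omega> p (\<lambda>x. \<phi> x - \<psi> x) < e" using \<phi> by blast
qed

subsection \<open>Vector fields define functionals\<close>

text \<open>\<open>weak_grad\<close> chooses among all weak gradients; choosing among those in
  \<open>Lp\<close> gives integrability against fields in \<open>Lq\<close> at once.\<close>

definition Lp_grad :: "('a \<Rightarrow> real) \<Rightarrow> 'a \<Rightarrow> 'a" where
  "Lp_grad u = (SOME g. has_weak_gradient \<Omega> u g \<and> Lp g)"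

lemma Lp_grad_weak_gradient:
  assumes "u \<in> W1p \<Omega> p"
  shows "has_weak_gradient \<Omega> u (Lp_grad u)" "Lp (Lp_grad u)"
proof -
  have "\<exists>g. has_weak_gradient \<Omega> u g \<and> Lp g" using assms by (simp add: W1p_def Lp_var_vec_iff)
  from someI_ex[OF this] show "has_weak_gradient \<Omega> u (Lp_grad u)" "Lp (Lp_grad u)"
    by (auto simp: Lp_grad_def)
qed

lemma field_integral_unique:
  assumes "Lq G" "has_weak_gradient \<Omega> u g" "has_weak_gradient \<Omega> u h" "Lp g" "Lp h"
  shows "(LINT x|lebesgue_on \<Omega>. G x \<bullet> g x) = (LINT x|lebesgue_on \<Omega>. G x \<bullet> h x)"
proof (rule integral_cong_AE)
  have [measurable]: "G \<in> borel_measurable (lebesgue_on \<Omega>)" "g \<in> borel_measurable (lebesgue_on \<Omega>)"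
    "h \<in> borel_measurable (lebesgue_on \<Omega>)"
    using assms Lq_measurable Lp_measurable by blast+
  show "(\<lambda>x. G x \<bullet> g x) \<in> borel_measurable (lebesgue_on \<Omega>)" "(\<lambda>x. G x \<bullet> h x) \<in> borel_measurable (lebesgue_on \<Omega>)"
    by measurable
  show "AE x in lebesgue_on \<Omega>. G x \<bullet> g x = G x \<bullet> h x"
    using weak_gradient_unique[OF open_domain assms(2,3)] by eventually_elim simp
qed

text \<open>For every \<open>t\<close> admissible in the Luxemburg norm of \<open>g\<close>, Young's
  inequality for \<open>G x\<close> and \<open>(1/t) *\<^sub>R g x\<close> bounds the pairing by
  \<open>t * (rhoq G + 1)\<close>; then take the infimum over \<open>t\<close>. This replaces
  Hoelder's inequality.\<close>

lemma field_functional_bound: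
  assumes G: "Lq G" and u: "Lp u" "has_weak_gradient \<Omega> u g" "Lp g"
  shows "\<bar>LINT x|lebesgue_on \<Omega>. G x \<bullet> g x\<bar> \<le> (rhoq G + 1) * W1p_norm \<Omega> p u"
proof -
  let ?I = "LINT x|lebesgue_on \<Omega>. G x \<bullet> g x"
  have c: "rhoq G + 1 > 0" using rhoq_nonneg[of G] by (simp add: add_nonneg_pos)
  have "\<bar>?I\<bar> / (rhoq G + 1) \<le> luxemburg_norm \<Omega> p (\<lambda>x. norm (g x))"
    unfolding luxemburg_norm_def
  proof (rule cInf_greatest)
    show "{t. 0 < t \<and> modular \<Omega> p (\<lambda>x. norm (g x) / t) \<le> 1} \<noteq> {}"
      using luxemburg_set[OF Lp_norm[OF u(3)]] by auto
    fix t assume "t \<in> {t. 0 < t \<and> modular \<Omega> p (\<lambda>x. norm (g x) / t) \<le> 1}"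
    then have t: "t > 0" "modular \<Omega> p (\<lambda>x. norm (g x) / t) \<le> 1" by auto
    have L: "Lp (\<lambda>x. (1/t) *\<^sub>R g x)" by (rule Lp_scaleR[OF u(3)])
    have "modular \<Omega> p (\<lambda>x. norm (g x) / t) = modular \<Omega> p (\<lambda>x. norm ((1/t) *\<^sub>R g x))"
      using t by simp
    also have "\<dots> = ennreal (rho (\<lambda>x. (1/t) *\<^sub>R g x))"
      using modular_eq_rho[OF Lp_norm[OF L]] by (simp only: rho_norm)
    finally have r: "rho (\<lambda>x. (1/t) *\<^sub>R g x) \<le> 1" using t(2) by simp
    have "\<bar>?I\<bar> \<le> (LINT x|lebesgue_on \<Omega>. norm (G x) * norm (g x))" by (rule inner_integrable(2)[OF G u(3)])
    also have "\<dots> = (LINT x|lebesgue_on \<Omega>. t * (norm (G x) * norm ((1/t) *\<^sub>R g x)))"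
      using t by (intro Bochner_Integration.integral_cong refl) simp
    also have "\<dots> = t * (LINT x|lebesgue_on \<Omega>. norm (G x) * norm ((1/t) *\<^sub>R g x))" by (rule integral_mult_right_zero)
    also have "\<dots> \<le> t * (rhoq G + 1)"
      using young_integrable(2)[OF G L] r t by (intro mult_left_mono) auto
    finally show "\<bar>?I\<bar> / (rhoq G + 1) \<le> t" using c by (simp add: pos_divide_le_eq)
  qed
  also have "\<dots> \<le> W1p_norm \<Omega> p u"
    using luxemburg_nonneg[OF u(1)] by (simp add: W1p_norm_eq[OF u(2)])
  finally show ?thesis using c by (simp add: pos_divide_le_eq mult.commute)
qed

text \<open>The choice hidden in \<open>Lp_grad\<close> is additive and homogeneous almost
  everywhere, which is enough under the integral.\<close>

lemma field_in_dual:
  assumes G: "Lq G"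
  shows "(\<lambda>u. LINT x|lebesgue_on \<Omega>. G x \<bullet> Lp_grad u x) \<in> dual_W1p_0 \<Omega> p"
  unfolding dual_W1p_0_def
proof (intro CollectI conjI ballI allI)
  have W: "u \<in> W1p \<Omega> p" if "u \<in> W1p_0 \<Omega> p" for u using that by (simp add: W1p_0_def)
  have Lu: "Lp u" if "u \<in> W1p \<Omega> p" for u using that by (simp add: W1p_def Lp_var_iff)
  fix u assume u: "u \<in> W1p_0 \<Omega> p"
  note gu = Lp_grad_weak_gradient[OF W[OF u]]
  show "(LINT x|lebesgue_on \<Omega>. G x \<bullet> Lp_grad (\<lambda>x. u x + v x) x) =
      (LINT x|lebesgue_on \<Omega>. G x \<bullet> Lp_grad u x) + (LINT x|lebesgue_on \<Omega>. G x \<bullet> Lp_grad v x)"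
    if v: "v \<in> W1p_0 \<Omega> p" for v
  proof -
    note gv = Lp_grad_weak_gradient[OF W[OF v]]
    note s = has_weak_gradient_add[OF open_domain gu(1) gv(1)] Lp_add(1)[OF gu(2) gv(2)]
    have "(\<lambda>x. u x + v x) \<in> W1p \<Omega> p"
      using s Lp_add(1)[OF Lu[OF W[OF u]] Lu[OF W[OF v]]] by (auto simp: W1p_def Lp_var_iff Lp_var_vec_iff)
    from field_integral_unique[OF G Lp_grad_weak_gradient(1)[OF this] s(1) Lp_grad_weak_gradient(2)[OF this] s(2)]
    show ?thesis
      using inner_integrable(1)[OF G gu(2)] inner_integrable(1)[OF G gv(2)] by (simp add: inner_add_right)
  qed
  show "(LINT x|lebesgue_on \<Omega>. G x \<bullet> Lp_grad (\<lambda>x. c * u x) x) = c * (LINT x|lebesgue_on \<Omega>. G x \<bullet> Lp_grad u x)" for c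
  proof -
    note s = has_weak_gradient_cmult[OF gu(1), of c] Lp_scaleR[OF gu(2), of c]
    have "(\<lambda>x. c * u x) \<in> W1p \<Omega> p"
      using s Lp_cmult[OF Lu[OF W[OF u]]] by (auto simp: W1p_def Lp_var_iff Lp_var_vec_iff)
    from field_integral_unique[OF G Lp_grad_weak_gradient(1)[OF this] s(1) Lp_grad_weak_gradient(2)[OF this] s(2)]
    show ?thesis by simp
  qed
next
  show "\<exists>C. \<forall>u\<in>W1p_0 \<Omega> p. \<bar>LINT x|lebesgue_on \<Omega>. G x \<bullet> Lp_grad u x\<bar> \<le> C * W1p_norm \<Omega> p u"
  proof (intro exI ballI)
    fix u assume "u \<in> W1p_0 \<Omega> p"
    then have u: "u \<in> W1p \<Omega> p" by (simp add: W1p_0_def)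
    then have "Lp u" by (simp add: W1p_def Lp_var_iff)
    from field_functional_bound[OF G this Lp_grad_weak_gradient[OF u]]
    show "\<bar>LINT x|lebesgue_on \<Omega>. G x \<bullet> Lp_grad u x\<bar> \<le> (rhoq G + 1) * W1p_norm \<Omega> p u" .
  qed
qed

lemma field_functional_test:
  assumes "Lq G" "\<phi> \<in> X"
  shows "(LINT x|lebesgue_on \<Omega>. G x \<bullet> Lp_grad \<phi> x) = (LINT x|lebesgue_on \<Omega>. G x \<bullet> grad \<phi> x)"
  by (rule field_integral_unique[OF assms(1) Lp_grad_weak_gradient(1)[OF X_W1p[OF assms(2)]]
      smooth_has_weak_gradient[OF X_smooth[OF assms(2)] open_domain] Lp_grad_weak_gradient(2)[OF X_W1p[OF assms(2)]] X_Lp_grad[OF assms(2)]])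

subsection \<open>Measures in the dual do not charge null sets\<close>

text \<open>Integrating the divergence of \<open>\<phi> x *\<^sub>R x\<close> replaces the usual one-dimensional argument.\<close>

lemma poincare:
  obtains R where "R > 0" "\<And>\<phi>. \<phi> \<in> X \<Longrightarrow> (\<And>x. 0 \<le> \<phi> x) \<Longrightarrow>
    (LINT x|lebesgue_on \<Omega>. \<phi> x) \<le> R * (LINT x|lebesgue_on \<Omega>. norm (grad \<phi> x))"
proof -
  let ?M = "lebesgue_on \<Omega>"
  obtain R where R: "R > 0" "\<And>x. x \<in> \<Omega> \<Longrightarrow> norm x \<le> R"
    using bounded_domain by (auto simp: bounded_pos)
  show thesis
  proof (rule that[OF R(1)])
    fix \<phi> assume \<phi>: "\<phi> \<in> X" and nn: "\<And>x. 0 \<le> \<phi> x"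
    note i = test_functions_integrable[OF \<phi> open_domain]
    have gi: "integrable ?M (\<lambda>x. (x \<bullet> b) * (grad \<phi> x \<bullet> b))" if b: "b \<in> Basis" for b
    proof -
      obtain K where K: "compact K" "K \<subseteq> \<Omega>" "\<And>x. x \<notin> K \<Longrightarrow> grad \<phi> x = 0"
        using test_functionsE[OF \<phi>] by metis
      show ?thesis
        by (rule integrable_lebesgue_on_compact_support[OF _ K(1) _ K(2)])
          (use K open_domain b in \<open>auto intro!: continuous_intros smooth_continuous smooth_grad_inner X_smooth[OF \<phi>]\<close>)
    qed
    have b0: "(LINT x|?M. \<phi> x) = - (LINT x|?M. (x \<bullet> b) * (grad \<phi> x \<bullet> b))" if b: "b \<in> Basis" for b
    proof -
      have t: "(\<lambda>x. (x \<bullet> b) * \<phi> x) \<in> X" by (rule test_functions_mult[OF \<phi> smooth_inner])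
      have "0 = (LINT x|?M. grad (\<lambda>x. (x \<bullet> b) * \<phi> x) x) \<bullet> b"
        by (simp add: integral_grad_eq_0[OF t open_domain])
      also have "\<dots> = (LINT x|?M. grad (\<lambda>x. (x \<bullet> b) * \<phi> x) x \<bullet> b)"
        by (rule integral_inner_left[symmetric]) (use test_functions_integrable(2)[OF t open_domain] in simp)
      also have "\<dots> = (LINT x|?M. (x \<bullet> b) * (grad \<phi> x \<bullet> b) + \<phi> x)"
        using b by (simp add: grad_mult[OF smooth_inner X_smooth[OF \<phi>]] inner_add_left)
      also have "\<dots> = (LINT x|?M. (x \<bullet> b) * (grad \<phi> x \<bullet> b)) + (LINT x|?M. \<phi> x)"
        using gi[OF b] i by simp
      finally show ?thesis by simp
    qed
    have I0: "(LINT x|?M. \<phi> x) \<ge> 0" using nn by simp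
    \<comment> \<open>Summing the identity over the coordinates counts the integral of \<phi> as
      often as the dimension, at least once, and assembles
      \<open>x \<bullet> grad \<phi> x\<close>.\<close>
    have "(LINT x|?M. \<phi> x) \<le> real DIM('a) * (LINT x|?M. \<phi> x)"
      using I0 DIM_positive[where 'a = 'a] by (simp add: mult_le_cancel_right1 Suc_leI)
    also have "\<dots> = (\<Sum>b\<in>(Basis::'a set). (LINT x|?M. \<phi> x))" by simp
    also have "\<dots> = (\<Sum>b\<in>(Basis::'a set). - (LINT x|?M. (x \<bullet> b) * (grad \<phi> x \<bullet> b)))"
      by (intro sum.cong refl b0)
    also have "\<dots> = - (LINT x|?M. (\<Sum>b\<in>Basis. (x \<bullet> b) * (grad \<phi> x \<bullet> b)))"
      by (subst Bochner_Integration.integral_sum) (use gi in \<open>auto simp: sum_negf\<close>)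
    also have "\<dots> = - (LINT x|?M. x \<bullet> grad \<phi> x)" by (simp add: euclidean_inner[symmetric])
    also have "\<dots> \<le> (LINT x|?M. norm (x \<bullet> grad \<phi> x))"
      by (metis abs_ge_minus_self integral_norm_bound order_trans real_norm_def)
    also have "\<dots> \<le> (LINT x|?M. R * norm (grad \<phi> x))"
    proof (rule integral_mono)
      have "integrable ?M (\<lambda>x. \<Sum>b\<in>Basis. (x \<bullet> b) * (grad \<phi> x \<bullet> b))" using gi by (intro Bochner_Integration.integrable_sum)
      then show "integrable ?M (\<lambda>x. norm (x \<bullet> grad \<phi> x))" by (simp add: euclidean_inner[symmetric])
      show "integrable ?M (\<lambda>x. R * norm (grad \<phi> x))" using i by auto
      fix x assume "x \<in> space ?M"
      then have "norm x * norm (grad \<phi> x) \<le> R * norm (grad \<phi> x)" using R(2) by (intro mult_right_mono) auto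
      then show "norm (x \<bullet> grad \<phi> x) \<le> R * norm (grad \<phi> x)"
        using Cauchy_Schwarz_ineq2[of x "grad \<phi> x"] by simp
    qed
    finally show "(LINT x|?M. \<phi> x) \<le> R * (LINT x|?M. norm (grad \<phi> x))" by simp
  qed
qed

text \<open>The Poincare inequality bounds the integral by that of the gradient norm, which is small
  because the constant 1 lies in the dual space.\<close>

lemma integral_small:
  assumes "\<epsilon> > 0"
  obtains \<eta> where "\<eta> > 0" "\<And>\<phi>. \<phi> \<in> X \<Longrightarrow> (\<And>x. 0 \<le> \<phi> x) \<Longrightarrow> rho (grad \<phi>) \<le> \<eta> \<Longrightarrow>
    (LINT x|lebesgue_on \<Omega>. \<phi> x) \<le> \<epsilon>"
proof -
  obtain R where R: "R > 0" "\<And>\<phi>. \<phi> \<in> X \<Longrightarrow> (\<And>x. 0 \<le> \<phi> x) \<Longrightarrow>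
    (LINT x|lebesgue_on \<Omega>. \<phi> x) \<le> R * (LINT x|lebesgue_on \<Omega>. norm (grad \<phi> x))"
    using poincare by blast
  have "Lq (\<lambda>x. 1::real)" unfolding Lq_eq by (rule var_exp.Lp_bounded[OF var_exp_dual, of _ 1]) auto
  moreover have "\<epsilon> / R > 0" using assms R by simp
  ultimately obtain \<eta> where \<eta>: "\<eta> > 0" "\<And>H :: 'a \<Rightarrow> 'a. Lp H \<Longrightarrow> rho H \<le> \<eta> \<Longrightarrow>
      (LINT x|lebesgue_on \<Omega>. norm (1::real) * norm (H x)) \<le> \<epsilon> / R"
    by (rule Lq_small) (rule that)
  show thesis
  proof (rule that[OF \<eta>(1)])
    fix \<phi> assume \<phi>: "\<phi> \<in> X" "\<And>x. 0 \<le> \<phi> x" "rho (grad \<phi>) \<le> \<eta>"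
    have "(LINT x|lebesgue_on \<Omega>. norm (grad \<phi> x)) \<le> \<epsilon> / R" using \<eta>(2)[OF X_Lp_grad[OF \<phi>(1)] \<phi>(3)] by simp
    then have "R * (LINT x|lebesgue_on \<Omega>. norm (grad \<phi> x)) \<le> R * (\<epsilon> / R)" using R(1) by (intro mult_left_mono) auto
    then show "(LINT x|lebesgue_on \<Omega>. \<phi> x) \<le> \<epsilon>" using R(2)[OF \<phi>(1,2)] R(1) by simp
  qed
qed

text \<open>The continuity shared by both summands of L^1 plus the dual. The factor \<zeta>
  localises: \<eta> may depend on it, so one can first choose where to test and then how small the
  energy has to be.\<close>

definition vanishing :: "(('a \<Rightarrow> real) \<Rightarrow> real) \<Rightarrow> bool" where
  "vanishing L \<longleftrightarrow> (\<forall>\<zeta>\<in>X. \<forall>\<epsilon>>0. \<exists>\<eta>>0. \<forall>\<phi>\<in>X. (\<forall>x. 0 \<le> \<phi> x \<and> \<phi> x \<le> 1) \<longrightarrow> rho (grad \<phi>) \<le> \<eta> \<longrightarrow>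
     \<bar>L (\<lambda>x. \<phi> x * \<zeta> x)\<bar> \<le> \<epsilon>)"

text \<open>Up to the bound of \<zeta>, the part of \<open>f\<close> above a level \<open>n\<close>
  contributes little; below that level the contribution is at most \<open>n\<close> times the
  integral of \<phi>, which \<open>integral_small\<close> makes small.\<close>

lemma vanishing_L1:
  assumes f: "integrable (lebesgue_on \<Omega>) f"
  shows "vanishing (\<lambda>\<phi>. LINT x|lebesgue_on \<Omega>. f x * \<phi> x)"
  unfolding vanishing_def
proof (intro ballI allI impI)
  let ?M = "lebesgue_on \<Omega>"
  fix \<zeta> and \<epsilon> :: real assume \<zeta>: "\<zeta> \<in> X" and \<epsilon>: "\<epsilon> > 0"
  obtain Z where Z: "Z > 0" "\<And>x. \<bar>\<zeta> x\<bar> \<le> Z" using test_functions_bounded[OF \<zeta>] by metis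
  have [measurable]: "f \<in> borel_measurable ?M" using f by auto
  have "(\<lambda>n. LINT x|?M. \<bar>f x\<bar> * indicator {x. \<bar>f x\<bar> > real n} x) \<longlonglongrightarrow> (LINT x|?M. 0)"
  proof (rule integral_dominated_convergence[where w = "\<lambda>x. \<bar>f x\<bar>"])
    show "AE x in ?M. (\<lambda>n. \<bar>f x\<bar> * indicator {x. \<bar>f x\<bar> > real n} x) \<longlonglongrightarrow> 0"
    proof (rule AE_I2)
      fix x
      obtain N where N: "\<bar>f x\<bar> \<le> real N" using real_arch_simple by blast
      have "\<forall>\<^sub>F n in sequentially. \<bar>f x\<bar> * indicator {x. \<bar>f x\<bar> > real n} x = 0"
        using eventually_ge_at_top[of N] by eventually_elim (use N in auto)
      then show "(\<lambda>n. \<bar>f x\<bar> * indicator {x. \<bar>f x\<bar> > real n} x) \<longlonglongrightarrow> 0" by (rule tendsto_eventually)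
    qed
    show "AE x in ?M. norm (\<bar>f x\<bar> * indicator {x. \<bar>f x\<bar> > real n} x) \<le> \<bar>f x\<bar>" for n
      by (rule AE_I2) (auto simp: indicator_def)
  qed (use f in auto)
  then have "\<forall>\<^sub>F n in sequentially. (LINT x|?M. \<bar>f x\<bar> * indicator {x. \<bar>f x\<bar> > real n} x) < \<epsilon> / (2 * Z)"
    using \<epsilon> Z by (intro order_tendstoD(2)[where y = 0]) auto
  then obtain n where n: "(LINT x|?M. \<bar>f x\<bar> * indicator {x. \<bar>f x\<bar> > real n} x) < \<epsilon> / (2 * Z)"
    using eventually_happens'[OF sequentially_bot] by blast
  define e where "e = \<epsilon> / (2 * Z * (real n + 1))"
  have "e > 0" using \<epsilon> Z by (simp add: e_def)
  then obtain \<eta> where \<eta>: "\<eta> > 0" "\<And>\<phi>. \<phi> \<in> X \<Longrightarrow> (\<And>x. 0 \<le> \<phi> x) \<Longrightarrow> rho (grad \<phi>) \<le> \<eta> \<Longrightarrow> (LINT x|?M. \<phi> x) \<le> e"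
    using integral_small by blast
  show "\<exists>\<eta>>0. \<forall>\<phi>\<in>X. (\<forall>x. 0 \<le> \<phi> x \<and> \<phi> x \<le> 1) \<longrightarrow> rho (grad \<phi>) \<le> \<eta> \<longrightarrow> \<bar>LINT x|?M. f x * (\<phi> x * \<zeta> x)\<bar> \<le> \<epsilon>"
  proof (intro exI[of _ \<eta>] conjI ballI impI)
    fix \<phi> assume \<phi>: "\<phi> \<in> X" and b: "\<forall>x. 0 \<le> \<phi> x \<and> \<phi> x \<le> 1" and r: "rho (grad \<phi>) \<le> \<eta>"
    have \<phi>i: "integrable ?M \<phi>" by (rule test_functions_integrable(1)[OF \<phi> open_domain])
    have [measurable]: "\<phi> \<in> borel_measurable ?M" "\<zeta> \<in> borel_measurable ?M" using X_measurable \<phi> \<zeta> by auto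
    have i2: "integrable ?M (\<lambda>x. \<bar>f x\<bar> * indicator {x. \<bar>f x\<bar> > real n} x)"
      by (rule Bochner_Integration.integrable_bound[OF f]) (auto simp: indicator_def)
    have "\<bar>LINT x|?M. f x * (\<phi> x * \<zeta> x)\<bar> \<le> (LINT x|?M. \<bar>f x * (\<phi> x * \<zeta> x)\<bar>)" by (rule integral_abs_bound)
    also have "\<dots> \<le> (LINT x|?M. Z * (real n * \<phi> x + \<bar>f x\<bar> * indicator {x. \<bar>f x\<bar> > real n} x))"
    proof (rule integral_mono)
      have le: "\<bar>f x * (\<phi> x * \<zeta> x)\<bar> \<le> Z * (\<bar>f x\<bar> * \<phi> x)" for x
      proof -
        have "\<bar>f x * (\<phi> x * \<zeta> x)\<bar> = \<bar>\<zeta> x\<bar> * (\<bar>f x\<bar> * \<phi> x)" using b by (simp add: abs_mult)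
        also have "\<dots> \<le> Z * (\<bar>f x\<bar> * \<phi> x)" using b Z by (intro mult_right_mono) auto
        finally show ?thesis .
      qed
      have le': "Z * (\<bar>f x\<bar> * \<phi> x) \<le> Z * \<bar>f x\<bar>" for x
        using b Z by (intro mult_left_mono) (auto simp: mult_left_le)
      show "integrable ?M (\<lambda>x. \<bar>f x * (\<phi> x * \<zeta> x)\<bar>)"
      proof (rule Bochner_Integration.integrable_bound)
        show "integrable ?M (\<lambda>x. Z * \<bar>f x\<bar>)" using f by auto
        show "AE x in ?M. norm \<bar>f x * (\<phi> x * \<zeta> x)\<bar> \<le> norm (Z * \<bar>f x\<bar>)"
          using order_trans[OF le le'] Z by (intro AE_I2) (simp add: abs_mult)
      qed measurable
      show "integrable ?M (\<lambda>x. Z * (real n * \<phi> x + \<bar>f x\<bar> * indicator {x. \<bar>f x\<bar> > real n} x))"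
        using \<phi>i i2 by auto
      show "\<bar>f x * (\<phi> x * \<zeta> x)\<bar> \<le> Z * (real n * \<phi> x + \<bar>f x\<bar> * indicator {x. \<bar>f x\<bar> > real n} x)" for x
      proof -
        have "\<bar>f x\<bar> * \<phi> x \<le> real n * \<phi> x + \<bar>f x\<bar> * indicator {x. \<bar>f x\<bar> > real n} x"
        proof (cases "\<bar>f x\<bar> > real n")
          case True
          have "\<bar>f x\<bar> * \<phi> x \<le> \<bar>f x\<bar>" using b by (simp add: mult_left_le)
          then show ?thesis using True b by (simp add: add_increasing)
        next
          case False
          then show ?thesis using b by (simp add: mult_right_mono)
        qed
        then have "Z * (\<bar>f x\<bar> * \<phi> x) \<le> Z * (real n * \<phi> x + \<bar>f x\<bar> * indicator {x. \<bar>f x\<bar> > real n} x)"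
          using Z by (intro mult_left_mono) auto
        then show ?thesis using le[of x] by simp
      qed
    qed
    also have "\<dots> = Z * (real n * (LINT x|?M. \<phi> x) + (LINT x|?M. \<bar>f x\<bar> * indicator {x. \<bar>f x\<bar> > real n} x))"
      using \<phi>i i2 by simp
    also have "\<dots> \<le> Z * (real n * e + \<epsilon> / (2 * Z))"
      using \<eta>(2)[OF \<phi> _ r] b n Z by (intro mult_left_mono add_mono) auto
    also have "\<dots> \<le> Z * ((real n + 1) * e + \<epsilon> / (2 * Z))"
      using Z \<open>e > 0\<close> by (intro mult_left_mono add_mono mult_right_mono) auto
    also have "\<dots> = \<epsilon>"
    proof -
      have "(real n + 1) * e = \<epsilon> / (2 * Z)" by (simp add: e_def)
      then show ?thesis using Z by simp
    qed
    finally show "\<bar>LINT x|?M. f x * (\<phi> x * \<zeta> x)\<bar> \<le> \<epsilon>" .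
  qed (use \<eta> in auto)
qed

text \<open>Boundedness of \<open>T\<close> asks for a small Sobolev norm of the product. The
  product rule reduces this to the modulars of \<phi> and its gradient, and the former is at most
  the integral of \<phi>, since \<open>0 \<le> \<phi> x \<le> 1\<close>.\<close>

lemma vanishing_dual:
  assumes T: "T \<in> dual_W1p_0 \<Omega> p"
  shows "vanishing T"
  unfolding vanishing_def
proof (intro ballI allI impI)
  let ?M = "lebesgue_on \<Omega>"
  fix \<zeta> and \<epsilon> :: real assume \<zeta>: "\<zeta> \<in> X" and \<epsilon>: "\<epsilon> > 0"
  obtain Z0 where Z0: "Z0 > 0" "\<And>x. \<bar>\<zeta> x\<bar> \<le> Z0" "\<And>x. norm (grad \<zeta> x) \<le> Z0" using test_functions_bounded[OF \<zeta>] by metis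
  define Z where "Z = Z0 + 1"
  have Z: "Z \<ge> 1" "\<And>x. \<bar>\<zeta> x\<bar> \<le> Z" "\<And>x. norm (grad \<zeta> x) \<le> Z"
    using Z0 by (auto simp: Z_def intro: add_increasing2)
  obtain C0 where C0: "\<And>u. u \<in> W1p_0 \<Omega> p \<Longrightarrow> \<bar>T u\<bar> \<le> C0 * W1p_norm \<Omega> p u"
    using T unfolding dual_W1p_0_def by blast
  define C where "C = \<bar>C0\<bar> + 1"
  define t where "t = min 1 (\<epsilon> / (2 * C))"
  have C: "C > 0" "C0 \<le> C" by (auto simp: C_def)
  have t: "0 < t" "t \<le> 1" "C * (2 * t) \<le> \<epsilon>"
    using \<epsilon> C by (auto simp: t_def min_def field_simps)
  \<comment> \<open>The constant of the product rule: the factor \<open>2 powr pp\<close> of the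
    triangle inequality for modulars, and \<open>Z powr pp\<close> for each of the two
    terms.\<close>
  define D where "D = 2 powr pp * (Z powr pp + Z powr pp)"
  have D: "D > 0" "Z powr pp \<le> D"
  proof -
    have z: "Z powr pp > 0" using Z by simp
    have "1 \<le> 2 powr pp" using pp_gt_1 by (intro ge_one_powr_ge_zero) auto
    then have "1 * (Z powr pp + Z powr pp) \<le> D" unfolding D_def using z by (intro mult_right_mono) auto
    then show "Z powr pp \<le> D" using z by argo
    then show "D > 0" using z by argo
  qed
  define e where "e = t powr pp / D"
  have e: "e > 0" "D * e = t powr pp" using t D by (auto simp: e_def)
  obtain \<eta> where \<eta>: "\<eta> > 0" "\<And>\<phi>. \<phi> \<in> X \<Longrightarrow> (\<And>x. 0 \<le> \<phi> x) \<Longrightarrow> rho (grad \<phi>) \<le> \<eta> \<Longrightarrow> (LINT x|?M. \<phi> x) \<le> e"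
    using integral_small[OF e(1)] by blast
  show "\<exists>\<eta>>0. \<forall>\<phi>\<in>X. (\<forall>x. 0 \<le> \<phi> x \<and> \<phi> x \<le> 1) \<longrightarrow> rho (grad \<phi>) \<le> \<eta> \<longrightarrow> \<bar>T (\<lambda>x. \<phi> x * \<zeta> x)\<bar> \<le> \<epsilon>"
  proof (intro exI[of _ "min \<eta> e"] conjI ballI impI)
    fix \<phi> assume \<phi>: "\<phi> \<in> X" and b: "\<forall>x. 0 \<le> \<phi> x \<and> \<phi> x \<le> 1" and r: "rho (grad \<phi>) \<le> min \<eta> e"
    have r1: "rho \<phi> \<le> e"
    proof -
      have "rho \<phi> \<le> (LINT x|?M. \<phi> x)"
        unfolding rho_def
      proof (rule integral_mono)
        show "integrable ?M (\<lambda>x. norm (\<phi> x) powr p x)" using X_Lp[OF \<phi>] by (simp add: Lp_def)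
        show "integrable ?M \<phi>" by (rule test_functions_integrable(1)[OF \<phi> open_domain])
        fix x assume "x \<in> space ?M"
        then have "1 \<le> p x" using p_gt_1 less_imp_le by blast
        then have "\<phi> x powr p x \<le> \<phi> x powr 1" using b by (intro powr_mono') auto
        then show "norm (\<phi> x) powr p x \<le> \<phi> x" using b by simp
      qed
      also have "\<dots> \<le> e" using \<eta>(2)[OF \<phi>] b r by simp
      finally show ?thesis .
    qed
    have r2: "rho (grad \<phi>) \<le> e" using r by simp
    have pX: "(\<lambda>x. \<phi> x * \<zeta> x) \<in> X" by (rule test_functions_mult[OF \<zeta> X_smooth[OF \<phi>]])
    have [measurable]: "\<phi> \<in> borel_measurable ?M" "\<zeta> \<in> borel_measurable ?M" "grad \<phi> \<in> borel_measurable ?M" "grad \<zeta> \<in> borel_measurable ?M"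
      using X_measurable \<phi> \<zeta> by auto
    have scale: "rho W \<le> Z powr pp * rho V" if "Lp V" "W \<in> borel_measurable ?M" "\<And>x. norm (W x) \<le> Z * norm (V x)"
      for V :: "'a \<Rightarrow> 'c::euclidean_space" and W :: "'a \<Rightarrow> 'd::euclidean_space"
    proof -
      have "rho W \<le> rho (\<lambda>x. Z *\<^sub>R V x)"
        using that Z(1) by (intro Lp_bound(2)[OF Lp_scaleR[OF that(1)]]) (auto intro!: AE_I2)
      also have "\<dots> \<le> Z powr pp * rho V" using Z(1) by (intro rho_scaleR(2) that) auto
      finally show ?thesis .
    qed
    have a1: "rho (\<lambda>x. \<phi> x * \<zeta> x) \<le> Z powr pp * rho \<phi>"
    proof (rule scale[OF X_Lp[OF \<phi>]])
      show "norm (\<phi> x * \<zeta> x) \<le> Z * norm (\<phi> x)" for x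
        using mult_right_mono[OF Z(2)[of x], of "\<bar>\<phi> x\<bar>"] by (simp add: abs_mult mult.commute)
    qed measurable
    have a2: "rho (\<lambda>x. \<phi> x *\<^sub>R grad \<zeta> x) \<le> Z powr pp * rho \<phi>"
    proof (rule scale[OF X_Lp[OF \<phi>]])
      show "norm (\<phi> x *\<^sub>R grad \<zeta> x) \<le> Z * norm (\<phi> x)" for x
        using mult_right_mono[OF Z(3)[of x], of "\<bar>\<phi> x\<bar>"] by (simp add: mult.commute)
    qed measurable
    have a3: "rho (\<lambda>x. \<zeta> x *\<^sub>R grad \<phi> x) \<le> Z powr pp * rho (grad \<phi>)"
    proof (rule scale[OF X_Lp_grad[OF \<phi>]])
      show "norm (\<zeta> x *\<^sub>R grad \<phi> x) \<le> Z * norm (grad \<phi> x)" for x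
        using mult_right_mono[OF Z(2)[of x], of "norm (grad \<phi> x)"] by simp
    qed measurable
    obtain B where B: "\<And>x. \<bar>\<phi> x\<bar> \<le> B" "\<And>x. norm (grad \<phi> x) \<le> B" using test_functions_bounded[OF \<phi>] by metis
    have La: "Lp (\<lambda>x. \<phi> x *\<^sub>R grad \<zeta> x)"
      by (rule Lp_bounded[where B = "B * Z"]) (auto intro!: AE_I2 mult_mono B Z order_trans[OF abs_ge_zero B(1)])
    have Lb: "Lp (\<lambda>x. \<zeta> x *\<^sub>R grad \<phi> x)"
      by (rule Lp_bounded[where B = "Z * B"]) (use Z in \<open>auto intro!: AE_I2 mult_mono B\<close>)
    have g: "grad (\<lambda>x. \<phi> x * \<zeta> x) = (\<lambda>x. \<phi> x *\<^sub>R grad \<zeta> x + \<zeta> x *\<^sub>R grad \<phi> x)"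
      by (intro ext grad_mult X_smooth \<phi> \<zeta>)
    have "rho (grad (\<lambda>x. \<phi> x * \<zeta> x)) \<le> 2 powr pp * (rho (\<lambda>x. \<phi> x *\<^sub>R grad \<zeta> x) + rho (\<lambda>x. \<zeta> x *\<^sub>R grad \<phi> x))"
      unfolding g by (rule Lp_add(2)[OF La Lb])
    also have "\<dots> \<le> 2 powr pp * (Z powr pp * e + Z powr pp * e)"
      using a2 a3 mult_left_mono[OF r1, of "Z powr pp"] mult_left_mono[OF r2, of "Z powr pp"]
      by (intro mult_left_mono add_mono) auto
    also have "\<dots> = t powr pp" using e(2) by (simp add: D_def algebra_simps)
    finally have s2: "rho (grad (\<lambda>x. \<phi> x * \<zeta> x)) \<le> t powr pp" .
    have "rho (\<lambda>x. \<phi> x * \<zeta> x) \<le> Z powr pp * e" using a1 mult_left_mono[OF r1, of "Z powr pp"] by simp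
    also have "\<dots> \<le> D * e" using D e by (intro mult_right_mono) auto
    finally have s1: "rho (\<lambda>x. \<phi> x * \<zeta> x) \<le> t powr pp" by (simp add: e)
    have nle: "W1p_norm \<Omega> p (\<lambda>x. \<phi> x * \<zeta> x) \<le> 2 * t" by (rule X_W1p_norm_le[OF pX t(1,2) s1 s2])
    have nn: "W1p_norm \<Omega> p (\<lambda>x. \<phi> x * \<zeta> x) \<ge> 0"
      unfolding X_W1p_norm[OF pX] by (intro add_nonneg_nonneg luxemburg_nonneg Lp_norm X_Lp X_Lp_grad pX)
    have "\<bar>T (\<lambda>x. \<phi> x * \<zeta> x)\<bar> \<le> C0 * W1p_norm \<Omega> p (\<lambda>x. \<phi> x * \<zeta> x)" by (rule C0[OF X_W1p_0[OF pX]])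
    also have "\<dots> \<le> C * W1p_norm \<Omega> p (\<lambda>x. \<phi> x * \<zeta> x)" using C nn by (intro mult_right_mono) auto
    also have "\<dots> \<le> C * (2 * t)" using C nle by (intro mult_left_mono) auto
    also have "\<dots> \<le> \<epsilon>" by (rule t(3))
    finally show "\<bar>T (\<lambda>x. \<phi> x * \<zeta> x)\<bar> \<le> \<epsilon>" .
  qed (use \<eta> e in auto)
qed

lemma vanishing_add:
  assumes "vanishing L1" "vanishing L2"
  shows "vanishing (\<lambda>\<phi>. L1 \<phi> + L2 \<phi>)"
  unfolding vanishing_def
proof (intro ballI allI impI)
  fix \<zeta> and \<epsilon> :: real assume \<zeta>: "\<zeta> \<in> X" and \<epsilon>: "\<epsilon> > 0"
  then have e2: "\<epsilon> / 2 > 0" by simp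
  obtain \<eta>1 where 1: "\<eta>1 > 0" "\<forall>\<phi>\<in>X. (\<forall>x. 0 \<le> \<phi> x \<and> \<phi> x \<le> 1) \<longrightarrow> rho (grad \<phi>) \<le> \<eta>1 \<longrightarrow> \<bar>L1 (\<lambda>x. \<phi> x * \<zeta> x)\<bar> \<le> \<epsilon> / 2"
    using assms(1) \<zeta> e2 unfolding vanishing_def by blast
  obtain \<eta>2 where 2: "\<eta>2 > 0" "\<forall>\<phi>\<in>X. (\<forall>x. 0 \<le> \<phi> x \<and> \<phi> x \<le> 1) \<longrightarrow> rho (grad \<phi>) \<le> \<eta>2 \<longrightarrow> \<bar>L2 (\<lambda>x. \<phi> x * \<zeta> x)\<bar> \<le> \<epsilon> / 2"
    using assms(2) \<zeta> e2 unfolding vanishing_def by blast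
  show "\<exists>\<eta>>0. \<forall>\<phi>\<in>X. (\<forall>x. 0 \<le> \<phi> x \<and> \<phi> x \<le> 1) \<longrightarrow> rho (grad \<phi>) \<le> \<eta> \<longrightarrow>
      \<bar>L1 (\<lambda>x. \<phi> x * \<zeta> x) + L2 (\<lambda>x. \<phi> x * \<zeta> x)\<bar> \<le> \<epsilon>"
  proof (intro exI[of _ "min \<eta>1 \<eta>2"] conjI ballI impI)
    fix \<phi> assume "\<phi> \<in> X" "\<forall>x. 0 \<le> \<phi> x \<and> \<phi> x \<le> 1" "rho (grad \<phi>) \<le> min \<eta>1 \<eta>2"
    then have "\<bar>L1 (\<lambda>x. \<phi> x * \<zeta> x)\<bar> \<le> \<epsilon> / 2" "\<bar>L2 (\<lambda>x. \<phi> x * \<zeta> x)\<bar> \<le> \<epsilon> / 2" using 1 2 by auto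
    then show "\<bar>L1 (\<lambda>x. \<phi> x * \<zeta> x) + L2 (\<lambda>x. \<phi> x * \<zeta> x)\<bar> \<le> \<epsilon>" unfolding abs_le_iff by argo
  qed (use 1 2 in auto)
qed

lemma vanishing_uminus: "vanishing L \<Longrightarrow> vanishing (\<lambda>\<phi>. - L \<phi>)"
  by (simp add: vanishing_def)

end

lemma signed_on_finite_on:
  assumes "signed_on \<Omega> \<mu>"
  shows "finite_on \<Omega> (positive_part \<Omega> \<mu>)"
proof -
  interpret signed_on \<Omega> \<mu> by fact
  show ?thesis
    using open_space sets_P finite_P by (auto simp: P_def intro: finite_on.intro)
qed

context sobolev
begin

lemma cap_compact_le_sobolev_cap:
  assumes "compact K" "K \<subseteq> E"
  shows "cap_compact \<Omega> p K \<le> sobolev_cap \<Omega> p E"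
  unfolding sobolev_cap_def
proof (rule INF_greatest)
  fix A assume "A \<in> {A. open A \<and> E \<subseteq> A \<and> A \<subseteq> \<Omega>}"
  then have "K \<in> {K. compact K \<and> K \<subseteq> A}" using assms by auto
  then show "cap_compact \<Omega> p K \<le> cap_open \<Omega> p A" unfolding cap_open_def by (rule SUP_upper)
qed

text \<open>The set \<open>A\<close> below nearly carries the positive part on \<open>E\<close>, so that the negative part is small there;
  it replaces a Hahn decomposition. Testing with \<open>\<phi> x * \<zeta> x\<close>, where \<open>\<zeta>\<close> is supported near a compact
  subset of \<open>A\<close> and \<open>\<phi>\<close> has small energy, gives the contradiction.\<close>

lemma positive_part_null:
  assumes lH: "log_Hoelder_on \<Omega> p" and \<mu>: "signed_on \<Omega> \<mu>"
    and L: "\<And>\<phi>. \<phi> \<in> X \<Longrightarrow> signed_integral \<Omega> \<mu> \<phi> = L \<phi>" "vanishing L"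
    and E: "E \<in> borel_sets \<Omega>" "sobolev_cap \<Omega> p E = 0"
  shows "measure (positive_part \<Omega> \<mu>) E = 0"
proof (rule ccontr)
  interpret s: signed_on \<Omega> \<mu> by fact
  interpret n: signed_on \<Omega> "\<lambda>A. - \<mu> A" by (rule signed_on_uminus[OF \<mu>])
  interpret P: finite_on \<Omega> "positive_part \<Omega> \<mu>" by (rule signed_on_finite_on[OF \<mu>])
  interpret N: finite_on \<Omega> "positive_part \<Omega> (\<lambda>A. - \<mu> A)" by (rule signed_on_finite_on[OF signed_on_uminus[OF \<mu>]])
  let ?P = "positive_part \<Omega> \<mu>" and ?N = "positive_part \<Omega> (\<lambda>A. - \<mu> A)"
  interpret fP: finite_measure ?P by (rule P.finite_Q)
  interpret fN: finite_measure ?N by (rule N.finite_Q)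
  define m where "m = measure ?P E"
  assume "measure ?P E \<noteq> 0"
  then have m: "m > 0" by (simp add: m_def less_le)
  define c where "c = flat (1/4)"
  have c: "0 < c" "c \<le> 1" by (simp_all add: c_def flat_le_1)
  \<comment> \<open>The errors below add up to \<open>3 * e + 3 * c * e\<close>, at most
    \<open>6 * e\<close>, which is half of \<open>c * m\<close>.\<close>
  define e where "e = c * m / 12"
  have e: "e > 0" using c m by (simp add: e_def)
  have E\<Omega>: "E \<subseteq> \<Omega>" using E by (simp add: s.borel_sets_iff)
  have "\<exists>A\<in>borel_sets \<Omega>. A \<subseteq> E \<and> m - e \<le> \<mu> A"
  proof (rule ccontr)
    assume "\<not> (\<exists>A\<in>borel_sets \<Omega>. A \<subseteq> E \<and> m - e \<le> \<mu> A)"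
    then have "measure s.P E \<le> m - e" by (intro s.measure_P_least[OF E(1)]) force
    then show False using e by (simp add: s.P_def m_def)
  qed
  then obtain A where A: "A \<in> borel_sets \<Omega>" "A \<subseteq> E" "m - e \<le> \<mu> A" by blast
  have AP: "\<mu> A \<le> measure ?P A" using s.measure_P_upper[OF A(1) A(1)] by (simp add: s.P_def)
  have "measure ?P A \<le> m" unfolding m_def using A E by (intro fP.finite_measure_mono) (auto simp: P.sets_Q)
  \<comment> \<open>By the Jordan decomposition the negative part of \<open>A\<close> is its
    positive part minus \<open>\<mu> A\<close>.\<close>
  then have AN: "measure ?N A \<le> e" using jordan[OF \<mu> A(1)] A(3) by simp
  obtain K where K: "compact K" "K \<subseteq> A" "K \<in> sets ?P" "measure ?P A \<le> measure ?P K + e"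
    using P.inner_compact[OF _ e, of A] A(1) P.sets_Q by blast
  have K\<Omega>: "K \<subseteq> \<Omega>" using K(2) A(2) E\<Omega> by blast
  have KN: "K \<in> sets ?N" using K(3) by (simp add: P.sets_Q N.sets_Q)
  have KP: "m - 2 * e \<le> measure ?P K" using K(4) A(3) AP by simp
  have KN': "measure ?N K \<le> e"
    using fN.finite_measure_mono[OF K(2)] A(1) AN by (simp add: N.sets_Q)
  \<comment> \<open>The negative part, small on \<open>K\<close>, stays small on an open
    neighbourhood, where \<zeta> will be supported.\<close>
  obtain U where U: "open U" "K \<subseteq> U" "U \<subseteq> \<Omega>" "measure ?N U \<le> measure ?N K + e"
    using N.outer_open[OF K(1) K\<Omega> e] by blast
  have UN: "measure ?N U \<le> 2 * e" using U(4) KN' by simp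
  have Us: "U \<in> sets ?N" using U by (simp add: N.sets_iff)
  obtain \<psi> :: "nat \<Rightarrow> 'a \<Rightarrow> real" where \<psi>: "\<And>j. \<psi> j \<in> test_functions U" "\<And>j x. 0 \<le> \<psi> j x"
    "\<And>j x. \<psi> j x \<le> 1" "\<And>x. (\<lambda>j. \<psi> j x) \<longlonglongrightarrow> indicator U x"
    using test_functions_approx_indicator[OF U(1)] by metis
  have meas: "f \<in> borel_measurable ?P" "f \<in> borel_measurable ?N" if "smooth f" for f :: "'a \<Rightarrow> real"
    unfolding measurable_cong_sets[OF P.sets_Q refl] measurable_cong_sets[OF N.sets_Q refl]
    using smooth_continuous[OF that] by (intro borel_measurable_continuous_on_restrict, simp)+
  have "(\<lambda>j. LINT x|?P. indicator K x * \<psi> j x) \<longlonglongrightarrow> (LINT x|?P. indicator K x)"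
  proof (rule integral_dominated_convergence[where w = "\<lambda>x. 1"])
    show "AE x in ?P. (\<lambda>j. indicator K x * \<psi> j x) \<longlonglongrightarrow> indicator K x"
    proof (rule AE_I2)
      fix x
      have "(\<lambda>j. indicator K x * \<psi> j x) \<longlonglongrightarrow> indicator K x * indicator U x"
        by (intro tendsto_mult tendsto_const \<psi>)
      also have "indicator K x * indicator U x = (indicator K x :: real)" using U(2) by (auto simp: indicator_def)
      finally show "(\<lambda>j. indicator K x * \<psi> j x) \<longlonglongrightarrow> indicator K x" .
    qed
    show "(\<lambda>x. indicator K x * \<psi> j x) \<in> borel_measurable ?P" for j
      using K(3) meas(1)[OF test_functions_smooth[OF \<psi>(1)]] by measurable
    show "AE x in ?P. norm (indicator K x * \<psi> j x) \<le> 1" for j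
      by (rule AE_I2) (use \<psi>(2,3) in \<open>auto simp: indicator_def\<close>)
  qed (use K(3) in auto)
  moreover have "(LINT x|?P. indicator K x) = measure ?P K" using K(3) by simp
  moreover have "measure ?P K - e < measure ?P K" using e by simp
  ultimately have "\<forall>\<^sub>F j in sequentially. measure ?P K - e < (LINT x|?P. indicator K x * \<psi> j x)"
    using order_tendstoD(1) by metis
  then obtain j where j: "measure ?P K - e < (LINT x|?P. indicator K x * \<psi> j x)"
    using eventually_happens'[OF sequentially_bot] by blast
  define \<zeta> where "\<zeta> = \<psi> j"
  have \<zeta>: "\<zeta> \<in> X" unfolding \<zeta>_def by (rule test_functions_mono[OF U(3) \<psi>(1)])
  have \<zeta>01: "0 \<le> \<zeta> x" "\<zeta> x \<le> 1" for x using \<psi> by (auto simp: \<zeta>_def)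
  have \<zeta>U: "\<zeta> x = 0" if "x \<notin> U" for x unfolding \<zeta>_def by (rule test_functions_outside(1)[OF \<psi>(1) that])
  obtain \<eta> where \<eta>: "\<eta> > 0" "\<forall>\<phi>\<in>X. (\<forall>x. 0 \<le> \<phi> x \<and> \<phi> x \<le> 1) \<longrightarrow> rho (grad \<phi>) \<le> \<eta> \<longrightarrow> \<bar>L (\<lambda>x. \<phi> x * \<zeta> x)\<bar> \<le> e"
    using L(2) \<zeta> e unfolding vanishing_def by blast
  have "cap_compact \<Omega> p K \<le> 0"
    using cap_compact_le_sobolev_cap[OF K(1), of E] K(2) A(2) E(2) by auto
  then have cap0: "cap_compact \<Omega> p K = 0" by simp
  obtain \<phi> where \<phi>: "\<phi> \<in> X" "\<And>x. 0 \<le> \<phi> x" "\<And>x. \<phi> x \<le> 1" "\<And>x. x \<in> K \<Longrightarrow> c \<le> \<phi> x" "rho (grad \<phi>) \<le> \<eta>"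
    using capacity_zero_test_function[OF lH cap0 K\<Omega> \<eta>(1)] unfolding c_def by metis
  have pX: "(\<lambda>x. \<phi> x * \<zeta> x) \<in> X" by (rule test_functions_mult[OF \<zeta> X_smooth[OF \<phi>(1)]])
  have p01: "0 \<le> \<phi> x * \<zeta> x" "\<phi> x * \<zeta> x \<le> 1" for x
    using \<phi>(2,3) \<zeta>01 by (auto intro: mult_le_one)
  have iP: "integrable ?P (\<lambda>x. \<phi> x * \<zeta> x)" and iN: "integrable ?N (\<lambda>x. \<phi> x * \<zeta> x)"
    using p01 smooth_continuous[OF X_smooth[OF pX]]
    by (auto intro!: P.integrable_bounded_continuous[where B = 1] N.integrable_bounded_continuous[where B = 1])
  have "c * (m - 3 * e) \<le> c * (LINT x|?P. indicator K x * \<zeta> x)"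
    using j KP c by (intro mult_left_mono) (auto simp: \<zeta>_def)
  also have "\<dots> = (LINT x|?P. c * (indicator K x * \<zeta> x))" by simp
  also have "\<dots> \<le> (LINT x|?P. \<phi> x * \<zeta> x)"
  proof (rule integral_mono[OF _ iP])
    show "integrable ?P (\<lambda>x. c * (indicator K x * \<zeta> x))"
    proof (rule fP.integrable_const_bound[where B = 1])
      show "AE x in ?P. norm (c * (indicator K x * \<zeta> x)) \<le> 1"
        using c \<zeta>01 by (intro AE_I2) (auto simp: indicator_def abs_mult intro!: mult_le_one)
      show "(\<lambda>x. c * (indicator K x * \<zeta> x)) \<in> borel_measurable ?P"
        using K(3) meas(1)[OF X_smooth[OF \<zeta>]] by measurable
    qed
    show "c * (indicator K x * \<zeta> x) \<le> \<phi> x * \<zeta> x" for x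
      using \<phi>(4)[of x] p01(1)[of x] \<zeta>01 by (cases "x \<in> K") (auto intro: mult_right_mono)
  qed
  also have "\<dots> = L (\<lambda>x. \<phi> x * \<zeta> x) + (LINT x|?N. \<phi> x * \<zeta> x)"
    using L(1)[OF pX] by (simp add: signed_integral_def)
  also have "\<dots> \<le> e + 2 * e"
  proof (rule add_mono)
    have "\<bar>L (\<lambda>x. \<phi> x * \<zeta> x)\<bar> \<le> e" using \<eta>(2) \<phi> by blast
    then show "L (\<lambda>x. \<phi> x * \<zeta> x) \<le> e" by simp
    have "(LINT x|?N. \<phi> x * \<zeta> x) \<le> (LINT x|?N. indicator U x)"
    proof (rule integral_mono[OF iN])
      show "integrable ?N (indicator U :: 'a \<Rightarrow> real)"
        using Us by (intro integrable_real_indicator) (auto simp: less_top[symmetric])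
      show "\<phi> x * \<zeta> x \<le> indicator U x" for x
        using p01(2)[of x] \<zeta>U[of x] by (cases "x \<in> U") auto
    qed
    also have "\<dots> = measure ?N U" using Us by simp
    finally show "(LINT x|?N. \<phi> x * \<zeta> x) \<le> 2 * e" using UN by simp
  qed
  finally have "c * m \<le> 3 * e + 3 * (c * e)" by (simp add: algebra_simps)
  also have "\<dots> \<le> 3 * e + 3 * (1 * e)" using c e by (intro add_left_mono mult_left_mono mult_right_mono) auto
  also have "\<dots> < 12 * e" using e by simp
  finally show False by (simp add: e_def)
qed

text \<open>\<open>positive_part_null\<close> applies to \<open>\<mu>\<close> and to its negative,
  so both Jordan parts vanish on \<open>E\<close>.\<close>

lemma measure_zero_of_vanishing:
  assumes lH: "log_Hoelder_on \<Omega> p" and \<mu>: "signed_on \<Omega> \<mu>"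
    and L: "\<And>\<phi>. \<phi> \<in> X \<Longrightarrow> signed_integral \<Omega> \<mu> \<phi> = L \<phi>" "vanishing L"
  shows "does_not_charge_null_cap \<Omega> p \<mu>"
  unfolding does_not_charge_null_cap_def
proof (intro ballI impI)
  fix E assume E: "E \<in> borel_sets \<Omega>" "sobolev_cap \<Omega> p E = 0"
  have "measure (positive_part \<Omega> (\<lambda>A. - \<mu> A)) E = 0"
  proof (rule positive_part_null[OF lH signed_on_uminus[OF \<mu>] _ vanishing_uminus[OF L(2)] E])
    show "signed_integral \<Omega> (\<lambda>A. - \<mu> A) \<phi> = - L \<phi>" if "\<phi> \<in> X" for \<phi>
      using L(1)[OF that] by (simp add: signed_integral_uminus)
  qed
  then show "\<mu> E = 0"
    using positive_part_null[OF lH \<mu> L E] jordan[OF \<mu> E(1)] by simp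
qed

subsection \<open>Measures that do not charge null sets\<close>

lemma sum_half_powers_le:
  assumes "finite I" "\<And>n. n \<in> I \<Longrightarrow> m \<le> n"
  shows "(\<Sum>n\<in>I. (1/2::real) ^ Suc n) \<le> (1/2) ^ m"
proof -
  obtain l where l: "\<And>n. n \<in> I \<Longrightarrow> n < l" using assms(1) unfolding finite_nat_set_iff_bounded by auto
  have "I \<subseteq> {m..<m + l}"
  proof
    fix n assume n: "n \<in> I"
    show "n \<in> {m..<m + l}" using assms(2)[OF n] l[OF n] by simp
  qed
  then have "(\<Sum>n\<in>I. (1/2::real) ^ Suc n) \<le> (\<Sum>n=m..<m + l. (1/2) ^ Suc n)"
    by (intro sum_mono2) simp_all
  also have "\<dots> = (\<Sum>n=m..<m + l. - ((1/2) ^ Suc n) - - ((1/2) ^ n))" by simp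
  also have "\<dots> = (1/2) ^ m - (1/2) ^ (m + l)"
    using sum_Suc_diff'[of m "m + l" "\<lambda>n. - ((1/2::real) ^ n)"] by simp
  also have "\<dots> \<le> (1/2) ^ m" by simp
  finally show ?thesis .
qed

text \<open>The convexity argument of \<open>Lp_summable\<close> for finite sums; the weights of the
  indices from \<open>m\<close> on have total at most \<open>(1/2) ^ m\<close>.\<close>

lemma rho_weighted_sum:
  fixes V :: "nat \<Rightarrow> 'a \<Rightarrow> 'a"
  assumes I: "finite I" "\<And>n. n \<in> I \<Longrightarrow> m \<le> n" and V: "\<And>n. n \<in> I \<Longrightarrow> Lp (V n)"
    "\<And>n. n \<in> I \<Longrightarrow> rho (\<lambda>x. (2 ^ Suc n) *\<^sub>R V n x) \<le> 1"
  shows "rho (\<lambda>x. \<Sum>n\<in>I. V n x) \<le> (1/2) ^ m"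
proof -
  let ?M = "lebesgue_on \<Omega>"
  let ?W = "\<lambda>n x. (2 ^ Suc n) *\<^sub>R V n x"
  have LW: "Lp (?W n)" if "n \<in> I" for n by (rule Lp_scaleR[OF V(1)[OF that]])
  have S: "Lp (\<lambda>x. \<Sum>n\<in>I. V n x)" using I V by (intro Lp_sum) auto
  have i: "integrable ?M (\<lambda>x. norm (?W n x) powr p x)" if "n \<in> I" for n using LW[OF that] by (simp only: Lp_def)
  have w: "sum (\<lambda>n. (1/2::real) ^ Suc n) I \<le> 1"
    by (rule order_trans[OF sum_half_powers_le[OF I]]) (auto intro: power_le_one)
  have "rho (\<lambda>x. \<Sum>n\<in>I. V n x) \<le> (LINT x|?M. (\<Sum>n\<in>I. (1/2) ^ Suc n * norm (?W n x) powr p x))"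
    unfolding rho_def
  proof (rule integral_mono)
    show "integrable ?M (\<lambda>x. norm (\<Sum>n\<in>I. V n x) powr p x)" using S by (simp only: Lp_def)
    show "integrable ?M (\<lambda>x. \<Sum>n\<in>I. (1/2) ^ Suc n * norm (?W n x) powr p x)"
      by (intro Bochner_Integration.integrable_sum integrable_mult_right i)
    fix x assume x: "x \<in> space ?M"
    have "norm (\<Sum>n\<in>I. V n x) \<le> (\<Sum>n\<in>I. (1/2) ^ Suc n * norm (?W n x))"
      by (rule order_trans[OF norm_sum]) (simp add: power_divide)
    then have "norm (\<Sum>n\<in>I. V n x) powr p x \<le> (\<Sum>n\<in>I. (1/2) ^ Suc n * norm (?W n x)) powr p x"
      using p_gt_1[OF x] by (intro powr_mono2) auto
    also have "\<dots> \<le> (\<Sum>n\<in>I. (1/2) ^ Suc n * norm (?W n x) powr p x)"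
      by (rule powr_convex_sum[OF p_gt_1[OF x] I(1) _ _ w]) auto
    finally show "norm (\<Sum>n\<in>I. V n x) powr p x \<le> (\<Sum>n\<in>I. (1/2) ^ Suc n * norm (?W n x) powr p x)" .
  qed
  also have "\<dots> = (\<Sum>n\<in>I. (1/2) ^ Suc n * rho (?W n))"
    by (subst Bochner_Integration.integral_sum) (use i in \<open>auto simp: rho_def\<close>)
  also have "\<dots> \<le> (\<Sum>n\<in>I. (1/2) ^ Suc n * 1)"
    using V(2) by (intro sum_mono mult_left_mono) auto
  also have "\<dots> \<le> (1/2) ^ m" using sum_half_powers_le[OF I] by simp
  finally show ?thesis .
qed

lemma cap_compact_le_test:
  assumes "v \<in> X" "\<And>x. 0 \<le> v x" "\<And>x. x \<in> K \<Longrightarrow> 1 \<le> v x"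
  shows "cap_compact \<Omega> p K \<le> ennreal (rho (grad v))"
proof -
  have "v \<in> C_0 \<Omega>"
    using smooth_continuous[OF X_smooth[OF assms(1)]] test_functions_outside(1)[OF assms(1)] open_domain
    by (auto simp: C_0_def frontier_def interior_open)
  then have v: "v \<in> {v \<in> W1p \<Omega> p \<inter> C_0 \<Omega>. (\<forall>x\<in>\<Omega>. 0 \<le> v x) \<and> (\<forall>x\<in>K. 1 \<le> v x)}"
    using X_W1p[OF assms(1)] assms by auto
  have "cap_compact \<Omega> p K \<le> modular \<Omega> p (\<lambda>x. norm (weak_grad \<Omega> v x))"
    unfolding cap_compact_def by (rule INF_lower[OF v])
  also have "\<dots> = modular \<Omega> p (\<lambda>x. norm (grad v x))"
    unfolding modular_def using weak_grad_smooth[OF open_domain X_smooth[OF assms(1)]]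
    by (intro nn_integral_cong_AE) (auto elim: eventually_mono)
  also have "\<dots> = ennreal (rho (grad v))"
    using modular_eq_rho[OF Lp_norm[OF X_Lp_grad[OF assms(1)]]] by (simp only: rho_norm)
  finally show ?thesis .
qed

text \<open>Otherwise there are test functions, bounded by 1 and of rapidly decreasing energy, whose
  integrals stay away from 0. The points at which they are not eventually small form a set of
  capacity 0; off it they tend to 0, and dominated convergence for both Jordan parts gives a
  contradiction.\<close>

lemma signed_integral_energy_cont:
  assumes \<mu>: "signed_on \<Omega> \<mu>" and nc: "does_not_charge_null_cap \<Omega> p \<mu>"
  obtains A where "A \<ge> 0" "energy_cont A (signed_integral \<Omega> \<mu>)"
proof -
  interpret s: signed_on \<Omega> \<mu> by fact
  interpret n: signed_on \<Omega> "\<lambda>A. - \<mu> A" by (rule signed_on_uminus[OF \<mu>])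
  interpret P: finite_on \<Omega> "positive_part \<Omega> \<mu>" by (rule signed_on_finite_on[OF \<mu>])
  interpret N: finite_on \<Omega> "positive_part \<Omega> (\<lambda>A. - \<mu> A)" by (rule signed_on_finite_on[OF signed_on_uminus[OF \<mu>]])
  let ?P = "positive_part \<Omega> \<mu>" and ?N = "positive_part \<Omega> (\<lambda>A. - \<mu> A)"
  interpret fP: finite_measure ?P by (rule P.finite_Q)
  interpret fN: finite_measure ?N by (rule N.finite_Q)
  have iP: "integrable ?P \<phi>" and iN: "integrable ?N \<phi>" if "\<phi> \<in> X" for \<phi>
    using supn_ge[OF that] smooth_continuous[OF X_smooth[OF that]]
    by (auto intro!: P.integrable_bounded_continuous[where B = "supn \<phi>"] N.integrable_bounded_continuous[where B = "supn \<phi>"])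
  have lin: "linear_on_X (signed_integral \<Omega> \<mu>)"
    unfolding linear_on_X_def signed_integral_def
  proof (intro conjI ballI allI)
    fix \<phi> \<psi> assume "\<phi> \<in> X" "\<psi> \<in> X"
    then show "(LINT x|?P. \<phi> x + \<psi> x) - (LINT x|?N. \<phi> x + \<psi> x) =
        (LINT x|?P. \<phi> x) - (LINT x|?N. \<phi> x) + ((LINT x|?P. \<psi> x) - (LINT x|?N. \<psi> x))"
      using iP iN by simp
  qed (simp add: right_diff_distrib)
  define A where "A = measure ?P \<Omega> + measure ?N \<Omega>"
  have bnd: "\<bar>LINT x|Q. \<phi> x\<bar> \<le> measure Q \<Omega> * supn \<phi>"
    if \<phi>: "\<phi> \<in> X" and Q: "finite_on \<Omega> Q" for Q \<phi>
  proof -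
    interpret Q: finite_on \<Omega> Q by fact
    interpret fQ: finite_measure Q by (rule Q.finite_Q)
    have i: "integrable Q \<phi>"
      using supn_ge[OF \<phi>] smooth_continuous[OF X_smooth[OF \<phi>]] by (intro Q.integrable_bounded_continuous)
    have "\<bar>LINT x|Q. \<phi> x\<bar> \<le> (LINT x|Q. \<bar>\<phi> x\<bar>)" by (rule integral_abs_bound)
    also have "\<dots> \<le> (LINT x|Q. supn \<phi>)" using i supn_ge[OF \<phi>] by (intro integral_mono) auto
    also have "\<dots> = measure Q \<Omega> * supn \<phi>" by (simp add: Q.space_Q)
    finally show ?thesis .
  qed
  have bound: "\<bar>signed_integral \<Omega> \<mu> \<phi>\<bar> \<le> A * supn \<phi>" if "\<phi> \<in> X" for \<phi>
    using bnd[OF that P.finite_on_axioms] bnd[OF that N.finite_on_axioms]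
    by (simp add: signed_integral_def A_def distrib_right)
  have "\<exists>\<eta>>0. \<forall>\<phi>\<in>X. supn \<phi> \<le> 1 \<longrightarrow> energy 1 \<phi> \<le> \<eta> \<longrightarrow> \<bar>signed_integral \<Omega> \<mu> \<phi>\<bar> \<le> \<epsilon>"
    if \<epsilon>: "\<epsilon> > 0" for \<epsilon>
  proof (rule ccontr)
    assume neg: "\<not> (\<exists>\<eta>>0. \<forall>\<phi>\<in>X. supn \<phi> \<le> 1 \<longrightarrow> energy 1 \<phi> \<le> \<eta> \<longrightarrow> \<bar>signed_integral \<Omega> \<mu> \<phi>\<bar> \<le> \<epsilon>)"
    \<comment> \<open>The factor \<open>2 * 2 ^ n\<close> comes from the gradient of
      \<open>v n\<close>, the factor \<open>2 ^ Suc n\<close> from the weight in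
      \<open>rho_weighted_sum\<close>.\<close>
    define \<eta> where "\<eta> n = 1 / (2 * 2 ^ n * 2 ^ Suc n) powr pp" for n :: nat
    have "\<eta> n > 0" for n by (simp add: \<eta>_def)
    then have "\<exists>\<phi>. \<phi> \<in> X \<and> supn \<phi> \<le> 1 \<and> energy 1 \<phi> \<le> \<eta> n \<and> \<bar>signed_integral \<Omega> \<mu> \<phi>\<bar> > \<epsilon>" for n
      using neg by (meson not_le)
    then obtain \<phi> where \<phi>: "\<And>n. \<phi> n \<in> X" "\<And>n. supn (\<phi> n) \<le> 1" "\<And>n. energy 1 (\<phi> n) \<le> \<eta> n"
      "\<And>n. \<bar>signed_integral \<Omega> \<mu> (\<phi> n)\<bar> > \<epsilon>" by metis
    have \<phi>1: "\<bar>\<phi> n x\<bar> \<le> 1" for n x using supn_ge[OF \<phi>(1), of n x] \<phi>(2)[of n] by simp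
    \<comment> \<open>The square makes the function nonnegative and keeps it smooth; the factor
      \<open>2 ^ n\<close> turns \<open>v n x \<le> 1\<close> into
      \<open>(\<phi> n x)\<^sup>2 \<le> (1/2) ^ n\<close>.\<close>
    define v where "v n x = 2 ^ n * (\<phi> n x * \<phi> n x)" for n x
    have vX: "v n \<in> X" for n
      unfolding v_def by (intro test_functions_cmult test_functions_mult X_smooth \<phi>(1))
    have v0: "0 \<le> v n x" for n x by (simp add: v_def)
    have gv: "grad (v n) x = (2 * 2 ^ n * \<phi> n x) *\<^sub>R grad (\<phi> n) x" for n x
    proof -
      have "smooth (\<lambda>x. \<phi> n x * \<phi> n x)" by (intro smooth_mult X_smooth \<phi>(1))
      then have "grad (v n) x = 2 ^ n *\<^sub>R grad (\<lambda>x. \<phi> n x * \<phi> n x) x"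
        unfolding v_def by (rule grad_cmult)
      also have "grad (\<lambda>x. \<phi> n x * \<phi> n x) x = (2 * \<phi> n x) *\<^sub>R grad (\<phi> n) x"
        by (simp add: grad_mult X_smooth \<phi>(1) scaleR_add_left[symmetric])
      finally show ?thesis by (simp add: ac_simps)
    qed
    have rv: "rho (\<lambda>x. (2 ^ Suc n) *\<^sub>R grad (v n) x) \<le> 1" for n
    proof -
      let ?c = "2 * 2 ^ n * 2 ^ Suc n :: real"
      have c: "?c \<ge> 1"
        using mult_mono[of 1 "2 ^ n" 1 "2 ^ n :: real"] by simp
      have L: "Lp (grad (\<phi> n))" by (rule X_Lp_grad[OF \<phi>(1)])
      have "rho (\<lambda>x. (2 ^ Suc n) *\<^sub>R grad (v n) x) \<le> rho (\<lambda>x. ?c *\<^sub>R grad (\<phi> n) x)"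
      proof (rule Lp_bound(2)[OF Lp_scaleR[OF L]])
        show "(\<lambda>x. (2 ^ Suc n) *\<^sub>R grad (v n) x) \<in> borel_measurable (lebesgue_on \<Omega>)"
          using X_measurable(2)[OF vX] by measurable
        show "AE x in lebesgue_on \<Omega>. norm ((2 ^ Suc n) *\<^sub>R grad (v n) x) \<le> norm (?c *\<^sub>R grad (\<phi> n) x)"
        proof (rule AE_I2)
          fix x
          have "norm ((2 ^ Suc n) *\<^sub>R grad (v n) x) = \<bar>\<phi> n x\<bar> * norm (?c *\<^sub>R grad (\<phi> n) x)"
            by (simp add: gv abs_mult)
          also have "\<dots> \<le> 1 * norm (?c *\<^sub>R grad (\<phi> n) x)" by (intro mult_right_mono \<phi>1) simp
          finally show "norm ((2 ^ Suc n) *\<^sub>R grad (v n) x) \<le> norm (?c *\<^sub>R grad (\<phi> n) x)" by simp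
        qed
      qed
      also have "\<dots> \<le> ?c powr pp * rho (grad (\<phi> n))" using c by (intro rho_scaleR(2)[OF L]) auto
      also have "\<dots> \<le> ?c powr pp * \<eta> n"
        using \<phi>(3)[of n] rho_nonneg[of "\<phi> n"] by (intro mult_left_mono) (auto simp: energy_def)
      also have "\<dots> = 1" by (simp add: \<eta>_def)
      finally show ?thesis .
    qed
    define O' where "O' m = (\<Union>n\<in>{m..}. {x. v n x > 1})" for m
    have O'open: "open (O' m)" for m
      unfolding O'_def by (intro open_UN ballI open_Collect_less continuous_on_const smooth_continuous X_smooth vX)
    have O'\<Omega>: "O' m \<subseteq> \<Omega>" for m
      unfolding O'_def using test_functions_outside(1)[OF vX] by force
    \<comment> \<open>A compact subset is covered by finitely many of the sets
      \<open>{x. v n x > 1}\<close>, and the sum of the corresponding \<open>v n\<close> is a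
      competitor for its capacity.\<close>
    have capO: "cap_open \<Omega> p (O' m) \<le> ennreal ((1/2) ^ m)" for m
      unfolding cap_open_def
    proof (rule SUP_least)
      fix K assume "K \<in> {K. compact K \<and> K \<subseteq> O' m}"
      then have K: "compact K" "K \<subseteq> (\<Union>n\<in>{m..}. {x. v n x > 1})" by (auto simp: O'_def)
      obtain I where I: "I \<subseteq> {m..}" "finite I" "K \<subseteq> (\<Union>n\<in>I. {x. v n x > 1})"
        by (rule compactE_image[OF K(1) _ K(2)])
          (auto intro!: open_Collect_less continuous_on_const smooth_continuous X_smooth vX)
      define V where "V x = (\<Sum>n\<in>I. v n x)" for x
      have VX: "V \<in> X" unfolding V_def by (rule test_functions_sum[OF vX])
      have "cap_compact \<Omega> p K \<le> ennreal (rho (grad V))"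
      proof (rule cap_compact_le_test[OF VX])
        show "0 \<le> V x" for x unfolding V_def by (intro sum_nonneg v0)
        show "1 \<le> V x" if x: "x \<in> K" for x
        proof -
          obtain n where n: "n \<in> I" "v n x > 1" using I(3) x by blast
          have "v n x \<le> V x" unfolding V_def by (rule member_le_sum[OF n(1) v0 I(2)])
          then show ?thesis using n by simp
        qed
      qed
      also have "rho (grad V) \<le> (1/2) ^ m"
      proof -
        have "grad V = (\<lambda>x. \<Sum>n\<in>I. grad (v n) x)"
          unfolding V_def by (intro ext grad_sum X_smooth vX)
        then show ?thesis using rho_weighted_sum[of I m "\<lambda>n. grad (v n)"] I X_Lp_grad[OF vX] rv by auto
      qed
      finally show "cap_compact \<Omega> p K \<le> ennreal ((1/2) ^ m)" by (simp add: ennreal_leI)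
    qed
    define E where "E = (\<Inter>m. O' m)"
    have EB: "E \<in> borel_sets \<Omega>"
      unfolding s.borel_sets_iff
    proof
      show "E \<subseteq> \<Omega>" unfolding E_def using O'\<Omega>[of 0] by blast
      show "E \<in> sets borel" unfolding E_def by (intro sets.countable_INT'' borel_open O'open) auto
    qed
    \<comment> \<open>All subsets of \<open>E\<close> have capacity 0, so \<open>\<mu>\<close>
      vanishes on each Borel one; this makes both Jordan parts vanish on \<open>E\<close>, and not
      only their difference.\<close>
    have cap0: "sobolev_cap \<Omega> p F = 0" if "F \<subseteq> E" for F
    proof -
      have "sobolev_cap \<Omega> p F \<le> ennreal ((1/2) ^ m)" for m
      proof -
        have "O' m \<in> {A. open A \<and> F \<subseteq> A \<and> A \<subseteq> \<Omega>}" using that O'open O'\<Omega> by (auto simp: E_def)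
        then have "sobolev_cap \<Omega> p F \<le> cap_open \<Omega> p (O' m)" unfolding sobolev_cap_def by (rule INF_lower)
        also have "\<dots> \<le> ennreal ((1/2) ^ m)" by (rule capO)
        finally show ?thesis .
      qed
      moreover have "(\<lambda>m. ennreal ((1/2) ^ m)) \<longlonglongrightarrow> ennreal 0"
        by (intro tendsto_ennrealI LIMSEQ_power_zero) simp
      ultimately have "sobolev_cap \<Omega> p F \<le> ennreal 0" by (intro LIMSEQ_le_const) auto
      then show ?thesis by simp
    qed
    have \<mu>0: "\<mu> F = 0" if "F \<in> borel_sets \<Omega>" "F \<subseteq> E" for F
      using nc cap0[OF that(2)] that(1) by (simp add: does_not_charge_null_cap_def)
    have "measure s.P E \<le> 0" by (rule s.measure_P_least[OF EB]) (simp add: \<mu>0)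
    moreover have "measure n.P E \<le> 0" by (rule n.measure_P_least[OF EB]) (simp add: \<mu>0)
    ultimately have PE: "measure ?P E = 0" "measure ?N E = 0"
      using measure_nonneg[of ?P E] measure_nonneg[of ?N E] by (auto simp: s.P_def n.P_def intro: antisym)
    have lim: "(\<lambda>n. \<phi> n x) \<longlonglongrightarrow> 0" if xE: "x \<notin> E" for x
    proof -
      obtain m where m: "x \<notin> O' m" using xE by (auto simp: E_def)
      have "(\<lambda>n. (\<phi> n x)\<^sup>2) \<longlonglongrightarrow> 0"
      proof (rule tendsto_sandwich[OF _ _ tendsto_const])
        show "\<forall>\<^sub>F n in sequentially. 0 \<le> (\<phi> n x)\<^sup>2" by simp
        show "\<forall>\<^sub>F n in sequentially. (\<phi> n x)\<^sup>2 \<le> (1/2) ^ n"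
          using eventually_ge_at_top[of m]
        proof eventually_elim
          case (elim n)
          then have "v n x \<le> 1" using m by (auto simp: O'_def not_less)
          then show ?case by (simp add: v_def power2_eq_square power_divide field_simps)
        qed
        show "(\<lambda>n. (1/2::real) ^ n) \<longlonglongrightarrow> 0" by (rule LIMSEQ_power_zero) simp
      qed
      then have "(\<lambda>n. sqrt ((\<phi> n x)\<^sup>2)) \<longlonglongrightarrow> sqrt 0" by (rule tendsto_real_sqrt)
      then show ?thesis by (simp add: tendsto_rabs_zero_iff)
    qed
    have L0: "(\<lambda>n. LINT x|Q. \<phi> n x) \<longlonglongrightarrow> 0" if Q: "finite_on \<Omega> Q" and QE: "measure Q E = 0" for Q
    proof -
      interpret Q: finite_on \<Omega> Q by fact
      interpret fQ: finite_measure Q by (rule Q.finite_Q)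
      have "E \<in> null_sets Q"
        using EB QE by (auto simp: Q.sets_Q fQ.emeasure_eq_measure)
      then have ae: "AE x in Q. x \<notin> E" by (rule AE_not_in)
      have "(\<lambda>n. LINT x|Q. \<phi> n x) \<longlonglongrightarrow> (LINT x|Q. 0)"
      proof (rule integral_dominated_convergence[where w = "\<lambda>x. 1"])
        show "AE x in Q. (\<lambda>n. \<phi> n x) \<longlonglongrightarrow> 0" using ae by eventually_elim (rule lim)
        show "\<phi> n \<in> borel_measurable Q" for n
          using Q.integrable_bounded_continuous[of "\<phi> n" 1] \<phi>1 smooth_continuous[OF X_smooth[OF \<phi>(1)]] by auto
        show "AE x in Q. norm (\<phi> n x) \<le> 1" for n using \<phi>1 by (intro AE_I2) simp
      qed auto
      then show ?thesis by simp
    qed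
    have "(\<lambda>n. signed_integral \<Omega> \<mu> (\<phi> n)) \<longlonglongrightarrow> 0 - 0"
      unfolding signed_integral_def
      by (intro tendsto_diff L0 P.finite_on_axioms N.finite_on_axioms PE)
    then have "(\<lambda>n. \<bar>signed_integral \<Omega> \<mu> (\<phi> n)\<bar>) \<longlonglongrightarrow> 0" by (simp add: tendsto_rabs_zero)
    then have "\<epsilon> \<le> 0"
      by (rule LIMSEQ_le_const) (use \<phi>(4) less_imp_le in blast)
    then show False using \<epsilon> by simp
  qed
  then have "energy_cont A (signed_integral \<Omega> \<mu>)"
    unfolding energy_cont_def using lin bound by blast
  moreover have "A \<ge> 0" by (simp add: A_def)
  ultimately show thesis using that by blast
qed

end

text \<open>As the distance tends to 0, so does \<open>- c / ln (dist x y)\<close>. Continuity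
  provides the measurability of \<open>p\<close>.\<close>

lemma log_Hoelder_continuous:
  assumes "log_Hoelder_on \<Omega> p"
  shows "continuous_on \<Omega> p"
  unfolding continuous_on_iff
proof (intro ballI allI impI)
  fix x and e :: real assume x: "x \<in> \<Omega>" and e: "e > 0"
  obtain c where c: "c > 0" "\<And>x y. x \<in> \<Omega> \<Longrightarrow> y \<in> \<Omega> \<Longrightarrow> dist x y < 1/2 \<Longrightarrow> \<bar>p x - p y\<bar> \<le> - c / ln (dist x y)"
    using assms unfolding log_Hoelder_on_def by blast
  show "\<exists>d>0. \<forall>y\<in>\<Omega>. dist y x < d \<longrightarrow> dist (p y) (p x) < e"
  \<comment> \<open>\<open>exp (- (c / e))\<close> is the distance at which the log-Hoelder bound
    equals \<open>e\<close>, and 1/2 is the range in which that bound holds.\<close>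
  proof (intro exI[of _ "min (1/2) (exp (- (c / e)))"] conjI ballI impI)
    fix y assume y: "y \<in> \<Omega>" "dist y x < min (1/2) (exp (- (c / e)))"
    show "dist (p y) (p x) < e"
    proof (cases "y = x")
      case False
      then have d: "0 < dist x y" by simp
      have "dist x y < exp (- (c / e))" using y by (simp add: dist_commute)
      then have "ln (dist x y) < ln (exp (- (c / e)))" using d by (subst ln_less_cancel_iff) auto
      then have l: "ln (dist x y) < - (c / e)" by simp
      have ce: "c / e > 0" using c e by simp
      have "- c / ln (dist x y) = c / (- ln (dist x y))" by simp
      also have "\<dots> < c / (c / e)"
      proof (rule divide_strict_left_mono)
        have l': "c / e < - ln (dist x y)" using l by simp
        then show "c / e < - ln (dist x y)" .
        show "0 < - ln (dist x y) * (c / e)" by (rule mult_pos_pos[OF less_trans[OF ce l'] ce])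
      qed (rule c(1))
      also have "\<dots> = e" using c by simp
      finally have "- c / ln (dist x y) < e" .
      moreover have "\<bar>p x - p y\<bar> \<le> - c / ln (dist x y)" using c(2)[OF x y(1)] y(2) by (simp add: dist_commute)
      ultimately show ?thesis by (simp add: dist_real_def)
    qed (use e in simp)
  qed simp
qed

theorem corollary4:
  fixes \<Omega> :: "'a::euclidean_space set"
    and p p' :: "'a \<Rightarrow> real"
    and \<mu> :: "'a set \<Rightarrow> real"
  assumes dim: "DIM('a) \<ge> 2"
    and domain: "open \<Omega>" "connected \<Omega>" "\<Omega> \<noteq> {}" "bounded \<Omega>"
    and exponent: "\<And>x. x \<in> \<Omega> \<Longrightarrow> 1 < p x"
    and log_Hoelder: "log_Hoelder_on \<Omega> p"
    and p_minus: "1 < (INF x\<in>\<Omega>. p x)"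
    and p_plus: "bdd_above (p ` \<Omega>)"
    and p'_def: "\<And>x. x \<in> \<Omega> \<Longrightarrow> p' x = p x / (p x - 1)"
    and measure: "\<mu> \<in> bounded_radon_measures \<Omega>"
  shows "(does_not_charge_null_cap \<Omega> p \<mu> \<longleftrightarrow> in_L1_plus_dual \<Omega> p \<mu>) \<and>
         (in_L1_plus_dual \<Omega> p \<mu> \<longleftrightarrow>
            (\<exists>f G. integrable (lebesgue_on \<Omega>) f \<and> G \<in> Lp_var_vec \<Omega> p' \<and> eq_minus_div \<Omega> \<mu> f G))"
proof -
  let ?pm = "INF x\<in>\<Omega>. p x" and ?pp = "SUP x\<in>\<Omega>. p x"
  have bounds: "?pm \<le> p x \<and> p x \<le> ?pp" if "x \<in> \<Omega>" for x
  proof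
    have "bdd_below (p ` \<Omega>)" using exponent by (intro bdd_belowI2[of _ 1]) (auto intro: less_imp_le)
    then show "?pm \<le> p x" using that by (rule cINF_lower)
    show "p x \<le> ?pp" using p_plus that by (intro cSUP_upper)
  qed
  interpret sobolev \<Omega> p ?pm ?pp
  proof (intro sobolev.intro var_exp.intro sobolev_axioms.intro)
    show "p \<in> borel_measurable (lebesgue_on \<Omega>)"
      using domain log_Hoelder_continuous[OF log_Hoelder]
      by (intro continuous_imp_measurable_on_sets_lebesgue) auto
    show "finite_measure (lebesgue_on \<Omega>)"
      using domain by (intro finite_measure_lebesgue_on lmeasurable_open)
    show "?pm \<le> ?pp" using domain(3) bounds by (meson all_not_in_conv order_trans)
    show "?pm \<le> p x \<and> p x \<le> ?pp" if "x \<in> space (lebesgue_on \<Omega>)" for x using that bounds by simp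
  qed (use p_minus domain in auto)
  have \<mu>: "signed_on \<Omega> \<mu>"
    using measure domain(1) by (auto simp: bounded_radon_measures_def intro: signed_on.intro)
  let ?fG = "\<exists>f G. integrable (lebesgue_on \<Omega>) f \<and> G \<in> Lp_var_vec \<Omega> p' \<and> eq_minus_div \<Omega> \<mu> f G"
  note dual = Lp_var_vec_dual_iff[of p', OF p'_def]
  \<comment> \<open>The implications close a cycle: null sets are not charged, then \<open>f\<close>
    and \<open>G\<close> exist, then the measure lies in the sum of spaces, then null sets are not
    charged.\<close>
  have 1: ?fG if nc: "does_not_charge_null_cap \<Omega> p \<mu>"
  proof -
    obtain A where A: "A \<ge> 0" "energy_cont A (signed_integral \<Omega> \<mu>)" using signed_integral_energy_cont[OF \<mu> nc] by blast
    obtain f G where "integrable (lebesgue_on \<Omega>) f" "Lq G"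
      "\<And>\<psi>. \<psi> \<in> X \<Longrightarrow> signed_integral \<Omega> \<mu> \<psi> =
        (LINT x|lebesgue_on \<Omega>. f x * \<psi> x) + (LINT x|lebesgue_on \<Omega>. G x \<bullet> grad \<psi> x)"
      using decomposition[OF A(2,1)] by metis
    then show ?thesis by (intro exI[of _ f] exI[of _ G]) (auto simp: dual eq_minus_div_def)
  qed
  have 2: "in_L1_plus_dual \<Omega> p \<mu>" if fG: ?fG
  proof -
    obtain f G where fG: "integrable (lebesgue_on \<Omega>) f" "Lq G" "eq_minus_div \<Omega> \<mu> f G"
      using fG by (auto simp: dual)
    show ?thesis
      unfolding in_L1_plus_dual_def
      by (intro exI[of _ f] exI[of _ "\<lambda>u. LINT x|lebesgue_on \<Omega>. G x \<bullet> Lp_grad u x"])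
        (use fG field_in_dual[OF fG(2)] field_functional_test[OF fG(2)] in \<open>auto simp: eq_minus_div_def\<close>)
  qed
  have 3: "does_not_charge_null_cap \<Omega> p \<mu>" if d: "in_L1_plus_dual \<Omega> p \<mu>"
  proof -
    obtain f T where fT: "integrable (lebesgue_on \<Omega>) f" "T \<in> dual_W1p_0 \<Omega> p"
      "\<And>\<phi>. \<phi> \<in> X \<Longrightarrow> signed_integral \<Omega> \<mu> \<phi> = (LINT x|lebesgue_on \<Omega>. f x * \<phi> x) + T \<phi>"
      using d unfolding in_L1_plus_dual_def by blast
    show ?thesis
      by (rule measure_zero_of_vanishing[OF log_Hoelder \<mu> fT(3) vanishing_add[OF vanishing_L1[OF fT(1)] vanishing_dual[OF fT(2)]]])
  qed
  show ?thesis using 1 2 3 by blast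
qed

end
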